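(* Let $N \in \mathbb{Z}_{\geq 1}$ and let $X(\tau)$, $\tau \in \mathbb{R}_{\geq 0}$, be a Markov process on $\mathrm{GL}_N(\mathbb{Q}_p)$ started at the identity with stationary, independent, $\mathrm{GL}_N(\mathbb{Z}_p)$-isotropic increments. Then there exist a constant $c \in \mathbb{R}_{\geq 0}$ and a probability measure $M_X$ on $\mathrm{Sig}_N$ such that $$\mathrm{SN}(X(\tau)) = \mathrm{SN}(Y^{(N,M_X,c)}(\tau)) \quad \text{in multi-time distribution},$$ i.e. the $\mathrm{Sig}_N$-valued stochastic processes $(\mathrm{SN}(X(\tau)))_{\tau \geq 0}$ and $(\mathrm{SN}(Y^{(N,M_X,c)}(\tau)))_{\tau \geq 0}$ have the same joint distributions at any finite collection of times.
   Context: Fix a prime $p$; $\mathbb{Q}_p$ and $\mathbb{Z}_p$ are the $p$-adic numbers and $p$-adic integers. $\mathrm{Sig}_N := \{(\lambda_1,\ldots,\lambda_N) \in \mathbb{Z}^N : \lambda_1 \geq \cdots \geq \lambda_N\}$. For $A \in \mathrm{GL}_N(\mathbb{Q}_p)$ there is a unique $\lambda \in \mathrm{Sig}_N$ such that $A = U\,\mathrm{diag}(p^{\lambda_1},\ldots,p^{\lambda_N})V$ for some $U,V \in \mathrm{GL}_N(\mathbb{Z}_p)$ (Smith normal form); write $\mathrm{SN}(A) := \lambda$ (the singular numbers of $A$). A stochastic process $X(\tau)$, $\tau \in \mathbb{R}_{\geq 0}$, on $\mathrm{GL}_N(\mathbb{Q}_p)$ has independent increments if for all $s,\tau \geq 0$,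 $X(\tau+s)X(\tau)^{-1}$ is independent of the trajectory of $X$ up to time $\tau$. It has stationary increments if $\mathrm{Law}(X(\tau+s)X(\tau)^{-1}) = \mathrm{Law}(X(s)X(0)^{-1})$ for all $s,\tau \geq 0$. It has $\mathrm{GL}_N(\mathbb{Z}_p)$-isotropic increments if $\mathrm{Law}(X(\tau+s)X(\tau)^{-1}) = \mathrm{Law}(kX(\tau+s)X(\tau)^{-1}k^{-1})$ for all $k \in \mathrm{GL}_N(\mathbb{Z}_p)$ and $s,\tau \geq 0$. For $N \in \mathbb{Z}_{\geq 1}$, a probability measure $M$ on $\mathrm{Sig}_N$, and $c \in \mathbb{R}_{\geq 0}$, the process $Y^{(N,M,c)}(\tau)$, $\tau \in \mathbb{R}_{\geq 0}$, on $\mathrm{GL}_N(\mathbb{Q}_p)$ is $$Y^{(N,M,c)}(\tau) := U_{P(\tau)}\,\mathrm{diag}(p^{\nu^{(P(\tau))}_1},\ldots,p^{\nu^{(P(\tau))}_N})\,V_{P(\tau)} \cdots U_1\,\mathrm{diag}(p^{\nu^{(1)}_1},\ldots,p^{\nu^{(1)}_N})\,V_1,$$ where $P(\tau)$ is a Poisson process on $\mathbb{Z}_{\geq 0}$ with rate $c$ (started at $0$), the $\nu^{(i)}$ ($i \geq 1$) are distributed according to $M$, the $U_i,V_i$ ($i\ge 1$) are distributed according to the Haar probability measure on $\mathrm{GL}_N(\mathbb{Z}_p)$, and all of $P$, $\nu^{(i)}$, $U_i$, $V_i$ are independent. The empty product (when $P(\tau)=0$) is the identity. *)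

theory Defs
  imports
    "HOL-Probability.Probability"
    "Berlekamp_Zassenhaus.Finite_Field"
begin

section \<open>The p-adic absolute value on the rationals\<close>

definition padic_abs :: "nat \<Rightarrow> rat \<Rightarrow> real" where
  "padic_abs p x = (if x = 0 then 0 else
     real p powi (int (multiplicity (int p) (snd (quotient_of x)))
                - int (multiplicity (int p) (fst (quotient_of x)))))"

lemma padic_abs_frac:
  assumes p: "prime p" and a: "a \<noteq> 0" and b: "b \<noteq> 0"
  shows "padic_abs p (of_int a / of_int b) =
    real p powi (int (multiplicity (int p) b) - int (multiplicity (int p) a))"
proof -
  obtain c d where cd: "quotient_of (of_int a / of_int b) = (c, d)" by fastforce
  have d: "d > 0" using quotient_of_denom_pos[OF cd] .
  have eq: "(of_int a / of_int b :: rat) = of_int c / of_int d" using quotient_of_div[OF cd] .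
  then have c: "c \<noteq> 0" using a b d by auto
  have "(of_int (a * d) :: rat) = of_int (c * b)"
    using eq b d by (simp add: field_simps)
  then have ad: "a * d = c * b" by (simp only: of_int_eq_iff)
  have pp: "prime_elem (int p)" using p by simp
  have "multiplicity (int p) a + multiplicity (int p) d
      = multiplicity (int p) c + multiplicity (int p) b"
    using arg_cong[OF ad, of "multiplicity (int p)"] a b c d
    by (simp add: prime_elem_multiplicity_mult_distrib[OF pp])
  then have "int (multiplicity (int p) d) - int (multiplicity (int p) c)
      = int (multiplicity (int p) b) - int (multiplicity (int p) a)"
    by linarith
  then show ?thesis using a b cd by (simp add: padic_abs_def)
qed

lemma padic_abs_0 [simp]: "padic_abs p 0 = 0"
  by (simp add: padic_abs_def)

lemma padic_abs_pos: "prime p \<Longrightarrow> x \<noteq> 0 \<Longrightarrow> padic_abs p x > 0"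
  by (auto simp: padic_abs_def prime_gt_0_nat intro!: zero_less_power_int)

lemma padic_abs_nonneg [simp]: "padic_abs p x \<ge> 0"
  by (simp add: padic_abs_def)

lemma padic_abs_eq_0 [simp]: "prime p \<Longrightarrow> padic_abs p x = 0 \<longleftrightarrow> x = 0"
  by (metis less_irrefl padic_abs_0 padic_abs_pos)

lemma padic_abs_1: "prime p \<Longrightarrow> padic_abs p 1 = 1"
  using padic_abs_frac[of p 1 1] by simp

lemma padic_abs_minus: "padic_abs p (- x) = padic_abs p x"
proof -
  have "multiplicity (int p) (- a) = multiplicity (int p) a" for a
    by (simp add: multiplicity_def)
  then show ?thesis by (cases "quotient_of x") (simp add: padic_abs_def rat_uminus_code)
qed

lemma padic_abs_minus_commute: "padic_abs p (x - y) = padic_abs p (y - x)"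
  using padic_abs_minus[of p "x - y"] by simp

lemma rat_frac_cases:
  obtains a b where "(x::rat) = of_int a / of_int b" "b > 0"
  by (metis quotient_of_denom_pos quotient_of_div surj_pair)

lemma padic_abs_mult:
  assumes p: "prime p" shows "padic_abs p (x * y) = padic_abs p x * padic_abs p y"
proof (cases "x = 0 \<or> y = 0")
  case False
  obtain a b where x: "x = of_int a / of_int b" "b > 0" by (rule rat_frac_cases)
  obtain c d where y: "y = of_int c / of_int d" "d > 0" by (rule rat_frac_cases)
  have nz: "a \<noteq> 0" "c \<noteq> 0" using False x y by auto
  have xy: "x * y = of_int (a * c) / of_int (b * d)" by (simp add: x y)
  have pp: "prime_elem (int p)" using p by simp
  have p0: "real p \<noteq> 0" using p prime_gt_0_nat by force
  have "padic_abs p (x * y) = real p powi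
      (int (multiplicity (int p) (b * d)) - int (multiplicity (int p) (a * c)))"
    unfolding xy using nz x(2) y(2) by (intro padic_abs_frac[OF p]) auto
  also have "int (multiplicity (int p) (b * d)) - int (multiplicity (int p) (a * c)) =
      (int (multiplicity (int p) b) - int (multiplicity (int p) a)) +
      (int (multiplicity (int p) d) - int (multiplicity (int p) c))"
    using nz x(2) y(2) by (simp add: prime_elem_multiplicity_mult_distrib[OF pp])
  also have "real p powi \<dots> = padic_abs p x * padic_abs p y"
    using nz x y p0 by (simp add: power_int_add padic_abs_frac[OF p])
  finally show ?thesis .
qed auto

lemma padic_abs_inverse:
  assumes p: "prime p" shows "padic_abs p (inverse x) = inverse (padic_abs p x)"
proof (cases "x = 0")
  case False
  have "padic_abs p (inverse x) * padic_abs p x = 1"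
    using False by (simp add: padic_abs_mult[OF p, symmetric] padic_abs_1[OF p])
  then show ?thesis by (metis inverse_unique mult.commute)
qed auto

lemma padic_abs_ultrametric:
  assumes p: "prime p" shows "padic_abs p (x + y) \<le> max (padic_abs p x) (padic_abs p y)"
proof (cases "x = 0 \<or> y = 0 \<or> x + y = 0")
  case False
  obtain a b where x: "x = of_int a / of_int b" "b > 0" by (rule rat_frac_cases)
  obtain c d where y: "y = of_int c / of_int d" "d > 0" by (rule rat_frac_cases)
  define e f g where "e = a * d" and "f = c * b" and "g = b * d"
  have g: "g \<noteq> 0" using x y by (simp add: g_def)
  have x': "x = of_int e / of_int g" and y': "y = of_int f / of_int g"
    using x y by (simp_all add: e_def f_def g_def)
  have xy: "x + y = of_int (e + f) / of_int g" by (simp add: x' y' add_divide_distrib)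
  have nz: "e \<noteq> 0" "f \<noteq> 0" "e + f \<noteq> 0" using False x' y' xy by auto
  have pp: "\<not> is_unit (int p)" using p not_prime_unit by fastforce
  define m where "m = min (multiplicity (int p) e) (multiplicity (int p) f)"
  have "int p ^ m dvd e + f"
    by (intro dvd_add multiplicity_dvd') (simp_all add: m_def)
  then have m: "m \<le> multiplicity (int p) (e + f)"
    using nz pp by (intro multiplicity_geI) auto
  have p1: "real p \<ge> 1" using p prime_ge_1_nat by fastforce
  have v: "padic_abs p (of_int h / of_int g) =
      real p powi (int (multiplicity (int p) g) - int (multiplicity (int p) h))" if "h \<noteq> 0" for h
    using that g by (rule padic_abs_frac[OF p])
  have "padic_abs p (x + y) \<le> real p powi (int (multiplicity (int p) g) - int m)"
    unfolding xy v[OF nz(3)] using m p1 by (intro power_int_increasing) auto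
  also have "\<dots> \<le> max (padic_abs p x) (padic_abs p y)"
    unfolding x' y' v[OF nz(1)] v[OF nz(2)] m_def by (simp add: min_def)
  finally show ?thesis .
qed (auto simp: le_max_iff_disj)

lemma padic_abs_triangle:
  assumes "prime p" shows "padic_abs p (x + y) \<le> padic_abs p x + padic_abs p y"
  using padic_abs_ultrametric[OF assms, of x y] padic_abs_nonneg[of p x] padic_abs_nonneg[of p y]
  by linarith

lemma padic_abs_triangle_diff:
  assumes "prime p" shows "\<bar>padic_abs p x - padic_abs p y\<bar> \<le> padic_abs p (x - y)"
  using padic_abs_triangle[OF assms, of "x - y" y] padic_abs_triangle[OF assms, of "y - x" x]
    padic_abs_minus_commute[of p x y] by simp

section \<open>The field of p-adic numbers\<close>

definition padic_vanishes :: "nat \<Rightarrow> (nat \<Rightarrow> rat) \<Rightarrow> bool" where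
  "padic_vanishes p X \<longleftrightarrow> (\<lambda>n. padic_abs p (X n)) \<longlonglongrightarrow> 0"

definition padic_cauchy :: "nat \<Rightarrow> (nat \<Rightarrow> rat) \<Rightarrow> bool" where
  "padic_cauchy p X \<longleftrightarrow> (\<forall>e>0. \<exists>k. \<forall>m\<ge>k. \<forall>n\<ge>k. padic_abs p (X m - X n) < e)"

lemma padic_vanishes_0 [simp]: "padic_vanishes p (\<lambda>n. 0)"
  by (simp add: padic_vanishes_def)

lemma padic_cauchy_const [simp]: "padic_cauchy p (\<lambda>n. x)"
  by (simp add: padic_cauchy_def)

lemma padic_vanishes_minus: "padic_vanishes p (\<lambda>n. - X n) \<longleftrightarrow> padic_vanishes p X"
  by (simp add: padic_vanishes_def padic_abs_minus)

lemma padic_vanishes_add: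
  assumes "prime p" "padic_vanishes p X" "padic_vanishes p Y"
  shows "padic_vanishes p (\<lambda>n. X n + Y n)"
  unfolding padic_vanishes_def
proof (rule tendsto_sandwich[OF _ _ tendsto_const])
  show "(\<lambda>n. padic_abs p (X n) + padic_abs p (Y n)) \<longlonglongrightarrow> 0"
    using tendsto_add[OF assms(2,3)[unfolded padic_vanishes_def]] by simp
qed (auto intro: always_eventually padic_abs_triangle assms)

lemma padic_cauchy_minus: "padic_cauchy p X \<Longrightarrow> padic_cauchy p (\<lambda>n. - X n)"
  unfolding padic_cauchy_def minus_diff_minus padic_abs_minus .

lemma padic_cauchy_add:
  assumes p: "prime p" and X: "padic_cauchy p X" and Y: "padic_cauchy p Y"
  shows "padic_cauchy p (\<lambda>n. X n + Y n)"
  unfolding padic_cauchy_def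
proof (intro allI impI)
  fix e :: real assume "e > 0"
  then obtain k l where
    k: "\<And>m n. m \<ge> k \<Longrightarrow> n \<ge> k \<Longrightarrow> padic_abs p (X m - X n) < e" and
    l: "\<And>m n. m \<ge> l \<Longrightarrow> n \<ge> l \<Longrightarrow> padic_abs p (Y m - Y n) < e"
    using X Y unfolding padic_cauchy_def by meson
  have "padic_abs p (X m + Y m - (X n + Y n)) < e" if "m \<ge> max k l" "n \<ge> max k l" for m n
    using padic_abs_ultrametric[OF p, of "X m - X n" "Y m - Y n"] k[of m n] l[of m n] that
    by (simp add: add_diff_add)
  then show "\<exists>k. \<forall>m\<ge>k. \<forall>n\<ge>k. padic_abs p (X m + Y m - (X n + Y n)) < e" by blast
qed

lemma padic_cauchy_abs_convergent:
  assumes p: "prime p" and X: "padic_cauchy p X"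
  shows "convergent (\<lambda>n. padic_abs p (X n))"
proof -
  have "Cauchy (\<lambda>n. padic_abs p (X n))"
    unfolding Cauchy_def dist_real_def
    using X padic_abs_triangle_diff[OF p] unfolding padic_cauchy_def
    by (meson order_le_less_trans)
  then show ?thesis by (simp add: Cauchy_convergent_iff)
qed

lemma padic_cauchy_bounded:
  assumes p: "prime p" and X: "padic_cauchy p X"
  obtains b where "b > 0" "\<And>n. padic_abs p (X n) \<le> b"
proof -
  have "Bseq (\<lambda>n. padic_abs p (X n))"
    using convergent_imp_Bseq[OF padic_cauchy_abs_convergent[OF p X]] .
  then obtain b where "b > 0" "\<And>n. norm (padic_abs p (X n)) \<le> b" by (rule BseqE) auto
  then show ?thesis using that by auto
qed

lemma padic_vanishes_mult:
  assumes p: "prime p" and X: "padic_cauchy p X" and Y: "padic_vanishes p Y"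
  shows "padic_vanishes p (\<lambda>n. X n * Y n)"
proof -
  obtain b where "b > 0" "\<And>n. padic_abs p (X n) \<le> b" by (rule padic_cauchy_bounded[OF p X]) blast
  then have b: "padic_abs p (X n * Y n) \<le> b * padic_abs p (Y n)" for n
    by (simp add: padic_abs_mult[OF p] mult_right_mono)
  show ?thesis
    unfolding padic_vanishes_def
  proof (rule tendsto_sandwich[OF _ _ tendsto_const])
    show "(\<lambda>n. b * padic_abs p (Y n)) \<longlonglongrightarrow> 0"
      using Y tendsto_mult_right_zero unfolding padic_vanishes_def by blast
    show "eventually (\<lambda>n. padic_abs p (X n * Y n) \<le> b * padic_abs p (Y n)) sequentially"
      using b by (rule always_eventually[OF allI])
  qed simp
qed

lemma padic_cauchy_mult:
  assumes p: "prime p" and X: "padic_cauchy p X" and Y: "padic_cauchy p Y"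
  shows "padic_cauchy p (\<lambda>n. X n * Y n)"
  unfolding padic_cauchy_def
proof (intro allI impI)
  fix e :: real assume e: "e > 0"
  obtain a where a: "a > 0" "\<And>n. padic_abs p (X n) \<le> a" by (rule padic_cauchy_bounded[OF p X]) blast
  obtain b where b: "b > 0" "\<And>n. padic_abs p (Y n) \<le> b" by (rule padic_cauchy_bounded[OF p Y]) blast
  have "e / a > 0" "e / b > 0" using e a b by auto
  then obtain k l where
    k: "\<And>m n. m \<ge> k \<Longrightarrow> n \<ge> k \<Longrightarrow> padic_abs p (X m - X n) < e / b" and
    l: "\<And>m n. m \<ge> l \<Longrightarrow> n \<ge> l \<Longrightarrow> padic_abs p (Y m - Y n) < e / a"
    using X Y unfolding padic_cauchy_def by meson
  have "padic_abs p (X m * Y m - X n * Y n) < e" if mn: "m \<ge> max k l" "n \<ge> max k l" for m n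
  proof -
    have 1: "padic_abs p (X m * (Y m - Y n)) < e"
    proof -
      have "padic_abs p (X m * (Y m - Y n)) \<le> a * padic_abs p (Y m - Y n)"
        by (simp add: padic_abs_mult[OF p] a mult_right_mono)
      also have "\<dots> < a * (e / a)" using l[of m n] mn a by (intro mult_strict_left_mono) auto
      finally show ?thesis using a by simp
    qed
    have 2: "padic_abs p ((X m - X n) * Y n) < e"
    proof -
      have "padic_abs p ((X m - X n) * Y n) \<le> padic_abs p (X m - X n) * b"
        by (simp add: padic_abs_mult[OF p] b mult_left_mono)
      also have "\<dots> < (e / b) * b" using k[of m n] mn b by (intro mult_strict_right_mono) auto
      finally show ?thesis using b by simp
    qed
    show ?thesis
      using padic_abs_ultrametric[OF p, of "X m * (Y m - Y n)" "(X m - X n) * Y n"] 1 2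
      by (simp add: mult_diff_mult)
  qed
  then show "\<exists>k. \<forall>m\<ge>k. \<forall>n\<ge>k. padic_abs p (X m * Y m - X n * Y n) < e" by blast
qed

lemma padic_not_vanishes:
  assumes p: "prime p" and X: "padic_cauchy p X" and nz: "\<not> padic_vanishes p X"
  obtains b k where "b > 0" "\<And>n. n \<ge> k \<Longrightarrow> padic_abs p (X n) > b" "\<And>n. n \<ge> k \<Longrightarrow> X n \<noteq> 0"
proof -
  obtain L where L: "(\<lambda>n. padic_abs p (X n)) \<longlonglongrightarrow> L"
    using padic_cauchy_abs_convergent[OF p X] unfolding convergent_def by blast
  have "L \<ge> 0" using L by (rule LIMSEQ_le_const) auto
  moreover have "L \<noteq> 0" using L nz unfolding padic_vanishes_def by auto
  ultimately have L0: "L / 2 > 0" "L / 2 < L" by auto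
  obtain k where k: "\<And>n. n \<ge> k \<Longrightarrow> padic_abs p (X n) > L / 2"
    using order_tendstoD(1)[OF L L0(2)] unfolding eventually_sequentially by blast
  have "X n \<noteq> 0" if "n \<ge> k" for n using k[OF that] L0 by auto
  then show ?thesis using that L0 k by blast
qed

lemma padic_cauchy_inverse:
  assumes p: "prime p" and X: "padic_cauchy p X" and nz: "\<not> padic_vanishes p X"
  shows "padic_cauchy p (\<lambda>n. inverse (X n))"
  unfolding padic_cauchy_def
proof (intro allI impI)
  fix e :: real assume e: "e > 0"
  obtain b k where b: "b > 0" and k: "\<And>n. n \<ge> k \<Longrightarrow> padic_abs p (X n) > b"
    "\<And>n. n \<ge> k \<Longrightarrow> X n \<noteq> 0" by (rule padic_not_vanishes[OF assms]) blast
  have "b * e * b > 0" using b e by simp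
  then obtain l where l: "\<And>m n. m \<ge> l \<Longrightarrow> n \<ge> l \<Longrightarrow> padic_abs p (X m - X n) < b * e * b"
    using X unfolding padic_cauchy_def by meson
  have "padic_abs p (inverse (X m) - inverse (X n)) < e"
    if mn: "m \<ge> max k l" "n \<ge> max k l" for m n
  proof -
    have "padic_abs p (inverse (X m) - inverse (X n)) =
        inverse (padic_abs p (X m)) * padic_abs p (X m - X n) * inverse (padic_abs p (X n))"
      using k(2) mn
      by (simp add: inverse_diff_inverse padic_abs_minus padic_abs_mult[OF p] padic_abs_inverse[OF p])
    also have "\<dots> \<le> inverse b * padic_abs p (X m - X n) * inverse b"
      using k(1)[of m] k(1)[of n] b mn by (intro mult_mono le_imp_inverse_le) auto
    also have "\<dots> < inverse b * (b * e * b) * inverse b"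
      using l[of m n] mn b by (intro mult_strict_right_mono mult_strict_left_mono) auto
    also have "\<dots> = e" using b by simp
    finally show ?thesis .
  qed
  then show "\<exists>k. \<forall>m\<ge>k. \<forall>n\<ge>k. padic_abs p (inverse (X m) - inverse (X n)) < e" by blast
qed

lemma padic_vanishes_cong:
  assumes p: "prime p" and d: "padic_vanishes p (\<lambda>n. X n - Y n)"
  shows "padic_vanishes p X \<longleftrightarrow> padic_vanishes p Y"
proof -
  have d': "padic_vanishes p (\<lambda>n. Y n - X n)"
    using d padic_vanishes_minus[of p "\<lambda>n. X n - Y n"] by simp
  show ?thesis
    using padic_vanishes_add[OF p d, of Y] padic_vanishes_add[OF p d', of X] by auto
qed

lemma padic_vanishes_diff_inverse:
  assumes p: "prime p" and X: "padic_cauchy p X" "\<not> padic_vanishes p X"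
    and Y: "padic_cauchy p Y" "\<not> padic_vanishes p Y"
    and XY: "padic_vanishes p (\<lambda>n. X n - Y n)"
  shows "padic_vanishes p (\<lambda>n. inverse (X n) - inverse (Y n))"
proof -
  obtain b k where k: "\<And>n. n \<ge> k \<Longrightarrow> X n \<noteq> 0" using padic_not_vanishes[OF p X] by metis
  obtain c l where l: "\<And>n. n \<ge> l \<Longrightarrow> Y n \<noteq> 0" using padic_not_vanishes[OF p Y] by metis
  have "padic_vanishes p (\<lambda>n. inverse (Y n) * (inverse (X n) * (X n - Y n)))"
    by (intro padic_vanishes_mult p padic_cauchy_inverse X Y XY)
  moreover have "eventually (\<lambda>n. padic_abs p (inverse (Y n) * (inverse (X n) * (X n - Y n))) =
      padic_abs p (inverse (X n) - inverse (Y n))) sequentially"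
    unfolding eventually_sequentially
    by (intro exI[of _ "max k l"])
      (auto simp: inverse_diff_inverse k l padic_abs_minus padic_abs_mult[OF p])
  ultimately show ?thesis
    unfolding padic_vanishes_def by (rule Lim_transform_eventually)
qed

text \<open>
  The type \<open>'p padic\<close> is \<open>\<rat>\<^sub>p\<close> for the prime \<open>p = CARD('p)\<close>, constructed as the ring of
  \<open>p\<close>-adic Cauchy sequences in \<open>\<rat>\<close> modulo the null sequences.  Every prime \<open>p\<close> is the
  cardinality of such a type \<open>'p\<close>, e.g. of one with carrier \<open>{..<p}\<close>.
\<close>

typedef (overloaded) 'p padic_seq = "{X. padic_cauchy CARD('p::prime_card) X}"
  morphisms seq_of Seq
  by (rule exI[of _ "\<lambda>n. 0"]) simp

lemma padic_cauchy_seq_of [simp]: "padic_cauchy CARD('p::prime_card) (seq_of (X :: 'p padic_seq))"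
  using seq_of[of X] by simp

lemma seq_of_Seq [simp]:
  "padic_cauchy CARD('p::prime_card) X \<Longrightarrow> seq_of (Seq X :: 'p padic_seq) = X"
  by (simp add: Seq_inverse)

definition padic_rel :: "'p::prime_card padic_seq \<Rightarrow> 'p padic_seq \<Rightarrow> bool" where
  "padic_rel X Y \<longleftrightarrow> padic_vanishes CARD('p) (\<lambda>n. seq_of X n - seq_of Y n)"

lemma equivp_padic_rel: "equivp (padic_rel :: 'p::prime_card padic_seq \<Rightarrow> _)"
proof (rule equivpI)
  show "reflp (padic_rel :: 'p padic_seq \<Rightarrow> _)"
    by (simp add: reflp_def padic_rel_def)
  show "symp (padic_rel :: 'p padic_seq \<Rightarrow> _)"
    unfolding symp_def padic_rel_def padic_vanishes_def
    by (simp add: padic_abs_minus_commute)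
  show "transp (padic_rel :: 'p padic_seq \<Rightarrow> _)"
  proof (rule transpI)
    fix X Y Z :: "'p padic_seq" assume "padic_rel X Y" "padic_rel Y Z"
    then show "padic_rel X Z"
      unfolding padic_rel_def
      using padic_vanishes_add[OF prime_card[where 'a='p],
          of "\<lambda>n. seq_of X n - seq_of Y n" "\<lambda>n. seq_of Y n - seq_of Z n"]
      by simp
  qed
qed

quotient_type (overloaded) 'p padic = "'p::prime_card padic_seq" / padic_rel
  by (rule equivp_padic_rel)

instantiation padic :: (prime_card) field
begin

lift_definition zero_padic :: "'a padic" is "Seq (\<lambda>n. 0)" .

lift_definition one_padic :: "'a padic" is "Seq (\<lambda>n. 1)" .

lift_definition plus_padic :: "'a padic \<Rightarrow> 'a padic \<Rightarrow> 'a padic"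
  is "\<lambda>X Y. Seq (\<lambda>n. seq_of X n + seq_of Y n)"
  unfolding padic_rel_def
  by (simp add: padic_cauchy_add padic_vanishes_add prime_card add_diff_add)

lift_definition uminus_padic :: "'a padic \<Rightarrow> 'a padic" is "\<lambda>X. Seq (\<lambda>n. - seq_of X n)"
  unfolding padic_rel_def
  by (simp add: padic_cauchy_minus padic_vanishes_def padic_abs_minus_commute)

lift_definition times_padic :: "'a padic \<Rightarrow> 'a padic \<Rightarrow> 'a padic"
  is "\<lambda>X Y. Seq (\<lambda>n. seq_of X n * seq_of Y n)"
proof -
  fix X X' Y Y' :: "'a padic_seq"
  assume X: "padic_rel X X'" and Y: "padic_rel Y Y'"
  have "padic_vanishes CARD('a) (\<lambda>n. seq_of X n * (seq_of Y n - seq_of Y' n)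
      + seq_of Y' n * (seq_of X n - seq_of X' n))"
    using X Y unfolding padic_rel_def
    by (intro padic_vanishes_add padic_vanishes_mult prime_card) auto
  then have "padic_vanishes CARD('a) (\<lambda>n. seq_of X n * seq_of Y n - seq_of X' n * seq_of Y' n)"
    by (simp add: algebra_simps)
  then show "padic_rel (Seq (\<lambda>n. seq_of X n * seq_of Y n) :: 'a padic_seq)
      (Seq (\<lambda>n. seq_of X' n * seq_of Y' n))"
    by (simp add: padic_rel_def padic_cauchy_mult prime_card)
qed

lift_definition inverse_padic :: "'a padic \<Rightarrow> 'a padic"
  is "\<lambda>X. if padic_vanishes CARD('a) (seq_of X) then Seq (\<lambda>n. 0)
          else Seq (\<lambda>n. inverse (seq_of X n))"
proof -
  fix X Y :: "'a padic_seq"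
  assume XY: "padic_rel X Y"
  then show "?thesis X Y"
    using padic_vanishes_cong[OF prime_card XY[unfolded padic_rel_def]]
    by (auto simp: padic_rel_def padic_cauchy_inverse padic_vanishes_diff_inverse prime_card)
qed

definition "x - y = x + - y" for x y :: "'a padic"

definition "x div y = x * inverse y" for x y :: "'a padic"

instance
proof
  fix a b c :: "'a padic"
  note [simp] = padic_rel_def padic_cauchy_add padic_cauchy_minus padic_cauchy_mult prime_card
  show "a + b = b + a" by transfer (simp add: ac_simps)
  show "(a + b) + c = a + (b + c)" by transfer (simp add: ac_simps)
  show "0 + a = a" by transfer simp
  show "- a + a = 0" by transfer simp
  show "a - b = a + - b" by (rule minus_padic_def)
  show "(a * b) * c = a * (b * c)" by transfer (simp add: ac_simps)
  show "a * b = b * a" by transfer (simp add: ac_simps)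
  show "1 * a = a" by transfer simp
  show "(a + b) * c = a * c + b * c" by transfer (simp add: distrib_right)
  show "(0::'a padic) \<noteq> 1"
    by transfer (simp add: padic_vanishes_def padic_abs_minus padic_abs_1 LIMSEQ_const_iff)
  show "a div b = a * inverse b" by (rule divide_padic_def)
  show "inverse (0::'a padic) = 0" by transfer simp
  have "padic_vanishes CARD('a) (\<lambda>n. inverse (X n) * X n - 1)"
    if X: "padic_cauchy CARD('a) X" "\<not> padic_vanishes CARD('a) X" for X
  proof -
    obtain b k where k: "\<And>n. n \<ge> k \<Longrightarrow> X n \<noteq> 0"
      using padic_not_vanishes[OF prime_card X] by metis
    have "eventually (\<lambda>n. padic_abs CARD('a) (inverse (X n) * X n - 1) = 0) sequentially"
      unfolding eventually_sequentially by (rule exI[of _ k]) (simp add: k)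
    then show ?thesis unfolding padic_vanishes_def by (rule tendsto_eventually)
  qed
  then show "a \<noteq> 0 \<Longrightarrow> inverse a * a = 1"
    by transfer (auto simp: padic_cauchy_inverse)
qed

end

lemma padic_norm_tendsto_cong:
  assumes p: "prime p" and X: "padic_cauchy p X" and d: "padic_vanishes p (\<lambda>n. X n - Y n)"
  shows "lim (\<lambda>n. padic_abs p (X n)) = lim (\<lambda>n. padic_abs p (Y n))"
proof -
  have X': "(\<lambda>n. padic_abs p (X n)) \<longlonglongrightarrow> lim (\<lambda>n. padic_abs p (X n))"
    using padic_cauchy_abs_convergent[OF p X] by (simp add: convergent_LIMSEQ_iff)
  have "(\<lambda>n. padic_abs p (X n) - padic_abs p (Y n)) \<longlonglongrightarrow> 0"
    by (rule Lim_null_comparison[OF _ d[unfolded padic_vanishes_def]])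
      (auto intro: always_eventually padic_abs_triangle_diff p)
  from tendsto_diff[OF X' this] show ?thesis by (simp add: limI)
qed

lift_definition padic_norm :: "'p::prime_card padic \<Rightarrow> real"
  is "\<lambda>X. lim (\<lambda>n. padic_abs CARD('p) (seq_of X n))"
  unfolding padic_rel_def by (rule padic_norm_tendsto_cong[OF prime_card padic_cauchy_seq_of])

lemma padic_abs_seq_tendsto:
  "(\<lambda>n. padic_abs CARD('p) (seq_of X n)) \<longlonglongrightarrow> padic_norm (abs_padic X :: 'p::prime_card padic)"
  using padic_cauchy_abs_convergent[OF prime_card padic_cauchy_seq_of[of X]]
  by (simp add: padic_norm.abs_eq convergent_LIMSEQ_iff)

lemma padic_norm_eq_0: "padic_norm x = 0 \<longleftrightarrow> x = 0"
proof (induction x)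
  case (1 X)
  have "padic_norm (abs_padic X) = 0 \<longleftrightarrow> padic_vanishes CARD('a) (seq_of X)"
    using padic_abs_seq_tendsto[of X] LIMSEQ_unique unfolding padic_vanishes_def by metis
  also have "\<dots> \<longleftrightarrow> abs_padic X = 0"
    unfolding zero_padic_def by (simp add: padic.abs_eq_iff padic_rel_def)
  finally show ?case .
qed

lemma padic_norm_minus: "padic_norm (- x) = padic_norm x"
  by transfer (simp add: padic_cauchy_minus padic_abs_minus)

lemma padic_norm_ultrametric: "padic_norm (x + y) \<le> max (padic_norm x) (padic_norm y)"
proof (induction x; induction y)
  fix Y X :: "'a padic_seq"
  let ?Z = "Seq (\<lambda>n. seq_of X n + seq_of Y n) :: 'a padic_seq"
  have Z: "seq_of ?Z = (\<lambda>n. seq_of X n + seq_of Y n)"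
    by (simp add: padic_cauchy_add prime_card)
  have eq: "abs_padic X + abs_padic Y = abs_padic ?Z" by (simp add: plus_padic.abs_eq)
  show "padic_norm (abs_padic X + abs_padic Y)
      \<le> max (padic_norm (abs_padic X)) (padic_norm (abs_padic Y))"
    unfolding eq
  proof (rule tendsto_le[OF _ tendsto_max])
    show "eventually (\<lambda>n. padic_abs CARD('a) (seq_of ?Z n) \<le>
        max (padic_abs CARD('a) (seq_of X n)) (padic_abs CARD('a) (seq_of Y n))) sequentially"
      unfolding Z by (intro always_eventually allI padic_abs_ultrametric prime_card)
  qed (auto intro: padic_abs_seq_tendsto)
qed

lemma padic_norm_mult: "padic_norm (x * y) = padic_norm x * padic_norm y"
proof (induction x; induction y)
  fix Y X :: "'a padic_seq"
  let ?Z = "Seq (\<lambda>n. seq_of X n * seq_of Y n) :: 'a padic_seq"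
  have Z: "seq_of ?Z = (\<lambda>n. seq_of X n * seq_of Y n)"
    by (simp add: padic_cauchy_mult prime_card)
  have "(\<lambda>n. padic_abs CARD('a) (seq_of ?Z n))
      \<longlonglongrightarrow> padic_norm (abs_padic X) * padic_norm (abs_padic Y)"
    unfolding Z padic_abs_mult[OF prime_card]
    by (intro tendsto_mult padic_abs_seq_tendsto)
  then have "padic_norm (abs_padic ?Z) = padic_norm (abs_padic X) * padic_norm (abs_padic Y)"
    using padic_abs_seq_tendsto LIMSEQ_unique by blast
  then show "padic_norm (abs_padic X * abs_padic Y) = padic_norm (abs_padic X) * padic_norm (abs_padic Y)"
    by (simp add: times_padic.abs_eq)
qed

lemma padic_norm_of_prime: "padic_norm (of_nat CARD('p) :: 'p::prime_card padic) = 1 / CARD('p)"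
proof -
  have of_nat: "(of_nat k :: 'p padic) = abs_padic (Seq (\<lambda>n. of_nat k))" for k
    by (induction k)
      (simp_all add: zero_padic_def one_padic_def plus_padic.abs_eq)
  have "multiplicity (int CARD('p)) (int CARD('p)) = 1"
    using prime_gt_1_nat[OF prime_card[where 'a='p]] by (intro multiplicity_self) auto
  then have "padic_abs CARD('p) (of_nat CARD('p)) = 1 / CARD('p)"
    using padic_abs_frac[OF prime_card[where 'a='p], of "int CARD('p)" 1]
      prime_gt_0_nat[OF prime_card[where 'a='p]]
    by (simp add: power_int_minus divide_inverse)
  then show ?thesis
    by (simp add: of_nat padic_norm.abs_eq)
qed

instantiation padic :: (prime_card) metric_space
begin

definition "dist x y = padic_norm (x - y)" for x y :: "'a padic"

definition "(uniformity :: ('a padic \<times> 'a padic) filter) =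
  (INF e\<in>{0 <..}. principal {(x, y). dist x y < e})"

definition "open U \<longleftrightarrow> (\<forall>x\<in>U. eventually (\<lambda>(x', y). x' = x \<longrightarrow> y \<in> U) uniformity)"
  for U :: "'a padic set"

instance
proof
  fix x y z :: "'a padic"
  show "dist x y = 0 \<longleftrightarrow> x = y" by (simp add: dist_padic_def padic_norm_eq_0)
  have nn: "padic_norm x \<ge> 0" for x :: "'a padic"
    using padic_norm_ultrametric[of x "- x"] padic_norm_eq_0[of "0 :: 'a padic"]
    by (simp add: padic_norm_minus)
  have "padic_norm (x - y) \<le> max (padic_norm (x - z)) (padic_norm (z - y))"
    using padic_norm_ultrametric[of "x - z" "z - y"] by simp
  moreover have "padic_norm (z - y) = padic_norm (y - z)"
    using padic_norm_minus[of "y - z"] by simp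
  ultimately show "dist x y \<le> dist x z + dist y z"
    unfolding dist_padic_def using nn[of "x - z"] nn[of "y - z"] by linarith
qed (simp_all add: uniformity_padic_def open_padic_def dist_padic_def)

end

section \<open>Matrices over the p-adic numbers\<close>

definition padic_ints :: "'p::prime_card padic set" where
  "padic_ints = {x. padic_norm x \<le> 1}"

type_synonym ('p, 'n) pmat = "'p padic ^ 'n ^ 'n"

definition GL_Qp :: "('p::prime_card, 'n::finite) pmat set" where
  "GL_Qp = {A. invertible A}"

definition integral_mat :: "('p::prime_card, 'n::finite) pmat \<Rightarrow> bool" where
  "integral_mat A \<longleftrightarrow> (\<forall>i j. A $ i $ j \<in> padic_ints)"

definition GL_Zp :: "('p::prime_card, 'n::finite) pmat set" where
  "GL_Zp = {A. integral_mat A \<and> (\<exists>B. integral_mat B \<and> A ** B = mat 1 \<and> B ** A = mat 1)}"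

type_synonym 'n tuple = "int ^ 'n"

text \<open>
  \<open>Sig\<^sub>N\<close> is indexed by a finite linearly ordered type \<open>'n\<close> with \<open>CARD('n) = N\<close>, standing for
  \<open>1 < \<dots> < N\<close>.
\<close>

definition Sig :: "'n::{finite, linorder} tuple set" where
  "Sig = {l. \<forall>i j. i \<le> j \<longrightarrow> l $ i \<ge> l $ j}"

definition diag_p :: "'n::finite tuple \<Rightarrow> ('p::prime_card, 'n) pmat" where
  "diag_p l = (\<chi> i j. if i = j then of_nat CARD('p) powi (l $ i) else 0)"

definition SN :: "('p::prime_card, 'n::{finite, linorder}) pmat \<Rightarrow> 'n tuple" where
  "SN A = (THE l. l \<in> Sig \<and> (\<exists>U\<in>GL_Zp. \<exists>V\<in>GL_Zp. A = U ** diag_p l ** V))"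

text \<open>
  Inversion is continuous for the subspace topology of the matrix space, so this is the topology
  of both groups as topological groups; its Borel algebra is the trace of the one on matrices.
\<close>

abbreviation borel_GL_Qp :: "('p::prime_card, 'n::finite) pmat measure" where
  "borel_GL_Qp \<equiv> restrict_space borel GL_Qp"

abbreviation borel_GL_Zp :: "('p::prime_card, 'n::finite) pmat measure" where
  "borel_GL_Zp \<equiv> restrict_space borel GL_Zp"

text \<open>As \<open>GL\<^sub>N(\<int>\<^sub>p)\<close> is compact, left invariance determines the probability measure and implies
  right invariance.\<close>

definition haar_GL_Zp :: "('p::prime_card, 'n::finite) pmat measure \<Rightarrow> bool" where
  "haar_GL_Zp H \<longleftrightarrow> prob_space H \<and> sets H = sets borel_GL_Zp \<and>
     (\<forall>k\<in>GL_Zp. distr H H (\<lambda>g. k ** g) = H)"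

section \<open>Stochastic processes on \<open>[0, \<infinity>)\<close>\<close>

definition trajectory :: "(real \<Rightarrow> 'a \<Rightarrow> 'b) \<Rightarrow> real \<Rightarrow> 'a \<Rightarrow> real \<Rightarrow> 'b" where
  "trajectory X t w = restrict (\<lambda>s. X s w) {0..t}"

text \<open>The sigma-algebra generated by the whole trajectory on \<open>[0, t]\<close>.\<close>

definition natural_filtration ::
  "'a measure \<Rightarrow> 'b measure \<Rightarrow> (real \<Rightarrow> 'a \<Rightarrow> 'b) \<Rightarrow> real \<Rightarrow> 'a measure" where
  "natural_filtration W S X t =
     vimage_algebra (space W) (trajectory X t) (PiM {0..t} (\<lambda>_. S))"

definition process :: "'a measure \<Rightarrow> 'b measure \<Rightarrow> (real \<Rightarrow> 'a \<Rightarrow> 'b) \<Rightarrow> bool" where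
  "process W S X \<longleftrightarrow> (\<forall>t\<ge>0. X t \<in> measurable W S)"

definition markov_process :: "'a measure \<Rightarrow> 'b measure \<Rightarrow> (real \<Rightarrow> 'a \<Rightarrow> 'b) \<Rightarrow> bool" where
  "markov_process W S X \<longleftrightarrow> process W S X \<and>
     (\<forall>s\<ge>0. \<forall>t\<ge>s. \<forall>A\<in>sets S. AE w in W.
        real_cond_exp W (natural_filtration W S X s) (\<lambda>w. indicator A (X t w)) w =
        real_cond_exp W (vimage_algebra (space W) (X s) S) (\<lambda>w. indicator A (X t w)) w)"

definition increment ::
  "(real \<Rightarrow> 'a \<Rightarrow> ('p::prime_card, 'n::finite) pmat) \<Rightarrow> real \<Rightarrow> real \<Rightarrow> 'a \<Rightarrow> ('p, 'n) pmat" where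
  "increment X t s w = X (t + s) w ** matrix_inv (X t w)"

definition independent_increments ::
  "'a measure \<Rightarrow> (real \<Rightarrow> 'a \<Rightarrow> ('p::prime_card, 'n::finite) pmat) \<Rightarrow> bool" where
  "independent_increments W X \<longleftrightarrow> (\<forall>t\<ge>0. \<forall>s\<ge>0. prob_space.indep_set W
     (sets (vimage_algebra (space W) (increment X t s) borel_GL_Qp))
     (sets (natural_filtration W borel_GL_Qp X t)))"

definition stationary_increments ::
  "'a measure \<Rightarrow> (real \<Rightarrow> 'a \<Rightarrow> ('p::prime_card, 'n::finite) pmat) \<Rightarrow> bool" where
  "stationary_increments W X \<longleftrightarrow> (\<forall>t\<ge>0. \<forall>s\<ge>0.
     distr W borel_GL_Qp (increment X t s) =
     distr W borel_GL_Qp (increment X 0 s))"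

definition isotropic_increments ::
  "'a measure \<Rightarrow> (real \<Rightarrow> 'a \<Rightarrow> ('p::prime_card, 'n::finite) pmat) \<Rightarrow> bool" where
  "isotropic_increments W X \<longleftrightarrow> (\<forall>k\<in>GL_Zp. \<forall>t\<ge>0. \<forall>s\<ge>0.
     distr W borel_GL_Qp (increment X t s) =
     distr W borel_GL_Qp (\<lambda>w. k ** increment X t s w ** matrix_inv k))"

text \<open>Monotonicity of the paths makes the truncated differences of naturals true differences.\<close>

definition poisson_process :: "'a measure \<Rightarrow> real \<Rightarrow> (real \<Rightarrow> 'a \<Rightarrow> nat) \<Rightarrow> bool" where
  "poisson_process W c P \<longleftrightarrow> process W (count_space UNIV) P \<and>
     (\<forall>w\<in>space W. P 0 w = 0 \<and> mono_on {0..} (\<lambda>t. P t w) \<and>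
        (\<forall>t\<ge>0. continuous (at_right t) (\<lambda>t. P t w))) \<and>
     (\<forall>t\<ge>0. \<forall>s\<ge>0. prob_space.indep_set W
        (sets (vimage_algebra (space W) (\<lambda>w. P (t + s) w - P t w) (count_space UNIV)))
        (sets (natural_filtration W (count_space UNIV) P t))) \<and>
     (\<forall>t\<ge>0. \<forall>s\<ge>0. \<forall>k. measure W {w \<in> space W. P (t + s) w - P t w = k} =
        (c * s) ^ k / fact k * exp (- (c * s)))"

section \<open>The process Y\<close>

definition has_law :: "'a measure \<Rightarrow> ('a \<Rightarrow> 'b) \<Rightarrow> 'b measure \<Rightarrow> bool" where
  "has_law W f D \<longleftrightarrow> f \<in> measurable W D \<and> distr W D f = D"

text \<open>Sequences are indexed from \<open>0\<close>: \<open>nu i\<close>, \<open>U i\<close>, \<open>V i\<close> are the \<open>(i+1)\<close>-st variables.\<close>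

datatype Y_source = Src_P | Src_nu nat | Src_U nat | Src_V nat

definition Y_data ::
  "'a measure \<Rightarrow> 'n::{finite, linorder} tuple measure \<Rightarrow> real \<Rightarrow> (real \<Rightarrow> 'a \<Rightarrow> nat) \<Rightarrow>
   (nat \<Rightarrow> 'a \<Rightarrow> 'n tuple) \<Rightarrow> (nat \<Rightarrow> 'a \<Rightarrow> ('p::prime_card, 'n) pmat) \<Rightarrow>
   (nat \<Rightarrow> 'a \<Rightarrow> ('p, 'n) pmat) \<Rightarrow> bool" where
  "Y_data W M c P nu U V \<longleftrightarrow> prob_space W \<and> poisson_process W c P \<and>
     (\<forall>i. has_law W (nu i) M) \<and>
     (\<forall>i. \<exists>H. haar_GL_Zp H \<and> has_law W (U i) H) \<and>
     (\<forall>i. \<exists>H. haar_GL_Zp H \<and> has_law W (V i) H) \<and>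
     prob_space.indep_sets W (\<lambda>src. case src of
         Src_P \<Rightarrow> sets (vimage_algebra (space W) (\<lambda>w. \<lambda>t\<in>{0..}. P t w)
           (PiM {0..} (\<lambda>_. count_space UNIV)))
       | Src_nu i \<Rightarrow> sets (vimage_algebra (space W) (nu i) M)
       | Src_U i \<Rightarrow> sets (vimage_algebra (space W) (U i) borel_GL_Zp)
       | Src_V i \<Rightarrow> sets (vimage_algebra (space W) (V i) borel_GL_Zp)) UNIV"

text \<open>
  HOL cannot quantify existentially over types, so a realisation of the process is sought on the
  canonical sample space of \<open>(P, nu, U, V)\<close>; every realisation can be transported to it.
\<close>

type_synonym ('p, 'n) Y_sample =
  "(real \<Rightarrow> nat) \<times> (nat \<Rightarrow> 'n tuple) \<times> (nat \<Rightarrow> ('p, 'n) pmat) \<times> (nat \<Rightarrow> ('p, 'n) pmat)"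

primrec Y_product ::
  "(nat \<Rightarrow> 'n::finite tuple) \<Rightarrow> (nat \<Rightarrow> ('p::prime_card, 'n) pmat) \<Rightarrow> (nat \<Rightarrow> ('p, 'n) pmat) \<Rightarrow>
   nat \<Rightarrow> ('p, 'n) pmat" where
  "Y_product nu U V 0 = mat 1"
| "Y_product nu U V (Suc k) = U k ** diag_p (nu k) ** V k ** Y_product nu U V k"

definition Y_process ::
  "(real \<Rightarrow> 'a \<Rightarrow> nat) \<Rightarrow> (nat \<Rightarrow> 'a \<Rightarrow> 'n::finite tuple) \<Rightarrow>
   (nat \<Rightarrow> 'a \<Rightarrow> ('p::prime_card, 'n) pmat) \<Rightarrow> (nat \<Rightarrow> 'a \<Rightarrow> ('p, 'n) pmat) \<Rightarrow>
   real \<Rightarrow> 'a \<Rightarrow> ('p, 'n) pmat" where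
  "Y_process P nu U V t w =
     Y_product (\<lambda>i. nu i w) (\<lambda>i. U i w) (\<lambda>i. V i w) (P t w)"

definition same_multitime_law ::
  "'a measure \<Rightarrow> 'b measure \<Rightarrow> 'c measure \<Rightarrow> (real \<Rightarrow> 'a \<Rightarrow> 'c) \<Rightarrow> (real \<Rightarrow> 'b \<Rightarrow> 'c) \<Rightarrow> bool" where
  "same_multitime_law W W' S X Y \<longleftrightarrow> process W S X \<and> process W' S Y \<and>
     (\<forall>J. finite J \<and> J \<subseteq> {0..} \<longrightarrow>
        distr W (PiM J (\<lambda>_. S)) (\<lambda>w. \<lambda>t\<in>J. X t w) =
        distr W' (PiM J (\<lambda>_. S)) (\<lambda>w. \<lambda>t\<in>J. Y t w))"

end

theory Submission imports Defs begin

text \<open>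
  The law of the increment \<open>X (t + s) ** matrix_inv (X t)\<close> is invariant under conjugation by \<open>K = GL\<^sub>N(\<int>\<^sub>p)\<close>, so a Haar
  distributed element of \<open>K\<close> may be inserted between it and the matrix \<open>X t\<close>.  Therefore the law of
  \<open>SN (X (t + s))\<close>, given the past, depends on the past only via \<open>SN (X t)\<close>, and \<open>SN\<close> of the process is a
  Markov process on the countable set \<open>Sig\<close>.  Its kernels have the form
  \<open>T s l = (\<Sum>\<mu>. m s \<mu> * step_law \<mu> l)\<close>, where \<open>m s\<close> is the law of \<open>SN (X s)\<close>, and \<open>step_law \<mu> l\<close> is the law
  of the singular numbers of a product \<open>diag_p \<mu> ** k ** diag_p l\<close> with Haar distributed \<open>k\<close>
  (\<open>law_X_mult\<close>, \<open>SN_markov\<close>).  The process \<open>Y\<close> has independent Haar factors around each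
  diagonal matrix, so \<open>SN (Y t)\<close> performs, at the jump times of \<open>P\<close>, independent steps with the same
  kernel \<open>step_law\<close>, of a type that is chosen by \<open>M\<close> (\<open>chain_step\<close>, \<open>SN_Y_process_markov\<close>).  It remains to
  show that the kernels \<open>T s\<close> are compound Poisson mixtures of powers of one step kernel; then both
  processes have the same kernels and the same initial state, hence the same joint laws
  (\<open>markov_from_unique\<close>).

  A semigroup of kernels of this form is a compound Poisson mixture as soon as
  \<open>m t 0\<close> tends to \<open>1\<close> for \<open>t\<close> tending to \<open>0\<close> (\<open>compound_poisson\<close>).  Two steps of time \<open>h\<close> can be made such that
  one of them stays put, so the rates \<open>m h \<mu> / h\<close> are monotone along \<open>h\<^sub>0 / 2^j\<close> up to a
  factor that tends to \<open>1\<close>, and converge to jump rates.  Dividing the time \<open>t\<close> into many steps, and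
  choosing those that are jumps, bounds \<open>T t\<close> from below by a binomial mixture of powers of the step kernel; in the limit this is
  a Poisson mixture, and a lower bound between probability laws is an equality.

  The convergence of \<open>m t 0\<close> comes from the semigroup property alone, by reduction to the integers: the norm of the determinant of \<open>X\<close>, and the
  norm of each column of \<open>X\<close>, are powers of \<open>p\<close> whose exponents have increments with laws that do not
  depend on the current state, because \<open>K\<close> acts transitively on vectors of norm \<open>1\<close>.  A convolution semigroup on the
  integers that is indexed by all positive reals concentrates at \<open>0\<close> for small times, as the possible
  positions of its large atom are divisible by all powers of \<open>2\<close> (\<open>int_convolution_semigroup_tendsto\<close>).
  When all these exponents vanish, the matrix lies in \<open>K\<close> (\<open>GL_Zp_of_logs\<close>), i.e. has singular numbers \<open>0\<close>.

  The remaining parts supply the objects: existence and uniqueness of the Smith normal form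
  (\<open>smith_normal_form\<close>, \<open>SN_unique\<close>), a two-sided invariant Haar measure on \<open>K\<close>, built from independent p-adic
  digits (\<open>haar_GL_Zp_exists\<close>), and a Poisson process, built from independent
  exponential gaps (\<open>poisson_path_law_exists\<close>).
\<close>

section \<open>The topology of the p-adic numbers\<close>

lemma prime_card_gt_1: "1 < real CARD('p::prime_card)"
  using prime_gt_1_nat[OF prime_card[where 'a='p]] by simp

lemma padic_norm_0 [simp]: "padic_norm 0 = 0"
  by (simp add: padic_norm_eq_0)

lemma padic_norm_nonneg [simp]: "0 \<le> padic_norm x"
  using padic_norm_ultrametric[of x "- x"] by (simp add: padic_norm_minus)

lemma padic_norm_pos: "x \<noteq> 0 \<Longrightarrow> 0 < padic_norm x"
  using padic_norm_nonneg[of x] padic_norm_eq_0[of x] by linarith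

lemma padic_norm_1 [simp]: "padic_norm (1 :: 'p::prime_card padic) = 1"
proof -
  have "padic_norm (1 :: 'p padic) * padic_norm (1 :: 'p padic) = padic_norm (1 :: 'p padic) * 1"
    by (simp flip: padic_norm_mult)
  moreover have "padic_norm (1 :: 'p padic) \<noteq> 0" by (simp add: padic_norm_eq_0)
  ultimately show ?thesis by (simp only: mult_cancel_left) blast
qed

lemma padic_norm_inverse: "padic_norm (inverse x) = inverse (padic_norm x)"
proof (cases "x = 0")
  case False
  have "padic_norm (inverse x) * padic_norm x = 1"
    using False by (simp flip: padic_norm_mult)
  then show ?thesis by (metis inverse_unique mult.commute)
qed simp

lemma padic_norm_divide: "padic_norm (x / y) = padic_norm x / padic_norm y"
  by (simp add: divide_inverse padic_norm_mult padic_norm_inverse)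

lemma padic_norm_diff_commute: "padic_norm (x - y) = padic_norm (y - x)"
  using padic_norm_minus[of "x - y"] by simp

lemma padic_norm_power: "padic_norm (x ^ n) = padic_norm x ^ n"
  by (induction n) (simp_all add: padic_norm_mult)

lemma padic_norm_powi: "padic_norm (x powi k) = padic_norm x powi k"
  by (simp add: power_int_def padic_norm_power padic_norm_inverse)

lemma padic_norm_add_le: "padic_norm x \<le> b \<Longrightarrow> padic_norm y \<le> b \<Longrightarrow> padic_norm (x + y) \<le> b"
  using padic_norm_ultrametric[of x y] by simp

lemma padic_norm_diff_le: "padic_norm x \<le> b \<Longrightarrow> padic_norm y \<le> b \<Longrightarrow> padic_norm (x - y) \<le> b"
  using padic_norm_add_le[of x b "- y"] by (simp add: padic_norm_minus)

lemma padic_norm_add_less: "padic_norm x < b \<Longrightarrow> padic_norm y < b \<Longrightarrow> padic_norm (x + y) < b"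
  using padic_norm_ultrametric[of x y] by simp

lemma padic_norm_sum_le: "0 \<le> b \<Longrightarrow> (\<And>i. i \<in> I \<Longrightarrow> padic_norm (f i) \<le> b) \<Longrightarrow> padic_norm (sum f I) \<le> b"
  by (induction I rule: infinite_finite_induct) (auto intro: padic_norm_add_le)

lemma padic_norm_sum_less: "0 < b \<Longrightarrow> (\<And>i. i \<in> I \<Longrightarrow> padic_norm (f i) < b) \<Longrightarrow> padic_norm (sum f I) < b"
  by (induction I rule: infinite_finite_induct) (auto intro: padic_norm_add_less)

lemma padic_norm_prod: "padic_norm (prod f I) = (\<Prod>i\<in>I. padic_norm (f i))"
  by (induction I rule: infinite_finite_induct) (auto simp: padic_norm_mult)

text \<open>In an ultrametric triangle the two longest sides are equal.\<close>

lemma padic_norm_add_eq: "padic_norm y < padic_norm x \<Longrightarrow> padic_norm (x + y) = padic_norm x"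
  using padic_norm_ultrametric[of x y] padic_norm_ultrametric[of "x + y" "- y"]
  by (simp add: padic_norm_minus)

definition padic_of_rat :: "rat \<Rightarrow> 'p::prime_card padic" where
  "padic_of_rat q = abs_padic (Seq (\<lambda>n. q))"

lemma padic_norm_of_rat: "padic_norm (padic_of_rat q :: 'p::prime_card padic) = padic_abs CARD('p) q"
  by (simp add: padic_of_rat_def padic_norm.abs_eq)

lemma padic_of_rat_diff: "padic_of_rat (a - b) = padic_of_rat a - padic_of_rat b"
  by (simp add: padic_of_rat_def minus_padic_def uminus_padic.abs_eq plus_padic.abs_eq)

lemma padic_of_rat_of_nat: "(padic_of_rat (of_nat k) :: 'p::prime_card padic) = of_nat k"
proof -
  have "of_nat k = (abs_padic (Seq (\<lambda>n. of_nat k)) :: 'p padic)"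
    by (induction k) (simp_all add: zero_padic_def one_padic_def plus_padic.abs_eq)
  then show ?thesis by (simp add: padic_of_rat_def)
qed

text \<open>A Cauchy sequence representing a p-adic number also converges to it.\<close>

lemma padic_of_rat_dense:
  assumes "e > 0" shows "\<exists>q. padic_norm (x - padic_of_rat q) < e"
proof (induction x)
  case (1 X)
  have half: "e / 2 > 0" using assms by simp
  obtain k where k: "\<And>m n. m \<ge> k \<Longrightarrow> n \<ge> k \<Longrightarrow> padic_abs CARD('a) (seq_of X m - seq_of X n) < e / 2"
    using padic_cauchy_seq_of[of X] half unfolding padic_cauchy_def by meson
  let ?Z = "Seq (\<lambda>n. seq_of X n - seq_of X k) :: 'a padic_seq"
  have "padic_cauchy CARD('a) (\<lambda>n. seq_of X n + - seq_of X k)"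
    by (rule padic_cauchy_add[OF prime_card]) simp_all
  then have Z: "seq_of ?Z = (\<lambda>n. seq_of X n - seq_of X k)"
    by (simp add: fun_eq_iff)
  have eq: "abs_padic X - padic_of_rat (seq_of X k) = abs_padic ?Z"
    by (simp add: padic_of_rat_def minus_padic_def uminus_padic.abs_eq plus_padic.abs_eq)
  have "padic_norm (abs_padic ?Z) \<le> e / 2"
    using padic_abs_seq_tendsto[of ?Z] unfolding Z
    by (rule LIMSEQ_le_const2) (use k in \<open>force intro: less_imp_le\<close>)
  then show ?case using assms unfolding eq[symmetric]
    by (intro exI[of _ "seq_of X k"]) simp
qed

lemma padic_abs_powi: "prime p \<Longrightarrow> x \<noteq> 0 \<Longrightarrow> \<exists>k. padic_abs p x = real p powi k"
  by (auto simp: padic_abs_def)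

text \<open>The value group is discrete: a nonzero p-adic number is so close to some rational that their norms agree.\<close>

lemma padic_norm_powi_ex:
  assumes "(x :: 'p::prime_card padic) \<noteq> 0"
  obtains k where "padic_norm x = real CARD('p) powi k"
proof -
  obtain q where q: "padic_norm (x - padic_of_rat q) < padic_norm x"
    using padic_of_rat_dense[OF padic_norm_pos[OF assms]] by blast
  then have eq: "padic_norm (padic_of_rat q :: 'p padic) = padic_norm x"
    using padic_norm_add_eq[of "padic_of_rat q - x" x] padic_norm_diff_commute[of x] by simp
  then have "(q :: rat) \<noteq> 0" using assms padic_norm_pos[OF assms] by (auto simp: padic_norm_of_rat)
  then show ?thesis
    using eq that padic_abs_powi[OF prime_card[where 'a='p]] by (metis padic_norm_of_rat)
qed

lemma padic_norm_less_1:
  assumes "padic_norm (x :: 'p::prime_card padic) < 1"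
  shows "padic_norm x \<le> 1 / CARD('p)"
proof (cases "x = 0")
  case False
  then obtain k where k: "padic_norm x = real CARD('p) powi k" by (rule padic_norm_powi_ex)
  have "k < 0" using assms prime_card_gt_1[where 'p='p] unfolding k
    by (metis less_eq_real_def linorder_not_less one_le_power_int)
  then have "real CARD('p) powi k \<le> real CARD('p) powi (- 1)"
    using prime_card_gt_1[where 'p='p] by (intro power_int_increasing) auto
  then show ?thesis by (simp add: k divide_inverse power_int_minus)
qed simp

lemma eventually_dist_prod:
  fixes a :: "'a::metric_space" and b :: "'b::metric_space"
  assumes "e > 0"
  shows "\<forall>\<^sub>F x in nhds a \<times>\<^sub>F nhds b. dist (fst x) a < e \<and> dist (snd x) b < e"
proof -
  have "\<forall>\<^sub>F x in nhds (a, b). dist (fst x) (fst (a, b)) < e"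
    by (rule tendstoD[OF tendsto_fst[OF filterlim_ident] assms])
  moreover have "\<forall>\<^sub>F x in nhds (a, b). dist (snd x) (snd (a, b)) < e"
    by (rule tendstoD[OF tendsto_snd[OF filterlim_ident] assms])
  ultimately show ?thesis by (simp add: nhds_prod eventually_conj_iff)
qed

instance padic :: (prime_card) topological_comm_monoid_add
proof
  fix a b :: "'a padic"
  show "((\<lambda>x. fst x + snd x) \<longlongrightarrow> a + b) (nhds a \<times>\<^sub>F nhds b)"
  proof (rule tendstoI)
    fix e :: real assume e: "e > 0"
    have "\<forall>\<^sub>F x in nhds a \<times>\<^sub>F nhds b. dist (fst x) a < e \<and> dist (snd x) b < e"
      using e by (rule eventually_dist_prod)
    then show "\<forall>\<^sub>F x in nhds a \<times>\<^sub>F nhds b. dist (fst x + snd x) (a + b) < e"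
    proof eventually_elim
      case (elim x)
      then show ?case using padic_norm_add_less[of "fst x - a" e "snd x - b"]
        by (simp add: dist_padic_def add_diff_add)
    qed
  qed
qed

instance padic :: (prime_card) topological_semigroup_mult
proof
  fix a b :: "'a padic"
  show "((\<lambda>x. fst x * snd x) \<longlongrightarrow> a * b) (nhds a \<times>\<^sub>F nhds b)"
  proof (rule tendstoI)
    fix e :: real assume e: "e > 0"
    define r where "r = min 1 (e / (1 + padic_norm a + padic_norm b))"
    have pos: "1 + padic_norm a + padic_norm b > 0"
      using padic_norm_nonneg[of a] padic_norm_nonneg[of b] by linarith
    have r: "r > 0" "r \<le> 1" using e pos by (auto simp: r_def)
    have re: "r * (1 + padic_norm a + padic_norm b) \<le> e"
      using pos by (simp add: r_def flip: pos_le_divide_eq)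
    have "\<forall>\<^sub>F x in nhds a \<times>\<^sub>F nhds b. dist (fst x) a < r \<and> dist (snd x) b < r"
      using r(1) by (rule eventually_dist_prod)
    then show "\<forall>\<^sub>F x in nhds a \<times>\<^sub>F nhds b. dist (fst x * snd x) (a * b) < e"
    proof eventually_elim
      case (elim x)
      define u v where "u = fst x - a" and "v = snd x - b"
      have u: "padic_norm u < r" "padic_norm v < r"
        using elim by (simp_all add: u_def v_def dist_padic_def)
      have eq: "fst x * snd x - a * b = (u * v + u * b) + a * v"
        by (simp add: u_def v_def algebra_simps)
      have le: "t \<le> 1 + padic_norm a + padic_norm b \<Longrightarrow> s < r \<Longrightarrow> 0 \<le> t \<Longrightarrow> 0 \<le> s \<Longrightarrow> s * t < e" for s t
      proof -
        assume t: "t \<le> 1 + padic_norm a + padic_norm b" "s < r" "0 \<le> t" "0 \<le> s"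
        have "s * t \<le> s * (1 + padic_norm a + padic_norm b)" using t by (intro mult_left_mono)
        also have "\<dots> < r * (1 + padic_norm a + padic_norm b)" using t pos by simp
        finally show "s * t < e" using re by simp
      qed
      have "padic_norm (u * v) < e" unfolding padic_norm_mult
        using u r(2) padic_norm_nonneg[of a] padic_norm_nonneg[of b] padic_norm_nonneg[of u]
          padic_norm_nonneg[of v] by (intro le) linarith+
      moreover have "padic_norm (u * b) < e" unfolding padic_norm_mult
        using u padic_norm_nonneg[of a] by (intro le) auto
      moreover have "padic_norm (a * v) < e" unfolding padic_norm_mult
        using u padic_norm_nonneg[of b] by (subst mult.commute, intro le) auto
      ultimately show ?case unfolding dist_padic_def eq by (intro padic_norm_add_less)
    qed
  qed
qed

instance padic :: (prime_card) second_countable_topology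
proof
  define B where "B = (\<lambda>(q, n). ball (padic_of_rat q :: 'a padic) (1 / real (Suc n))) ` (UNIV :: (rat \<times> nat) set)"
  have "topological_basis B"
  proof (rule topological_basisI)
    fix U :: "'a padic set" and x assume "open U" "x \<in> U"
    then obtain e where e: "e > 0" "ball x e \<subseteq> U" by (meson openE)
    obtain n where n: "1 / real (Suc n) < e / 2"
      using nat_approx_posE[of "e / 2"] e by auto
    obtain q where q: "padic_norm (x - padic_of_rat q) < 1 / real (Suc n)"
      using padic_of_rat_dense[of "1 / real (Suc n)"] by auto
    have "y \<in> U" if "dist (padic_of_rat q) y < 1 / real (Suc n)" for y
    proof -
      have "dist x y < e" using q that n dist_triangle[of x y "padic_of_rat q"]
        by (simp add: dist_padic_def)
      then show ?thesis using e by auto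
    qed
    moreover have "ball (padic_of_rat q :: 'a padic) (1 / real (Suc n)) \<in> B" unfolding B_def by auto
    moreover have "x \<in> ball (padic_of_rat q) (1 / real (Suc n))"
      using q by (simp add: dist_padic_def padic_norm_diff_commute)
    ultimately show "\<exists>b\<in>B. x \<in> b \<and> b \<subseteq> U" by (metis mem_ball subsetI)
  qed (auto simp: B_def)
  then show "\<exists>B::'a padic set set. countable B \<and> open = generate_topology B"
    by (intro exI[of _ B]) (auto simp: B_def topological_basis_imp_subbasis)
qed

instance vec :: ("{metric_space, second_countable_topology}", finite) second_countable_topology
proof
  obtain B :: "'a set set" where B: "countable B" "topological_basis B"
    using ex_countable_basis by blast
  define C where "C = (\<lambda>f. {x :: 'a ^ 'b. \<forall>i. x $ i \<in> f i}) ` (UNIV \<rightarrow>\<^sub>E B)"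
  have "countable C" unfolding C_def by (intro countable_image countable_PiE) (auto simp: B)
  moreover have "topological_basis C"
  proof (rule topological_basisI)
    fix U assume "U \<in> C"
    then obtain f where f: "f \<in> UNIV \<rightarrow>\<^sub>E B" "U = {x. \<forall>i. x $ i \<in> f i}" by (auto simp: C_def)
    show "open U" unfolding f(2) open_vec_def
      using f(1) by (intro ballI exI[of _ f]) (auto intro: topological_basis_open[OF B(2)])
  next
    fix U :: "('a ^ 'b) set" and x assume "open U" "x \<in> U"
    then have "\<exists>A. (\<forall>i. open (A i) \<and> x $ i \<in> A i) \<and> (\<forall>y. (\<forall>i. y $ i \<in> A i) \<longrightarrow> y \<in> U)"
      unfolding open_vec_def by blast
    then obtain A where AA: "(\<forall>i. open (A i) \<and> x $ i \<in> A i) \<and> (\<forall>y. (\<forall>i. y $ i \<in> A i) \<longrightarrow> y \<in> U)"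
      by (elim exE)
    then have A: "\<And>i. open (A i)" "\<And>i. x $ i \<in> A i" and
      A': "\<forall>y. (\<forall>i. y $ i \<in> A i) \<longrightarrow> y \<in> U"
      by simp_all
    have "\<exists>b\<in>B. x $ i \<in> b \<and> b \<subseteq> A i" for i
      using topological_basisE[OF B(2) A(1,2)] by metis
    then obtain f where f: "\<And>i. f i \<in> B \<and> x $ i \<in> f i \<and> f i \<subseteq> A i" by metis
    then have "{x. \<forall>i. x $ i \<in> f i} \<in> C" unfolding C_def by (intro imageI) auto
    moreover have "{x. \<forall>i. x $ i \<in> f i} \<subseteq> U" using f A' by (auto simp: subset_iff)
    ultimately show "\<exists>c\<in>C. x \<in> c \<and> c \<subseteq> U" using f by (intro bexI[of _ "{x. \<forall>i. x $ i \<in> f i}"]) auto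
  qed
  ultimately show "\<exists>B::('a ^ 'b) set set. countable B \<and> open = generate_topology B"
    by (intro exI[of _ C]) (simp add: topological_basis_imp_subbasis)
qed

section \<open>The group of integral matrices\<close>

lemma integral_matD: "integral_mat A \<Longrightarrow> padic_norm (A $ i $ j) \<le> 1"
  by (simp add: integral_mat_def padic_ints_def)

lemma integral_mat_mult: "integral_mat A \<Longrightarrow> integral_mat B \<Longrightarrow> integral_mat (A ** B)"
  unfolding integral_mat_def padic_ints_def matrix_matrix_mult_def
  by (auto intro!: padic_norm_sum_le simp: padic_norm_mult mult_le_one)

lemma integral_mat_1: "integral_mat (mat 1)"
  by (simp add: integral_mat_def padic_ints_def mat_def)

lemma GL_ZpI: "integral_mat A \<Longrightarrow> integral_mat B \<Longrightarrow> A ** B = mat 1 \<Longrightarrow> A \<in> GL_Zp"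
  unfolding GL_Zp_def using matrix_left_right_inverse by blast

lemma GL_ZpE:
  assumes "A \<in> GL_Zp"
  obtains B where "B \<in> GL_Zp" "A ** B = mat 1" "B ** A = mat 1"
  using assms unfolding GL_Zp_def by blast

lemma GL_Zp_integral: "A \<in> GL_Zp \<Longrightarrow> integral_mat A"
  by (simp add: GL_Zp_def)

lemma GL_Zp_1: "mat 1 \<in> GL_Zp"
  by (rule GL_ZpI[of _ "mat 1"]) (simp_all add: integral_mat_1)

lemma GL_Zp_mult: 
  assumes "A \<in> GL_Zp" "B \<in> GL_Zp" shows "A ** B \<in> GL_Zp"
proof -
  obtain A' B' where A': "A' \<in> GL_Zp" "A ** A' = mat 1" and B': "B' \<in> GL_Zp" "B ** B' = mat 1"
    using assms by (metis GL_ZpE)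
  have "(A ** B) ** (B' ** A') = A ** (B ** B') ** A'"
    by (simp only: matrix_mul_assoc)
  then show ?thesis
    using A' B' assms by (intro GL_ZpI[of _ "B' ** A'"]) (simp_all add: integral_mat_mult GL_Zp_integral)
qed

lemma GL_Zp_subset_GL_Qp: "A \<in> GL_Zp \<Longrightarrow> A \<in> GL_Qp"
  by (auto simp: GL_Zp_def GL_Qp_def invertible_def)

lemma GL_Qp_mult: "A \<in> GL_Qp \<Longrightarrow> B \<in> GL_Qp \<Longrightarrow> A ** B \<in> GL_Qp"
  by (simp add: GL_Qp_def invertible_mult)

lemma GL_Qp_1: "mat 1 \<in> GL_Qp"
  by (simp add: GL_Zp_1 GL_Zp_subset_GL_Qp)

lemma matrix_inv_GL_Qp:
  assumes "A \<in> GL_Qp"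
  shows "A ** matrix_inv A = mat 1" "matrix_inv A ** A = mat 1" "matrix_inv A \<in> GL_Qp"
proof -
  show 1: "A ** matrix_inv A = mat 1" "matrix_inv A ** A = mat 1"
    using assms someI_ex[of "\<lambda>B. A ** B = mat 1 \<and> B ** A = mat 1"]
    unfolding GL_Qp_def invertible_def matrix_inv_def by auto
  then show "matrix_inv A \<in> GL_Qp" unfolding GL_Qp_def invertible_def by blast
qed

lemma matrix_inv_unique: "(A :: ('p::prime_card, 'n::finite) pmat) ** B = mat 1 \<Longrightarrow> matrix_inv A = B"
  by (metis GL_Qp_def invertible_def matrix_inv_GL_Qp(2) matrix_left_right_inverse matrix_mul_assoc
      matrix_mul_lid matrix_mul_rid mem_Collect_eq)

lemma matrix_inv_1: "matrix_inv (mat 1 :: ('p::prime_card, 'n::finite) pmat) = mat 1"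
  by (rule matrix_inv_unique) simp

lemma matrix_inv_GL_Zp: "A \<in> GL_Zp \<Longrightarrow> matrix_inv A \<in> GL_Zp"
  by (metis GL_ZpE matrix_inv_unique)

lemma GL_Zp_transpose: "A \<in> GL_Zp \<Longrightarrow> transpose A \<in> GL_Zp"
proof -
  assume A: "A \<in> GL_Zp"
  then obtain B where B: "B \<in> GL_Zp" "B ** A = mat 1" by (metis GL_ZpE)
  have "transpose A ** transpose B = mat 1"
    by (simp add: B(2) transpose_mat flip: matrix_transpose_mul)
  then show ?thesis using GL_Zp_integral[OF A] GL_Zp_integral[OF B(1)]
    by (intro GL_ZpI[of _ "transpose B"]) (auto simp: integral_mat_def transpose_def)
qed

lemma padic_norm_det_le:
  assumes "integral_mat A" shows "padic_norm (det A) \<le> 1"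
  unfolding det_def
  by (intro padic_norm_sum_le)
    (auto simp: padic_norm_mult padic_norm_prod sign_def padic_norm_minus
      intro!: prod_le_1 integral_matD assms)

lemma padic_norm_det_GL_Zp: 
  assumes "A \<in> GL_Zp" shows "padic_norm (det A) = 1"
proof -
  obtain B where B: "B \<in> GL_Zp" "A ** B = mat 1" using assms by (metis GL_ZpE)
  have "padic_norm (det A) * padic_norm (det B) = 1"
    by (simp add: B(2) flip: padic_norm_mult det_mul)
  moreover have "padic_norm (det A) \<le> 1" "padic_norm (det B) \<le> 1"
    using assms B by (simp_all add: GL_Zp_integral padic_norm_det_le)
  ultimately show ?thesis
    by (metis dual_order.antisym mult.right_neutral mult_left_mono padic_norm_nonneg)
qed

lemma diag_p_nth: "diag_p l $ i $ j = (if i = j then of_nat CARD('p) powi (l $ i) else 0 :: 'p::prime_card padic)"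
  by (simp add: diag_p_def)

lemma diag_p_mult_left: "(diag_p l ** A) $ i $ j = of_nat CARD('p) powi (l $ i) * (A $ i $ j :: 'p::prime_card padic)"
  by (simp add: matrix_matrix_mult_def diag_p_nth if_distrib[of "\<lambda>x. x * _"] cong: if_cong)

lemma diag_p_mult_right: "(A ** diag_p l) $ i $ j = (A $ i $ j :: 'p::prime_card padic) * of_nat CARD('p) powi (l $ j)"
  by (simp add: matrix_matrix_mult_def diag_p_nth if_distrib[of "\<lambda>x. _ * x"] cong: if_cong)

lemma padic_norm_p_powi: "padic_norm (of_nat CARD('p) powi k :: 'p::prime_card padic) = real CARD('p) powi (- k)"
  by (simp add: padic_norm_powi padic_norm_of_prime power_int_minus power_int_one_over divide_inverse power_int_inverse)

lemma of_nat_p_neq_0: "(of_nat CARD('p) :: 'p::prime_card padic) \<noteq> 0"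
  using padic_norm_of_prime[where 'p='p] by (auto simp: padic_norm_eq_0)

lemma diag_p_0: "diag_p 0 = mat 1"
  by (simp add: diag_p_def mat_def vec_eq_iff)

lemma diag_p_GL_Qp: "(diag_p l :: ('p::prime_card, 'n::finite) pmat) \<in> GL_Qp"
proof -
  have "diag_p l ** (diag_p (- l) :: ('p, 'n) pmat) = mat 1"
    using of_nat_p_neq_0[where 'p='p]
    by (simp add: vec_eq_iff diag_p_mult_left diag_p_nth mat_def flip: power_int_add)
  then show ?thesis unfolding GL_Qp_def invertible_def using matrix_left_right_inverse by blast
qed

section \<open>Singular numbers\<close>

text \<open>Otherwise \<open>f\<close> would map \<open>{..m}\<close> injectively into \<open>{..<m}\<close>.\<close>

lemma pigeonhole_permutes:
  fixes f :: "'n::{finite, linorder} \<Rightarrow> 'n"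
  assumes "f permutes UNIV" shows "\<exists>i\<le>m. m \<le> f i"
proof (rule ccontr)
  assume "\<not> ?thesis"
  then have "f ` {..m} \<subseteq> {..<m}" by auto
  then have "card (f ` {..m}) \<le> card {..<m}" by (intro card_mono) auto
  also have "\<dots> < card {..m}" by (intro psubset_card_mono) auto
  also have "\<dots> = card (f ` {..m})"
    using permutes_inj[OF assms] by (intro card_image[symmetric]) (auto intro: inj_on_subset)
  finally show False by simp
qed

text \<open>
  An integral matrix with an \<open>a \<times> b\<close> block in \<open>p\<int>\<^sub>p\<close>, where \<open>a + b > N\<close>, has a determinant
  in \<open>p\<int>\<^sub>p\<close>, because every term of the Leibniz formula meets the block.  If two sorted
  diagonal matrices are equivalent and differ at index \<open>m\<close>, the transforming matrix has
  such a block, with corner at \<open>m\<close>.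
\<close>

lemma SN_unique_le:
  fixes l l' :: "'n::{finite, linorder} tuple"
  assumes U: "U \<in> GL_Zp" and V: "V \<in> GL_Zp" and l: "l \<in> Sig" and l': "l' \<in> Sig"
    and eq: "(U :: ('p::prime_card, 'n) pmat) ** diag_p l' = diag_p l ** V"
  shows "l $ m \<le> l' $ m"
proof (rule ccontr)
  assume "\<not> ?thesis"
  then have m: "l' $ m < l $ m" by simp
  have small: "padic_norm (U $ i $ j) < 1" if "i \<le> m" "m \<le> j" for i j
  proof -
    have "l $ m \<le> l $ i" "l' $ j \<le> l' $ m" using l l' that by (auto simp: Sig_def)
    then have lt: "l' $ j < l $ i" using m by simp
    have "U $ i $ j * of_nat CARD('p) powi (l' $ j) = of_nat CARD('p) powi (l $ i) * V $ i $ j"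
      using eq by (metis diag_p_mult_left diag_p_mult_right)
    then have "padic_norm (U $ i $ j) * real CARD('p) powi (- (l' $ j)) =
        real CARD('p) powi (- (l $ i)) * padic_norm (V $ i $ j)"
      by (metis padic_norm_mult padic_norm_p_powi)
    also have "\<dots> \<le> real CARD('p) powi (- (l $ i)) * 1"
      using integral_matD[OF GL_Zp_integral[OF V]] by (intro mult_left_mono) auto
    also have "\<dots> < real CARD('p) powi (- (l' $ j))"
      using lt prime_card_gt_1[where 'p='p] by (simp add: power_int_strict_increasing)
    finally show ?thesis
      using prime_card_gt_1[where 'p='p] by (simp add: zero_less_power_int)
  qed
  have "padic_norm (det U) < 1"
    unfolding det_def
  proof (intro padic_norm_sum_less)
    fix f assume "f \<in> {f. f permutes (UNIV :: 'n set)}"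
    then obtain i where i: "i \<le> m" "m \<le> f i" using pigeonhole_permutes by blast
    have "(\<Prod>i\<in>UNIV. padic_norm (U $ i $ f i)) = padic_norm (U $ i $ f i) * (\<Prod>i\<in>UNIV-{i}. padic_norm (U $ i $ f i))"
      by (rule prod.remove) auto
    also have "\<dots> \<le> padic_norm (U $ i $ f i) * 1"
      using integral_matD[OF GL_Zp_integral[OF U]] by (intro mult_left_mono prod_le_1) auto
    also have "\<dots> < 1" using small[OF i] by simp
    finally show "padic_norm (of_int (sign f) * (\<Prod>i\<in>UNIV. U $ i $ f i)) < 1"
      by (simp add: padic_norm_mult padic_norm_prod sign_def padic_norm_minus)
  qed simp
  then show False using padic_norm_det_GL_Zp[OF U] by simp
qed

lemma SN_unique:
  fixes l l' :: "'n::{finite, linorder} tuple"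
  assumes "U \<in> GL_Zp" "V \<in> GL_Zp" "U' \<in> GL_Zp" "V' \<in> GL_Zp" "l \<in> Sig" "l' \<in> Sig"
    and eq: "(U :: ('p::prime_card, 'n) pmat) ** diag_p l ** V = U' ** diag_p l' ** V'"
  shows "l = l'"
proof -
  have "l $ m \<le> l' $ m" if K: "U \<in> GL_Zp" "V \<in> GL_Zp" "U' \<in> GL_Zp" "V' \<in> GL_Zp" "l \<in> Sig" "l' \<in> Sig"
    and eq: "(U :: ('p, 'n) pmat) ** diag_p l ** V = U' ** diag_p l' ** V'" for U V U' V' l l' m
  proof -
    have "(matrix_inv U ** U') ** diag_p l' = matrix_inv U ** (U' ** diag_p l' ** V') ** matrix_inv V'"
      using matrix_inv_GL_Qp(1)[OF GL_Zp_subset_GL_Qp[OF K(4)]]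
      by (metis (no_types, lifting) matrix_mul_assoc matrix_mul_rid)
    also have "\<dots> = diag_p l ** (V ** matrix_inv V')"
      unfolding eq[symmetric] using matrix_inv_GL_Qp(2)[OF GL_Zp_subset_GL_Qp[OF K(1)]]
      by (metis (no_types, lifting) matrix_mul_assoc matrix_mul_lid)
    finally show ?thesis
      using K by (intro SN_unique_le[where U="matrix_inv U ** U'" and V="V ** matrix_inv V'"])
        (auto intro: GL_Zp_mult matrix_inv_GL_Zp)
  qed
  then show ?thesis using assms by (intro vec_eq_iff[THEN iffD2] allI antisym) metis+
qed

text \<open>
  For the existence, Gaussian elimination is run from the largest index downwards, each time with
  an entry of maximal norm as pivot: maximality makes all multipliers integral, and yields the
  exponents in sorted order.  All row and column operations that are needed add multiples
  of one row (column) to others.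
\<close>

text \<open>Left multiplication by this matrix adds \<open>c i\<close> times row \<open>m\<close> to row \<open>i\<close>, for every \<open>i\<close>.\<close>

definition transvection :: "'n \<Rightarrow> ('n \<Rightarrow> 'p padic) \<Rightarrow> ('p::prime_card, 'n::finite) pmat" where
  "transvection m c = (\<chi> i j. (if i = j then 1 else 0) + (if j = m then c i else 0))"

lemma transvection_mult: "(transvection m c ** A) $ i $ j = A $ i $ j + c i * A $ m $ j"
  unfolding transvection_def matrix_matrix_mult_def
  by (simp add: distrib_right sum.distrib if_distrib[of "\<lambda>x. x * _"] cong: if_cong)

lemma transvection_GL_Zp:
  assumes c: "\<And>i. padic_norm (c i) \<le> 1" "c m = 0"
  shows "transvection m c \<in> GL_Zp"
proof (rule GL_ZpI)
  have int: "integral_mat (transvection m d)" if d: "\<And>i. padic_norm (d i) \<le> 1" for d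
    using d unfolding integral_mat_def padic_ints_def transvection_def by (auto intro!: padic_norm_add_le)
  show "integral_mat (transvection m c)" "integral_mat (transvection m (\<lambda>i. - c i))"
    by (rule int; simp add: c padic_norm_minus)+
  show "transvection m c ** transvection m (\<lambda>i. - c i) = mat 1"
    using c by (simp add: vec_eq_iff transvection_mult) (simp add: transvection_def mat_def)
qed

definition K_equiv :: "('p::prime_card, 'n::finite) pmat \<Rightarrow> ('p, 'n) pmat \<Rightarrow> bool" where
  "K_equiv A B \<longleftrightarrow> (\<exists>U\<in>GL_Zp. \<exists>V\<in>GL_Zp. A = U ** B ** V)"

lemma K_equiv_trans: "K_equiv A B \<Longrightarrow> K_equiv B C \<Longrightarrow> K_equiv A C"
  unfolding K_equiv_def by (metis GL_Zp_mult matrix_mul_assoc)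

lemma K_equiv_mult_left: 
  assumes "U \<in> GL_Zp" shows "K_equiv A (U ** A)"
proof -
  obtain B where B: "B \<in> GL_Zp" "B ** U = mat 1" using assms by (metis GL_ZpE)
  have "A = B ** (U ** A) ** mat 1" using B(2) by (simp add: matrix_mul_assoc)
  then show ?thesis unfolding K_equiv_def using B(1) GL_Zp_1 by blast
qed

lemma K_equiv_GL_Qp: "K_equiv A B \<Longrightarrow> A \<in> GL_Qp \<Longrightarrow> B \<in> GL_Qp"
proof -
  assume "K_equiv A B" and A: "A \<in> GL_Qp"
  then obtain U V where UV: "U \<in> GL_Zp" "V \<in> GL_Zp" "A = U ** B ** V" unfolding K_equiv_def by blast
  obtain U' V' where "U' \<in> GL_Zp" "U' ** U = mat 1" "V' \<in> GL_Zp" "V ** V' = mat 1"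
    using UV by (metis GL_ZpE)
  moreover from this have "B = U' ** A ** V'" unfolding UV(3)
    by (metis matrix_mul_assoc matrix_mul_lid matrix_mul_rid)
  ultimately show ?thesis using A by (simp add: GL_Qp_mult GL_Zp_subset_GL_Qp)
qed

text \<open>The state of the elimination: outside the index set \<open>R\<close> the matrix is already diagonal.\<close>

definition partly_diagonal :: "'n set \<Rightarrow> real \<Rightarrow> ('p::prime_card, 'n::finite) pmat \<Rightarrow> bool" where
  "partly_diagonal R x A \<longleftrightarrow> (\<forall>i j. i \<noteq> j \<longrightarrow> i \<notin> R \<or> j \<notin> R \<longrightarrow> A $ i $ j = 0) \<and>
     (\<forall>i\<in>R. \<forall>j\<in>R. padic_norm (A $ i $ j) \<le> x)"

lemma partly_diagonal_row:
  assumes A: "partly_diagonal R x A" and c: "\<And>i. padic_norm (c i) \<le> 1" "\<And>i. i \<notin> R \<Longrightarrow> c i = 0" and m: "m \<in> R"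
  shows "partly_diagonal R x (transvection m c ** A)"
    and "i \<notin> R \<Longrightarrow> (transvection m c ** A) $ i $ j = A $ i $ j"
proof -
  have "padic_norm (c i * A $ m $ j) \<le> x" if "i \<in> R" "j \<in> R" for i j
  proof -
    have "padic_norm (c i * A $ m $ j) \<le> 1 * padic_norm (A $ m $ j)"
      unfolding padic_norm_mult by (intro mult_right_mono c) auto
    also have "\<dots> \<le> x" using A m that by (auto simp: partly_diagonal_def)
    finally show ?thesis .
  qed
  moreover have "A $ m $ j = 0" if "j \<notin> R" for j
    using A m that unfolding partly_diagonal_def by metis
  ultimately show "partly_diagonal R x (transvection m c ** A)"
    using A m c(2) unfolding partly_diagonal_def transvection_mult by (auto intro!: padic_norm_add_le)
  show "i \<notin> R \<Longrightarrow> (transvection m c ** A) $ i $ j = A $ i $ j" by (simp add: transvection_mult c)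
qed

lemma partly_diagonal_transpose: "partly_diagonal R x (transpose A) \<longleftrightarrow> partly_diagonal R x A"
  unfolding partly_diagonal_def transpose_def by auto

text \<open>
  If the entry in row \<open>m\<close> is not of maximal norm, adding row \<open>a\<close> to row \<open>m\<close> makes it so, by the
  isosceles property of the norm.
\<close>

lemma pivot_row:
  fixes A :: "('p::prime_card, 'n::finite) pmat"
  assumes A: "partly_diagonal R x A" and ab: "a \<in> R" "b \<in> R" "padic_norm (A $ a $ b) = x" and m: "m \<in> R"
  shows "\<exists>B. K_equiv A B \<and> partly_diagonal R x B \<and> (\<forall>i. i \<notin> R \<longrightarrow> B $ i $ i = A $ i $ i) \<and> padic_norm (B $ m $ b) = x"
proof (cases "padic_norm (A $ m $ b) = x")
  case True
  then show ?thesis using A K_equiv_mult_left[OF GL_Zp_1, of A] by (intro exI[of _ A]) simp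
next
  case False
  then have lt: "padic_norm (A $ m $ b) < padic_norm (A $ a $ b)" and am: "a \<noteq> m"
    using A ab m unfolding partly_diagonal_def by force+
  define c where "c i = (if i = m then 1 else 0 :: 'p padic)" for i
  let ?B = "transvection a c ** A"
  have c: "padic_norm (c i) \<le> 1" "i \<notin> R \<Longrightarrow> c i = 0" "c a = 0" for i
    using am m by (auto simp: c_def)
  have "?B $ m $ b = A $ a $ b + A $ m $ b" by (simp add: transvection_mult c_def)
  then have "padic_norm (?B $ m $ b) = x" using padic_norm_add_eq[OF lt] ab by simp
  then show ?thesis
    using partly_diagonal_row[OF A c(1,2) ab(1)] K_equiv_mult_left[OF transvection_GL_Zp[of c a], of A] c
    by (intro exI[of _ ?B]) auto
qed

lemma K_equiv_transpose: "K_equiv (transpose A) B \<Longrightarrow> K_equiv A (transpose B)"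
proof -
  assume "K_equiv (transpose A) B"
  then obtain U V where "U \<in> GL_Zp" "V \<in> GL_Zp" "transpose A = U ** B ** V" unfolding K_equiv_def by blast
  then have "U \<in> GL_Zp" "V \<in> GL_Zp" "A = transpose V ** transpose B ** transpose U"
    by (simp_all add: matrix_transpose_mul[symmetric] matrix_mul_assoc) (metis transpose_transpose)
  then show ?thesis unfolding K_equiv_def using GL_Zp_transpose by blast
qed

text \<open>First along the rows and then, after transposition, along the columns.\<close>

lemma pivot:
  fixes A :: "('p::prime_card, 'n::finite) pmat"
  assumes A: "partly_diagonal R x A" and ab: "a \<in> R" "b \<in> R" "padic_norm (A $ a $ b) = x" and m: "m \<in> R"
  shows "\<exists>B. K_equiv A B \<and> partly_diagonal R x B \<and> (\<forall>i. i \<notin> R \<longrightarrow> B $ i $ i = A $ i $ i) \<and> padic_norm (B $ m $ m) = x"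
proof -
  obtain B where B: "K_equiv A B" "partly_diagonal R x B" "\<And>i. i \<notin> R \<Longrightarrow> B $ i $ i = A $ i $ i" "padic_norm (B $ m $ b) = x"
    using pivot_row[OF assms] by blast
  have B': "partly_diagonal R x (transpose B)"
    using B by (simp add: partly_diagonal_transpose)
  have "padic_norm (transpose B $ b $ m) = x"
    using B by (simp add: transpose_def)
  from pivot_row[OF B' ab(2) m this m] obtain C where
    C: "K_equiv (transpose B) C" "partly_diagonal R x C" "\<And>i. i \<notin> R \<Longrightarrow> C $ i $ i = transpose B $ i $ i" "padic_norm (C $ m $ m) = x"
    by blast
  show ?thesis
    using C B K_equiv_trans[OF B(1) K_equiv_transpose[OF C(1)]]
    by (intro exI[of _ "transpose C"]) (simp add: partly_diagonal_transpose, simp add: transpose_def)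
qed

text \<open>The multipliers are quotients by an entry of maximal norm, so they are integral.\<close>

lemma clear_column:
  fixes A :: "('p::prime_card, 'n::finite) pmat"
  assumes A: "partly_diagonal R x A" and m: "m \<in> R" "padic_norm (A $ m $ m) = x" "x > 0"
  shows "\<exists>B. K_equiv A B \<and> partly_diagonal R x B \<and> (\<forall>i. i \<notin> R \<longrightarrow> B $ i $ i = A $ i $ i) \<and> 
    (\<forall>j. B $ m $ j = A $ m $ j) \<and> (\<forall>i. i \<noteq> m \<longrightarrow> B $ i $ m = 0)"
proof -
  define c where "c i = (if i \<in> R \<and> i \<noteq> m then - A $ i $ m / A $ m $ m else 0)" for i
  let ?B = "transvection m c ** A"
  have nz: "A $ m $ m \<noteq> 0" using m by auto
  have c: "padic_norm (c i) \<le> 1" "i \<notin> R \<Longrightarrow> c i = 0" "c m = 0" for i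
    using A m unfolding partly_diagonal_def c_def by (auto simp: padic_norm_divide padic_norm_minus)
  have "?B $ i $ m = 0" if "i \<noteq> m" for i
    using that A m(1) nz by (cases "i \<in> R") (auto simp: transvection_mult c_def partly_diagonal_def)
  then show ?thesis
    using partly_diagonal_row[OF A c(1,2) m(1)] K_equiv_mult_left[OF transvection_GL_Zp[of c m], of A] c
    by (intro exI[of _ ?B]) (auto simp: transvection_mult)
qed

lemma clear_cross:
  fixes A :: "('p::prime_card, 'n::finite) pmat"
  assumes A: "partly_diagonal R x A" and m: "m \<in> R" "padic_norm (A $ m $ m) = x" "x > 0"
  shows "\<exists>B. K_equiv A B \<and> partly_diagonal (R - {m}) x B \<and> (\<forall>i. i \<notin> R \<longrightarrow> B $ i $ i = A $ i $ i) \<and> 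
    B $ m $ m = A $ m $ m"
proof -
  obtain B where B: "K_equiv A B" "partly_diagonal R x B" "\<And>i. i \<notin> R \<Longrightarrow> B $ i $ i = A $ i $ i"
    "\<And>j. B $ m $ j = A $ m $ j" "\<And>i. i \<noteq> m \<Longrightarrow> B $ i $ m = 0"
    using clear_column[OF assms] by metis
  have B': "partly_diagonal R x (transpose B)"
    using B by (simp add: partly_diagonal_transpose)
  have "padic_norm (transpose B $ m $ m) = x"
    using B m by (simp add: transpose_def)
  from clear_column[OF B' m(1) this m(3)] obtain C where
    C: "K_equiv (transpose B) C" "partly_diagonal R x C" "\<And>i. i \<notin> R \<Longrightarrow> C $ i $ i = transpose B $ i $ i"
    "\<And>j. C $ m $ j = transpose B $ m $ j" "\<And>i. i \<noteq> m \<Longrightarrow> C $ i $ m = 0"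
    by metis
  have "partly_diagonal (R - {m}) x C"
    using C(2,4,5) B(5) unfolding partly_diagonal_def transpose_def by auto
  then show ?thesis
    using C B K_equiv_trans[OF B(1) K_equiv_transpose[OF C(1)]]
    by (intro exI[of _ "transpose C"]) (simp add: partly_diagonal_transpose, simp add: transpose_def)
qed

definition scaling :: "'n \<Rightarrow> 'p padic \<Rightarrow> ('p::prime_card, 'n::finite) pmat" where
  "scaling m u = (\<chi> i j. if i = j then (if i = m then u else 1) else 0)"

lemma scaling_mult: "(scaling m u ** A) $ i $ j = (if i = m then u else 1) * A $ i $ j"
  unfolding scaling_def matrix_matrix_mult_def by (simp add: if_distrib[of "\<lambda>x. x * _"] cong: if_cong)

lemma scaling_GL_Zp: "padic_norm u = 1 \<Longrightarrow> scaling m u \<in> GL_Zp"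
proof (rule GL_ZpI)
  assume u: "padic_norm u = 1"
  have int: "integral_mat (scaling m v)" if "padic_norm v = 1" for v
    using that unfolding integral_mat_def padic_ints_def scaling_def by auto
  show "integral_mat (scaling m u)" "integral_mat (scaling m (inverse u))"
    by (rule int; simp add: u padic_norm_inverse)+
  have "u \<noteq> 0" using u by auto
  then show "scaling m u ** scaling m (inverse u) = mat 1"
    by (simp add: vec_eq_iff scaling_mult) (simp add: scaling_def mat_def)
qed

text \<open>
  \<open>R\<close> is an initial segment of the indices, and \<open>x\<close> bounds both the entries that remain and, from
  below, the norms of the diagonal entries already found.  So each further exponent is
  at least as large as all exponents at larger indices.
\<close>

lemma smith_elimination:
  fixes A :: "('p::prime_card, 'n::{finite, linorder}) pmat"
  assumes "A \<in> GL_Qp" "\<And>i j. i \<in> R \<Longrightarrow> j \<notin> R \<Longrightarrow> i < j" "partly_diagonal R x A"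
    "\<And>i. i \<notin> R \<Longrightarrow> A $ i $ i = of_nat CARD('p) powi (l $ i)"
    "\<And>i. i \<notin> R \<Longrightarrow> x \<le> real CARD('p) powi (- (l $ i))"
    "\<And>i j. i \<notin> R \<Longrightarrow> j \<notin> R \<Longrightarrow> i \<le> j \<Longrightarrow> l $ j \<le> l $ i"
  shows "\<exists>l\<in>Sig. K_equiv A (diag_p l)"
  using assms
proof (induction "card R" arbitrary: R x A l)
  case 0
  then have R: "R = {}" by simp
  have "l \<in> Sig" using 0(7) unfolding R Sig_def by auto
  moreover have "A = diag_p l"
    using 0(4,5) unfolding R by (auto simp: vec_eq_iff diag_p_nth partly_diagonal_def)
  moreover have "K_equiv A A" using K_equiv_mult_left[OF GL_Zp_1, of A] by simp
  ultimately show ?case by blast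
next
  case (Suc n)
  let ?f = "\<lambda>(i, j). padic_norm (A $ i $ j)"
  have ne: "R \<noteq> {}" using Suc(2) by auto
  define y where "y = Max (?f ` (R \<times> R))"
  have yle: "padic_norm (A $ i $ j) \<le> y" if "i \<in> R" "j \<in> R" for i j
    unfolding y_def using that by (intro Max_ge) force+
  have "y \<in> ?f ` (R \<times> R)" unfolding y_def by (intro Max_in) (use ne in auto)
  then obtain a b where ab: "a \<in> R" "b \<in> R" "padic_norm (A $ a $ b) = y" by auto
  have yx: "y \<le> x" using Suc.prems(3) ab unfolding partly_diagonal_def by auto
  have pd: "partly_diagonal R y A" using Suc.prems(3) yle unfolding partly_diagonal_def by blast
  define m where "m = Max R"
  have m: "m \<in> R" "\<And>i. i \<in> R \<Longrightarrow> i \<le> m" unfolding m_def using ne by auto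
  have "y > 0"
  proof (rule ccontr)
    assume "\<not> y > 0"
    then have "A $ m $ j = 0" if "j \<in> R" for j
      using yle[OF m(1) that] padic_norm_nonneg[of "A $ m $ j"] by (metis linorder_not_less order.trans padic_norm_eq_0 order_antisym)
    then have "row m A = 0"
      using Suc.prems(3) m(1) unfolding partly_diagonal_def row_def vec_eq_iff
      by (metis vec_lambda_beta zero_index)
    then have "det A = 0" by (rule det_zero_row)
    then show False using Suc.prems(1) by (simp add: GL_Qp_def invertible_det_nz)
  qed
  obtain B where B: "K_equiv A B" "partly_diagonal R y B" "\<And>i. i \<notin> R \<Longrightarrow> B $ i $ i = A $ i $ i" "padic_norm (B $ m $ m) = y"
    using pivot[OF pd ab m(1)] by blast
  obtain C where C: "K_equiv B C" "partly_diagonal (R - {m}) y C" "\<And>i. i \<notin> R \<Longrightarrow> C $ i $ i = B $ i $ i" "C $ m $ m = B $ m $ m"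
    using clear_cross[OF B(2) m(1) B(4) \<open>y > 0\<close>] by blast
  have "C $ m $ m \<noteq> 0" using C(4) B(4) \<open>y > 0\<close> by auto
  obtain k where k: "y = real CARD('p) powi k"
    using padic_norm_powi_ex[of "C $ m $ m"] \<open>C $ m $ m \<noteq> 0\<close> B(4) C(4) by metis
  \<comment> \<open>The pivot is a power of \<open>p\<close> up to a unit, which a scaling of the row removes.\<close>
  define u where "u = of_nat CARD('p) powi (- k) / C $ m $ m"
  have u: "padic_norm u = 1"
    using B(4) C(4) k \<open>y > 0\<close> by (simp add: u_def padic_norm_divide padic_norm_p_powi)
  let ?D = "scaling m u ** C"
  define l' where "l' = (\<chi> i. if i = m then - k else l $ i)"
  have AD: "K_equiv A ?D"
    using K_equiv_trans[OF K_equiv_trans[OF B(1) C(1)] K_equiv_mult_left[OF scaling_GL_Zp[OF u, of m]]] .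
  have "\<exists>l\<in>Sig. K_equiv ?D (diag_p l)"
  proof (rule Suc.hyps(1))
    show "n = card (R - {m})" using Suc(2) m by simp
    show "?D \<in> GL_Qp" using K_equiv_GL_Qp[OF AD Suc.prems(1)] .
    show "i < j" if "i \<in> R - {m}" "j \<notin> R - {m}" for i j
      using that m(2)[of i] Suc.prems(2)[of i j] by (cases "j = m") auto
    show "partly_diagonal (R - {m}) y ?D"
      using C(2) unfolding partly_diagonal_def scaling_mult by auto
    show "?D $ i $ i = of_nat CARD('p) powi (l' $ i)" if "i \<notin> R - {m}" for i
      using that C(3) B(3) Suc.prems(4) \<open>C $ m $ m \<noteq> 0\<close> by (auto simp: scaling_mult l'_def u_def)
    show "y \<le> real CARD('p) powi (- (l' $ i))" if "i \<notin> R - {m}" for i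
      using that Suc.prems(5)[of i] yx k by (auto simp: l'_def)
    show "l' $ j \<le> l' $ i" if ij: "i \<notin> R - {m}" "j \<notin> R - {m}" "i \<le> j" for i j
    proof (cases "i = m")
      case True
      have "l $ j \<le> - k" if "j \<noteq> m"
      proof -
        have "real CARD('p) powi k \<le> real CARD('p) powi (- (l $ j))"
          using Suc.prems(5)[of j] that ij yx k by auto
        then show ?thesis using prime_card_gt_1[where 'p='p]
          by (metis linorder_not_less minus_less_iff minus_minus power_int_strict_increasing)
      qed
      then show ?thesis using True by (simp add: l'_def)
    next
      case False
      then have "i \<notin> R" "j \<noteq> m" using ij Suc.prems(2)[of m i] m(1) by auto
      then show ?thesis using False ij Suc.prems(6)[of i j] by (simp add: l'_def)
    qed
  qed
  then show ?case using K_equiv_trans[OF AD] by blast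
qed

lemma smith_normal_form:
  fixes A :: "('p::prime_card, 'n::{finite, linorder}) pmat"
  assumes "A \<in> GL_Qp"
  shows "\<exists>l\<in>Sig. \<exists>U\<in>GL_Zp. \<exists>V\<in>GL_Zp. A = U ** diag_p l ** V"
proof -
  have "partly_diagonal UNIV (Max (range (\<lambda>(i, j). padic_norm (A $ i $ j)))) A"
    unfolding partly_diagonal_def by (auto intro!: Max_ge intro: range_eqI[of _ _ "(i, j)" for i j])
  from smith_elimination[OF assms _ this] show ?thesis by (auto simp: K_equiv_def)
qed

lemma SN_eqI:
  assumes "l \<in> Sig" "U \<in> GL_Zp" "V \<in> GL_Zp" "A = U ** diag_p l ** V" shows "SN A = l"
  unfolding SN_def
proof (rule the_equality)
  fix k assume "k \<in> Sig \<and> (\<exists>U\<in>GL_Zp. \<exists>V\<in>GL_Zp. A = U ** diag_p k ** V)"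
  then show "k = l" using assms SN_unique by blast
qed (use assms in blast)

lemma SN_decomp:
  fixes A :: "('p::prime_card, 'n::{finite, linorder}) pmat"
  assumes "A \<in> GL_Qp"
  obtains U V where "U \<in> GL_Zp" "V \<in> GL_Zp" "A = U ** diag_p (SN A) ** V" "SN A \<in> Sig"
  using smith_normal_form[OF assms] SN_eqI that by metis

lemma SN_Sig: "A \<in> GL_Qp \<Longrightarrow> SN A \<in> Sig"
  by (metis SN_decomp)

lemma SN_mult_K:
  assumes "A \<in> GL_Qp" "U \<in> GL_Zp" "V \<in> GL_Zp" shows "SN (U ** A ** V) = SN A"
proof -
  obtain U' V' l where "U' \<in> GL_Zp" "V' \<in> GL_Zp" "A = U' ** diag_p l ** V'" "l \<in> Sig" "SN A = l"
    using SN_decomp[OF assms(1)] by metis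
  then show ?thesis
    using assms by (intro SN_eqI[of _ "U ** U'" "V' ** V"]) (auto intro: GL_Zp_mult simp: matrix_mul_assoc)
qed

lemma SN_mult_left_K: "A \<in> GL_Qp \<Longrightarrow> U \<in> GL_Zp \<Longrightarrow> SN (U ** A) = SN A"
  using SN_mult_K[of A U "mat 1"] by (simp add: GL_Zp_1)

lemma SN_mult_right_K: "A \<in> GL_Qp \<Longrightarrow> V \<in> GL_Zp \<Longrightarrow> SN (A ** V) = SN A"
  using SN_mult_K[of A "mat 1" V] by (simp add: GL_Zp_1)

lemma SN_diag_p: "l \<in> Sig \<Longrightarrow> SN (diag_p l :: ('p::prime_card, 'n::{finite, linorder}) pmat) = l"
  using GL_Zp_1 by (intro SN_eqI[of _ "mat 1" "mat 1"]) auto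

lemma zero_Sig: "0 \<in> Sig"
  by (simp add: Sig_def)

lemma SN_GL_Zp: "A \<in> GL_Zp \<Longrightarrow> SN A = 0"
  using GL_Zp_1 zero_Sig by (intro SN_eqI[of _ A "mat 1"]) (auto simp: diag_p_0)

lemma SN_eq_0_iff: "A \<in> GL_Qp \<Longrightarrow> SN A = 0 \<longleftrightarrow> A \<in> GL_Zp"
  by (metis GL_Zp_mult SN_GL_Zp SN_decomp diag_p_0 matrix_mul_rid)

text \<open>The singular numbers of an integral matrix are nonnegative, and their sum is the valuation of
  the determinant.\<close>

lemma GL_Zp_of_det:
  fixes A :: "('p::prime_card, 'n::{finite, linorder}) pmat"
  assumes A: "integral_mat A" "padic_norm (det A) = 1"
  shows "A \<in> GL_Zp"
proof -
  have "det A \<noteq> 0" using A(2) by auto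
  then have G: "A \<in> GL_Qp" by (simp add: GL_Qp_def invertible_det_nz)
  then obtain U V l where UV: "U \<in> GL_Zp" "V \<in> GL_Zp" "A = U ** diag_p l ** V" and l: "SN A = l"
    by (metis SN_decomp)
  let ?D = "diag_p l :: ('p, 'n) pmat"
  obtain U' V' where U': "U' \<in> GL_Zp" "U' ** U = mat 1" "V' \<in> GL_Zp" "V ** V' = mat 1"
    using UV by (metis GL_ZpE)
  have "?D = U' ** A ** V'" using U' UV(3)
    by (metis matrix_mul_assoc matrix_mul_lid matrix_mul_rid)
  then have int: "integral_mat ?D" using A U' by (metis integral_mat_mult GL_Zp_integral)
  have le: "real CARD('p) powi (- l $ i) \<le> 1" for i
    using integral_matD[OF int, of i i] by (simp add: diag_p_nth padic_norm_p_powi)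
  have "padic_norm (det A) = padic_norm (det ?D)"
    by (subst UV(3)) (simp add: det_mul padic_norm_mult padic_norm_det_GL_Zp UV)
  also have "det ?D = (\<Prod>i\<in>UNIV. ?D $ i $ i)" by (rule det_diagonal) (simp add: diag_p_nth)
  finally have prod: "(\<Prod>i\<in>UNIV. real CARD('p) powi (- l $ i)) = 1"
    using A(2) by (simp add: padic_norm_prod diag_p_nth padic_norm_p_powi)
  have "l $ m = 0" for m
  proof -
    have "1 = real CARD('p) powi (- l $ m) * (\<Prod>i\<in>UNIV-{m}. real CARD('p) powi (- l $ i))"
      unfolding prod[symmetric] by (rule prod.remove) auto
    also have "\<dots> \<le> real CARD('p) powi (- l $ m) * 1"
      using le by (intro mult_left_mono prod_le_1) auto
    finally have "real CARD('p) powi (- l $ m) = real CARD('p) powi 0" using le[of m] by simp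
    then show ?thesis using prime_card_gt_1[where 'p='p]
      by (metis add.inverse_neutral neg_equal_iff_equal less_irrefl linorder_neqE power_int_strict_increasing)
  qed
  then show ?thesis using G l by (simp add: vec_eq_iff flip: SN_eq_0_iff)
qed

text \<open>
  In the Leibniz formula for the determinant every permutation but the identity meets an entry
  outside the diagonal, which is in \<open>p\<int>\<^sub>p\<close>.  So the determinant is \<open>1\<close> modulo \<open>p\<close>.
\<close>

lemma GL_Zp_one_plus:
  fixes F :: "('p::prime_card, 'n::{finite, linorder}) pmat"
  assumes F: "\<And>i j. padic_norm (F $ i $ j) < 1"
  shows "mat 1 + F \<in> GL_Zp"
proof (rule GL_Zp_of_det)
  let ?A = "mat 1 + F"
  have le: "padic_norm (?A $ i $ j) \<le> 1" for i j
    using less_imp_le[OF F] by (auto simp: mat_def intro!: padic_norm_add_le)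
  then show "integral_mat ?A" by (simp add: integral_mat_def padic_ints_def)
  have diag: "padic_norm (?A $ i $ i) = 1" for i
    using padic_norm_add_eq[of "F $ i $ i" 1] F by (simp add: mat_def)
  let ?t = "\<lambda>f. of_int (sign f) * (\<Prod>i\<in>UNIV. ?A $ i $ f i)"
  let ?P = "{f. f permutes (UNIV :: 'n set)}"
  have "det ?A = ?t id + (\<Sum>f\<in>?P - {id}. ?t f)"
    unfolding det_def by (rule sum.remove) (auto simp: permutes_id finite_permutations)
  moreover have "padic_norm (?t id) = 1"
    using diag by (simp add: padic_norm_mult padic_norm_prod sign_id)
  moreover have "padic_norm (\<Sum>f\<in>?P - {id}. ?t f) < 1"
  proof (rule padic_norm_sum_less)
    fix f assume "f \<in> ?P - {id}"
    then obtain i where i: "f i \<noteq> i" by (auto simp: fun_eq_iff)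
    have "(\<Prod>i\<in>UNIV. padic_norm (?A $ i $ f i)) = padic_norm (?A $ i $ f i) * (\<Prod>i\<in>UNIV-{i}. padic_norm (?A $ i $ f i))"
      by (rule prod.remove) auto
    also have "\<dots> \<le> padic_norm (?A $ i $ f i) * 1"
      using le by (intro mult_left_mono prod_le_1) (auto simp del: vector_add_component)
    also have "\<dots> < 1" using F[of i "f i"] i by (simp add: mat_def)
    finally show "padic_norm (?t f) < 1"
      by (simp add: padic_norm_mult padic_norm_prod sign_def padic_norm_minus)
  qed simp
  ultimately show "padic_norm (det ?A) = 1" by (simp add: padic_norm_add_eq)
qed

section \<open>Measurability on the matrix group\<close>

lemma matrix_mult_continuous_on:
  fixes f :: "'a::topological_space \<Rightarrow> ('p::prime_card, 'n::finite) pmat"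
  shows "continuous_on S f \<Longrightarrow> continuous_on S g \<Longrightarrow> continuous_on S (\<lambda>x. f x ** g x)"
  unfolding matrix_matrix_mult_def
  by (intro continuous_on_vec_lambda continuous_on_sum continuous_on_mult' continuous_on_component)

lemma matrix_mult_measurable [measurable]:
  fixes f :: "'a \<Rightarrow> ('p::prime_card, 'n::finite) pmat"
  assumes "f \<in> borel_measurable M" "g \<in> borel_measurable M"
  shows "(\<lambda>x. f x ** g x) \<in> borel_measurable M"
  using assms by (rule borel_measurable_continuous_Pair)
    (intro matrix_mult_continuous_on continuous_on_fst continuous_on_snd continuous_on_id)

lemma matrix_mult_GL_Qp_measurable:
  fixes f :: "'a \<Rightarrow> ('p::prime_card, 'n::finite) pmat"
  assumes "f \<in> measurable M borel_GL_Qp" "g \<in> measurable M borel_GL_Qp"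
  shows "(\<lambda>x. f x ** g x) \<in> measurable M borel_GL_Qp"
  using assms by (auto simp: measurable_restrict_space2_iff GL_Qp_mult Pi_iff intro!: matrix_mult_measurable)

lemma padic_norm_entry_diff_le_dist:
  fixes A B :: "('p::prime_card, 'n::finite) pmat"
  shows "padic_norm (B $ i $ j - A $ i $ j) \<le> dist A B"
proof -
  have "padic_norm (B $ i $ j - A $ i $ j) = dist (A $ i $ j) (B $ i $ j)"
    by (simp add: dist_padic_def padic_norm_diff_commute)
  also have "\<dots> \<le> dist (A $ i) (B $ i)" by (rule dist_vec_nth_le)
  also have "\<dots> \<le> dist A B" by (rule dist_vec_nth_le)
  finally show ?thesis .
qed

text \<open>A matrix close to \<open>A\<close> has the form \<open>A(1 + F)\<close> with small \<open>F\<close>, and \<open>1 + F\<close> is in \<open>GL\<^sub>N(\<int>\<^sub>p)\<close>.\<close>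

lemma open_right_K_invariant:
  fixes S :: "('p::prime_card, 'n::{finite, linorder}) pmat set"
  assumes S: "S \<subseteq> GL_Qp" and inv: "\<And>A k. A \<in> S \<Longrightarrow> k \<in> GL_Zp \<Longrightarrow> A ** k \<in> S"
  shows "open S"
  unfolding open_dist
proof
  fix A assume A: "A \<in> S"
  define B where "B = matrix_inv A"
  have B: "A ** B = mat 1" using A S matrix_inv_GL_Qp(1) unfolding B_def by blast
  define b where "b = 1 + Max (range (\<lambda>(i, j). padic_norm (B $ i $ j)))"
  have b: "padic_norm (B $ i $ j) < b" for i j
  proof -
    have "padic_norm (B $ i $ j) \<le> Max (range (\<lambda>(i, j). padic_norm (B $ i $ j)))"
      by (intro Max_ge) (auto intro: range_eqI[of _ _ "(i, j)"])
    then show ?thesis by (simp add: b_def)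
  qed
  have b0: "b > 0" using b[of undefined undefined] padic_norm_nonneg order.strict_trans1 by blast
  show "\<exists>e>0. \<forall>C. dist C A < e \<longrightarrow> C \<in> S"
  proof (intro exI[of _ "1 / b"] conjI allI impI)
    fix C assume C: "dist C A < 1 / b"
    let ?F = "B ** (C - A)"
    have "padic_norm (?F $ i $ j) < 1" for i j
      unfolding matrix_matrix_mult_def
    proof (simp, intro padic_norm_sum_less)
      fix k
      have "padic_norm (B $ i $ k * (C $ k $ j - A $ k $ j)) \<le> b * padic_norm (C $ k $ j - A $ k $ j)"
        using b[of i k] by (auto simp: padic_norm_mult intro!: mult_right_mono)
      also have "\<dots> \<le> b * dist A C" using b0 by (intro mult_left_mono padic_norm_entry_diff_le_dist) auto
      also have "\<dots> < b * (1 / b)" using b0 C by (intro mult_strict_left_mono) (auto simp: dist_commute)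
      finally show "padic_norm (B $ i $ k * (C $ k $ j - A $ k $ j)) < 1" using b0 by simp
    qed simp
    then have "mat 1 + ?F \<in> GL_Zp" by (rule GL_Zp_one_plus)
    then have "A ** (mat 1 + ?F) \<in> S" using inv A by blast
    also have "A ** (mat 1 + ?F) = C"
      by (simp add: matrix_add_ldistrib matrix_mul_assoc B)
    finally show "C \<in> S" .
  qed (use b0 in auto)
qed

text \<open>A union of cosets of an open subgroup is open.\<close>

lemma sets_right_K_invariant:
  fixes S :: "('p::prime_card, 'n::{finite, linorder}) pmat set"
  assumes "S \<subseteq> GL_Qp" "\<And>A k. A \<in> S \<Longrightarrow> k \<in> GL_Zp \<Longrightarrow> A ** k \<in> S"
  shows "S \<in> sets borel"
  using open_right_K_invariant[OF assms] by simp

lemma GL_Qp_sets: "(GL_Qp :: ('p::prime_card, 'n::{finite, linorder}) pmat set) \<in> sets borel"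
  by (rule sets_right_K_invariant) (auto intro: GL_Qp_mult GL_Zp_subset_GL_Qp)

lemma GL_Zp_sets: "(GL_Zp :: ('p::prime_card, 'n::{finite, linorder}) pmat set) \<in> sets borel"
  by (rule sets_right_K_invariant) (auto intro: GL_Zp_mult GL_Zp_subset_GL_Qp)

lemma SN_measurable:
  "(SN :: ('p::prime_card, 'n::{finite, linorder}) pmat \<Rightarrow> _) \<in> measurable borel_GL_Qp (count_space Sig)"
proof (rule measurable_count_space_eq_countable[THEN iffD2])
  show "countable (Sig :: 'n tuple set)" by simp
  have "SN -` {l} \<inter> GL_Qp \<in> sets (borel :: ('p, 'n) pmat measure)" for l
    by (rule sets_right_K_invariant) (auto intro: GL_Qp_mult GL_Zp_subset_GL_Qp simp: SN_mult_right_K)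
  then show "SN \<in> space borel_GL_Qp \<rightarrow> Sig \<and> (\<forall>a\<in>Sig. SN -` {a} \<inter> space borel_GL_Qp \<in> sets (borel_GL_Qp :: ('p, 'n) pmat measure))"
    by (auto simp: space_restrict_space SN_Sig sets_restrict_space_iff GL_Qp_sets)
qed

section \<open>The maximum norm of vectors\<close>

definition vec_norm :: "('p::prime_card padic, 'n::finite) vec \<Rightarrow> real" where
  "vec_norm v = Max (range (\<lambda>i. padic_norm (v $ i)))"

lemma vec_norm_ge: "padic_norm (v $ i) \<le> vec_norm v"
  unfolding vec_norm_def by (intro Max_ge) auto

lemma vec_norm_attained: obtains i where "vec_norm v = padic_norm (v $ i)"
proof -
  have "vec_norm v \<in> range (\<lambda>i. padic_norm (v $ i))" unfolding vec_norm_def by (intro Max_in) auto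
  then show ?thesis using that by auto
qed

lemma vec_norm_leI: "(\<And>i. padic_norm (v $ i) \<le> b) \<Longrightarrow> vec_norm v \<le> b"
  by (metis vec_norm_attained)

lemma vec_norm_scale: "vec_norm (c *s v) = padic_norm c * vec_norm v"
proof (rule antisym)
  show "vec_norm (c *s v) \<le> padic_norm c * vec_norm v"
    by (rule vec_norm_leI) (simp add: padic_norm_mult mult_left_mono vec_norm_ge)
  obtain i where "vec_norm v = padic_norm (v $ i)" by (rule vec_norm_attained)
  then show "padic_norm c * vec_norm v \<le> vec_norm (c *s v)"
    using vec_norm_ge[of "c *s v" i] by (simp add: padic_norm_mult)
qed

lemma vec_norm_pos: "v \<noteq> 0 \<Longrightarrow> 0 < vec_norm v"
  by (metis padic_norm_pos vec_norm_ge order_less_le_trans vec_eq_iff zero_index)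

lemma vec_norm_nonneg: "0 \<le> vec_norm v"
  by (metis vec_norm_ge order.trans padic_norm_nonneg)

lemma vec_norm_GL_Zp:
  fixes v :: "('p::prime_card padic, 'n::finite) vec"
  assumes "k \<in> GL_Zp" shows "vec_norm (k *v v) = vec_norm v"
proof -
  have le: "vec_norm (k *v v) \<le> vec_norm v" if "k \<in> GL_Zp" for k :: "('p, 'n) pmat" and v
  proof (rule vec_norm_leI)
    fix i
    have "padic_norm (k $ i $ j * v $ j) \<le> 1 * vec_norm v" for j
      unfolding padic_norm_mult using integral_matD[OF GL_Zp_integral[OF that]]
      by (intro mult_mono vec_norm_ge) auto
    then show "padic_norm ((k *v v) $ i) \<le> vec_norm v"
      unfolding matrix_vector_mult_def by (auto intro!: padic_norm_sum_le vec_norm_nonneg)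
  qed
  obtain B where B: "B \<in> GL_Zp" "B ** k = mat 1" using assms by (metis GL_ZpE)
  have "v = B *v (k *v v)" by (simp add: matrix_vector_mul_assoc B)
  then have "vec_norm v \<le> vec_norm (k *v v)" using le[OF B(1), of "k *v v"] by simp
  then show ?thesis using le[OF assms, of v] by simp
qed

lemma matrix_axis_column: "(A :: ('p::prime_card, 'n::finite) pmat) *v axis a 1 = column a A"
  by (simp add: vec_eq_iff matrix_vector_mult_def axis_def column_def if_distrib[of "\<lambda>x. _ * x"] cong: if_cong)

lemma unimodular_column:
  fixes v :: "('p::prime_card padic, 'n::finite) vec"
  assumes "vec_norm v = 1" "padic_norm (v $ a) = 1"
  obtains k where "k \<in> GL_Zp" "k *v axis a 1 = v"
proof -
  define c where "c i = (if i = a then 0 else v $ i / v $ a)" for i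
  have nz: "v $ a \<noteq> 0" using assms(2) by auto
  have "padic_norm (c i) \<le> 1" for i
    using assms vec_norm_ge[of v i] by (simp add: c_def padic_norm_divide)
  then have T: "transvection a c \<in> GL_Zp" by (rule transvection_GL_Zp) (simp add: c_def)
  let ?k = "transvection a c ** scaling a (v $ a)"
  have "?k *v axis a 1 = v"
    unfolding matrix_axis_column
    by (simp add: vec_eq_iff column_def transvection_mult) (simp add: scaling_def c_def nz)
  then show ?thesis using that GL_Zp_mult[OF T scaling_GL_Zp[OF assms(2)]] by blast
qed

lemma vec_norm_powi:
  fixes v :: "('p::prime_card padic, 'n::finite) vec"
  assumes "v \<noteq> 0" obtains k where "vec_norm v = real CARD('p) powi k"
proof -
  obtain i where i: "vec_norm v = padic_norm (v $ i)" by (rule vec_norm_attained)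
  then have "v $ i \<noteq> 0" using vec_norm_pos[OF assms] by auto
  then show ?thesis using that i by (metis padic_norm_powi_ex)
qed

lemma vec_norm_normalize:
  fixes v :: "('p::prime_card padic, 'n::finite) vec"
  assumes "v \<noteq> 0"
  obtains c u where "c \<noteq> 0" "v = c *s u" "vec_norm u = 1"
proof -
  obtain i where i: "vec_norm v = padic_norm (v $ i)" by (rule vec_norm_attained)
  then have nz: "v $ i \<noteq> 0" using vec_norm_pos[OF assms] by auto
  have "vec_norm ((1 / v $ i) *s v) = 1"
    using nz i by (simp add: vec_norm_scale padic_norm_divide padic_norm_eq_0)
  moreover have "v = v $ i *s ((1 / v $ i) *s v)" using nz by (simp add: vec_eq_iff)
  ultimately show ?thesis using that nz by blast
qed

lemma padic_norm_measurable [measurable]: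
  assumes "f \<in> borel_measurable M" shows "(\<lambda>x. padic_norm (f x)) \<in> borel_measurable M"
proof -
  have "continuous_on UNIV (\<lambda>x :: 'b padic. dist x 0)"
    by (intro continuous_on_dist continuous_on_id continuous_on_const)
  then have "(\<lambda>x :: 'b padic. padic_norm x) \<in> borel_measurable borel"
    by (simp add: dist_padic_def borel_measurable_continuous_onI)
  from measurable_compose[OF assms this] show ?thesis .
qed

lemma matrix_entry_measurable [measurable]:
  fixes f :: "'a \<Rightarrow> ('p::prime_card, 'n::finite) pmat"
  assumes "f \<in> borel_measurable M" shows "(\<lambda>x. f x $ i $ j) \<in> borel_measurable M"
proof -
  have "continuous_on UNIV (\<lambda>A :: ('p, 'n) pmat. A $ i $ j)"
    by (intro continuous_on_component continuous_on_id)
  from measurable_compose[OF assms borel_measurable_continuous_onI[OF this]] show ?thesis .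
qed

lemma vec_norm_column_measurable [measurable]:
  fixes f :: "'a \<Rightarrow> ('p::prime_card, 'n::finite) pmat"
  assumes "f \<in> borel_measurable M" shows "(\<lambda>x. vec_norm (f x *v axis a 1)) \<in> borel_measurable M"
  unfolding matrix_axis_column vec_norm_def column_def
  using assms by (simp add: borel_measurable_Max)

lemma det_measurable [measurable]:
  fixes f :: "'a \<Rightarrow> ('p::prime_card, 'n::finite) pmat"
  assumes "f \<in> borel_measurable M" shows "(\<lambda>x. det (f x)) \<in> borel_measurable M"
proof -
  have "continuous_on UNIV (\<lambda>A :: ('p, 'n) pmat. (\<Prod>i\<in>I. A $ i $ q i))" if "finite I" for I q
    using that by (induction I) (simp_all add: continuous_on_mult' continuous_on_component continuous_on_id continuous_on_const)
  then have "continuous_on UNIV (\<lambda>A :: ('p, 'n) pmat. det A)"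
    unfolding det_def
    by (intro continuous_on_sum continuous_on_mult' continuous_on_const) auto
  from measurable_compose[OF assms borel_measurable_continuous_onI[OF this]] show ?thesis .
qed

section \<open>Haar measure on the integral matrices\<close>

lemma padic_abs_of_int_le_1:
  assumes p: "prime p" shows "padic_abs p (of_int a) \<le> 1"
proof (cases "a = 0")
  case False
  have "padic_abs p (of_int a / of_int 1) = real p powi (int (multiplicity (int p) 1) - int (multiplicity (int p) a))"
    using False by (intro padic_abs_frac[OF p]) auto
  moreover have "real p powi (- int (multiplicity (int p) a)) \<le> 1"
    using prime_gt_1_nat[OF p] by (simp add: power_int_minus inverse_le_1_iff one_le_power)
  ultimately show ?thesis by simp
qed simp

lemma padic_abs_of_int_less_1_iff:
  assumes p: "prime p" shows "padic_abs p (of_int a) < 1 \<longleftrightarrow> int p dvd a"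
proof (cases "a = 0")
  case False
  have "padic_abs p (of_int a / of_int 1) = real p powi (int (multiplicity (int p) 1) - int (multiplicity (int p) a))"
    using False by (intro padic_abs_frac[OF p]) auto
  then have eq: "padic_abs p (of_int a) = inverse (real p ^ multiplicity (int p) a)"
    by (simp add: power_int_minus)
  have np: "\<not> is_unit (int p)" using p not_prime_unit by fastforce
  show ?thesis
  proof (cases "multiplicity (int p) a = 0")
    case True
    then show ?thesis using False np eq by (simp add: multiplicity_eq_zero_iff)
  next
    case F: False
    then have "inverse (real p ^ multiplicity (int p) a) < 1"
      using prime_gt_1_nat[OF p] by (intro inverse_less_1_iff[THEN iffD2]) (simp add: one_less_power)
    moreover have "int p dvd a" using F not_dvd_imp_multiplicity_0 by metis
    ultimately show ?thesis using eq by simp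
  qed
qed simp

lemma padic_of_rat_of_nat_diff:
  "(of_nat a - of_nat b :: 'p::prime_card padic) = padic_of_rat (of_int (int a - int b))"
  by (simp add: padic_of_rat_diff padic_of_rat_of_nat)

text \<open>
  The residue field consists of the classes of integers: a rational number of norm at most \<open>1\<close> has
  a denominator prime to \<open>p\<close>, which is invertible modulo \<open>p\<close>.
\<close>

lemma padic_residue_ex:
  assumes "padic_norm (x :: 'p::prime_card padic) \<le> 1"
  obtains d where "d < CARD('p)" "padic_norm (x - of_nat d) < 1"
proof -
  note p = prime_card[where 'a='p]
  obtain q where q: "padic_norm (x - padic_of_rat q) < 1" using padic_of_rat_dense[of 1 x] by auto
  have "padic_norm (padic_of_rat q :: 'p padic) \<le> 1"
    using padic_norm_diff_le[OF assms less_imp_le[OF q]] by simp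
  then have q1: "padic_abs CARD('p) q \<le> 1" by (simp add: padic_norm_of_rat)
  obtain a b where ab: "quotient_of q = (a, b)" by fastforce
  then have b: "b > 0" "coprime a b" "q = of_int a / of_int b"
    using quotient_of_denom_pos quotient_of_coprime quotient_of_div by auto
  have nb: "\<not> int CARD('p) dvd b"
  proof
    assume pb: "int CARD('p) dvd b"
    then have lt: "padic_abs CARD('p) (of_int b) < 1" using padic_abs_of_int_less_1_iff[OF p] by blast
    have "of_int a = q * of_int b" using b by simp
    then have "padic_abs CARD('p) (of_int a) = padic_abs CARD('p) q * padic_abs CARD('p) (of_int b)"
      by (metis padic_abs_mult[OF p])
    also have "\<dots> \<le> 1 * padic_abs CARD('p) (of_int b)" by (intro mult_right_mono q1) auto
    finally have "padic_abs CARD('p) (of_int a) < 1" using lt by simp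
    then have "int CARD('p) dvd a" using padic_abs_of_int_less_1_iff[OF p] by blast
    then have "is_unit (int CARD('p))" using pb b(2) coprime_common_divisor by blast
    then show False using p not_prime_unit[of "int CARD('p)"] by simp
  qed
  have "coprime b (int CARD('p))"
    using nb p prime_imp_coprime[of "int CARD('p)" b] by (simp add: coprime_commute)
  then obtain c where c: "[b * c = 1] (mod int CARD('p))" using cong_solve_coprime_int by blast
  define d where "d = nat ((a * c) mod int CARD('p))"
  have pos: "int CARD('p) > 0" using prime_gt_0_nat[OF p] by simp
  have d: "int d = (a * c) mod int CARD('p)" using pos by (simp add: d_def)
  have "[b * int d = b * (a * c)] (mod int CARD('p))" unfolding d by (simp add: cong_def mod_mult_right_eq)
  also have "b * (a * c) = a * (b * c)" by simp
  also have "[a * (b * c) = a * 1] (mod int CARD('p))" by (intro cong_mult c) simp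
  finally have "int CARD('p) dvd a - b * int d" by (simp add: cong_iff_dvd_diff dvd_diff_commute)
  then have "padic_abs CARD('p) (of_int (a - b * int d)) < 1" using padic_abs_of_int_less_1_iff[OF p] by blast
  moreover have "of_int (a - b * int d) = (q - of_nat d) * of_int b" using b by (simp add: field_simps)
  moreover have "padic_abs CARD('p) (of_int b) = 1"
    using nb padic_abs_of_int_less_1_iff[OF p, of b] padic_abs_of_int_le_1[OF p, of b] by linarith
  ultimately have "padic_abs CARD('p) (q - of_nat d) < 1" by (simp add: padic_abs_mult[OF p])
  then have "padic_norm (padic_of_rat q - of_nat d :: 'p padic) < 1"
    by (simp add: padic_norm_of_rat flip: padic_of_rat_diff padic_of_rat_of_nat)
  then have "padic_norm (x - padic_of_rat q + (padic_of_rat q - of_nat d)) < 1"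
    using q by (rule padic_norm_add_less[rotated])
  moreover have "int d < int CARD('p)" unfolding d using pos by (rule pos_mod_bound)
  ultimately show ?thesis using that by simp
qed

lemma padic_residue_unique:
  assumes "d < CARD('p)" "d' < CARD('p)" "padic_norm (of_nat d - of_nat d' :: 'p::prime_card padic) < 1"
  shows "d = d'"
proof -
  have "int CARD('p) dvd int d - int d'"
    using assms(3) unfolding padic_of_rat_of_nat_diff padic_norm_of_rat
    by (simp only: padic_abs_of_int_less_1_iff[OF prime_card])
  moreover have "\<bar>int d - int d'\<bar> < int CARD('p)" using assms by auto
  ultimately show ?thesis by (metis abs_of_nonneg dvd_imp_le_int eq_iff_diff_eq_0 linorder_not_less of_nat_0_le_iff of_nat_eq_iff)
qed

definition digit_sum :: "nat \<Rightarrow> (nat \<Rightarrow> nat) \<Rightarrow> nat \<Rightarrow> rat" where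
  "digit_sum p d n = (\<Sum>l<n. of_nat (d l) * of_nat p ^ l)"

definition padic_of_digits :: "(nat \<Rightarrow> nat) \<Rightarrow> 'p::prime_card padic" where
  "padic_of_digits d = abs_padic (Seq (digit_sum CARD('p) d))"

lemma digit_sum_Suc: "digit_sum p d (Suc n) = of_nat (d 0) + of_nat p * digit_sum p (\<lambda>l. d (Suc l)) n"
  unfolding digit_sum_def by (subst sum.lessThan_Suc_shift) (simp add: sum_distrib_left ac_simps)

lemma padic_abs_p: "padic_abs CARD('p::prime_card) (of_nat CARD('p)) = 1 / CARD('p)"
  using padic_norm_of_prime[where 'p='p] by (simp flip: padic_norm_of_rat padic_of_rat_of_nat)

lemma digit_sum_diff_le:
  "m \<le> n \<Longrightarrow> padic_abs CARD('p::prime_card) (digit_sum CARD('p) d n - digit_sum CARD('p) d m) \<le> (1 / CARD('p)) ^ m"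
proof (induction m arbitrary: n d)
  case 0
  have "padic_abs CARD('p) (of_int (int (\<Sum>l<n. d l * CARD('p) ^ l))) \<le> 1"
    by (rule padic_abs_of_int_le_1[OF prime_card])
  then show ?case by (simp add: digit_sum_def)
next
  case (Suc m)
  then obtain k where n: "n = Suc k" "m \<le> k" by (cases n) auto
  have "digit_sum CARD('p) d n - digit_sum CARD('p) d (Suc m) =
      of_nat CARD('p) * (digit_sum CARD('p) (\<lambda>l. d (Suc l)) k - digit_sum CARD('p) (\<lambda>l. d (Suc l)) m)"
    by (simp add: n digit_sum_Suc algebra_simps)
  then show ?case using Suc.IH[OF n(2), of "\<lambda>l. d (Suc l)"]
    by (simp add: padic_abs_mult[OF prime_card] padic_abs_p divide_right_mono)
qed

lemma inverse_prime_power_tendsto: "(\<lambda>n. (1 / real CARD('p::prime_card)) ^ n) \<longlonglongrightarrow> 0"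
  using prime_card_gt_1[where 'p='p] by (intro LIMSEQ_realpow_zero) auto

lemma digit_sum_cauchy: "padic_cauchy CARD('p::prime_card) (digit_sum CARD('p) d)"
  unfolding padic_cauchy_def
proof (intro allI impI)
  fix e :: real assume "e > 0"
  then obtain k where k: "(1 / real CARD('p)) ^ k < e"
    using order_tendstoD(2)[OF inverse_prime_power_tendsto[where 'p='p]] unfolding eventually_sequentially by blast
  have "padic_abs CARD('p) (digit_sum CARD('p) d m - digit_sum CARD('p) d n) < e" if "m \<ge> k" "n \<ge> k" for m n
  proof -
    have "padic_abs CARD('p) ((digit_sum CARD('p) d m - digit_sum CARD('p) d k) + - (digit_sum CARD('p) d n - digit_sum CARD('p) d k)) \<le> (1 / real CARD('p)) ^ k"
      using digit_sum_diff_le[OF that(1), where 'p='p, of d] digit_sum_diff_le[OF that(2), where 'p='p, of d]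
      by (intro order_trans[OF padic_abs_ultrametric[OF prime_card]] max.boundedI) (simp_all only: padic_abs_minus)
    then show ?thesis using k by simp
  qed
  then show "\<exists>k. \<forall>m\<ge>k. \<forall>n\<ge>k. padic_abs CARD('p) (digit_sum CARD('p) d m - digit_sum CARD('p) d n) < e" by blast
qed

lemma padic_of_digits_rec:
  "padic_of_digits d = of_nat (d 0) + of_nat CARD('p) * (padic_of_digits (\<lambda>l. d (Suc l)) :: 'p::prime_card padic)"
proof -
  let ?d' = "\<lambda>l. d (Suc l)"
  have c: "padic_cauchy CARD('p) (\<lambda>n. of_nat (d 0) + of_nat CARD('p) * digit_sum CARD('p) ?d' n)"
    "padic_cauchy CARD('p) (\<lambda>n. of_nat CARD('p) * digit_sum CARD('p) ?d' n)"
    by (intro padic_cauchy_add padic_cauchy_mult prime_card padic_cauchy_const digit_sum_cauchy)+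
  have "of_nat (d 0) + of_nat CARD('p) * (padic_of_digits ?d' :: 'p padic) =
      abs_padic (Seq (\<lambda>n. of_nat (d 0) + of_nat CARD('p) * digit_sum CARD('p) ?d' n))"
    unfolding padic_of_digits_def padic_of_rat_of_nat[symmetric] padic_of_rat_def
    by (simp add: times_padic.abs_eq plus_padic.abs_eq digit_sum_cauchy c)
  moreover have eq: "(\<lambda>n. of_nat (d 0) + of_nat CARD('p) * digit_sum CARD('p) ?d' n) = (\<lambda>n. digit_sum CARD('p) d (Suc n))"
    by (simp add: digit_sum_Suc)
  moreover have "padic_rel (Seq (digit_sum CARD('p) d) :: 'p padic_seq) (Seq (\<lambda>n. digit_sum CARD('p) d (Suc n)))"
    unfolding padic_rel_def seq_of_Seq[OF digit_sum_cauchy] seq_of_Seq[OF c(1)[unfolded eq]] padic_vanishes_def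
  proof (rule tendsto_sandwich[OF _ _ tendsto_const inverse_prime_power_tendsto[where 'p='p]])
    show "\<forall>\<^sub>F n in sequentially. padic_abs CARD('p) (digit_sum CARD('p) d n - digit_sum CARD('p) d (Suc n)) \<le> (1 / real CARD('p)) ^ n"
      using digit_sum_diff_le[where 'p='p, of n "Suc n" d for n]
      by (intro always_eventually allI) (subst padic_abs_minus_commute, simp)
  qed simp
  ultimately show ?thesis unfolding padic_of_digits_def by (simp only: padic.abs_eq_iff)
qed

lemma padic_of_digits_le_1: "padic_norm (padic_of_digits d :: 'p::prime_card padic) \<le> 1"
proof -
  have "(\<lambda>n. padic_abs CARD('p) (digit_sum CARD('p) d n)) \<longlonglongrightarrow> padic_norm (padic_of_digits d :: 'p padic)"
    using padic_abs_seq_tendsto[of "Seq (digit_sum CARD('p) d) :: 'p padic_seq"]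
    unfolding padic_of_digits_def by (simp add: digit_sum_cauchy)
  then show ?thesis
    by (rule LIMSEQ_le_const2) (use digit_sum_diff_le[where 'p='p, of 0 _ d] in \<open>auto simp: digit_sum_def\<close>)
qed

text \<open>The cosets of \<open>p\<^sup>j M\<^sub>N(\<int>\<^sub>p)\<close>.\<close>

definition coset :: "('p::prime_card, 'n::finite) pmat \<Rightarrow> nat \<Rightarrow> ('p, 'n) pmat set" where
  "coset x j = {A. \<forall>i k. padic_norm (A $ i $ k - x $ i $ k) \<le> (1 / CARD('p)) ^ j}"

lemma coset_self: "x \<in> coset x j"
  by (simp add: coset_def)

lemma coset_eq: "y \<in> coset x j \<Longrightarrow> coset y j = coset x j"
proof -
  assume y: "y \<in> coset x j"
  have "padic_norm (A $ i $ k - y $ i $ k) \<le> (1 / CARD('a)) ^ j \<longleftrightarrow> padic_norm (A $ i $ k - x $ i $ k) \<le> (1 / CARD('a)) ^ j" for A i k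
    using y padic_norm_add_le[of "A $ i $ k - y $ i $ k" _ "y $ i $ k - x $ i $ k"]
      padic_norm_diff_le[of "A $ i $ k - x $ i $ k" _ "y $ i $ k - x $ i $ k"]
    by (auto simp: coset_def)
  then show ?thesis by (simp add: coset_def)
qed

lemma coset_mono: "j \<le> l \<Longrightarrow> coset (x :: ('p::prime_card, 'n::finite) pmat) l \<subseteq> coset x j"
proof -
  assume "j \<le> l"
  then have "(1 / real CARD('p)) ^ l \<le> (1 / real CARD('p)) ^ j"
    using prime_card_gt_1[where 'p='p] by (intro power_decreasing) auto
  from order_trans[OF _ this] show ?thesis unfolding coset_def by blast
qed

lemma coset_Int:
  fixes x y :: "('p::prime_card, 'n::finite) pmat"
  assumes "coset x j \<inter> coset y l \<noteq> {}" "j \<le> l" shows "coset x j \<inter> coset y l = coset y l"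
proof -
  obtain z where z: "z \<in> coset x j" "z \<in> coset y l" using assms by blast
  have "coset y l = coset z l" "coset x j = coset z j" using z coset_eq by blast+
  then show ?thesis using coset_mono[OF assms(2), of z] by blast
qed

lemma coset_open: "open (coset (x :: ('p::prime_card, 'n::finite) pmat) j)"
  unfolding open_dist
proof
  fix A assume A: "A \<in> coset x j"
  show "\<exists>e>0. \<forall>B. dist B A < e \<longrightarrow> B \<in> coset x j"
  proof (intro exI[of _ "(1 / real CARD('p)) ^ j"] conjI allI impI)
    fix B assume "dist B A < (1 / real CARD('p)) ^ j"
    then have "B \<in> coset A j"
      using order_trans[OF padic_norm_entry_diff_le_dist[of B _ _ A] less_imp_le] by (auto simp: coset_def dist_commute)
    then show "B \<in> coset x j" using coset_eq[OF A] by simp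
  qed simp
qed

text \<open>The Euclidean distance of matrices is bounded in terms of the distances of their entries.\<close>

lemma coset_base:
  fixes U :: "('p::prime_card, 'n::finite) pmat set"
  assumes "open U" "x \<in> U" shows "\<exists>j. coset x j \<subseteq> U"
proof -
  obtain e where e: "e > 0" "ball x e \<subseteq> U" using assms by (meson openE)
  define c where "c = e / (real CARD('n) * real CARD('n) + 1)"
  have c: "c > 0" using e unfolding c_def by (intro divide_pos_pos add_nonneg_pos) auto
  obtain j where j: "(1 / real CARD('p)) ^ j < c"
    using order_tendstoD(2)[OF inverse_prime_power_tendsto[where 'p='p] c] unfolding eventually_sequentially by blast
  have "y \<in> U" if y: "y \<in> coset x j" for y
  proof -
    have "dist (y $ i) (x $ i) \<le> real CARD('n) * (1 / real CARD('p)) ^ j" for i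
    proof -
      have "dist (y $ i) (x $ i) \<le> (\<Sum>k\<in>UNIV. dist (y $ i $ k) (x $ i $ k))"
        unfolding dist_vec_def by (rule L2_set_le_sum) simp
      also have "\<dots> \<le> (\<Sum>k\<in>(UNIV :: 'n set). (1 / real CARD('p)) ^ j)"
        using y by (intro sum_mono) (simp add: coset_def dist_padic_def)
      finally show ?thesis by simp
    qed
    then have "dist y x \<le> (\<Sum>i\<in>(UNIV :: 'n set). real CARD('n) * (1 / real CARD('p)) ^ j)"
      unfolding dist_vec_def[of y x] by (intro order_trans[OF L2_set_le_sum] sum_mono) auto
    also have "\<dots> \<le> (real CARD('n) * real CARD('n)) * c" using j by (simp add: mult_left_mono)
    also have "\<dots> < e" using e(1) by (simp add: c_def field_simps add_pos_nonneg)
    finally show ?thesis using e(2) by (auto simp: dist_commute)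
  qed
  then show ?thesis by blast
qed

definition cosets :: "('p::prime_card, 'n::finite) pmat set set" where
  "cosets = insert {} (range (\<lambda>(x, j). coset x j))"

lemma open_countable_Union_cosets:
  fixes U :: "('p::prime_card, 'n::finite) pmat set"
  assumes "open U"
  obtains F where "countable F" "F \<subseteq> cosets" "\<Union>F = U"
proof -
  let ?F = "{C \<in> cosets. C \<subseteq> U}"
  have eq: "\<Union>?F = U"
  proof
    show "U \<subseteq> \<Union>?F"
    proof
      fix x assume "x \<in> U"
      then obtain j where "coset x j \<subseteq> U" using coset_base assms by blast
      moreover have "coset x j \<in> cosets" unfolding cosets_def by (auto intro: range_eqI[of _ _ "(x, j)"])
      ultimately show "x \<in> \<Union>?F" using coset_self by blast
    qed
  qed auto
  have "open C" if "C \<in> ?F" for C using that by (auto simp: cosets_def coset_open)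
  then obtain F where F: "F \<subseteq> ?F" "countable F" "\<Union>F = \<Union>?F" by (rule Lindelof)
  show ?thesis by (rule that[of F]) (use F eq in auto)
qed

lemma Int_stable_cosets: "Int_stable cosets"
proof (rule Int_stableI)
  have *: "coset x j \<inter> coset y l \<in> cosets" if "j \<le> l" for x y :: "('a, 'b) pmat" and j l
    using coset_Int[OF _ that, of x y] by (cases "coset x j \<inter> coset y l = {}")
      (auto simp: cosets_def intro: range_eqI[of _ _ "(y, l)"])
  fix a b :: "('a, 'b) pmat set" assume ab: "a \<in> cosets" "b \<in> cosets"
  show "a \<inter> b \<in> cosets"
  proof (cases "a = {} \<or> b = {}")
    case False
    then obtain x j y l where "a = coset x j" "b = coset y l" using ab by (auto simp: cosets_def)
    then show ?thesis using *[of j l x y] *[of l j y x] by (metis Int_commute linorder_le_cases)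
  qed (auto simp: cosets_def)
qed

lemma sets_borel_cosets: "sets (borel :: ('p::prime_card, 'n::finite) pmat measure) = sigma_sets UNIV cosets"
proof -
  have "sigma_sets UNIV {S. open S} = sigma_sets UNIV (cosets :: ('p, 'n) pmat set set)"
  proof (rule sigma_sets_eqI)
    fix U :: "('p, 'n) pmat set" assume "U \<in> {S. open S}"
    then obtain F where F: "countable F" "F \<subseteq> cosets" "\<Union>F = U" using open_countable_Union_cosets by blast
    have "\<Union>F \<in> sigma_sets UNIV cosets"
    proof (cases "F = {}")
      case False
      then have "\<Union>F = (\<Union>i. from_nat_into F i)" using F(1) by simp
      also have "\<dots> \<in> sigma_sets UNIV cosets"
        using F False by (intro sigma_sets.Union sigma_sets.Basic) (auto intro: from_nat_into)
      finally show ?thesis .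
    qed (simp add: sigma_sets.Empty)
    then show "U \<in> sigma_sets UNIV cosets" using F by simp
  qed (auto simp: cosets_def coset_open)
  then show ?thesis by (simp add: borel_def)
qed

lemma measure_eqI_cosets:
  fixes M N :: "('p::prime_card, 'n::finite) pmat measure"
  assumes "sets M = sets borel" "sets N = sets borel" "finite_measure M"
    and eq: "\<And>x j. emeasure M (coset x j) = emeasure N (coset x j)"
  shows "M = N"
proof -
  obtain F :: "('p, 'n) pmat set set" where F: "countable F" "F \<subseteq> cosets" "\<Union>F = UNIV"
    using open_countable_Union_cosets[OF open_UNIV] by blast
  interpret finite_measure M by fact
  show ?thesis
  proof (rule measure_eqI_generator_eq_countable[OF Int_stable_cosets _ _ _ _ F(2,3,1)])
    show "emeasure M X = emeasure N X" if "X \<in> cosets" for X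
      using that eq by (auto simp: cosets_def)
  qed (simp_all add: assms sets_borel_cosets)
qed

definition digit_matrices :: "'p::prime_card itself \<Rightarrow> (nat ^ 'n ^ 'n::finite) set" where
  "digit_matrices _ = {d. \<forall>i k. d $ i $ k < CARD('p)}"

lemma finite_digit_matrices: "finite (digit_matrices TYPE('p::prime_card) :: (nat ^ 'n ^ 'n::finite) set)"
proof -
  have "digit_matrices TYPE('p) \<subseteq> (\<lambda>f. \<chi> i k. f (i, k)) ` (UNIV \<rightarrow>\<^sub>E {..<CARD('p)} :: ('n \<times> 'n \<Rightarrow> nat) set)"
  proof
    fix d :: "nat ^ 'n ^ 'n" assume "d \<in> digit_matrices TYPE('p)"
    then show "d \<in> (\<lambda>f. \<chi> i k. f (i, k)) ` (UNIV \<rightarrow>\<^sub>E {..<CARD('p)})"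
      by (intro image_eqI[of _ _ "\<lambda>(i, k). d $ i $ k"]) (auto simp: vec_eq_iff digit_matrices_def)
  qed
  then show ?thesis by (rule finite_subset) (intro finite_imageI finite_PiE, auto)
qed

lemma digit_matrices_nonempty: "digit_matrices TYPE('p::prime_card) \<noteq> ({} :: (nat ^ 'n ^ 'n::finite) set)"
  using prime_card_gt_1[where 'p='p] by (auto simp: digit_matrices_def intro!: exI[of _ "\<chi> i j. 0"])

definition matrix_of_digits :: "(nat \<Rightarrow> nat ^ 'n ^ 'n) \<Rightarrow> ('p::prime_card, 'n::finite) pmat" where
  "matrix_of_digits w = (\<chi> i k. padic_of_digits (\<lambda>l. w l $ i $ k))"

lemma matrix_of_digits_integral: "integral_mat (matrix_of_digits w)"
  by (simp add: integral_mat_def padic_ints_def matrix_of_digits_def padic_of_digits_le_1)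

lemma coset_integral:
  assumes "integral_mat A" "A \<in> coset x j" shows "integral_mat (x :: ('p::prime_card, 'n::finite) pmat)"
proof -
  have "A \<in> coset x 0" using assms(2) coset_mono[of 0 j] by blast
  then have *: "padic_norm (A $ i $ k - x $ i $ k) \<le> 1" for i k
    by (simp add: coset_def)
  have "padic_norm (x $ i $ k) \<le> 1" for i k
    using padic_norm_diff_le[OF integral_matD[OF assms(1), of i k] *[of i k]] by simp
  then show ?thesis by (simp add: integral_mat_def padic_ints_def)
qed

text \<open>Membership in a coset of \<open>p\<^sup>j\<^sup>+\<^sup>1 M\<^sub>N(\<int>\<^sub>p)\<close> is decided by the first digit and by the coset of
  \<open>p\<^sup>j M\<^sub>N(\<int>\<^sub>p)\<close> that contains the matrix of the remaining digits.\<close>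

lemma matrix_of_digits_coset_Suc:
  fixes x :: "('p::prime_card, 'n::finite) pmat"
  assumes x: "integral_mat x"
  obtains \<delta> and y :: "('p, 'n) pmat" where "\<delta> \<in> digit_matrices TYPE('p)" "integral_mat y"
    "\<And>w j. (\<And>l. w l \<in> digit_matrices TYPE('p)) \<Longrightarrow>
      matrix_of_digits w \<in> coset x (Suc j) \<longleftrightarrow> w 0 = \<delta> \<and> matrix_of_digits (\<lambda>l. w (Suc l)) \<in> coset y j"
proof -
  let ?p = "of_nat CARD('p) :: 'p padic"
  have "\<exists>d. d < CARD('p) \<and> padic_norm (x $ i $ k - of_nat d) < 1" for i k
    using padic_residue_ex[OF integral_matD[OF x]] by metis
  then obtain f where f: "\<And>i k. f i k < CARD('p)" "\<And>i k. padic_norm (x $ i $ k - of_nat (f i k)) < 1" by metis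
  define \<delta> :: "nat ^ 'n ^ 'n" where "\<delta> = (\<chi> i k. f i k)"
  define y where "y = (\<chi> i k. (x $ i $ k - of_nat (f i k)) / ?p)"
  have p1: "real CARD('p) > 0" using prime_card_gt_1[where 'p='p] by linarith
  have xy: "x $ i $ k = of_nat (f i k) + ?p * y $ i $ k" for i k
    using of_nat_p_neq_0[where 'p='p] by (simp add: y_def)
  have "padic_norm (y $ i $ k) \<le> 1" for i k
    using padic_norm_less_1[OF f(2)[of i k]] p1
    by (simp add: y_def padic_norm_divide padic_norm_of_prime field_simps)
  then have "integral_mat y" by (simp add: integral_mat_def padic_ints_def)
  have \<delta>: "\<delta> \<in> digit_matrices TYPE('p)" using f by (simp add: \<delta>_def digit_matrices_def)
  have step: "matrix_of_digits w \<in> coset x (Suc j) \<longleftrightarrow> w 0 = \<delta> \<and> matrix_of_digits (\<lambda>l. w (Suc l)) \<in> coset y j"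
    if w: "\<And>l. w l \<in> digit_matrices TYPE('p)" for w j
  proof -
    let ?z = "matrix_of_digits (\<lambda>l. w (Suc l)) :: ('p, 'n) pmat"
    have W: "(matrix_of_digits w :: ('p, 'n) pmat) $ i $ k = of_nat (w 0 $ i $ k) + ?p * ?z $ i $ k" for i k
      unfolding matrix_of_digits_def by (simp add: padic_of_digits_rec[of "\<lambda>l. w l $ i $ k"])
    have small: "padic_norm (?p * (?z $ i $ k - y $ i $ k)) < 1" for i k
    proof -
      have "padic_norm (?z $ i $ k - y $ i $ k) \<le> 1"
        using integral_matD[OF matrix_of_digits_integral] integral_matD[OF \<open>integral_mat y\<close>] by (intro padic_norm_diff_le)
      then have "padic_norm (?p * (?z $ i $ k - y $ i $ k)) \<le> 1 / CARD('p) * 1"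
        unfolding padic_norm_mult padic_norm_of_prime by (intro mult_left_mono) auto
      also have "\<dots> < 1" using prime_card_gt_1[where 'p='p] by simp
      finally show ?thesis .
    qed
    have eq: "(matrix_of_digits w :: ('p, 'n) pmat) $ i $ k - x $ i $ k =
        (of_nat (w 0 $ i $ k) - of_nat (\<delta> $ i $ k)) + ?p * (?z $ i $ k - y $ i $ k)" for i k
      unfolding W xy by (simp add: \<delta>_def algebra_simps)
    have scale: "padic_norm (?p * t) \<le> (1 / CARD('p)) ^ Suc j \<longleftrightarrow> padic_norm t \<le> (1 / CARD('p)) ^ j" for t
      unfolding padic_norm_mult padic_norm_of_prime power_Suc using p1 by (intro mult_le_cancel_left_pos) auto
    show ?thesis
    proof
      assume L: "matrix_of_digits w \<in> coset x (Suc j)"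
      have "w 0 $ i $ k = \<delta> $ i $ k" for i k
      proof (rule padic_residue_unique[where 'p='p])
        have lt: "(1 / real CARD('p)) ^ Suc j < 1"
          using prime_card_gt_1[where 'p='p] by (intro power_Suc_less_one) auto
        have "padic_norm ((matrix_of_digits w :: ('p, 'n) pmat) $ i $ k - x $ i $ k) < 1"
          by (rule order.strict_trans1[OF _ lt]) (use L in \<open>simp add: coset_def del: power_Suc\<close>)
        then have "padic_norm ((of_nat (w 0 $ i $ k) - of_nat (\<delta> $ i $ k) + ?p * (?z $ i $ k - y $ i $ k)) + - (?p * (?z $ i $ k - y $ i $ k))) < 1"
          using small[of i k] unfolding eq by (rule padic_norm_add_less[OF _ iffD2[OF arg_cong[of _ _ "\<lambda>t. t < 1", OF padic_norm_minus]]])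
        then show "padic_norm (of_nat (w 0 $ i $ k) - of_nat (\<delta> $ i $ k) :: 'p padic) < 1" by simp
      qed (use w[of 0] f in \<open>auto simp: digit_matrices_def \<delta>_def\<close>)
      then have "w 0 = \<delta>" by (simp add: vec_eq_iff)
      moreover have "?z \<in> coset y j"
        using L eq \<open>w 0 = \<delta>\<close> unfolding coset_def by (simp add: scale del: power_Suc)
      ultimately show "w 0 = \<delta> \<and> ?z \<in> coset y j" by blast
    next
      assume "w 0 = \<delta> \<and> ?z \<in> coset y j"
      then show "matrix_of_digits w \<in> coset x (Suc j)"
        using eq unfolding coset_def by (simp add: scale del: power_Suc)
    qed
  qed
  show ?thesis
    by (rule that, rule \<delta>, rule \<open>integral_mat y\<close>, rule step)
qed

text \<open>
  Independent uniformly distributed digits make a matrix whose law is the additive Haar measure of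
  \<open>M\<^sub>N(\<int>\<^sub>p)\<close>.
\<close>

locale digit_space =
  fixes tp :: "'p::prime_card itself" and tn :: "'n::finite itself"
begin

definition D :: "(nat ^ 'n ^ 'n) set" where "D = digit_matrices TYPE('p)"

sublocale sequence_space "uniform_count_measure D"
  unfolding sequence_space_def D_def
  by (intro product_prob_spaceI prob_space_uniform_count_measure finite_digit_matrices digit_matrices_nonempty)

lemma space_S: "w \<in> space S \<longleftrightarrow> (\<forall>l. w l \<in> D)"
  by (auto simp: space_PiM space_uniform_count_measure)

text \<open>
  By induction on \<open>j\<close>: the coset prescribes the first digit matrix, with probability \<open>1 / card D\<close>, and
  confines the remaining digits to a coset of the next lower level.  The same decomposition gives the
  measurability of the event, which is therefore part of the induction.
\<close>

lemma emeasure_coset: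
  fixes x :: "('p, 'n) pmat"
  shows "{w \<in> space S. matrix_of_digits w \<in> coset x j} \<in> sets S \<and>
    emeasure S {w \<in> space S. matrix_of_digits w \<in> coset x j} = (if integral_mat x then ennreal ((1 / card D) ^ j) else 0)"
proof (cases "integral_mat x")
  case False
  then have "{w \<in> space S. matrix_of_digits w \<in> coset x j} = {}"
    using coset_integral[OF matrix_of_digits_integral] by blast
  then show ?thesis using False by (simp only: if_False sets.empty_sets emeasure_empty)
next
  case True
  then show ?thesis
  proof (induction j arbitrary: x)
    case 0
    have "matrix_of_digits w \<in> coset x 0" for w
      using integral_matD[OF matrix_of_digits_integral] integral_matD[OF 0]
      by (auto simp: coset_def intro!: padic_norm_diff_le)
    then show ?case using 0 by (simp add: emeasure_space_1)
  next
    case (Suc j)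
    obtain \<delta> and y :: "('p, 'n) pmat" where \<delta>: "\<delta> \<in> D" and y: "integral_mat y" and
      step: "\<And>w j. (\<And>l. w l \<in> D) \<Longrightarrow>
      matrix_of_digits w \<in> coset x (Suc j) \<longleftrightarrow> w 0 = \<delta> \<and> matrix_of_digits (\<lambda>l. w (Suc l)) \<in> coset y j"
      using matrix_of_digits_coset_Suc[OF Suc.prems] unfolding D_def by metis
    let ?M = "uniform_count_measure D"
    define A where "A = {w \<in> space S. matrix_of_digits w \<in> coset x (Suc j)}"
    define B where "B = {w \<in> space S. matrix_of_digits w \<in> coset y j}"
    have B: "B \<in> sets S" "emeasure S B = ennreal ((1 / card D) ^ j)"
      unfolding B_def using conjunct1[OF Suc.IH[OF y]] conjunct2[OF Suc.IH[OF y]] y by (simp_all only: if_True)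
    have A_eq: "A = {w \<in> space S. w 0 = \<delta>} \<inter> (\<lambda>w l. w (Suc l)) -` B \<inter> space S"
    proof (rule Set.set_eqI)
      fix w show "w \<in> A \<longleftrightarrow> w \<in> {w \<in> space S. w 0 = \<delta>} \<inter> (\<lambda>w l. w (Suc l)) -` B \<inter> space S"
        unfolding A_def B_def using step[of w j] space_S[of w] space_S[of "\<lambda>l. w (Suc l)"] by blast
    qed
    have "(\<lambda>w. w 0) \<in> measurable S ?M" by measurable
    then have "(\<lambda>w. w 0) -` {\<delta>} \<inter> space S \<in> sets S"
      using \<delta> by (auto simp: sets_uniform_count_measure intro: measurable_sets)
    moreover have "(\<lambda>w. w 0) -` {\<delta>} \<inter> space S = {w \<in> space S. w 0 = \<delta>}" by auto
    ultimately have first: "{w \<in> space S. w 0 = \<delta>} \<in> sets S" by (simp only:)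
    have shift: "(\<lambda>w l. w (Suc l)) \<in> measurable S S"
    proof (rule measurable_PiM_single')
      show "(\<lambda>w. w (Suc l)) \<in> measurable S ?M" for l by (rule measurable_component_singleton) simp
      show "(\<lambda>w l. w (Suc l)) \<in> space S \<rightarrow> (\<Pi>\<^sub>E l\<in>UNIV. space ?M)"
        by (intro Pi_I) (simp add: space_S PiE_UNIV_domain space_uniform_count_measure)
    qed
    have A: "A \<in> sets S"
      unfolding A_eq Int_assoc by (rule sets.Int[OF first measurable_sets[OF shift B(1)]])
    have cm: "(\<lambda>(s, w). case_nat s w) \<in> measurable (?M \<Otimes>\<^sub>M S) S"
      by measurable
    have vim: "(\<lambda>(s, w). case_nat s w) -` A \<inter> space (?M \<Otimes>\<^sub>M S) = {\<delta>} \<times> B"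
    proof -
      have "case_nat s w \<in> A \<longleftrightarrow> s = \<delta> \<and> w \<in> B" if "s \<in> D" "w \<in> space S" for s w
        using that step[of "case_nat s w"] unfolding A_def B_def space_S
        by (auto split: nat.split)
      then show ?thesis using \<delta> sets.sets_into_space[OF B(1)]
        by (auto simp: space_pair_measure space_uniform_count_measure)
    qed
    have "emeasure S A = emeasure (distr (?M \<Otimes>\<^sub>M S) S (\<lambda>(s, w). case_nat s w)) A"
      by (subst PiM_iter) simp
    also have "\<dots> = emeasure (?M \<Otimes>\<^sub>M S) ({\<delta>} \<times> B)"
      unfolding vim[symmetric] by (rule emeasure_distr[OF cm A])
    also have "\<dots> = emeasure ?M {\<delta>} * emeasure S B"
      using B(1) \<delta> by (intro P.emeasure_pair_measure_Times) (auto simp: sets_uniform_count_measure)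
    also have "\<dots> = ennreal ((1 / card D) ^ Suc j)"
    proof -
      have "finite D" unfolding D_def by (rule finite_digit_matrices)
      then have "emeasure ?M {\<delta>} = ennreal (1 / card D)"
        using \<delta> by (simp add: emeasure_uniform_count_measure)
      then show ?thesis by (simp only: B(2) power_Suc) (rule ennreal_mult'[symmetric], simp)
    qed
    finally show ?case using A Suc.prems unfolding A_def by simp
  qed
qed

lemma matrix_of_digits_measurable: "(matrix_of_digits :: _ \<Rightarrow> ('p, 'n) pmat) \<in> measurable S borel"
  unfolding measurable_def
proof safe
  fix A :: "('p, 'n) pmat set" assume "A \<in> sets borel"
  then have "A \<in> sigma_sets UNIV cosets" unfolding sets_borel_cosets .
  then show "matrix_of_digits -` A \<inter> space S \<in> sets S"
  proof induction
    case (Basic a)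
    have "matrix_of_digits -` coset x j \<inter> space S \<in> sets S" for x :: "('p, 'n) pmat" and j
      using emeasure_coset[of x j] by (simp add: vimage_def Int_def conj_commute)
    then show ?case using Basic by (auto simp: cosets_def)
  next
    case (Compl a)
    have "matrix_of_digits -` (UNIV - a) \<inter> space S = space S - (matrix_of_digits -` a \<inter> space S)" by auto
    then show ?case using Compl by auto
  next
    case (Union a)
    have eq: "matrix_of_digits -` \<Union> (range a) \<inter> space S = (\<Union>i. matrix_of_digits -` a i \<inter> space S)" by auto
    show ?case unfolding eq using Union by (intro sets.countable_UN) auto
  qed simp
qed simp

definition additive_haar :: "('p, 'n) pmat measure" where
  "additive_haar = distr S borel matrix_of_digits"

lemma emeasure_additive_haar_coset:
  "emeasure additive_haar (coset x j) = (if integral_mat x then ennreal ((1 / card D) ^ j) else 0)"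
proof -
  have "emeasure additive_haar (coset x j) = emeasure S (matrix_of_digits -` coset x j \<inter> space S)"
    unfolding additive_haar_def by (rule emeasure_distr[OF matrix_of_digits_measurable]) (simp add: coset_open)
  then show ?thesis using emeasure_coset[of x j] by (simp add: vimage_def Int_def conj_commute)
qed

lemma prob_space_additive_haar: "prob_space additive_haar"
  unfolding additive_haar_def by (rule prob_space_distr[OF matrix_of_digits_measurable])

text \<open>An additive automorphism that permutes the cosets of every \<open>p\<^sup>j M\<^sub>N(\<int>\<^sub>p)\<close>, and preserves
  integrality, preserves the additive Haar measure.\<close>

lemma additive_haar_invariant:
  assumes f: "f \<in> borel_measurable borel"
    and g: "\<And>x j. f -` coset x j = coset (g x) j" "\<And>x. integral_mat (g x) \<longleftrightarrow> integral_mat x"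
  shows "distr additive_haar borel f = additive_haar"
proof (rule measure_eqI_cosets)
  interpret prob_space additive_haar by (rule prob_space_additive_haar)
  have "sets additive_haar = sets borel" by (simp add: additive_haar_def)
  then have fm: "f \<in> measurable additive_haar borel"
    using f measurable_cong_sets[OF _ refl] by blast
  show "finite_measure (distr additive_haar borel f)" by (rule finite_measure_distr[OF fm])
  have UNIV: "space additive_haar = UNIV" by (simp add: additive_haar_def)
  fix x j
  show "emeasure (distr additive_haar borel f) (coset x j) = emeasure additive_haar (coset x j)"
    using g by (subst emeasure_distr[OF fm]) (simp_all add: coset_open emeasure_additive_haar_coset UNIV)
qed (simp_all add: additive_haar_def)

end

lemma integral_mult_coset:
  fixes k :: "('p::prime_card, 'n::finite) pmat"
  assumes "integral_mat k" "A \<in> coset x j"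
  shows "k ** A \<in> coset (k ** x) j" "A ** k \<in> coset (x ** k) j"
proof -
  have le: "padic_norm (a * b) \<le> (1 / CARD('p)) ^ j" if "padic_norm a \<le> 1" "padic_norm b \<le> (1 / CARD('p)) ^ j" for a b :: "'p padic"
    using mult_mono[OF that] by (simp add: padic_norm_mult)
  have le': "padic_norm (b * a) \<le> (1 / CARD('p)) ^ j" if "padic_norm a \<le> 1" "padic_norm b \<le> (1 / CARD('p)) ^ j" for a b :: "'p padic"
    using le[OF that] by (simp add: mult.commute)
  have "(k ** A) $ i $ l - (k ** x) $ i $ l = (\<Sum>m\<in>UNIV. k $ i $ m * (A $ m $ l - x $ m $ l))"
    "(A ** k) $ i $ l - (x ** k) $ i $ l = (\<Sum>m\<in>UNIV. (A $ i $ m - x $ i $ m) * k $ m $ l)" for i l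
    by (simp_all add: matrix_matrix_mult_def sum_subtractf right_diff_distrib left_diff_distrib)
  note eq = this
  have *: "padic_norm (A $ i $ m - x $ i $ m) \<le> (1 / CARD('p)) ^ j" for i m
    using assms(2) by (simp add: coset_def)
  show "k ** A \<in> coset (k ** x) j" "A ** k \<in> coset (x ** k) j"
    unfolding coset_def mem_Collect_eq eq
    by (intro allI padic_norm_sum_le le integral_matD[OF assms(1)] *; simp)
      (intro allI padic_norm_sum_le le' integral_matD[OF assms(1)] *; simp)
qed

text \<open>Normalising the additive Haar measure to \<open>GL\<^sub>N(\<int>\<^sub>p)\<close> gives a two-sided invariant measure, as
  multiplication by an element of \<open>GL\<^sub>N(\<int>\<^sub>p)\<close> from either side permutes the cosets.\<close>

lemma haar_GL_Zp_exists:
  "\<exists>H :: ('p::prime_card, 'n::{finite, linorder}) pmat measure.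
    haar_GL_Zp H \<and> (\<forall>k\<in>GL_Zp. distr H H (\<lambda>g. g ** k) = H)"
proof -
  interpret digit_space "TYPE('p)" "TYPE('n)" .
  let ?K = "GL_Zp :: ('p, 'n) pmat set"
  define \<mu> :: "('p, 'n) pmat measure" where "\<mu> = additive_haar"
  interpret \<mu>: prob_space \<mu> unfolding \<mu>_def by (rule prob_space_additive_haar)
  have sets_\<mu>: "sets \<mu> = sets borel" by (simp add: \<mu>_def additive_haar_def)
  have space_\<mu>: "space \<mu> = UNIV" by (simp add: \<mu>_def additive_haar_def)
  \<comment> \<open>The group has positive additive measure, as it contains the open subgroup \<open>1 + p M\<^sub>N(\<int>\<^sub>p)\<close>.\<close>
  have "coset (mat 1) 1 \<subseteq> ?K"
  proof
    fix A :: "('p, 'n) pmat" assume A: "A \<in> coset (mat 1) 1"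
    have lt: "1 / real CARD('p) < 1" using prime_card_gt_1[where 'p='p] by simp
    have "padic_norm ((A - mat 1) $ i $ j) < 1" for i j
      by (rule order.strict_trans1[OF _ lt]) (use A in \<open>simp add: coset_def\<close>)
    then have "mat 1 + (A - mat 1) \<in> GL_Zp" by (rule GL_Zp_one_plus)
    then show "A \<in> ?K" by simp
  qed
  then have "emeasure \<mu> (coset (mat 1) 1) \<le> emeasure \<mu> ?K"
    by (intro emeasure_mono) (simp_all add: sets_\<mu> GL_Zp_sets)
  moreover have "0 < emeasure \<mu> (coset (mat 1) 1)"
    using finite_digit_matrices[where 'p='p and 'n='n] digit_matrices_nonempty[where 'p='p and 'n='n]
    unfolding \<mu>_def emeasure_additive_haar_coset by (simp add: integral_mat_1 D_def card_gt_0_iff)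
  ultimately have K0: "emeasure \<mu> ?K \<noteq> 0" by auto
  define H where "H = restrict_space (uniform_measure \<mu> ?K) ?K"
  interpret U: prob_space "uniform_measure \<mu> ?K"
    using K0 by (intro prob_space_uniform_measure) (auto simp: \<mu>.emeasure_finite)
  have KU: "?K \<in> sets (uniform_measure \<mu> ?K)" by (simp add: sets_\<mu> GL_Zp_sets)
  have sets_H: "sets H = sets borel_GL_Zp"
    unfolding H_def by (rule sets_restrict_space_cong) (simp add: sets_\<mu>)
  have space_H: "space H = ?K" by (simp add: H_def space_restrict_space space_\<mu>)
  have emeasure_H: "emeasure H A = emeasure \<mu> A / emeasure \<mu> ?K" if "A \<in> sets H" for A
  proof -
    have A: "A \<subseteq> ?K" "A \<in> sets borel"
      using that sets.sets_into_space[OF that] by (auto simp: space_H sets_H sets_restrict_space_iff GL_Zp_sets)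
    then have "emeasure H A = emeasure (uniform_measure \<mu> ?K) A"
      unfolding H_def by (intro emeasure_restrict_space) (auto simp: GL_Zp_sets sets_\<mu> space_\<mu>)
    also have "\<dots> = emeasure \<mu> (?K \<inter> A) / emeasure \<mu> ?K"
      using A by (intro emeasure_uniform_measure) (simp_all add: GL_Zp_sets sets_\<mu>)
    finally show ?thesis using A by (simp add: Int_absorb1)
  qed
  have inv: "distr H H f = H"
    if f: "f \<in> borel_measurable borel" "\<And>g. f g \<in> ?K \<longleftrightarrow> g \<in> ?K" "distr \<mu> borel f = \<mu>" for f
  proof (rule measure_eqI)
    have fH: "f \<in> measurable H H"
    proof -
      have "f \<in> measurable (restrict_space borel ?K) (restrict_space borel ?K)"
        using f(1,2) by (auto simp: measurable_restrict_space2_iff space_restrict_space intro: measurable_restrict_space1)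
      then show ?thesis using sets_H by (simp cong: measurable_cong_sets)
    qed
    fix A assume "A \<in> sets (distr H H f)"
    then have A: "A \<in> sets H" by simp
    then have A': "A \<subseteq> ?K" "A \<in> sets borel"
      using sets.sets_into_space[OF A] by (auto simp: space_H sets_H sets_restrict_space_iff GL_Zp_sets)
    have "emeasure (distr H H f) A = emeasure H (f -` A \<inter> space H)" by (rule emeasure_distr[OF fH A])
    also have "\<dots> = emeasure \<mu> (f -` A \<inter> space H) / emeasure \<mu> ?K"
      by (rule emeasure_H) (rule measurable_sets[OF fH A])
    also have "f -` A \<inter> space H = f -` A \<inter> space \<mu>" using A' f(2) by (auto simp: space_H space_\<mu>)
    also have "emeasure \<mu> (f -` A \<inter> space \<mu>) = emeasure (distr \<mu> borel f) A"
      using f(1) A' by (intro emeasure_distr[symmetric]) (simp_all add: sets_\<mu> cong: measurable_cong_sets)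
    also have "\<dots> / emeasure \<mu> ?K = emeasure H A" using emeasure_H[OF A] f(3) by simp
    finally show "emeasure (distr H H f) A = emeasure H A" .
  qed simp
  have "distr H H (\<lambda>g. k ** g) = H" "distr H H (\<lambda>g. g ** k) = H" if k: "k \<in> ?K" for k
  proof -
    obtain B where B: "B \<in> ?K" "k ** B = mat 1" "B ** k = mat 1" using k by (rule GL_ZpE)
    note int = GL_Zp_integral[OF k] GL_Zp_integral[OF B(1)]
    have 1: "B ** (k ** A) = A" "k ** (B ** A) = A" "(A ** k) ** B = A" "(A ** B) ** k = A" for A
      using B(2,3) by (simp_all add: matrix_mul_assoc, simp_all flip: matrix_mul_assoc)
    show "distr H H (\<lambda>g. k ** g) = H"
    proof (rule inv)
      show "k ** g \<in> ?K \<longleftrightarrow> g \<in> ?K" for g using GL_Zp_mult k B(1) 1 by metis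
      show "distr \<mu> borel (\<lambda>g. k ** g) = \<mu>" unfolding \<mu>_def
      proof (rule additive_haar_invariant[where g="\<lambda>x. B ** x"])
        show "(\<lambda>g. k ** g) -` coset x j = coset (B ** x) j" for x j
          using integral_mult_coset(1)[OF int(2), of _ x j] integral_mult_coset(1)[OF int(1), of _ "B ** x" j] 1 by (auto simp: set_eq_iff) metis+
        show "integral_mat (B ** x) \<longleftrightarrow> integral_mat x" for x using int integral_mat_mult 1 by metis
      qed simp
    qed simp
    show "distr H H (\<lambda>g. g ** k) = H"
    proof (rule inv)
      show "g ** k \<in> ?K \<longleftrightarrow> g \<in> ?K" for g using GL_Zp_mult k B(1) 1 by metis
      show "distr \<mu> borel (\<lambda>g. g ** k) = \<mu>" unfolding \<mu>_def
      proof (rule additive_haar_invariant[where g="\<lambda>x. x ** B"])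
        show "(\<lambda>g. g ** k) -` coset x j = coset (x ** B) j" for x j
          using integral_mult_coset(2)[OF int(2), of _ x j] integral_mult_coset(2)[OF int(1), of _ "x ** B" j] 1 by (auto simp: set_eq_iff) metis+
        show "integral_mat (x ** B) \<longleftrightarrow> integral_mat x" for x using int integral_mat_mult 1 by metis
      qed simp
    qed simp
  qed
  moreover have "prob_space H"
  proof -
    have "emeasure \<mu> ?K / emeasure \<mu> ?K = 1"
      by (rule ennreal_divide_self[OF K0]) (metis \<mu>.emeasure_finite infinity_ennreal_def top.not_eq_extremum)
    then have "emeasure (uniform_measure \<mu> ?K) ?K = 1"
      by (subst emeasure_uniform_measure) (simp_all only: sets_\<mu> GL_Zp_sets Int_absorb)
    then show ?thesis unfolding H_def by (rule prob_space_restrict_space[OF KU])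
  qed
  ultimately show ?thesis unfolding haar_GL_Zp_def using sets_H by blast
qed

section \<open>Convolution semigroups on the integers\<close>

lemma pmf_bind_ge: "pmf p x * pmf (f x) i \<le> pmf (bind_pmf p f) i"
proof -
  have "pmf p x * pmf (f x) i = (\<integral>y. indicator {x} y * pmf (f x) i \<partial>measure_pmf p)"
    by (simp add: pmf.rep_eq)
  also have "\<dots> \<le> (\<integral>y. pmf (f y) i \<partial>measure_pmf p)"
    by (intro integral_mono measure_pmf.integrable_const_bound[where B=1])
      (auto simp: indicator_def pmf_le_1 pmf_nonneg split: if_splits)
  finally show ?thesis by (simp add: pmf_bind)
qed

lemma pmf_map_add: "pmf (map_pmf (\<lambda>y. x + y) p) (x + y :: int) = pmf p y"
  by (rule pmf_map_inj') (simp add: inj_def)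

text \<open>Real and imaginary part of the characteristic function.\<close>

definition expect_cos :: "int pmf \<Rightarrow> real \<Rightarrow> real" where
  "expect_cos p \<theta> = measure_pmf.expectation p (\<lambda>x. cos (\<theta> * x))"

definition expect_sin :: "int pmf \<Rightarrow> real \<Rightarrow> real" where
  "expect_sin p \<theta> = measure_pmf.expectation p (\<lambda>x. sin (\<theta> * x))"

lemma integrable_bounded_pmf:
  fixes f :: "'a \<Rightarrow> real"
  assumes "\<And>x. \<bar>f x\<bar> \<le> B" shows "integrable (measure_pmf p) f"
  by (rule measure_pmf.integrable_const_bound[where B=B]) (auto simp: assms)

lemma expectation_bind_pmf:
  fixes f :: "'a \<Rightarrow> real"
  assumes "\<And>x. \<bar>f x\<bar> \<le> B"
  shows "measure_pmf.expectation (bind_pmf p g) f = (\<integral>x. measure_pmf.expectation (g x) f \<partial>measure_pmf p)"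
  unfolding measure_pmf_bind
  by (rule integral_bind[where K="count_space UNIV" and B=B and B'=1])
    (auto simp: assms measure_subprob measure_pmf.finite_measure_axioms measure_pmf.emeasure_space_1[simplified])

lemma expect_cos_sin_bind:
  fixes p q :: "int pmf"
  defines "b \<equiv> \<lambda>s. bind_pmf p (\<lambda>x. map_pmf (\<lambda>y. x + s * y) q)"
  shows "expect_cos (b 1) \<theta> = expect_cos p \<theta> * expect_cos q \<theta> - expect_sin p \<theta> * expect_sin q \<theta>"
    and "expect_sin (b 1) \<theta> = expect_sin p \<theta> * expect_cos q \<theta> + expect_cos p \<theta> * expect_sin q \<theta>"
    and "expect_cos (b (-1)) \<theta> = expect_cos p \<theta> * expect_cos q \<theta> + expect_sin p \<theta> * expect_sin q \<theta>"
    and "expect_sin (b (-1)) \<theta> = expect_sin p \<theta> * expect_cos q \<theta> - expect_cos p \<theta> * expect_sin q \<theta>"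
proof -
  note [simp] = integrable_bounded_pmf[where B=1]
  have cs: "measure_pmf.expectation (bind_pmf p (\<lambda>x. map_pmf (\<lambda>y. x + s * y) q)) f
      = (\<integral>x. \<integral>y. f (x + s * y) \<partial>measure_pmf q \<partial>measure_pmf p)"
    if "\<And>x. \<bar>f x\<bar> \<le> 1" for f :: "int \<Rightarrow> real" and s
    using that by (subst expectation_bind_pmf[where B=1]) auto
  show "expect_cos (b 1) \<theta> = expect_cos p \<theta> * expect_cos q \<theta> - expect_sin p \<theta> * expect_sin q \<theta>"
    and "expect_sin (b 1) \<theta> = expect_sin p \<theta> * expect_cos q \<theta> + expect_cos p \<theta> * expect_sin q \<theta>"
    and "expect_cos (b (-1)) \<theta> = expect_cos p \<theta> * expect_cos q \<theta> + expect_sin p \<theta> * expect_sin q \<theta>"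
    and "expect_sin (b (-1)) \<theta> = expect_sin p \<theta> * expect_cos q \<theta> - expect_cos p \<theta> * expect_sin q \<theta>"
    unfolding expect_cos_def expect_sin_def b_def
    by (subst cs; simp add: distrib_left right_diff_distrib cos_add sin_add cos_diff sin_diff)+
qed

text \<open>The squared modulus of the characteristic function, which is the characteristic function of the symmetrization.\<close>

definition char_sq :: "int pmf \<Rightarrow> real \<Rightarrow> real" where
  "char_sq p \<theta> = (expect_cos p \<theta>)\<^sup>2 + (expect_sin p \<theta>)\<^sup>2"

definition symmetrization :: "int pmf \<Rightarrow> int pmf" where
  "symmetrization p = bind_pmf p (\<lambda>x. map_pmf (\<lambda>y. x + -1 * y) p)"

lemma expect_symmetrization:
  "expect_cos (symmetrization p) \<theta> = char_sq p \<theta>" "expect_sin (symmetrization p) \<theta> = 0"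
  unfolding symmetrization_def by (simp_all only: expect_cos_sin_bind char_sq_def) (simp_all add: power2_eq_square)

lemma char_sq_conv:
  "char_sq (bind_pmf p (\<lambda>x. map_pmf (\<lambda>y. x + y) q)) \<theta> = char_sq p \<theta> * char_sq q \<theta>"
proof -
  have "expect_cos (bind_pmf p (\<lambda>x. map_pmf (\<lambda>y. x + y) q)) \<theta> = expect_cos p \<theta> * expect_cos q \<theta> - expect_sin p \<theta> * expect_sin q \<theta>"
    "expect_sin (bind_pmf p (\<lambda>x. map_pmf (\<lambda>y. x + y) q)) \<theta> = expect_sin p \<theta> * expect_cos q \<theta> + expect_cos p \<theta> * expect_sin q \<theta>"
    using expect_cos_sin_bind(1,2)[of p q \<theta>] by simp_all
  then show ?thesis unfolding char_sq_def by (simp only:) (simp add: power2_eq_square algebra_simps)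
qed

lemma char_sq_le_1: "char_sq p \<theta> \<le> 1"
proof -
  have "expect_cos (symmetrization p) \<theta> \<le> (\<integral>x. 1 \<partial>measure_pmf (symmetrization p))"
    unfolding expect_cos_def by (intro integral_mono integrable_bounded_pmf[where B=1]) auto
  then show ?thesis by (simp add: expect_symmetrization)
qed

lemma char_sq_nonneg: "0 \<le> char_sq p \<theta>"
  by (simp add: char_sq_def)

text \<open>\<open>1 - cos (2 * x) \<le> 4 * (1 - cos x)\<close>, averaged over the symmetrization.\<close>

lemma char_sq_double: "1 - char_sq p (2 * \<theta>) \<le> 4 * (1 - char_sq p \<theta>)"
proof -
  note int = integrable_bounded_pmf[where B=1]
  have c: "1 - cos (2 * \<theta> * x) \<le> 4 * (1 - cos (\<theta> * x))" for x
  proof -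
    have "cos (2 * (\<theta> * x)) = 2 * (cos (\<theta> * x))\<^sup>2 - 1" by (simp add: cos_double_cos)
    moreover have "0 \<le> 2 * (1 - cos (\<theta> * x))\<^sup>2" by simp
    ultimately show ?thesis by (simp add: power2_eq_square algebra_simps)
  qed
  have "(\<integral>x. 1 - cos (2 * \<theta> * real_of_int x) \<partial>measure_pmf (symmetrization p))
      \<le> (\<integral>x. 4 * (1 - cos (\<theta> * real_of_int x)) \<partial>measure_pmf (symmetrization p))"
    by (intro integral_mono c) (simp_all add: int)
  then show ?thesis
    by (simp add: int expect_symmetrization[symmetric] expect_cos_def)
qed

lemma char_measure_pmf:
  "char (distr (measure_pmf p) borel real_of_int) \<theta> = Complex (expect_cos p \<theta>) (expect_sin p \<theta>)"
proof -
  have "char (distr (measure_pmf p) borel real_of_int) \<theta> = (\<integral>x. iexp (\<theta> * real_of_int x) \<partial>measure_pmf p)"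
    unfolding char_def by (subst integral_distr) auto
  also have "\<dots> = Complex (expect_cos p \<theta>) (expect_sin p \<theta>)"
  proof (rule complex_eqI)
    have int: "integrable (measure_pmf p) (\<lambda>x. iexp (\<theta> * real_of_int x))"
      by (rule measure_pmf.integrable_const_bound[where B=1]) auto
    show "Re (\<integral>x. iexp (\<theta> * real_of_int x) \<partial>measure_pmf p) = Re (Complex (expect_cos p \<theta>) (expect_sin p \<theta>))"
      unfolding integral_Re[OF int, symmetric] by (simp add: expect_cos_def Re_exp)
    show "Im (\<integral>x. iexp (\<theta> * real_of_int x) \<partial>measure_pmf p) = Im (Complex (expect_cos p \<theta>) (expect_sin p \<theta>))"
      unfolding integral_Im[OF int, symmetric] by (simp add: expect_sin_def Im_exp)
  qed
  finally show ?thesis .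
qed

lemma real_distribution_measure_pmf: "real_distribution (distr (measure_pmf (p :: int pmf)) borel real_of_int)"
  by (intro prob_space.real_distribution_distr[OF prob_space_measure_pmf]) simp

lemma char_sq_near_0: obtains \<theta>0 where "\<theta>0 > 0" "\<And>\<theta>. \<bar>\<theta>\<bar> < \<theta>0 \<Longrightarrow> char_sq p \<theta> > 1 / 2"
proof -
  let ?M = "distr (measure_pmf p) borel real_of_int"
  interpret real_distribution ?M by (rule real_distribution_measure_pmf)
  have eq: "char_sq p = (\<lambda>\<theta>. (cmod (char ?M \<theta>))\<^sup>2)"
    by (simp add: fun_eq_iff char_measure_pmf char_sq_def cmod_power2)
  have "isCont (char_sq p) 0" unfolding eq using isCont_char[of 0] by (intro continuous_intros)
  moreover have "char_sq p 0 = 1" unfolding eq by (simp add: char_zero)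
  ultimately have "char_sq p \<midarrow>0\<rightarrow> 1" by (simp add: isCont_def)
  then have "\<forall>\<^sub>F \<theta> in at 0. char_sq p \<theta> > 1 / 2" by (rule order_tendstoD) simp
  then obtain d where "d > 0" "\<And>\<theta>. \<theta> \<noteq> 0 \<Longrightarrow> dist \<theta> 0 < d \<Longrightarrow> char_sq p \<theta> > 1 / 2"
    unfolding eventually_at by auto
  moreover have "char_sq p 0 > 1 / 2" using \<open>char_sq p 0 = 1\<close> by simp
  ultimately show ?thesis by (intro that[of d]) (auto, metis dist_real_def diff_zero)
qed

text \<open>
  Convergence of the characteristic functions gives weak convergence by Levy's theorem, and \<open>-1/2\<close> and
  \<open>1/2\<close> are continuity points that separate \<open>0\<close> from the other integers.
\<close>

lemma symmetrization_tendsto: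
  assumes "\<And>\<theta>. (\<lambda>n. char_sq (p n) \<theta>) \<longlonglongrightarrow> 1"
  shows "(\<lambda>n. pmf (symmetrization (p n)) 0) \<longlonglongrightarrow> 1"
proof -
  let ?M = "\<lambda>n. distr (measure_pmf (symmetrization (p n))) borel real_of_int"
  let ?N = "distr (measure_pmf (return_pmf 0 :: int pmf)) borel real_of_int"
  have "char ?N \<theta> = 1" for \<theta>
    by (simp add: char_measure_pmf expect_cos_def expect_sin_def complex_eq_iff)
  moreover have "(\<lambda>n. char (?M n) \<theta>) \<longlonglongrightarrow> 1" for \<theta>
  proof -
    have "char (?M n) \<theta> = complex_of_real (char_sq (p n) \<theta>)" for n
      by (simp add: char_measure_pmf expect_symmetrization complex_eq_iff)
    then show ?thesis using tendsto_of_real[OF assms[of \<theta>]] by simp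
  qed
  ultimately have w: "weak_conv_m ?M ?N"
    by (intro levy_continuity real_distribution_measure_pmf) simp
  have cdfN: "cdf ?N x = (if 0 \<le> x then 1 else 0)" for x
    by (simp add: cdf_def measure_distr indicator_def)
  have "(\<lambda>n. cdf (?M n) x) \<longlonglongrightarrow> cdf ?N x" if "x \<noteq> 0" for x
  proof -
    interpret N: real_distribution ?N by (rule real_distribution_measure_pmf)
    have "measure ?N {x} = 0" using that by (subst measure_distr) (auto simp: indicator_def)
    then have "isCont (cdf ?N) x" by (simp add: N.isCont_cdf)
    then show ?thesis using w unfolding weak_conv_m_def weak_conv_def by blast
  qed
  from tendsto_diff[OF this[of "1/2"] this[of "-1/2"]]
  have "(\<lambda>n. cdf (?M n) (1/2) - cdf (?M n) (-1/2)) \<longlonglongrightarrow> 1" by (simp add: cdfN)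
  moreover have "cdf (?M n) (1/2) - cdf (?M n) (-1/2) = pmf (symmetrization (p n)) 0" for n
  proof -
    interpret M: real_distribution "?M n" by (rule real_distribution_measure_pmf)
    have "cdf (?M n) (1/2) - cdf (?M n) (-1/2) = measure (?M n) {-1/2<..1/2}"
      by (rule M.cdf_diff_eq) simp
    also have "\<dots> = measure (measure_pmf (symmetrization (p n))) (real_of_int -` {-1/2<..1/2})"
      by (subst measure_distr) auto
    also have "real_of_int -` {-1/2<..1/2} = {0}"
    proof (intro equalityI subsetI)
      fix x assume "x \<in> real_of_int -` {- 1 / 2<..1 / 2}"
      then have "- 1 < real_of_int x" "real_of_int x < 1" by auto
      then show "x \<in> {0}" by simp
    qed auto
    finally show ?thesis by (simp add: pmf.rep_eq)
  qed
  ultimately show ?thesis by simp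
qed

text \<open>The symmetrization has at \<open>0\<close> the average of the probabilities of \<open>p\<close>, weighted by \<open>p\<close> itself.\<close>

lemma large_atom_of_symmetrization:
  assumes "c < pmf (symmetrization p) 0" shows "\<exists>x. c < pmf p x"
proof (rule ccontr)
  assume "\<not> ?thesis"
  then have le: "pmf p x \<le> c" for x by (simp add: not_less)
  have "pmf (symmetrization p) 0 = (\<integral>x. pmf (map_pmf (\<lambda>y. x - y) p) 0 \<partial>measure_pmf p)"
    by (simp add: symmetrization_def pmf_bind)
  also have "\<dots> = (\<integral>x. pmf p x \<partial>measure_pmf p)"
  proof (intro Bochner_Integration.integral_cong refl)
    fix x show "pmf (map_pmf (\<lambda>y. x - y) p) 0 = pmf p x"
      using pmf_map_inj'[of "\<lambda>y. x - y" p x] by (simp add: inj_def)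
  qed
  also have "\<dots> \<le> (\<integral>x. c \<partial>measure_pmf p)"
    by (rule integral_mono[OF integrable_bounded_pmf[where B=1]]) (auto simp: le pmf_nonneg pmf_le_1)
  finally show False using assms by simp
qed

text \<open>
  The squared modulus of the characteristic function is
  multiplicative in \<open>t\<close>, so it tends to \<open>1\<close> as \<open>t\<close> decreases to \<open>0\<close> wherever it is nonzero at time
  \<open>1\<close>: near \<open>0\<close>, and then everywhere, by doubling.  Hence the symmetrized law concentrates at \<open>0\<close>,
  and the law itself at some point \<open>x\<^sub>t\<close>.  This point depends additively on \<open>t\<close>, so it is divisible
  by all powers of \<open>2\<close>.
\<close>

lemma int_convolution_semigroup_tendsto:
  fixes r :: "real \<Rightarrow> int pmf"
  assumes conv: "\<And>s t. s > 0 \<Longrightarrow> t > 0 \<Longrightarrow> r (s + t) = bind_pmf (r s) (\<lambda>x. map_pmf (\<lambda>y. x + y) (r t))"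
  shows "((\<lambda>t. pmf (r t) 0) \<longlongrightarrow> 1) (at_right 0)"
proof -
  let ?F = "\<lambda>t. char_sq (r t)"
  have mult: "?F (s + t) \<theta> = ?F s \<theta> * ?F t \<theta>" if "s > 0" "t > 0" for s t \<theta>
    by (simp add: conv that char_sq_conv)
  have pow: "?F (real (Suc n) * t) \<theta> = ?F t \<theta> ^ Suc n" if "t > 0" for n t \<theta>
  proof (induction n)
    case (Suc n)
    have "real (Suc (Suc n)) * t = real (Suc n) * t + t" by (simp add: algebra_simps)
    then show ?case using Suc that by (simp add: mult del: of_nat_Suc)
  qed simp
  \<comment> \<open>With \<open>u = 1 - F t\<close>, multiplicativity and monotonicity in the time give \<open>1 / 2 \<le> (1 - u) ^ n\<close>.
    Multiplied by Bernoulli's inequality for \<open>(1 + u) ^ n\<close>, this bounds \<open>n * u\<close> by \<open>1\<close>.\<close>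
  have rate: "1 - ?F t \<theta> \<le> 1 / real (Suc n)" if t: "0 < t" "t < 1 / real (Suc n)" and \<theta>: "?F 1 \<theta> > 1 / 2" for t \<theta> n
  proof -
    let ?h = "1 / real (Suc n)"
    define u where "u = 1 - ?F t \<theta>"
    have u: "0 \<le> u" "u \<le> 1" using char_sq_le_1[of "r t" \<theta>] char_sq_nonneg[of "r t" \<theta>] by (auto simp: u_def)
    have "?F ?h \<theta> = ?F t \<theta> * ?F (?h - t) \<theta>" using mult[of t "?h - t" \<theta>] t by simp
    also have "\<dots> \<le> ?F t \<theta> * 1" by (intro mult_left_mono char_sq_le_1 char_sq_nonneg)
    finally have "?F ?h \<theta> ^ Suc n \<le> (1 - u) ^ Suc n"
      unfolding u_def by (intro power_mono char_sq_nonneg) simp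
    moreover have "?F ?h \<theta> ^ Suc n = ?F 1 \<theta>" using pow[of ?h n \<theta>] by simp
    ultimately have half: "1 / 2 \<le> (1 - u) ^ Suc n" using \<theta> by simp
    have "(1 / 2) * (1 + real (Suc n) * u) \<le> (1 - u) ^ Suc n * (1 + u) ^ Suc n"
      using half Bernoulli_inequality[of u "Suc n"] u by (intro mult_mono) auto
    also have "\<dots> = (1 - u\<^sup>2) ^ Suc n" by (simp add: power_mult_distrib[symmetric] algebra_simps power2_eq_square)
    also have "\<dots> \<le> 1" using u by (intro power_le_one) (auto simp: power_le_one)
    finally have "real (Suc n) * u \<le> 1" by simp
    then show ?thesis by (simp add: u_def[symmetric] field_simps)
  qed
  have lim: "((\<lambda>t. ?F t \<theta>) \<longlongrightarrow> 1) (at_right 0)" if \<theta>: "?F 1 \<theta> > 1 / 2" for \<theta> :: real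
  proof (rule tendstoI)
    fix e :: real assume "e > 0"
    then obtain n where n: "1 / real (Suc n) < e" by (rule nat_approx_posE)
    show "\<forall>\<^sub>F t in at_right 0. dist (?F t \<theta>) 1 < e"
    proof (rule eventually_at_rightI[of 0 "1 / real (Suc n)"])
      fix t assume "t \<in> {0<..<1 / real (Suc n)}"
      then show "dist (?F t \<theta>) 1 < e"
        using rate[OF _ _ \<theta>, of t n] n char_sq_le_1[of "r t" \<theta>] by (simp add: dist_real_def)
    qed simp
  qed
  have lim_double: "((\<lambda>t. ?F t (2 * \<theta>)) \<longlongrightarrow> 1) (at_right 0)"
    if "((\<lambda>t. ?F t \<theta>) \<longlongrightarrow> 1) (at_right 0)" for \<theta> :: real
  proof (rule tendsto_sandwich[OF _ _ _ tendsto_const])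
    show "((\<lambda>t. 1 - 4 * (1 - ?F t \<theta>)) \<longlongrightarrow> 1) (at_right 0)"
      by (rule tendsto_eq_intros that refl)+ simp
    show "\<forall>\<^sub>F t in at_right 0. 1 - 4 * (1 - ?F t \<theta>) \<le> ?F t (2 * \<theta>)"
    proof (intro always_eventually allI)
      show "1 - 4 * (1 - ?F t \<theta>) \<le> ?F t (2 * \<theta>)" for t using char_sq_double[of "r t" \<theta>] by simp
    qed
  qed (simp add: char_sq_le_1)
  obtain \<theta>0 where \<theta>0: "\<theta>0 > 0" "\<And>\<theta>. \<bar>\<theta>\<bar> < \<theta>0 \<Longrightarrow> ?F 1 \<theta> > 1 / 2"
    using char_sq_near_0 by blast
  have lim_pow: "((\<lambda>t. ?F t \<theta>) \<longlongrightarrow> 1) (at_right 0)" if "\<bar>\<theta>\<bar> < 2 ^ k * \<theta>0" for \<theta> and k :: nat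
    using that
  proof (induction k arbitrary: \<theta>)
    case 0 then show ?case using lim \<theta>0 by simp
  next
    case (Suc k)
    then have "\<bar>\<theta> / 2\<bar> < 2 ^ k * \<theta>0" by simp
    from lim_double[OF Suc.IH[OF this]] show ?case by simp
  qed
  have lim_all: "((\<lambda>t. ?F t \<theta>) \<longlongrightarrow> 1) (at_right 0)" for \<theta>
  proof -
    obtain k where "\<bar>\<theta>\<bar> / \<theta>0 < 2 ^ k" using real_arch_pow[of 2 "\<bar>\<theta>\<bar> / \<theta>0"] by auto
    then show ?thesis using \<theta>0(1) by (intro lim_pow[of _ k]) (simp add: field_simps)
  qed
  have sym: "((\<lambda>t. pmf (symmetrization (r t)) 0) \<longlongrightarrow> 1) (at_right 0)"
  proof (rule tendsto_at_right_sequentially[of 0 1])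
    fix S :: "nat \<Rightarrow> real" assume S: "\<And>n. 0 < S n" "S \<longlonglongrightarrow> 0"
    have "filterlim S (at_right 0) sequentially"
      by (rule tendsto_imp_filterlim_at_right[OF S(2)]) (simp add: S(1))
    from filterlim_compose[OF lim_all this]
    show "(\<lambda>n. pmf (symmetrization (r (S n))) 0) \<longlonglongrightarrow> 1" by (rule symmetrization_tendsto)
  qed simp
  \<comment> \<open>An atom exceeding \<open>9 / 10\<close> is unique, and its square still exceeds \<open>1 / 2\<close>.  So the atom at time
    \<open>t\<close> is twice the atom at time \<open>t / 2\<close>.\<close>
  have ge: "\<forall>\<^sub>F t in at_right 0. a < pmf (r t) 0" if "a < 1" for a
  proof -
    define c where "c = max a (9 / 10)"
    have "\<forall>\<^sub>F t in at_right 0. c < pmf (symmetrization (r t)) 0"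
      by (rule order_tendstoD(1)[OF sym]) (use that in \<open>simp add: c_def\<close>)
    then obtain \<delta> where \<delta>: "\<delta> > 0" "\<And>t. 0 < t \<Longrightarrow> t < \<delta> \<Longrightarrow> c < pmf (symmetrization (r t)) 0"
      unfolding eventually_at_right_field by auto
    then have "\<exists>x. c < pmf (r t) x" if "0 < t" "t < \<delta>" for t
      using that large_atom_of_symmetrization by blast
    then obtain x where x: "\<And>t. 0 < t \<Longrightarrow> t < \<delta> \<Longrightarrow> c < pmf (r t) (x t)" by metis
    have unique: "y = z" if "pmf p y > 1 / 2" "pmf p z > 1 / 2" for p and y z :: int
    proof (rule ccontr)
      assume "y \<noteq> z"
      then have "pmf p y + pmf p z = measure (measure_pmf p) {y, z}"
        by (simp add: measure_measure_pmf_finite)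
      also have "\<dots> \<le> 1" by simp
      finally show False using that by simp
    qed
    have double: "x t = 2 * x (t / 2)" if t: "0 < t" "t < \<delta>" for t
    proof (rule unique)
      have h: "pmf (r (t / 2)) (x (t / 2)) > 9 / 10" using x[of "t / 2"] t by (simp add: c_def)
      have "(9 / 10) * (9 / 10) \<le> pmf (r (t / 2)) (x (t / 2)) * pmf (r (t / 2)) (x (t / 2))"
        using h by (intro mult_mono) auto
      also have "\<dots> = pmf (r (t / 2)) (x (t / 2)) * pmf (map_pmf (\<lambda>y. x (t / 2) + y) (r (t / 2))) (x (t / 2) + x (t / 2))"
        by (simp only: pmf_map_add)
      also have "\<dots> \<le> pmf (r (t / 2 + t / 2)) (x (t / 2) + x (t / 2))"
        using t by (subst conv[of "t / 2" "t / 2"]) (auto intro: pmf_bind_ge)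
      finally show "1 / 2 < pmf (r t) (2 * x (t / 2))" by simp
      show "1 / 2 < pmf (r t) (x t)" using x[OF t] by (simp add: c_def)
    qed
    have divis: "x t = 2 ^ k * x (t / 2 ^ k)" if "0 < t" "t < \<delta>" for t and k :: nat
    proof (induction k)
      case (Suc k)
      have "t / 2 ^ k \<le> t" using that by (simp add: divide_le_eq)
      then have "x (t / 2 ^ k) = 2 * x (t / 2 ^ Suc k)"
        using double[of "t / 2 ^ k"] that by (simp add: mult.commute)
      then show ?case using Suc by simp
    qed simp
    have zero: "x t = 0" if t: "0 < t" "t < \<delta>" for t
    proof (rule ccontr)
      assume "x t \<noteq> 0"
      let ?k = "nat \<bar>x t\<bar>"
      have "2 ^ ?k dvd x t" using divis[OF t, of ?k] by (metis dvd_triv_left)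
      from dvd_imp_le_int[OF \<open>x t \<noteq> 0\<close> this] have "2 ^ ?k \<le> \<bar>x t\<bar>" by simp
      moreover have "int ?k < 2 ^ ?k" by (metis of_nat_less_two_power)
      ultimately show False by simp
    qed
    show ?thesis
    proof (rule eventually_at_rightI[of 0 \<delta>])
      fix t assume "t \<in> {0<..<\<delta>}"
      then show "a < pmf (r t) 0" using x[of t] zero[of t] by (simp add: c_def)
    qed (rule \<delta>(1))
  qed
  show ?thesis
  proof (rule order_tendstoI)
    show "\<forall>\<^sub>F t in at_right 0. pmf (r t) 0 < a" if "1 < a" for a
      by (intro always_eventually allI order.strict_trans1[OF pmf_le_1 that])
  qed (rule ge)
qed

section \<open>Semigroups of kernels generated by convolution\<close>

lemma pmf_bind_ge2:
  assumes "x \<noteq> y"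
  shows "pmf p x * pmf (f x) i + pmf p y * pmf (f y) i \<le> pmf (bind_pmf p f) i"
proof -
  note int = integrable_bounded_pmf[where B=1]
  have "pmf p x * pmf (f x) i + pmf p y * pmf (f y) i
      = (\<integral>z. indicator {x} z * pmf (f x) i + indicator {y} z * pmf (f y) i \<partial>measure_pmf p)"
  proof -
    have "integrable (measure_pmf p) (\<lambda>z. indicator {x} z * c)" for x and c :: real
      by (rule integrable_bounded_pmf[where B="\<bar>c\<bar>"]) (auto simp: indicator_def)
    from Bochner_Integration.integral_add[OF this this] show ?thesis by (simp add: pmf.rep_eq)
  qed
  also have "\<dots> \<le> (\<integral>z. pmf (f z) i \<partial>measure_pmf p)"
    using assms by (intro integral_mono Bochner_Integration.integrable_add int)
      (auto simp: indicator_def pmf_le_1 pmf_nonneg split: if_splits)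
  finally show ?thesis by (simp add: pmf_bind)
qed

lemma pmf_eq_of_le: "(\<And>y. pmf p y \<le> pmf q y) \<Longrightarrow> p = q"
  using pmf_neq_exists_less[of q p] by (metis linorder_not_less)

text \<open>At rate \<open>0\<close> the Poisson law degenerates to the point mass at \<open>0\<close>.\<close>

definition poisson_law :: "real \<Rightarrow> nat pmf" where
  "poisson_law c = (if c = 0 then return_pmf 0 else poisson_pmf c)"

lemma pmf_poisson_law: "0 \<le> c \<Longrightarrow> pmf (poisson_law c) k = c ^ k / fact k * exp (- c)"
  by (cases "k = 0") (auto simp: poisson_law_def)

primrec kernel_power :: "('s \<Rightarrow> 's pmf) \<Rightarrow> nat \<Rightarrow> 's \<Rightarrow> 's pmf" where
  "kernel_power R 0 x = return_pmf x"
| "kernel_power R (Suc k) x = bind_pmf (kernel_power R k x) R"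

lemma binomial_mult_power_tendsto:
  fixes n :: "nat \<Rightarrow> nat" and h :: "nat \<Rightarrow> real"
  assumes nh: "(\<lambda>j. real (n j) * h j) \<longlonglongrightarrow> t" and h: "h \<longlonglongrightarrow> 0"
  shows "(\<lambda>j. real (n j choose k) * h j ^ k) \<longlonglongrightarrow> t ^ k / fact k"
proof -
  have eq: "real (n j choose k) * h j ^ k = (\<Prod>i<k. real (n j) * h j - real i * h j) / fact k" for j
  proof -
    have "real (n j choose k) = (\<Prod>i<k. real (n j) - real i) / fact k"
      by (simp add: binomial_gbinomial gbinomial_prod_rev atLeast0LessThan)
    then show ?thesis by (simp add: prod.distrib flip: left_diff_distrib)
  qed
  have "(\<lambda>j. (\<Prod>i<k. real (n j) * h j - real i * h j) / fact k) \<longlonglongrightarrow> (\<Prod>i<k. t - real i * 0) / fact k"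
    by (intro tendsto_intros nh h) simp
  then show ?thesis unfolding eq by simp
qed

text \<open>A lower bound for the probability that none of \<open>n\<close> steps is a jump.\<close>

lemma exp_le_one_minus_power:
  fixes e :: real
  assumes "0 \<le> e" "e < 1" shows "exp (- (real n * e / (1 - e))) \<le> (1 - e) ^ n"
proof -
  have "1 / (1 - e) = 1 + e / (1 - e)" using assms by (simp add: field_simps)
  also have "\<dots> \<le> exp (e / (1 - e))" by (rule exp_ge_add_one_self)
  finally have "exp (- (e / (1 - e))) \<le> 1 - e"
    using assms by (simp add: exp_minus field_simps)
  then have "exp (- (e / (1 - e))) ^ n \<le> (1 - e) ^ n" by (intro power_mono) auto
  then show ?thesis by (simp add: exp_of_nat_mult[symmetric])
qed

text \<open>
  The process makes, from \<open>z\<close>, a step of type \<open>\<mu>\<close> to a random state with law \<open>Q \<mu> z\<close>; type \<open>zero\<close> stays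
  put, and \<open>zero\<close> serves as base point as well.  The types of the steps made up to time \<open>t\<close> combine to
  a single one, with law \<open>m t\<close>.
\<close>

locale convolution_semigroup =
  fixes Q :: "'s \<Rightarrow> 's \<Rightarrow> 's pmf" and zero :: 's and m :: "real \<Rightarrow> 's pmf" and T :: "real \<Rightarrow> 's \<Rightarrow> 's pmf"
  assumes Q_zero_left: "Q zero z = return_pmf z"
    and Q_zero_right: "Q \<mu> zero = return_pmf \<mu>"
    and T_eq: "0 < t \<Longrightarrow> T t z = bind_pmf (m t) (\<lambda>\<mu>. Q \<mu> z)"
    and T_add: "0 < s \<Longrightarrow> 0 < t \<Longrightarrow> T (s + t) z = bind_pmf (T s z) (T t)"
    and m_tendsto: "((\<lambda>t. pmf (m t) zero) \<longlongrightarrow> 1) (at_right 0)"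
begin

definition \<epsilon> :: "real \<Rightarrow> real" where "\<epsilon> h = 1 - pmf (m h) zero"

lemma T_zero: "0 < t \<Longrightarrow> T t zero = m t"
  by (simp add: T_eq Q_zero_right bind_return_pmf')

lemma T_stay: assumes "0 < t" shows "pmf (m t) zero \<le> pmf (T t z) z"
  using pmf_bind_ge[of "m t" zero "\<lambda>\<mu>. Q \<mu> z" z] unfolding T_eq[OF assms] Q_zero_left by simp

text \<open>Either of the two steps may be the one of type \<open>\<mu>\<close> while the other stays put.\<close>

lemma m_double:
  assumes h: "0 < h" and \<mu>: "\<mu> \<noteq> zero"
  shows "2 * pmf (m h) \<mu> * (1 - \<epsilon> h) \<le> pmf (m (2 * h)) \<mu>"
proof -
  have "m (2 * h) = bind_pmf (m h) (T h)"
    using T_add[OF h h, of zero] T_zero[of "2 * h"] T_zero[OF h] h by simp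
  then have "pmf (m h) zero * pmf (T h zero) \<mu> + pmf (m h) \<mu> * pmf (T h \<mu>) \<mu> \<le> pmf (m (2 * h)) \<mu>"
    using pmf_bind_ge2[of zero \<mu> "m h" "T h" \<mu>] \<mu> by simp
  moreover have "pmf (m h) \<mu> * pmf (m h) zero \<le> pmf (m h) \<mu> * pmf (T h \<mu>) \<mu>"
    by (intro mult_left_mono T_stay h) simp
  ultimately show ?thesis unfolding T_zero[OF h] \<epsilon>_def by (simp add: algebra_simps)
qed

lemma \<epsilon>_eq_integral: "\<epsilon> h = (\<integral>\<mu>. pmf (m h) \<mu> \<partial>count_space (- {zero}))"
proof -
  have "measure (measure_pmf (m h)) (- {zero}) = 1 - measure (measure_pmf (m h)) {zero}"
    using measure_pmf.prob_compl[of "{zero}" "m h"] by (simp add: Compl_eq_Diff_UNIV)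
  then show ?thesis unfolding \<epsilon>_def integral_pmf by (simp add: pmf.rep_eq)
qed

lemma \<epsilon>_double:
  assumes "0 < h" shows "2 * \<epsilon> h * (1 - \<epsilon> h) \<le> \<epsilon> (2 * h)"
proof -
  have "2 * \<epsilon> h * (1 - \<epsilon> h) = (\<integral>\<mu>. 2 * pmf (m h) \<mu> * (1 - \<epsilon> h) \<partial>count_space (- {zero}))"
    by (simp add: \<epsilon>_eq_integral[of h, THEN arg_cong[of _ _ "\<lambda>e. 2 * e * (1 - \<epsilon> h)"]])
  also have "\<dots> \<le> (\<integral>\<mu>. pmf (m (2 * h)) \<mu> \<partial>count_space (- {zero}))"
    using m_double[OF assms] by (intro integral_mono) (auto simp: integrable_pmf)
  finally show ?thesis by (simp add: \<epsilon>_eq_integral[of "2 * h"])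
qed

lemma \<epsilon>_bounds: "0 \<le> \<epsilon> h" "\<epsilon> h \<le> 1"
  by (auto simp: \<epsilon>_def pmf_le_1)

text \<open>
  Along \<open>h\<^sub>j = h\<^sub>0 / 2\<^sup>j\<close> the rates \<open>m h\<^sub>j \<mu> / h\<^sub>j\<close>, multiplied by a correction \<open>exp (\<kappa> h\<^sub>j)\<close> that tends to \<open>1\<close>,
  decrease: one of two steps of length \<open>h\<close> can already account for the type \<open>\<mu>\<close>.  Their limits are
  the jump rates.
\<close>

lemma jump_rates:
  "\<exists>h0 \<kappa> c M. 0 < h0 \<and> 0 \<le> c \<and> (\<forall>\<mu>\<in>set_pmf M. \<mu> = zero \<or> (\<exists>t>0. \<mu> \<in> set_pmf (m t))) \<and>
    c * pmf M zero = 0 \<and> (\<lambda>j. \<epsilon> (h0 / 2 ^ j) / (h0 / 2 ^ j)) \<longlonglongrightarrow> c \<and>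
    (\<forall>j \<mu>. \<mu> \<noteq> zero \<longrightarrow> (h0 / 2 ^ j) * exp (- \<kappa> * (h0 / 2 ^ j)) * c * pmf M \<mu> \<le> pmf (m (h0 / 2 ^ j)) \<mu>)"
proof -
  have "\<forall>\<^sub>F t in at_right 0. 3 / 4 < pmf (m t) zero" by (rule order_tendstoD(1)[OF m_tendsto]) simp
  then obtain \<delta> where \<delta>: "0 < \<delta>" "\<And>t. 0 < t \<Longrightarrow> t < \<delta> \<Longrightarrow> 3 / 4 < pmf (m t) zero"
    unfolding eventually_at_right_field by auto
  define h0 where "h0 = \<delta> / 2"
  define h where "h j = h0 / 2 ^ j" for j :: nat
  have h0: "0 < h0" "h0 < \<delta>" using \<delta> by (auto simp: h0_def)
  have h: "0 < h j" "h j \<le> h0" "h j = 2 * h (Suc j)" for j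
    using h0 by (auto simp: h_def divide_le_eq)
  \<comment> \<open>As \<open>u j \<le> (u (Suc j))^2\<close>, the sequence \<open>u\<close> is bounded below by an exponential in \<open>h j\<close>, whose rate \<open>\<kappa>\<close>
    is read off at \<open>j = 0\<close>.\<close>
  define u where "u j = 1 - 2 * \<epsilon> (h j)" for j
  have u: "1 / 2 < u j" "u j \<le> 1" for j
    using \<delta>(2)[OF h(1)[of j]] h(2)[of j] h0 \<epsilon>_bounds[of "h j"] by (auto simp: u_def \<epsilon>_def)
  have u_sq: "u j \<le> (u (Suc j))\<^sup>2" for j
    using \<epsilon>_double[OF h(1)[of "Suc j"]] unfolding u_def h(3)[of j]
    by (simp add: power2_eq_square algebra_simps)
  define \<kappa> where "\<kappa> = - ln (u 0) / h0"
  have u_exp: "exp (- \<kappa> * h j) \<le> u j" for j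
  proof (induction j)
    case 0 then show ?case using h0 u(1)[of 0] by (simp add: \<kappa>_def h_def)
  next
    case (Suc j)
    have "(exp (- \<kappa> * h (Suc j)))\<^sup>2 = exp (- \<kappa> * h j)"
      by (simp add: h(3)[of j] power2_eq_square flip: exp_add)
    then have "(exp (- \<kappa> * h (Suc j)))\<^sup>2 \<le> (u (Suc j))\<^sup>2" using Suc u_sq[of j] by simp
    then show ?case by (rule power2_le_imp_le) (use u(1)[of "Suc j"] in simp)
  qed
  define b where "b j \<mu> = exp (\<kappa> * h j) * pmf (m (h j)) \<mu> / h j" for j \<mu>
  have b_dec: "b (Suc j) \<mu> \<le> b j \<mu>" if "\<mu> \<noteq> zero" for j \<mu>
  proof -
    let ?h = "h (Suc j)"
    have "exp (- \<kappa> * ?h) * pmf (m ?h) \<mu> \<le> (1 - \<epsilon> ?h) * pmf (m ?h) \<mu>"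
      using u_exp[of "Suc j"] \<epsilon>_bounds[of ?h] by (intro mult_right_mono) (auto simp: u_def)
    also have "2 * \<dots> \<le> pmf (m (h j)) \<mu>"
      using m_double[OF h(1) that, of "Suc j"] by (simp add: h(3)[of j] algebra_simps)
    finally have "exp (\<kappa> * h j) * (2 * (exp (- \<kappa> * ?h) * pmf (m ?h) \<mu>)) \<le> exp (\<kappa> * h j) * pmf (m (h j)) \<mu>"
      by (intro mult_left_mono) auto
    moreover have "exp (\<kappa> * h j) * exp (- \<kappa> * ?h) = exp (\<kappa> * ?h)"
      by (simp add: h(3)[of j] flip: exp_add)
    ultimately have "2 * (exp (\<kappa> * ?h) * pmf (m ?h) \<mu>) \<le> exp (\<kappa> * h j) * pmf (m (h j)) \<mu>"
      by (metis (no_types, opaque_lifting) mult.assoc mult.left_commute)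
    then have "2 * (exp (\<kappa> * ?h) * pmf (m ?h) \<mu>) / h j \<le> b j \<mu>"
      unfolding b_def using h(1)[of j] by (intro divide_right_mono) auto
    then show ?thesis unfolding b_def using h(3)[of j] by simp
  qed
  have b_nonneg: "0 \<le> b j \<mu>" for j \<mu> using h(1)[of j] by (simp add: b_def)
  have "\<exists>l. (\<lambda>j. b j \<mu>) \<longlonglongrightarrow> l \<and> (\<forall>j. l \<le> b j \<mu>)" if "\<mu> \<noteq> zero" for \<mu>
  proof -
    have dec: "decseq (\<lambda>j. b j \<mu>)" using b_dec[OF that] by (simp add: decseq_Suc_iff)
    then obtain l where "(\<lambda>j. b j \<mu>) \<longlonglongrightarrow> l"
      using decseq_convergent[OF dec, of 0] b_nonneg by metis
    then show ?thesis using decseq_ge[OF dec] by blast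
  qed
  then obtain a where a: "\<And>\<mu>. \<mu> \<noteq> zero \<Longrightarrow> (\<lambda>j. b j \<mu>) \<longlonglongrightarrow> a \<mu>" "\<And>\<mu> j. \<mu> \<noteq> zero \<Longrightarrow> a \<mu> \<le> b j \<mu>"
    by metis
  have a_nonneg: "0 \<le> a \<mu>" if "\<mu> \<noteq> zero" for \<mu>
    by (rule LIMSEQ_le_const[OF a(1)[OF that]]) (use b_nonneg in auto)
  have h_lim: "h \<longlonglongrightarrow> 0" unfolding h_def
    by (rule LIMSEQ_divide_realpow_zero) simp
  have rate_lim: "(\<lambda>j. pmf (m (h j)) \<mu> / h j) \<longlonglongrightarrow> a \<mu>" if "\<mu> \<noteq> zero" for \<mu>
  proof -
    have "(\<lambda>j. exp (- \<kappa> * h j) * b j \<mu>) \<longlonglongrightarrow> exp (- \<kappa> * 0) * a \<mu>"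
      by (intro tendsto_intros h_lim a(1) that)
    moreover have "exp (- \<kappa> * h j) * b j \<mu> = pmf (m (h j)) \<mu> / h j" for j
      by (simp add: b_def exp_minus field_simps)
    ultimately show ?thesis by simp
  qed
  have b_le: "b j \<mu> \<le> b 0 \<mu>" if "\<mu> \<noteq> zero" for j \<mu>
    using decseqD[of "\<lambda>j. b j \<mu>" 0 j] b_dec[OF that] by (simp add: decseq_Suc_iff)
  define c where "c = (\<integral>\<mu>. a \<mu> \<partial>count_space (- {zero}))"
  have int_b: "integrable (count_space (- {zero})) (b 0)"
    unfolding b_def by (intro integrable_divide integrable_mult_right integrable_pmf)
  have dom: "norm (pmf (m (h j)) \<mu> / h j) \<le> b 0 \<mu>" if "\<mu> \<noteq> zero" for j \<mu>
  proof -
    have "ln (u 0) \<le> 0" using u[of 0] by simp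
    then have "0 \<le> \<kappa>" using h0 unfolding \<kappa>_def by (intro divide_nonneg_pos) auto
    then have "pmf (m (h j)) \<mu> * 1 \<le> pmf (m (h j)) \<mu> * exp (\<kappa> * h j)"
      using h(1)[of j] by (intro mult_left_mono) auto
    then have "pmf (m (h j)) \<mu> / h j \<le> b j \<mu>"
      unfolding b_def using h(1)[of j] by (intro divide_right_mono) (auto simp: mult.commute)
    then show ?thesis using b_le[OF that, of j] h(1)[of j] by simp
  qed
  have int_a: "integrable (count_space (- {zero})) a"
    by (rule integrable_dominated_convergence[OF _ _ int_b, where s="\<lambda>j \<mu>. pmf (m (h j)) \<mu> / h j"])
      (use rate_lim dom in \<open>auto simp: AE_count_space\<close>)
  have "(\<lambda>j. \<integral>\<mu>. pmf (m (h j)) \<mu> / h j \<partial>count_space (- {zero})) \<longlonglongrightarrow> c"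
    unfolding c_def
    by (rule integral_dominated_convergence[OF _ _ int_b])
      (use rate_lim dom in \<open>auto simp: AE_count_space\<close>)
  then have c_lim: "(\<lambda>j. \<epsilon> (h j) / h j) \<longlonglongrightarrow> c" by (simp add: \<epsilon>_eq_integral)
  have c0: "0 \<le> c" unfolding c_def
    by (intro integral_nonneg_AE) (use a_nonneg in \<open>auto simp: AE_count_space\<close>)
  have "\<exists>M. c * pmf M zero = 0 \<and> (\<forall>\<mu>. \<mu> \<noteq> zero \<longrightarrow> c * pmf M \<mu> = a \<mu>) \<and>
      (\<forall>\<mu>\<in>set_pmf M. \<mu> = zero \<or> a \<mu> \<noteq> 0)"
  proof (cases "c = 0")
    case True
    have "AE \<mu> in count_space (- {zero}). a \<mu> = 0"
      using integral_nonneg_eq_0_iff_AE[OF int_a] True a_nonneg unfolding c_def by (auto simp: AE_count_space)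
    then show ?thesis using True by (intro exI[of _ "return_pmf zero"]) (auto simp: AE_count_space)
  next
    case False
    \<comment> \<open>The rates of all types, divided by the total rate \<open>c\<close>, form a probability law.\<close>
    define f where "f \<mu> = (if \<mu> = zero then 0 else a \<mu> / c)" for \<mu>
    have f0: "0 \<le> f \<mu>" for \<mu> using a_nonneg c0 by (simp add: f_def)
    have "(\<integral>\<^sup>+\<mu>. ennreal (f \<mu>) \<partial>count_space UNIV) = (\<integral>\<^sup>+\<mu>. ennreal (a \<mu> / c) \<partial>count_space (- {zero}))"
      by (subst (2) nn_integral_count_space_indicator) (auto simp: f_def intro!: nn_integral_cong)
    also have "\<dots> = ennreal (\<integral>\<mu>. a \<mu> / c \<partial>count_space (- {zero}))"
      using int_a a_nonneg c0 by (intro nn_integral_eq_integral) (auto simp: AE_count_space)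
    also have "\<dots> = 1" using False by (simp flip: c_def)
    finally have pmf_f: "pmf (embed_pmf f) \<mu> = f \<mu>" for \<mu> using f0 by (intro pmf_embed_pmf)
    show ?thesis using False
      by (intro exI[of _ "embed_pmf f"]) (auto simp: pmf_f f_def set_pmf_iff split: if_splits)
  qed
  then obtain M where M: "c * pmf M zero = 0" "\<And>\<mu>. \<mu> \<noteq> zero \<Longrightarrow> c * pmf M \<mu> = a \<mu>"
    "\<And>\<mu>. \<mu> \<in> set_pmf M \<Longrightarrow> \<mu> = zero \<or> a \<mu> \<noteq> 0" by blast
  have lower: "h j * exp (- \<kappa> * h j) * c * pmf M \<mu> \<le> pmf (m (h j)) \<mu>" if "\<mu> \<noteq> zero" for j \<mu>
  proof -
    have "h j * exp (- \<kappa> * h j) * (c * pmf M \<mu>) \<le> h j * exp (- \<kappa> * h j) * b j \<mu>"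
      unfolding M(2)[OF that] using h(1)[of j] a(2)[OF that] by (intro mult_left_mono) auto
    also have "\<dots> = pmf (m (h j)) \<mu>" using h(1)[of j] by (simp add: b_def exp_minus field_simps)
    finally show ?thesis by (simp add: mult.assoc)
  qed
  have supp: "\<mu> = zero \<or> (\<exists>t>0. \<mu> \<in> set_pmf (m t))" if "\<mu> \<in> set_pmf M" for \<mu>
  proof (cases "\<mu> = zero")
    case False
    then have "0 < a \<mu>" using M(3)[OF that] a_nonneg[of \<mu>] by auto
    then have "pmf (m (h 0)) \<mu> \<noteq> 0" using a(2)[OF False, of 0] by (auto simp: b_def)
    then show ?thesis using h(1)[of 0] by (auto simp: set_pmf_iff)
  qed simp
  show ?thesis
    using h0 c0 M(1) c_lim lower supp unfolding h_def by blast
qed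

text \<open>
  Among \<open>n\<close> steps of length \<open>h\<close>, choose \<open>k\<close> that are jumps and let the others stay put.  This bounds
  the law at time \<open>n h\<close> from below by a binomial mixture.
\<close>

lemma binomial_lower_bound:
  assumes h: "0 < h" and g: "0 \<le> g"
    and step: "\<And>\<mu>. \<mu> \<noteq> zero \<Longrightarrow> g * pmf M \<mu> \<le> pmf (m h) \<mu>" "g * pmf M zero = 0"
  shows "(\<Sum>k\<le>N. real (n choose k) * (1 - \<epsilon> h) ^ (n - k) * g ^ k *
      pmf (kernel_power (\<lambda>z. bind_pmf M (\<lambda>\<mu>. Q \<mu> z)) k x) y) \<le> pmf (kernel_power (T h) n x) y"
proof (induction n arbitrary: N y)
  case 0
  have "(\<Sum>k\<le>N. real (0 choose k) * (1 - \<epsilon> h) ^ (0 - k) * g ^ k * pmf (kernel_power (\<lambda>z. bind_pmf M (\<lambda>\<mu>. Q \<mu> z)) k x) y)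
    = (\<Sum>k\<in>{0}. real (0 choose k) * (1 - \<epsilon> h) ^ (0 - k) * g ^ k * pmf (kernel_power (\<lambda>z. bind_pmf M (\<lambda>\<mu>. Q \<mu> z)) k x) y)"
    by (rule sum.mono_neutral_right) auto
  then show ?case by simp
next
  case (Suc n)
  define R where "R z = bind_pmf M (\<lambda>\<mu>. Q \<mu> z)" for z
  define w where "w n k = real (n choose k) * (1 - \<epsilon> h) ^ (n - k) * g ^ k" for n k
  have w0: "0 \<le> w n k" for n k using g \<epsilon>_bounds[of h] by (simp add: w_def)
  define P where "P k z = pmf (kernel_power R k x) z" for k z
  have pascal: "w (Suc n) (Suc k) = (1 - \<epsilon> h) * w n (Suc k) + g * w n k" for k
  proof (cases "Suc k \<le> n")
    case True
    then have "n - k = Suc (n - Suc k)" by simp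
    then show ?thesis by (simp add: w_def algebra_simps)
  qed (auto simp: w_def not_le binomial_eq_0)
  have one_step: "(1 - \<epsilon> h) * indicator {z} y + g * pmf (R z) y \<le> pmf (T h z) y" for z
  proof -
    note int = integrable_bounded_pmf[where B=1]
    have "ennreal ((1 - \<epsilon> h) * indicator {z} y + g * pmf (R z) y)
      = ennreal ((1 - \<epsilon> h) * indicator {z} y) + ennreal g * ennreal (pmf (R z) y)"
      using g \<epsilon>_bounds[of h] by (simp add: ennreal_mult' ennreal_plus)
    also have "\<dots> = (\<integral>\<^sup>+\<mu>. ennreal ((1 - \<epsilon> h) * indicator {z} y) * indicator {zero} \<mu> \<partial>count_space UNIV)
       + (\<integral>\<^sup>+\<mu>. ennreal g * (ennreal (pmf M \<mu>) * ennreal (pmf (Q \<mu> z) y)) \<partial>count_space UNIV)"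
      unfolding R_def ennreal_pmf_bind nn_integral_measure_pmf by (simp add: nn_integral_cmult)
    also have "\<dots> = (\<integral>\<^sup>+\<mu>. ennreal ((1 - \<epsilon> h) * indicator {z} y) * indicator {zero} \<mu> +
       ennreal g * (ennreal (pmf M \<mu>) * ennreal (pmf (Q \<mu> z) y)) \<partial>count_space UNIV)"
      by (rule nn_integral_add[symmetric]) auto
    also have "\<dots> \<le> (\<integral>\<^sup>+\<mu>. ennreal (pmf (m h) \<mu>) * ennreal (pmf (Q \<mu> z) y) \<partial>count_space UNIV)"
    proof (rule nn_integral_mono)
      fix \<mu>
      show "ennreal ((1 - \<epsilon> h) * indicator {z} y) * indicator {zero} \<mu> +
       ennreal g * (ennreal (pmf M \<mu>) * ennreal (pmf (Q \<mu> z) y)) \<le> ennreal (pmf (m h) \<mu>) * ennreal (pmf (Q \<mu> z) y)"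
      proof (cases "\<mu> = zero")
        case True
        have "ennreal g * (ennreal (pmf M zero) * t) = 0" for t
          using step(2) g by (auto simp: mult.assoc[symmetric] simp flip: ennreal_mult')
        then show ?thesis using True by (auto simp: Q_zero_left \<epsilon>_def indicator_def ennreal_mult')
      next
        case False
        have "ennreal g * (ennreal (pmf M \<mu>) * ennreal (pmf (Q \<mu> z) y)) = ennreal ((g * pmf M \<mu>) * pmf (Q \<mu> z) y)"
          using g by (simp add: ennreal_mult' mult.assoc)
        also have "\<dots> \<le> ennreal (pmf (m h) \<mu> * pmf (Q \<mu> z) y)"
          using step(1)[OF False] by (intro ennreal_leI mult_right_mono) auto
        finally show ?thesis using False by (simp add: ennreal_mult')
      qed
    qed
    also have "\<dots> = ennreal (pmf (T h z) y)"
      unfolding T_eq[OF h] ennreal_pmf_bind nn_integral_measure_pmf ..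
    finally show ?thesis by simp
  qed
  have IH: "(\<Sum>k\<le>N. w n k * P k z) \<le> pmf (kernel_power (T h) n x) z" for N z
    unfolding w_def P_def R_def[abs_def] by (rule Suc.IH)
  have jump: "(\<Sum>k\<le>N. w n k * P (Suc k) y) \<le> pmf (bind_pmf (kernel_power (T h) n x) R) y" for N
  proof -
    have "ennreal (\<Sum>k\<le>N. w n k * P (Suc k) y) = (\<Sum>k\<le>N. ennreal (w n k) * (\<integral>\<^sup>+z. ennreal (P k z) * ennreal (pmf (R z) y) \<partial>count_space UNIV))"
      unfolding P_def kernel_power.simps ennreal_pmf_bind[symmetric] nn_integral_measure_pmf[symmetric]
      by (simp add: ennreal_mult' w0 flip: sum_ennreal)
    also have "\<dots> = (\<integral>\<^sup>+z. (\<Sum>k\<le>N. ennreal (w n k) * (ennreal (P k z) * ennreal (pmf (R z) y))) \<partial>count_space UNIV)"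
      by (simp add: nn_integral_sum nn_integral_cmult)
    also have "\<dots> = (\<integral>\<^sup>+z. ennreal (\<Sum>k\<le>N. w n k * P k z) * ennreal (pmf (R z) y) \<partial>count_space UNIV)"
      by (intro nn_integral_cong) (simp add: sum_distrib_right ennreal_mult' w0 P_def mult.assoc flip: sum_ennreal)
    also have "\<dots> \<le> (\<integral>\<^sup>+z. ennreal (pmf (kernel_power (T h) n x) z) * ennreal (pmf (R z) y) \<partial>count_space UNIV)"
      by (intro nn_integral_mono mult_right_mono ennreal_leI IH) auto
    also have "\<dots> = ennreal (pmf (bind_pmf (kernel_power (T h) n x) R) y)"
      unfolding ennreal_pmf_bind nn_integral_measure_pmf ..
    finally show ?thesis by simp
  qed
  have "(\<Sum>k\<le>N. w (Suc n) k * P k y) \<le> (\<Sum>k\<le>Suc N. w (Suc n) k * P k y)"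
    by (intro sum_mono2) (auto simp: w0 P_def)
  also have "\<dots> = w (Suc n) 0 * P 0 y + (\<Sum>k\<le>N. w (Suc n) (Suc k) * P (Suc k) y)"
    by (rule sum.atMost_Suc_shift)
  also have "\<dots> = (1 - \<epsilon> h) * (w n 0 * P 0 y + (\<Sum>k\<le>N. w n (Suc k) * P (Suc k) y)) + g * (\<Sum>k\<le>N. w n k * P (Suc k) y)"
  proof -
    have "w (Suc n) 0 = (1 - \<epsilon> h) * w n 0" by (simp add: w_def)
    then show ?thesis unfolding pascal distrib_right distrib_left sum.distrib sum_distrib_left by (simp add: mult.assoc)
  qed
  also have "w n 0 * P 0 y + (\<Sum>k\<le>N. w n (Suc k) * P (Suc k) y) = (\<Sum>k\<le>Suc N. w n k * P k y)"
    by (rule sum.atMost_Suc_shift[symmetric])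
  also have "(1 - \<epsilon> h) * (\<Sum>k\<le>Suc N. w n k * P k y) + g * (\<Sum>k\<le>N. w n k * P (Suc k) y)
     \<le> (1 - \<epsilon> h) * pmf (kernel_power (T h) n x) y + g * pmf (bind_pmf (kernel_power (T h) n x) R) y"
    using g \<epsilon>_bounds[of h] by (intro add_mono mult_left_mono IH jump) auto
  also have "\<dots> = (\<integral>z. (1 - \<epsilon> h) * indicator {y} z + g * pmf (R z) y \<partial>measure_pmf (kernel_power (T h) n x))"
    unfolding pmf_bind by (subst Bochner_Integration.integral_add)
      (auto intro!: integrable_bounded_pmf[where B=1] simp: pmf_le_1 pmf.rep_eq[symmetric] pmf_nonneg measure_pmf_single)
  also have "\<dots> \<le> (\<integral>z. pmf (T h z) y \<partial>measure_pmf (kernel_power (T h) n x))"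
  proof (rule integral_mono)
    show "(1 - \<epsilon> h) * indicator {y} z + g * pmf (R z) y \<le> pmf (T h z) y" for z
      using one_step[of z] by (cases "y = z") (auto simp: indicator_def)
    show "integrable (measure_pmf (kernel_power (T h) n x)) (\<lambda>z. (1 - \<epsilon> h) * indicator {y} z + g * pmf (R z) y)"
      by (intro Bochner_Integration.integrable_add integrable_mult_right integrable_bounded_pmf[where B=1])
        (auto simp: pmf_le_1 indicator_def)
  qed (auto intro!: integrable_bounded_pmf[where B=1] simp: pmf_le_1)
  also have "\<dots> = pmf (kernel_power (T h) (Suc n) x) y" by (simp add: pmf_bind)
  finally show ?case unfolding w_def P_def R_def[abs_def] .
qed

lemma kernel_power_T: "0 < h \<Longrightarrow> kernel_power (T h) (Suc n) x = T (real (Suc n) * h) x"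
proof (induction n)
  case (Suc n)
  have "real (Suc (Suc n)) * h = real (Suc n) * h + h" by (simp add: algebra_simps)
  then show ?case using Suc T_add[of "real (Suc n) * h" h x] by simp
qed (simp add: bind_return_pmf)

text \<open>
  In the limit of small \<open>h\<close> the binomial mixtures become a Poisson mixture.  A lower bound of one
  probability law by another is an equality.
\<close>

theorem compound_poisson:
  "\<exists>c M. 0 \<le> c \<and> (\<forall>\<mu>\<in>set_pmf M. \<mu> = zero \<or> (\<exists>t>0. \<mu> \<in> set_pmf (m t))) \<and>
    (\<forall>t>0. \<forall>x. T t x = bind_pmf (poisson_law (c * t)) (\<lambda>k. kernel_power (\<lambda>z. bind_pmf M (\<lambda>\<mu>. Q \<mu> z)) k x))"
proof -
  obtain h0 \<kappa> c M where h0: "0 < h0" and c: "0 \<le> c" and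
    M: "\<forall>\<mu>\<in>set_pmf M. \<mu> = zero \<or> (\<exists>t>0. \<mu> \<in> set_pmf (m t))" "c * pmf M zero = 0" and
    lim0: "(\<lambda>j. \<epsilon> (h0 / 2 ^ j) / (h0 / 2 ^ j)) \<longlonglongrightarrow> c" and
    low0: "\<And>j \<mu>. \<mu> \<noteq> zero \<Longrightarrow> (h0 / 2 ^ j) * exp (- \<kappa> * (h0 / 2 ^ j)) * c * pmf M \<mu> \<le> pmf (m (h0 / 2 ^ j)) \<mu>"
    using jump_rates by blast
  define h where "h j = h0 / 2 ^ j" for j :: nat
  note lim = lim0[folded h_def] and low = low0[folded h_def]
  have h: "0 < h j" for j using h0 by (simp add: h_def)
  have h_lim: "h \<longlonglongrightarrow> 0" unfolding h_def by (rule LIMSEQ_divide_realpow_zero) simp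
  define K where "K = kernel_power (\<lambda>z. bind_pmf M (\<lambda>\<mu>. Q \<mu> z))"
  have "bind_pmf (poisson_law (c * t)) (\<lambda>k. K k x) = T t x" if t: "0 < t" for t x
  proof (rule pmf_eq_of_le)
    fix y
    \<comment> \<open>The time \<open>t\<close> is approximated from below by a multiple of \<open>h j\<close>, and the remaining time is bridged by
      staying put, which has probability at least \<open>q j\<close>.\<close>
    define n where "n j = nat \<lfloor>t / h j\<rfloor>" for j
    have n: "real (n j) * h j \<le> t" "t < real (n j) * h j + h j" for j
    proof -
      have "real (n j) = of_int \<lfloor>t / h j\<rfloor>" unfolding n_def using t h[of j] by simp
      then have "real (n j) \<le> t / h j" "t / h j < real (n j) + 1" by linarith+
      then show "real (n j) * h j \<le> t" "t < real (n j) * h j + h j"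
        using h[of j] by (simp_all add: field_simps)
    qed
    have nh_lim: "(\<lambda>j. real (n j) * h j) \<longlonglongrightarrow> t"
    proof (rule tendsto_sandwich[OF _ _ _ tendsto_const])
      show "(\<lambda>j. t - h j) \<longlonglongrightarrow> t" using tendsto_diff[OF tendsto_const h_lim, of t] by simp
    qed (use n in \<open>auto simp: less_imp_le algebra_simps intro!: always_eventually\<close>)
    define q where "q j = (if real (n j) * h j = t then 1 else pmf (m (t - real (n j) * h j)) zero)" for j
    have q_lim: "q \<longlonglongrightarrow> 1"
    proof (rule order_tendstoI)
      fix a :: real assume "a < 1"
      then have "\<forall>\<^sub>F s in at_right 0. a < pmf (m s) zero" by (rule order_tendstoD(1)[OF m_tendsto])
      then obtain \<delta> where \<delta>: "0 < \<delta>" "\<And>s. 0 < s \<Longrightarrow> s < \<delta> \<Longrightarrow> a < pmf (m s) zero"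
        unfolding eventually_at_right_field by auto
      have "\<forall>\<^sub>F j in sequentially. h j < \<delta>" by (rule order_tendstoD(2)[OF h_lim \<delta>(1)])
      then show "\<forall>\<^sub>F j in sequentially. a < q j"
      proof eventually_elim
        case (elim j)
        show ?case using \<delta>(2)[of "t - real (n j) * h j"] n[of j] elim \<open>a < 1\<close> by (auto simp: q_def)
      qed
    next
      fix a :: real assume a: "1 < a"
      have "q j < a" for j using a pmf_le_1[of "m (t - real (n j) * h j)" zero] by (auto simp: q_def)
      then show "\<forall>\<^sub>F j in sequentially. q j < a" by simp
    qed
    have q0: "0 \<le> q j" for j by (simp add: q_def)
    define coef where "coef k j = q j * (real (n j choose k) * h j ^ k) *
       exp (- (real (n j) * \<epsilon> (h j) / (1 - \<epsilon> (h j)))) * exp (- \<kappa> * h j) ^ k * c ^ k" for k j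
    have \<epsilon>_lim: "(\<lambda>j. \<epsilon> (h j)) \<longlonglongrightarrow> 0"
    proof -
      have "(\<lambda>j. \<epsilon> (h j) / h j * h j) \<longlonglongrightarrow> c * 0" by (intro tendsto_intros lim h_lim)
      then show ?thesis using h by (simp add: less_imp_neq[symmetric])
    qed
    have coef_lim: "(\<lambda>j. coef k j) \<longlonglongrightarrow> pmf (poisson_law (c * t)) k" for k
    proof -
      have "(\<lambda>j. (real (n j) * h j) * (\<epsilon> (h j) / h j) / (1 - \<epsilon> (h j))) \<longlonglongrightarrow> t * c / (1 - 0)"
        by (intro tendsto_intros nh_lim lim \<epsilon>_lim) simp
      then have e: "(\<lambda>j. real (n j) * \<epsilon> (h j) / (1 - \<epsilon> (h j))) \<longlonglongrightarrow> t * c"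
        using h by (simp add: less_imp_neq[symmetric])
      have "(\<lambda>j. coef k j) \<longlonglongrightarrow> 1 * (t ^ k / fact k) * exp (- (t * c)) * exp (- \<kappa> * 0) ^ k * c ^ k"
        unfolding coef_def by (intro tendsto_intros q_lim binomial_mult_power_tendsto[OF nh_lim h_lim] e h_lim)
      then show ?thesis using c t by (simp add: pmf_poisson_law power_mult_distrib mult_ac)
    qed
    have ev: "\<forall>\<^sub>F j in sequentially. (\<Sum>k\<le>N. coef k j * pmf (K k x) y) \<le> pmf (T t x) y" for N
    proof -
      have "\<forall>\<^sub>F j in sequentially. h j < t" by (rule order_tendstoD(2)[OF h_lim t])
      moreover have "\<forall>\<^sub>F j in sequentially. \<epsilon> (h j) < 1" by (rule order_tendstoD(2)[OF \<epsilon>_lim]) simp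
      ultimately show ?thesis
      proof eventually_elim
        case (elim j)
        let ?e = "\<epsilon> (h j)" and ?g = "h j * exp (- \<kappa> * h j) * c"
        have e: "0 \<le> ?e" "?e \<le> 1" by (rule \<epsilon>_bounds)+
        have npos: "n j \<noteq> 0" using n(2)[of j] elim by (intro notI) simp
        then obtain n' where n': "n j = Suc n'" by (cases "n j") auto
        have step: "(\<Sum>k\<le>N. real (n j choose k) * (1 - ?e) ^ (n j - k) * ?g ^ k * pmf (K k x) y) \<le> pmf (T (real (n j) * h j) x) y"
          using binomial_lower_bound[OF h[of j], where g="?g" and M=M and N=N and n="n j" and x=x and y=y] low[of _ j] h[of j] c M(2)
          unfolding K_def n' kernel_power_T[OF h] by (auto simp: less_imp_le)
        have "coef k j * pmf (K k x) y \<le> q j * (real (n j choose k) * (1 - ?e) ^ (n j - k) * ?g ^ k * pmf (K k x) y)" for k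
        proof -
          have "exp (- (real (n j) * ?e / (1 - ?e))) \<le> (1 - ?e) ^ n j"
            using e elim by (intro exp_le_one_minus_power) auto
          also have "\<dots> \<le> (1 - ?e) ^ (n j - k)" using e by (intro power_decreasing) auto
          finally have "exp (- (real (n j) * ?e / (1 - ?e))) * (q j * real (n j choose k) * ?g ^ k * pmf (K k x) y)
             \<le> (1 - ?e) ^ (n j - k) * (q j * real (n j choose k) * ?g ^ k * pmf (K k x) y)"
            using q0[of j] h[of j] c by (intro mult_right_mono mult_nonneg_nonneg) auto
          then show ?thesis by (simp add: coef_def power_mult_distrib mult_ac)
        qed
        then have "(\<Sum>k\<le>N. coef k j * pmf (K k x) y) \<le> (\<Sum>k\<le>N. q j * (real (n j choose k) * (1 - ?e) ^ (n j - k) * ?g ^ k * pmf (K k x) y))"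
          by (rule sum_mono)
        also have "\<dots> \<le> q j * pmf (T (real (n j) * h j) x) y"
          unfolding sum_distrib_left[symmetric] by (rule mult_left_mono[OF step q0])
        also have "\<dots> \<le> pmf (T t x) y"
        proof (cases "real (n j) * h j = t")
          case False
          let ?s = "real (n j) * h j"
          have pos: "0 < ?s" "0 < t - ?s" using False n(1)[of j] npos h[of j] by auto
          have "q j * pmf (T ?s x) y \<le> pmf (T ?s x) y * pmf (T (t - ?s) y) y"
            using T_stay[OF pos(2), of y] False by (simp add: q_def mult.commute mult_left_mono)
          also have "\<dots> \<le> pmf (bind_pmf (T ?s x) (T (t - ?s))) y" by (rule pmf_bind_ge)
          also have "\<dots> = pmf (T t x) y" using T_add[OF pos, of x] by simp
          finally show ?thesis .
        qed (simp add: q_def)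
        finally show ?case .
      qed
    qed
    have part: "(\<Sum>k\<le>N. pmf (poisson_law (c * t)) k * pmf (K k x) y) \<le> pmf (T t x) y" for N
    proof (rule tendsto_upperbound[OF _ ev])
      show "(\<lambda>j. \<Sum>k\<le>N. coef k j * pmf (K k x) y) \<longlonglongrightarrow> (\<Sum>k\<le>N. pmf (poisson_law (c * t)) k * pmf (K k x) y)"
        by (intro tendsto_intros coef_lim)
    qed simp
    have "ennreal (pmf (bind_pmf (poisson_law (c * t)) (\<lambda>k. K k x)) y) = (\<Sum>k. ennreal (pmf (poisson_law (c * t)) k) * ennreal (pmf (K k x) y))"
      unfolding ennreal_pmf_bind nn_integral_measure_pmf nn_integral_count_space_nat ..
    also have "\<dots> \<le> ennreal (pmf (T t x) y)"
    proof (rule suminf_le_const)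
      fix N
      have "(\<Sum>k<N. ennreal (pmf (poisson_law (c * t)) k) * ennreal (pmf (K k x) y)) \<le> (\<Sum>k\<le>N. ennreal (pmf (poisson_law (c * t)) k) * ennreal (pmf (K k x) y))"
        by (intro sum_mono2) auto
      also have "\<dots> = ennreal (\<Sum>k\<le>N. pmf (poisson_law (c * t)) k * pmf (K k x) y)"
        by (simp add: ennreal_mult' flip: sum_ennreal)
      also have "\<dots> \<le> ennreal (pmf (T t x) y)" by (rule ennreal_leI[OF part])
      finally show "(\<Sum>k<N. ennreal (pmf (poisson_law (c * t)) k) * ennreal (pmf (K k x) y)) \<le> ennreal (pmf (T t x) y)" .
    qed simp
    finally show "pmf (bind_pmf (poisson_law (c * t)) (\<lambda>k. K k x)) y \<le> pmf (T t x) y" by simp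
  qed
  then show ?thesis using c M(1) unfolding K_def by metis
qed

end

section \<open>Existence of the Poisson process\<close>

definition poisson_prob :: "real \<Rightarrow> real \<Rightarrow> nat \<Rightarrow> real" where
  "poisson_prob c t k = (c * t) ^ k / fact k * exp (- (c * t))"

lemma poisson_prob_nonneg: "0 \<le> c \<Longrightarrow> 0 \<le> t \<Longrightarrow> 0 \<le> poisson_prob c t k"
  by (simp add: poisson_prob_def)

lemma pmf_poisson_law_eq: "0 \<le> c \<Longrightarrow> 0 \<le> t \<Longrightarrow> pmf (poisson_law (c * t)) k = poisson_prob c t k"
  by (simp add: pmf_poisson_law poisson_prob_def)

lemma poisson_prob_sums: "0 \<le> c \<Longrightarrow> 0 \<le> t \<Longrightarrow> (\<Sum>k. ennreal (poisson_prob c t k)) = 1"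
proof -
  assume "0 \<le> c" "0 \<le> t"
  then have "(\<Sum>k. ennreal (poisson_prob c t k)) = (\<integral>\<^sup>+k. ennreal (pmf (poisson_law (c * t)) k) \<partial>count_space UNIV)"
    by (simp add: nn_integral_count_space_nat pmf_poisson_law_eq)
  then show ?thesis using measure_pmf.emeasure_space_1[of "poisson_law (c * t)"] by (simp add: nn_integral_pmf)
qed

definition arrival :: "(nat \<Rightarrow> real) \<Rightarrow> nat \<Rightarrow> real" where
  "arrival w n = (\<Sum>i<n. w i)"

lemma arrival_case_nat: "arrival (case_nat e w) (Suc n) = e + arrival w n"
  unfolding arrival_def by (subst sum.lessThan_Suc_shift) simp

text \<open>The gap \<open>w i\<close> precedes the arrival number \<open>Suc i\<close>, so that arrival happens at time \<open>arrival w (Suc i)\<close>.\<close>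

definition arrivals_up_to :: "(nat \<Rightarrow> real) \<Rightarrow> real \<Rightarrow> nat" where
  "arrivals_up_to w t = (LEAST n. t < arrival w (Suc n))"

text \<open>The gap sequences without simultaneous arrivals and with only finitely many arrivals in bounded time.\<close>

definition good_gaps :: "(nat \<Rightarrow> real) \<Rightarrow> bool" where
  "good_gaps w \<longleftrightarrow> (\<forall>i. 0 < w i) \<and> (\<forall>m::nat. \<exists>k. real m < arrival w k)"

lemma arrival_mono: "(\<And>i. 0 < w i) \<Longrightarrow> m \<le> n \<Longrightarrow> arrival w m \<le> arrival w n"
  unfolding arrival_def by (intro sum_mono2) (auto simp: less_imp_le)

lemma good_gaps_ex:
  assumes "good_gaps w" shows "\<exists>n. t < arrival w (Suc n)"
proof -
  obtain m :: nat where "t < real m" using reals_Archimedean2 by blast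
  moreover obtain k where "real m < arrival w k" using assms by (auto simp: good_gaps_def)
  moreover have "arrival w k \<le> arrival w (Suc k)"
    using assms by (intro arrival_mono) (auto simp: good_gaps_def)
  ultimately show ?thesis by (intro exI[of _ k]) linarith
qed

lemma arrivals_up_to_iff:
  assumes w: "good_gaps w" and t: "0 \<le> t"
  shows "arrivals_up_to w t = K \<longleftrightarrow> arrival w K \<le> t \<and> t < arrival w (Suc K)"
proof
  assume K: "arrivals_up_to w t = K"
  have "t < arrival w (Suc K)" using LeastI_ex[OF good_gaps_ex[OF w]] unfolding K[symmetric] arrivals_up_to_def .
  moreover have "arrival w K \<le> t"
  proof (cases K)
    case (Suc K')
    then have "\<not> t < arrival w (Suc K')" using K not_less_Least unfolding arrivals_up_to_def by (metis lessI)
    then show ?thesis using Suc by simp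
  qed (simp add: arrival_def t)
  ultimately show "arrival w K \<le> t \<and> t < arrival w (Suc K)" by simp
next
  assume K: "arrival w K \<le> t \<and> t < arrival w (Suc K)"
  show "arrivals_up_to w t = K" unfolding arrivals_up_to_def
  proof (rule Least_equality)
    fix n assume "t < arrival w (Suc n)"
    then have "\<not> Suc n \<le> K" using arrival_mono[of w "Suc n" K] w K by (auto simp: good_gaps_def)
    then show "K \<le> n" by simp
  qed (use K in simp)
qed

lemma arrivals_up_to_0: "good_gaps w \<Longrightarrow> arrivals_up_to w 0 = 0"
  by (simp add: arrivals_up_to_iff) (simp add: arrival_def good_gaps_def)

lemma arrivals_up_to_mono:
  assumes w: "good_gaps w" and t: "0 \<le> t" "t \<le> u" shows "arrivals_up_to w t \<le> arrivals_up_to w u"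
  unfolding arrivals_up_to_def[of w t]
proof (rule Least_le)
  show "t < arrival w (Suc (arrivals_up_to w u))"
    using arrivals_up_to_iff[OF w, of u "arrivals_up_to w u"] t by simp
qed

lemma arrivals_up_to_right_continuous:
  assumes w: "good_gaps w" and t: "0 \<le> t" shows "continuous (at_right t) (arrivals_up_to w)"
proof -
  let ?K = "arrivals_up_to w t"
  have K: "arrival w ?K \<le> t" "t < arrival w (Suc ?K)" using arrivals_up_to_iff[OF w t, of ?K] by auto
  have "\<forall>\<^sub>F s in at_right t. arrivals_up_to w s = ?K"
  proof (rule eventually_at_rightI[OF _ K(2)])
    fix s assume "s \<in> {t<..<arrival w (Suc ?K)}"
    then show "arrivals_up_to w s = ?K" using arrivals_up_to_iff[OF w, of s ?K] K t by simp
  qed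
  then show ?thesis unfolding continuous_within by (rule tendsto_eventually)
qed

lemma good_gaps_case_nat: "good_gaps (case_nat e w) \<longleftrightarrow> 0 < e \<and> good_gaps w"
proof (intro iffI conjI)
  assume L: "good_gaps (case_nat e w)"
  have pos: "0 < case_nat e w i" for i using L by (simp add: good_gaps_def)
  show e: "0 < e" using pos[of 0] by simp
  show "good_gaps w" unfolding good_gaps_def
  proof (intro conjI allI)
    show "0 < w i" for i using pos[of "Suc i"] by simp
    fix m :: nat
    obtain m' :: nat where m': "real m + e < real m'" using reals_Archimedean2 by blast
    obtain k where k: "real m' < arrival (case_nat e w) k" using L by (auto simp: good_gaps_def)
    then have "k \<noteq> 0" by (intro notI) (simp add: arrival_def)
    then obtain k' where "k = Suc k'" by (cases k) auto
    then show "\<exists>k. real m < arrival w k" using k m' by (intro exI[of _ k']) (simp add: arrival_case_nat)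
  qed
next
  assume R: "0 < e \<and> good_gaps w"
  show "good_gaps (case_nat e w)" unfolding good_gaps_def
  proof (intro conjI allI)
    show "0 < case_nat e w i" for i using R by (cases i) (auto simp: good_gaps_def)
    fix m :: nat
    obtain k where "real m < arrival w k" using R by (auto simp: good_gaps_def)
    then show "\<exists>k. real m < arrival (case_nat e w) k"
      using R by (intro exI[of _ "Suc k"]) (simp add: arrival_case_nat)
  qed
qed

lemma arrivals_up_to_case_nat:
  assumes w: "good_gaps w" and e: "0 < e" and t: "0 \<le> t"
  shows "arrivals_up_to (case_nat e w) t = (if t < e then 0 else Suc (arrivals_up_to w (t - e)))"
proof -
  have good: "good_gaps (case_nat e w)" using w e by (simp add: good_gaps_case_nat)
  let ?K = "arrivals_up_to w (t - e)"
  show ?thesis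
  proof (cases "t < e")
    case True
    then have "arrivals_up_to (case_nat e w) t = 0"
      unfolding arrivals_up_to_iff[OF good t] arrival_case_nat using t by (simp add: arrival_def)
    then show ?thesis using True by simp
  next
    case False
    then have K: "arrival w ?K \<le> t - e" "t - e < arrival w (Suc ?K)"
      using arrivals_up_to_iff[OF w, of "t - e" ?K] by auto
    then have "arrivals_up_to (case_nat e w) t = Suc ?K"
      unfolding arrivals_up_to_iff[OF good t] arrival_case_nat by simp
    then show ?thesis using False by simp
  qed
qed

text \<open>
  The first gap ends in \<open>{t<..t + s}\<close>, at \<open>e\<close>, and \<open>k\<close> further arrivals follow in the remaining time
  \<open>t + s - e\<close>: this amounts to no arrival up to \<open>t\<close> and \<open>Suc k\<close> arrivals in the time \<open>s\<close> afterwards.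
\<close>

lemma nn_integral_exponential_poisson:
  assumes c: "0 < c" and t: "0 \<le> t" "0 \<le> s"
  shows "(\<integral>\<^sup>+e. ennreal (erlang_density 0 c e) * (ennreal (poisson_prob c (t + s - e) k) * indicator {t<..t + s} e) \<partial>lborel)
    = ennreal (exp (- (c * t)) * poisson_prob c s (Suc k))"
proof -
  define C where "C = c ^ Suc k * exp (- (c * (t + s)))"
  let ?f = "\<lambda>e. C * (t + s - e) ^ k / fact k" and ?F = "\<lambda>e. - (C * (t + s - e) ^ Suc k / fact (Suc k))"
  have "(\<integral>\<^sup>+e. ennreal (erlang_density 0 c e) * (ennreal (poisson_prob c (t + s - e) k) * indicator {t<..t + s} e) \<partial>lborel)
     = (\<integral>\<^sup>+e. ennreal (?f e) * indicator {t..t + s} e \<partial>lborel)"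
  proof (rule nn_integral_cong_AE)
    have "AE e in lborel. e \<noteq> t" by (rule AE_lborel_singleton)
    then show "AE e in lborel. ennreal (erlang_density 0 c e) * (ennreal (poisson_prob c (t + s - e) k) * indicator {t<..t + s} e)
       = ennreal (?f e) * indicator {t..t + s} e"
    proof eventually_elim
      case (elim e)
      show ?case
      proof (cases "e \<in> {t<..t + s}")
        case True
        have ex: "exp (- c * e) * exp (- (c * (t + s - e))) = exp (- (c * (t + s)))"
          by (simp add: algebra_simps flip: exp_add)
        have "erlang_density 0 c e * poisson_prob c (t + s - e) k = c * (c * (t + s - e)) ^ k / fact k * (exp (- c * e) * exp (- (c * (t + s - e))))"
          using True t by (simp add: erlang_density_def poisson_prob_def)
        also have "\<dots> = ?f e" unfolding ex C_def by (simp add: power_mult_distrib)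
        finally show ?thesis using True c t by (simp add: ennreal_mult'[symmetric])
      qed (use elim in \<open>auto simp: indicator_def\<close>)
    qed
  qed
  also have "\<dots> = ennreal (?F (t + s) - ?F t)"
  proof (rule nn_integral_FTC_Icc)
    fix e assume e: "e \<in> {t..t + s}"
    show "0 \<le> ?f e" using e c by (simp add: C_def)
    have "((\<lambda>e. (t + s - e) ^ Suc k) has_real_derivative real (Suc k) * (t + s - e) ^ k * (-1)) (at e)"
      by (rule derivative_eq_intros refl | simp)+
    from DERIV_minus[OF DERIV_cdivide[OF DERIV_cmult[OF this, of C], of "fact (Suc k)"]]
    have "(?F has_real_derivative - (C * (real (Suc k) * (t + s - e) ^ k * (-1)) / fact (Suc k))) (at e)" .
    moreover have "- (C * (real (Suc k) * (t + s - e) ^ k * (-1)) / fact (Suc k)) = ?f e"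
      unfolding fact_Suc by (simp del: of_nat_Suc add: mult.assoc)
    ultimately show "(?F has_real_derivative ?f e) (at e)" by simp
  qed (use t in auto)
  also have "?F (t + s) - ?F t = exp (- (c * t)) * poisson_prob c s (Suc k)"
  proof -
    have "exp (- (c * (t + s))) = exp (- (c * t)) * exp (- (c * s))" by (simp add: algebra_simps flip: exp_add)
    then show ?thesis by (simp add: C_def poisson_prob_def power_mult_distrib mult_ac del: fact_Suc)
  qed
  finally show ?thesis .
qed

locale exponential_gaps =
  fixes c :: real assumes c_pos: "0 < c"
begin

definition "M = density lborel (\<lambda>x. ennreal (erlang_density 0 c x))"

lemma prob_space_M: "prob_space M"
  unfolding M_def by (rule prob_space_erlang_density[OF c_pos])

sublocale sequence_space M
  unfolding sequence_space_def by (intro product_prob_spaceI prob_space_M)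

lemma sets_M [measurable_cong]: "sets M = sets borel" by (simp add: M_def)
lemma space_M: "space M = UNIV" by (simp add: M_def)
lemma space_S: "space S = UNIV" by (simp add: space_PiM space_M)

lemma coordinate_measurable [measurable]: "(\<lambda>w. w i) \<in> borel_measurable S"
proof -
  have "(\<lambda>w. w i) \<in> measurable S M" by (rule measurable_component_singleton) simp
  then show ?thesis by (simp cong: measurable_cong_sets add: sets_M)
qed

lemma arrival_measurable [measurable]: "(\<lambda>w. arrival w n) \<in> borel_measurable S"
  unfolding arrival_def by measurable

lemma good_gaps_measurable [measurable]: "Measurable.pred S good_gaps"
  unfolding good_gaps_def[abs_def] by measurable

lemma arrivals_up_to_measurable [measurable]: "(\<lambda>w. arrivals_up_to w t) \<in> measurable S (count_space UNIV)"
  unfolding arrivals_up_to_def by measurable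

lemma nn_integral_M:
  assumes "g \<in> borel_measurable M"
  shows "(\<integral>\<^sup>+e. g e \<partial>M) = (\<integral>\<^sup>+e. ennreal (erlang_density 0 c e) * g e \<partial>lborel)"
proof -
  have "g \<in> borel_measurable lborel" using assms by (simp cong: measurable_cong_sets add: sets_M)
  then show ?thesis unfolding M_def by (intro nn_integral_density) auto
qed

lemma emeasure_first_gap:
  assumes A: "A \<in> sets S"
  shows "emeasure S A = (\<integral>\<^sup>+e. ennreal (erlang_density 0 c e) * emeasure S {w. case_nat e w \<in> A} \<partial>lborel)"
proof -
  interpret M: prob_space M by (rule prob_space_M)
  have cm: "(\<lambda>(s, w). case_nat s w) \<in> measurable (M \<Otimes>\<^sub>M S) S" by measurable
  let ?B = "(\<lambda>(s, w). case_nat s w) -` A \<inter> space (M \<Otimes>\<^sub>M S)"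
  have B: "?B \<in> sets (M \<Otimes>\<^sub>M S)" by (rule measurable_sets[OF cm A])
  have "emeasure S A = emeasure (distr (M \<Otimes>\<^sub>M S) S (\<lambda>(s, w). case_nat s w)) A" by (subst PiM_iter) simp
  also have "\<dots> = emeasure (M \<Otimes>\<^sub>M S) ?B" by (rule emeasure_distr[OF cm A])
  also have "\<dots> = (\<integral>\<^sup>+e. emeasure S (Pair e -` ?B) \<partial>M)" by (rule P.emeasure_pair_measure_alt[OF B])
  also have "\<dots> = (\<integral>\<^sup>+e. ennreal (erlang_density 0 c e) * emeasure S (Pair e -` ?B) \<partial>lborel)"
    by (rule nn_integral_M[OF P.measurable_emeasure_Pair[OF B]])
  also have "(\<lambda>e. Pair e -` ?B) = (\<lambda>e. {w. case_nat e w \<in> A})"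
    by (auto simp: fun_eq_iff space_pair_measure space_S space_M)
  finally show ?thesis by (simp add: fun_eq_iff)
qed

lemma AE_gaps_pos: "AE w in S. \<forall>i. 0 < w i"
proof -
  have "AE x in M. 0 < x" unfolding M_def
    using AE_lborel_singleton[of 0] by (subst AE_density) (auto simp: erlang_density_def elim!: eventually_mono)
  then show ?thesis unfolding AE_all_countable by (intro allI AE_PiM_component prob_space_M) auto
qed

text \<open>
  The events that there are \<open>k\<close> arrivals up to time \<open>t\<close>, in a form that makes sense before the gaps are
  known to be almost surely good.
\<close>

definition window :: "real \<Rightarrow> nat \<Rightarrow> (nat \<Rightarrow> real) set" where
  "window t k = {w. (\<forall>i. 0 < w i) \<and> arrival w k \<le> t \<and> t < arrival w (Suc k)}"

lemma window_sets [measurable]: "window t k \<in> sets S"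
proof -
  have "{w \<in> space S. (\<forall>i. 0 < w i) \<and> arrival w k \<le> t \<and> t < arrival w (Suc k)} \<in> sets S" by measurable
  then show ?thesis by (simp add: window_def space_S)
qed

lemma emeasure_window: "0 \<le> t \<Longrightarrow> emeasure S (window t k) = ennreal (poisson_prob c t k)"
proof (induction k arbitrary: t)
  case 0
  interpret M: prob_space M by (rule prob_space_M)
  have "emeasure S (window t 0) = emeasure S {w \<in> space S. t < w 0}"
  proof (rule emeasure_eq_AE)
    show "AE w in S. w \<in> window t 0 \<longleftrightarrow> w \<in> {w \<in> space S. t < w 0}"
      using AE_gaps_pos 0 by (auto simp: window_def arrival_def space_S elim!: eventually_mono)
    show "{w \<in> space S. t < w 0} \<in> sets S" by measurable
  qed (rule window_sets)
  also have "{w \<in> space S. t < w 0} = (\<lambda>w. w 0) -` {t<..} \<inter> space S" by auto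
  also have "emeasure S \<dots> = emeasure (distr S M (\<lambda>w. w 0)) {t<..}"
    by (rule emeasure_distr[symmetric]) (auto simp: sets_M intro: measurable_component_singleton)
  also have "distr S M (\<lambda>w. w 0) = M"
    by (rule distr_PiM_component[OF prob_space_M]) simp
  also have "emeasure M {t<..} = 1 - emeasure M {..t}"
  proof -
    have "{t<..} = space M - {..t}" by (auto simp: space_M)
    then show ?thesis by (simp add: emeasure_compl sets_M M.emeasure_space_1)
  qed
  also have "emeasure M {..t} = ennreal (1 - exp (- (c * t)))"
    unfolding M_def emeasure_erlang_density[OF c_pos] using 0 by (simp add: erlang_CDF_def)
  also have "1 - \<dots> = ennreal (exp (- (c * t)))"
    using 0 c_pos by (simp add: ennreal_minus flip: ennreal_1)
  finally show ?case by (simp add: poisson_prob_def)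
next
  case (Suc k)
  have "emeasure S (window t (Suc k)) = (\<integral>\<^sup>+e. ennreal (erlang_density 0 c e) * emeasure S {w. case_nat e w \<in> window t (Suc k)} \<partial>lborel)"
    by (rule emeasure_first_gap) simp
  also have "\<dots> = (\<integral>\<^sup>+e. ennreal (erlang_density 0 c e) * (ennreal (poisson_prob c (0 + t - e) k) * indicator {0<..0 + t} e) \<partial>lborel)"
  proof (intro nn_integral_cong arg_cong2[of _ _ _ _ "(*)"] refl)
    fix e :: real
    have pos: "(\<forall>i. 0 < case_nat e w i) \<longleftrightarrow> 0 < e \<and> (\<forall>i. 0 < w i)" for w
      by (metis nat.case nat.exhaust)
    have nn: "arrival w k \<ge> 0" if "\<forall>i. 0 < w i" for w using arrival_mono[of w 0 k] that by (simp add: arrival_def)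
    have "case_nat e w \<in> window t (Suc k) \<longleftrightarrow> (0 < e \<and> e \<le> t) \<and> w \<in> window (t - e) k" for w
      unfolding window_def mem_Collect_eq pos arrival_case_nat using nn[of w]
      by (cases "\<forall>i. 0 < w i") auto
    then have "{w. case_nat e w \<in> window t (Suc k)} = (if 0 < e \<and> e \<le> t then window (t - e) k else {})"
      by (auto split: if_splits)
    then show "emeasure S {w. case_nat e w \<in> window t (Suc k)} = ennreal (poisson_prob c (0 + t - e) k) * indicator {0<..0 + t} e"
      using Suc.IH[of "t - e"] by (auto simp: indicator_def)
  qed
  also have "\<dots> = ennreal (poisson_prob c t (Suc k))"
    using nn_integral_exponential_poisson[OF c_pos _ Suc.prems, of 0 k] by simp
  finally show ?case .
qed

text \<open>
  The probabilities of the windows at time \<open>m\<close> sum to \<open>1\<close>, so almost surely the arrivals go beyond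
  every \<open>m\<close>.
\<close>

lemma AE_good_gaps: "AE w in S. good_gaps w"
proof -
  have "AE w in S. \<exists>k. w \<in> window (real m) k" for m :: nat
  proof -
    have disj: "disjoint_family (window (real m))"
      unfolding disjoint_family_on_def
    proof (intro ballI impI)
      have *: "window (real m) k \<inter> window (real m) l = {}" if "k < l" for k l
      proof (rule ccontr)
        assume "\<not> ?thesis"
        then obtain w where w: "w \<in> window (real m) k" "w \<in> window (real m) l" by blast
        then have "arrival w (Suc k) \<le> arrival w l" using that by (intro arrival_mono) (auto simp: window_def)
        then show False using w by (simp add: window_def)
      qed
      fix k l :: nat assume "k \<noteq> l"
      then show "window (real m) k \<inter> window (real m) l = {}" using *[of k l] *[of l k] by (metis Int_commute linorder_neqE_nat)
    qed
    have "emeasure S (\<Union>k. window (real m) k) = (\<Sum>k. emeasure S (window (real m) k))"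
      by (rule suminf_emeasure[symmetric]) (use disj in auto)
    also have "\<dots> = 1" using c_pos by (simp add: emeasure_window poisson_prob_sums)
    finally have "measure S (\<Union>k. window (real m) k) = 1" by (simp add: measure_def)
    then have "AE w in S. w \<in> (\<Union>k. window (real m) k)"
      by (intro P.AE_in_set_eq_1[THEN iffD2] sets.countable_UN) auto
    then show ?thesis by simp
  qed
  then have "AE w in S. \<forall>m::nat. \<exists>k. w \<in> window (real m) k" by (simp add: AE_all_countable)
  then show ?thesis
  proof eventually_elim
    case (elim w)
    then show ?case unfolding good_gaps_def window_def by blast
  qed
qed

lemma good_event_sets:
  "finite J \<Longrightarrow> {w. good_gaps w \<and> (\<forall>j\<in>J. arrivals_up_to w j = n j) \<and> arrivals_up_to w t = K} \<in> sets S"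
  "finite J \<Longrightarrow> {w. good_gaps w \<and> (\<forall>j\<in>J. arrivals_up_to w j = n j) \<and> arrivals_up_to w t = K \<and> arrivals_up_to w u = L} \<in> sets S"
proof -
  assume "finite J"
  then have "{w \<in> space S. good_gaps w \<and> (\<forall>j\<in>J. arrivals_up_to w j = n j) \<and> arrivals_up_to w t = K} \<in> sets S"
    "{w \<in> space S. good_gaps w \<and> (\<forall>j\<in>J. arrivals_up_to w j = n j) \<and> arrivals_up_to w t = K \<and> arrivals_up_to w u = L} \<in> sets S"
    by measurable
  then show "{w. good_gaps w \<and> (\<forall>j\<in>J. arrivals_up_to w j = n j) \<and> arrivals_up_to w t = K} \<in> sets S"
  "{w. good_gaps w \<and> (\<forall>j\<in>J. arrivals_up_to w j = n j) \<and> arrivals_up_to w t = K \<and> arrivals_up_to w u = L} \<in> sets S"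
    by (simp_all add: space_S)
qed

lemma emeasure_arrivals: 
  assumes "0 \<le> t" shows "emeasure S {w. good_gaps w \<and> arrivals_up_to w t = k} = ennreal (poisson_prob c t k)"
proof -
  have "emeasure S {w. good_gaps w \<and> arrivals_up_to w t = k} = emeasure S (window t k)"
  proof (rule emeasure_eq_AE)
    show "AE w in S. w \<in> {w. good_gaps w \<and> arrivals_up_to w t = k} \<longleftrightarrow> w \<in> window t k"
      using AE_good_gaps
    proof eventually_elim
      case (elim w)
      then show ?case using arrivals_up_to_iff[OF elim assms, of k] by (auto simp: window_def good_gaps_def)
    qed
    show "{w. good_gaps w \<and> arrivals_up_to w t = k} \<in> sets S" using good_event_sets(1)[of "{}" _ t k] by simp
  qed simp
  then show ?thesis using emeasure_window[OF assms] by simp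
qed

text \<open>
  Independence of the increments, by conditioning on the first gap \<open>e\<close>.  If it ends before \<open>t\<close>, the
  process restarts at time \<open>e\<close> with one arrival less before \<open>t\<close>; and if not, the memorylessness of the
  gap is used, in the form of an explicit integral.
\<close>

lemma increment_independent:
  assumes "finite J" "J \<subseteq> {0..t}" "0 \<le> t" and s: "0 \<le> s"
  shows "emeasure S {w. good_gaps w \<and> (\<forall>j\<in>J. arrivals_up_to w j = n j) \<and> arrivals_up_to w t = K \<and> arrivals_up_to w (t + s) = K + k}
    = emeasure S {w. good_gaps w \<and> (\<forall>j\<in>J. arrivals_up_to w j = n j) \<and> arrivals_up_to w t = K} * ennreal (poisson_prob c s k)"
  using assms(1-3)
proof (induction K arbitrary: J n t)
  case 0
  show ?case
  proof (cases "\<forall>j\<in>J. n j = 0")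
    case False
    then obtain j where j: "j \<in> J" "n j \<noteq> 0" by blast
    have "arrivals_up_to w j = 0" if "good_gaps w" "arrivals_up_to w t = 0" for w
      using arrivals_up_to_mono[OF that(1), of j t] that(2) j 0(2) by auto
    then have "{w. good_gaps w \<and> (\<forall>j\<in>J. arrivals_up_to w j = n j) \<and> arrivals_up_to w t = 0} = {}"
      "{w. good_gaps w \<and> (\<forall>j\<in>J. arrivals_up_to w j = n j) \<and> arrivals_up_to w t = 0 \<and> arrivals_up_to w (t + s) = 0 + k} = {}"
      using j by fastforce+
    then show ?thesis by (simp only: emeasure_empty mult_zero_left)
  next
    case True
    have le: "arrivals_up_to w j = 0" if "good_gaps w" "arrivals_up_to w t = 0" "j \<in> J" for w j
      using arrivals_up_to_mono[OF that(1), of j t] that 0(2) by auto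
    have e1: "{w. good_gaps w \<and> (\<forall>j\<in>J. arrivals_up_to w j = n j) \<and> arrivals_up_to w t = 0} = {w. good_gaps w \<and> arrivals_up_to w t = 0}"
      using True le by auto
    have e2: "{w. good_gaps w \<and> (\<forall>j\<in>J. arrivals_up_to w j = n j) \<and> arrivals_up_to w t = 0 \<and> arrivals_up_to w (t + s) = 0 + k}
      = {w. good_gaps w \<and> arrivals_up_to w t = 0 \<and> arrivals_up_to w (t + s) = k}"
      using True le by auto
    have "emeasure S {w. good_gaps w \<and> arrivals_up_to w t = 0 \<and> arrivals_up_to w (t + s) = k} = ennreal (exp (- (c * t)) * poisson_prob c s k)"
    proof (cases k)
      case 0
      have "arrivals_up_to w t = 0" if "good_gaps w" "arrivals_up_to w (t + s) = 0" for w
        using arrivals_up_to_mono[OF that(1) \<open>0 \<le> t\<close>, of "t + s"] that s by simp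
      then have "{w. good_gaps w \<and> arrivals_up_to w t = 0 \<and> arrivals_up_to w (t + s) = k} = {w. good_gaps w \<and> arrivals_up_to w (t + s) = 0}"
        using 0 by auto
      then show ?thesis using emeasure_arrivals[of "t + s" 0] \<open>0 \<le> t\<close> s 0
        by (simp add: poisson_prob_def algebra_simps flip: exp_add)
    next
      case (Suc k')
      let ?A = "{w. good_gaps w \<and> arrivals_up_to w t = 0 \<and> arrivals_up_to w (t + s) = k}"
      have "emeasure S ?A = (\<integral>\<^sup>+e. ennreal (erlang_density 0 c e) * emeasure S {w. case_nat e w \<in> ?A} \<partial>lborel)"
        using good_event_sets(2)[of "{}" _ t 0 "t + s" k] by (intro emeasure_first_gap) simp
      also have "\<dots> = (\<integral>\<^sup>+e. ennreal (erlang_density 0 c e) * (ennreal (poisson_prob c (t + s - e) k') * indicator {t<..t + s} e) \<partial>lborel)"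
      proof (intro nn_integral_cong arg_cong2[of _ _ _ _ "(*)"] refl)
        fix e :: real
        have "case_nat e w \<in> ?A \<longleftrightarrow> t < e \<and> e \<le> t + s \<and> good_gaps w \<and> arrivals_up_to w (t + s - e) = k'" for w
          using \<open>0 \<le> t\<close> s Suc
          by (auto simp: good_gaps_case_nat arrivals_up_to_case_nat split: if_splits)
        then have "{w. case_nat e w \<in> ?A} = (if t < e \<and> e \<le> t + s then {w. good_gaps w \<and> arrivals_up_to w (t + s - e) = k'} else {})"
          by auto
        then show "emeasure S {w. case_nat e w \<in> ?A} = ennreal (poisson_prob c (t + s - e) k') * indicator {t<..t + s} e"
          using emeasure_arrivals[of "t + s - e" k'] by (auto simp: indicator_def)
      qed
      finally show ?thesis using nn_integral_exponential_poisson[OF c_pos \<open>0 \<le> t\<close> s, of k'] Suc by simp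
    qed
    then show ?thesis unfolding e1 e2 emeasure_arrivals[OF \<open>0 \<le> t\<close>]
      by (simp add: poisson_prob_def[of c t 0] ennreal_mult')
  qed
next
  case (Suc K)
  let ?A = "{w. good_gaps w \<and> (\<forall>j\<in>J. arrivals_up_to w j = n j) \<and> arrivals_up_to w t = Suc K}"
  let ?B = "{w. good_gaps w \<and> (\<forall>j\<in>J. arrivals_up_to w j = n j) \<and> arrivals_up_to w t = Suc K \<and> arrivals_up_to w (t + s) = Suc K + k}"
  define J' where "J' e = (\<lambda>j. j - e) ` {j\<in>J. e \<le> j}" for e
  define n' where "n' e j = n (j + e) - 1" for e j
  define ok where "ok e \<longleftrightarrow> 0 < e \<and> e \<le> t \<and> (\<forall>j\<in>J. if j < e then n j = 0 else n j \<noteq> 0)" for e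
  have J0: "0 \<le> j" if "j \<in> J" for j using that Suc.prems by auto
  have past: "(\<forall>j\<in>J. arrivals_up_to (case_nat e w) j = n j) \<longleftrightarrow>
      (\<forall>j\<in>J. if j < e then n j = 0 else n j \<noteq> 0) \<and> (\<forall>j\<in>J' e. arrivals_up_to w j = n' e j)"
    if "0 < e" "good_gaps w" for e w
  proof -
    have "arrivals_up_to (case_nat e w) j = n j \<longleftrightarrow> (if j < e then n j = 0 else n j \<noteq> 0 \<and> arrivals_up_to w (j - e) = n j - 1)" if "j \<in> J" for j
      using arrivals_up_to_case_nat[OF \<open>good_gaps w\<close> \<open>0 < e\<close> J0[OF that]] by auto
    then show ?thesis unfolding J'_def n'_def by (auto split: if_splits)
  qed
  have A: "{w. case_nat e w \<in> ?A} = (if ok e then {w. good_gaps w \<and> (\<forall>j\<in>J' e. arrivals_up_to w j = n' e j) \<and> arrivals_up_to w (t - e) = K} else {})" for e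
  proof (rule Set.set_eqI)
    fix w
    show "w \<in> {w. case_nat e w \<in> ?A} \<longleftrightarrow> w \<in> (if ok e then {w. good_gaps w \<and> (\<forall>j\<in>J' e. arrivals_up_to w j = n' e j) \<and> arrivals_up_to w (t - e) = K} else {})"
      using past[of e w] arrivals_up_to_case_nat[of w e t] \<open>0 \<le> t\<close>
      by (cases "0 < e \<and> good_gaps w"; cases "t < e") (simp_all add: good_gaps_case_nat ok_def, auto)
  qed
  have B: "{w. case_nat e w \<in> ?B} = (if ok e then {w. good_gaps w \<and> (\<forall>j\<in>J' e. arrivals_up_to w j = n' e j) \<and> arrivals_up_to w (t - e) = K \<and> arrivals_up_to w (t - e + s) = K + k} else {})" for e
  proof (rule Set.set_eqI)
    fix w
    show "w \<in> {w. case_nat e w \<in> ?B} \<longleftrightarrow> w \<in> (if ok e then {w. good_gaps w \<and> (\<forall>j\<in>J' e. arrivals_up_to w j = n' e j) \<and> arrivals_up_to w (t - e) = K \<and> arrivals_up_to w (t - e + s) = K + k} else {})"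
      using past[of e w] arrivals_up_to_case_nat[of w e t] arrivals_up_to_case_nat[of w e "t + s"] \<open>0 \<le> t\<close> s
      by (cases "0 < e \<and> good_gaps w"; cases "t < e") (simp_all add: good_gaps_case_nat ok_def diff_add_eq, auto)
  qed
  have AB: "emeasure S {w. case_nat e w \<in> ?B} = emeasure S {w. case_nat e w \<in> ?A} * ennreal (poisson_prob c s k)" for e
  proof (cases "ok e")
    case True
    have "emeasure S {w. good_gaps w \<and> (\<forall>j\<in>J' e. arrivals_up_to w j = n' e j) \<and> arrivals_up_to w (t - e) = K \<and> arrivals_up_to w (t - e + s) = K + k}
      = emeasure S {w. good_gaps w \<and> (\<forall>j\<in>J' e. arrivals_up_to w j = n' e j) \<and> arrivals_up_to w (t - e) = K} * ennreal (poisson_prob c s k)"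
      using True Suc.prems by (intro Suc.IH) (auto simp: J'_def ok_def)
    then show ?thesis unfolding A B using True by simp
  next
    case False
    then show ?thesis unfolding A B by (simp only: if_False emeasure_empty mult_zero_left)
  qed
  have mA: "?A \<in> sets S" "?B \<in> sets S" using good_event_sets Suc.prems(1) by blast+
  have meas: "(\<lambda>e. emeasure S {w. case_nat e w \<in> ?A}) \<in> borel_measurable lborel"
  proof -
    have cm: "(\<lambda>(s, w). case_nat s w) \<in> measurable (M \<Otimes>\<^sub>M S) S" by measurable
    have "(\<lambda>e. emeasure S (Pair e -` ((\<lambda>(s, w). case_nat s w) -` ?A \<inter> space (M \<Otimes>\<^sub>M S)))) \<in> borel_measurable M"
      by (rule P.measurable_emeasure_Pair[OF measurable_sets[OF cm mA(1)]])
    moreover have "(\<lambda>e. Pair e -` ((\<lambda>(s, w). case_nat s w) -` ?A \<inter> space (M \<Otimes>\<^sub>M S))) = (\<lambda>e. {w. case_nat e w \<in> ?A})"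
      by (auto simp: fun_eq_iff space_pair_measure space_S space_M)
    ultimately show ?thesis by (simp cong: measurable_cong_sets add: sets_M fun_eq_iff)
  qed
  have "emeasure S ?B = (\<integral>\<^sup>+e. ennreal (erlang_density 0 c e) * emeasure S {w. case_nat e w \<in> ?B} \<partial>lborel)"
    by (rule emeasure_first_gap[OF mA(2)])
  also have "\<dots> = (\<integral>\<^sup>+e. (ennreal (erlang_density 0 c e) * emeasure S {w. case_nat e w \<in> ?A}) * ennreal (poisson_prob c s k) \<partial>lborel)"
    unfolding AB by (simp add: mult.assoc)
  also have "\<dots> = (\<integral>\<^sup>+e. ennreal (erlang_density 0 c e) * emeasure S {w. case_nat e w \<in> ?A} \<partial>lborel) * ennreal (poisson_prob c s k)"
    by (rule nn_integral_multc, rule borel_measurable_times_ennreal[OF _ meas]) simp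
  also have "(\<integral>\<^sup>+e. ennreal (erlang_density 0 c e) * emeasure S {w. case_nat e w \<in> ?A} \<partial>lborel) = emeasure S ?A"
    by (rule emeasure_first_gap[OF mA(1), symmetric])
  finally show ?case .
qed

end

definition counting_paths :: "(real \<Rightarrow> nat) set" where
  "counting_paths = {x. x 0 = 0 \<and> mono_on {0..} x \<and> (\<forall>t\<ge>0. continuous (at_right t) x)}"

definition path_space :: "(real \<Rightarrow> nat) measure" where
  "path_space = restrict_space (PiM UNIV (\<lambda>_. count_space UNIV)) counting_paths"

lemma space_path_space: "space path_space = counting_paths"
  by (simp add: path_space_def space_restrict_space space_PiM)

lemma coordinate_path_space [measurable]: "(\<lambda>x. x t) \<in> measurable path_space (count_space UNIV)"
  unfolding path_space_def by (intro measurable_restrict_space1 measurable_component_singleton) simp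

text \<open>
  The increment after time \<open>t\<close> is Poisson distributed and independent of every cylinder event of the
  past.
\<close>

definition has_poisson_increments :: "real \<Rightarrow> (real \<Rightarrow> nat) measure \<Rightarrow> bool" where
  "has_poisson_increments c D \<longleftrightarrow> (\<forall>J n t s K k. finite J \<longrightarrow> J \<subseteq> {0..t} \<longrightarrow> 0 \<le> t \<longrightarrow> 0 \<le> s \<longrightarrow>
     measure D {x \<in> space D. (\<forall>j\<in>J. x j = n j) \<and> x t = K \<and> x (t + s) = K + k} =
     measure D {x \<in> space D. (\<forall>j\<in>J. x j = n j) \<and> x t = K} * poisson_prob c s k)"

lemma zero_path: "(\<lambda>_. 0) \<in> counting_paths"
  by (auto simp: counting_paths_def mono_on_def)

text \<open>
  The counting path of exponential gaps, replaced by the constant path where the gaps are not good.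
  At rate \<open>0\<close> no arrival ever happens.
\<close>

lemma poisson_path_law_exists:
  assumes c: "0 \<le> c"
  shows "\<exists>D. prob_space D \<and> sets D = sets path_space \<and> has_poisson_increments c D"
proof (cases "c = 0")
  case True
  let ?D = "return path_space (\<lambda>_. 0)"
  have z: "(\<lambda>_. 0) \<in> space path_space" by (simp add: space_path_space zero_path)
  have "measure ?D {x \<in> space ?D. (\<forall>j\<in>J. x j = n j) \<and> x t = K \<and> x (t + s) = K + k} =
     measure ?D {x \<in> space ?D. (\<forall>j\<in>J. x j = n j) \<and> x t = K} * poisson_prob c s k" if "finite J" for J n t s K k
  proof -
    have "{x \<in> space path_space. (\<forall>j\<in>J. x j = n j) \<and> x t = K \<and> x (t + s) = K + k} \<in> sets path_space"
      "{x \<in> space path_space. (\<forall>j\<in>J. x j = n j) \<and> x t = K} \<in> sets path_space"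
      using that by measurable
    then show ?thesis using z True by (auto simp: measure_return poisson_prob_def indicator_def power_0_left)
  qed
  then show ?thesis using prob_space_return[OF z] unfolding has_poisson_increments_def by (intro exI[of _ ?D]) simp
next
  case False
  then interpret exponential_gaps c using c by unfold_locales simp
  define path where "path w = (if good_gaps w then arrivals_up_to w else (\<lambda>_. 0))" for w
  have cp: "path w \<in> counting_paths" for w
    using arrivals_up_to_0[of w] arrivals_up_to_mono[of w] arrivals_up_to_right_continuous[of w] zero_path
    by (auto simp: path_def counting_paths_def mono_on_def)
  have "(\<lambda>w. \<lambda>t\<in>UNIV. path w t) \<in> measurable S (PiM UNIV (\<lambda>_. count_space UNIV))"
    unfolding path_def by (rule measurable_restrict) (simp add: if_distrib[of "\<lambda>f. f _"] cong: if_cong)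
  then have "path \<in> measurable S (PiM UNIV (\<lambda>_. count_space UNIV))" by (simp add: restrict_UNIV)
  then have pm: "path \<in> measurable S path_space"
    unfolding path_space_def using cp by (intro measurable_restrict_space2) auto
  let ?D = "distr S path_space path"
  have m: "measure ?D {x \<in> space ?D. (\<forall>j\<in>J. x j = n j) \<and> x t = K}
      = enn2real (emeasure S {w. good_gaps w \<and> (\<forall>j\<in>J. arrivals_up_to w j = n j) \<and> arrivals_up_to w t = K})"
     "measure ?D {x \<in> space ?D. (\<forall>j\<in>J. x j = n j) \<and> x t = K \<and> x u = L}
      = enn2real (emeasure S {w. good_gaps w \<and> (\<forall>j\<in>J. arrivals_up_to w j = n j) \<and> arrivals_up_to w t = K \<and> arrivals_up_to w u = L})"
    if J: "finite J" for J n t K u L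
  proof -
    have A: "{x \<in> space path_space. (\<forall>j\<in>J. x j = n j) \<and> x t = K} \<in> sets path_space"
      "{x \<in> space path_space. (\<forall>j\<in>J. x j = n j) \<and> x t = K \<and> x u = L} \<in> sets path_space"
      using J by measurable
    have e: "emeasure S (path -` {x \<in> space path_space. Q x} \<inter> space S) = emeasure S {w. good_gaps w \<and> Q (arrivals_up_to w)}"
      if "{x \<in> space path_space. Q x} \<in> sets path_space" "{w. good_gaps w \<and> Q (arrivals_up_to w)} \<in> sets S" for Q
    proof (rule emeasure_eq_AE)
      show "AE w in S. (w \<in> path -` {x \<in> space path_space. Q x} \<inter> space S) = (w \<in> {w. good_gaps w \<and> Q (arrivals_up_to w)})"
        using AE_good_gaps by eventually_elim (use cp in \<open>auto simp: space_S space_path_space path_def split: if_splits\<close>)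
    qed (use that measurable_sets[OF pm that(1)] in auto)
    show "measure ?D {x \<in> space ?D. (\<forall>j\<in>J. x j = n j) \<and> x t = K}
      = enn2real (emeasure S {w. good_gaps w \<and> (\<forall>j\<in>J. arrivals_up_to w j = n j) \<and> arrivals_up_to w t = K})"
      unfolding measure_def space_distr emeasure_distr[OF pm A(1)] e[OF A(1) good_event_sets(1)[OF J]] ..
    show "measure ?D {x \<in> space ?D. (\<forall>j\<in>J. x j = n j) \<and> x t = K \<and> x u = L}
      = enn2real (emeasure S {w. good_gaps w \<and> (\<forall>j\<in>J. arrivals_up_to w j = n j) \<and> arrivals_up_to w t = K \<and> arrivals_up_to w u = L})"
      unfolding measure_def space_distr emeasure_distr[OF pm A(2)] e[OF A(2) good_event_sets(2)[OF J]] ..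
  qed
  have "has_poisson_increments c ?D"
    unfolding has_poisson_increments_def
    by (intro allI impI) (simp only: m increment_independent enn2real_mult enn2real_ennreal poisson_prob_nonneg c)
  then show ?thesis using P.prob_space_distr[OF pm] by (intro exI[of _ ?D]) simp
qed

text \<open>
  The cylinder events of the past form an intersection-stable generator of the natural filtration, so
  independence on them suffices.
\<close>

lemma poisson_processI:
  fixes P :: "real \<Rightarrow> 'a \<Rightarrow> nat"
  assumes W: "prob_space W" and c: "0 \<le> c"
    and D: "has_poisson_increments c D" "sets D = sets path_space"
    and f: "f \<in> measurable W path_space" "distr W path_space f = D"
  shows "poisson_process W c (\<lambda>t w. f w t)"
proof -
  interpret prob_space W by fact
  let ?P = "\<lambda>t w. f w t"
  have meas [measurable]: "?P t \<in> measurable W (count_space UNIV)" for t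
    using measurable_compose[OF f(1) coordinate_path_space] .
  have cp: "f w \<in> counting_paths" if "w \<in> space W" for w
    using measurable_space[OF f(1) that] by (simp add: space_path_space)
  have sD: "space D = space path_space" by (rule sets_eq_imp_space_eq[OF D(2)])
  have push: "measure D {x \<in> space D. Q x} = measure W {w \<in> space W. Q (f w)}"
    if "{x \<in> space path_space. Q x} \<in> sets path_space" for Q
  proof -
    have "measure D {x \<in> space D. Q x} = measure W (f -` {x \<in> space path_space. Q x} \<inter> space W)"
      unfolding f(2)[symmetric] using that by (subst measure_distr[OF f(1)]) simp_all
    also have "f -` {x \<in> space path_space. Q x} \<inter> space W = {w \<in> space W. Q (f w)}"
      using measurable_space[OF f(1)] by auto
    finally show ?thesis .
  qed
  have fdd: "measure W {w \<in> space W. (\<forall>j\<in>J. f w j = n j) \<and> f w t = K \<and> f w (t + s) = K + k} =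
     measure W {w \<in> space W. (\<forall>j\<in>J. f w j = n j) \<and> f w t = K} * poisson_prob c s k"
    if J: "finite J" "J \<subseteq> {0..t}" "0 \<le> t" "0 \<le> s" for J n t s K k
  proof -
    have "{x \<in> space path_space. (\<forall>j\<in>J. x j = n j) \<and> x t = K} \<in> sets path_space"
      "{x \<in> space path_space. (\<forall>j\<in>J. x j = n j) \<and> x t = K \<and> x (t + s) = K + k} \<in> sets path_space"
      using J(1) by measurable
    then show ?thesis using D(1) J unfolding has_poisson_increments_def by (simp add: push)
  qed
  have key: "measure W ({w \<in> space W. f w (t + s) - f w t = k} \<inter> {w \<in> space W. \<forall>j\<in>J. f w j = n j})
      = poisson_prob c s k * measure W {w \<in> space W. \<forall>j\<in>J. f w j = n j}"
    if J: "finite J" "J \<subseteq> {0..t}" "0 \<le> t" "0 \<le> s" for J n t s k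
  proof -
    let ?A = "\<lambda>K. {w \<in> space W. (\<forall>j\<in>J. f w j = n j) \<and> f w t = K}"
    let ?B = "\<lambda>K. {w \<in> space W. (\<forall>j\<in>J. f w j = n j) \<and> f w t = K \<and> f w (t + s) = K + k}"
    have sets: "?A K \<in> sets W" "?B K \<in> sets W" for K using J(1) by measurable
    have mono: "f w t \<le> f w (t + s)" if "w \<in> space W" for w
      using cp[OF that] J by (auto simp: counting_paths_def mono_on_def)
    have "(\<lambda>K. measure W (?A K)) sums measure W (\<Union>K. ?A K)"
      by (rule finite_measure_UNION) (use sets in \<open>auto simp: disjoint_family_on_def\<close>)
    moreover have "(\<Union>K. ?A K) = {w \<in> space W. \<forall>j\<in>J. f w j = n j}" by auto
    ultimately have "(\<lambda>K. measure W (?A K) * poisson_prob c s k) sums (measure W {w \<in> space W. \<forall>j\<in>J. f w j = n j} * poisson_prob c s k)"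
      using sums_mult2 by simp
    moreover have "(\<lambda>K. measure W (?B K)) sums measure W (\<Union>K. ?B K)"
      by (rule finite_measure_UNION) (use sets in \<open>auto simp: disjoint_family_on_def\<close>)
    moreover have "(\<Union>K. ?B K) = {w \<in> space W. f w (t + s) - f w t = k} \<inter> {w \<in> space W. \<forall>j\<in>J. f w j = n j}"
      using mono by (auto simp: le_imp_diff_is_add)
    ultimately show ?thesis using fdd[OF J] sums_unique2 by (simp add: mult.commute)
  qed
  have marginal: "measure W {w \<in> space W. f w (t + s) - f w t = k} = poisson_prob c s k" if "0 \<le> t" "0 \<le> s" for t s k
    using key[of "{}" t s k] that by (simp add: prob_space Int_absorb2 subset_eq)
  have indep: "indep_set (sets (vimage_algebra (space W) (\<lambda>w. f w (t + s) - f w t) (count_space UNIV)))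
      (sets (natural_filtration W (count_space UNIV) ?P t))" if ts: "0 \<le> t" "0 \<le> s" for t s
  proof -
    define A where "A = insert {} (range (\<lambda>k. {w \<in> space W. f w (t + s) - f w t = k}))"
    define B where "B = insert {} ((\<lambda>(J, n). {w \<in> space W. \<forall>j\<in>J. f w j = n j}) ` ({J. finite J \<and> J \<subseteq> {0..t}} \<times> UNIV))"
    have B_I: "{w \<in> space W. \<forall>j\<in>J. f w j = n j} \<in> B" if "finite J" "J \<subseteq> {0..t}" for J n
      unfolding B_def using that by (intro insertI2 image_eqI[of _ _ "(J, n)"]) auto
    have [measurable]: "(\<lambda>w. f w (t + s) - f w t) \<in> measurable W (count_space UNIV)"
      by (rule measurable_compose_countable[OF _ meas[of "t + s"], where f="\<lambda>i w. i - f w t"])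
        (rule measurable_compose[OF meas], simp)
    have "{w \<in> space W. f w (t + s) - f w t = k} \<in> events" for k by measurable
    then have Aev: "A \<subseteq> events" unfolding A_def by auto
    have Bev: "B \<subseteq> events"
    proof -
      have "{w \<in> space W. \<forall>j\<in>J. f w j = n j} \<in> events" if "finite J" for J n using that by measurable
      then show ?thesis by (auto simp: B_def)
    qed
    have "indep_set A B"
    proof (rule indep_setI[OF Aev Bev])
      fix a b assume "a \<in> A" "b \<in> B"
      then show "prob (a \<inter> b) = prob a * prob b"
        using key[OF _ _ ts] marginal[OF ts] by (auto simp: A_def B_def)
    qed
    moreover have "Int_stable A"
      by (rule Int_stableI) (auto simp: A_def)
    moreover have "Int_stable B"
    proof (rule Int_stableI)
      fix a b assume "a \<in> B" "b \<in> B"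
      show "a \<inter> b \<in> B"
      proof (cases "a = {} \<or> b = {}")
        case False
        with \<open>a \<in> B\<close> \<open>b \<in> B\<close> obtain J n J' n' where
          J: "finite J" "J \<subseteq> {0..t}" "a = {w \<in> space W. \<forall>j\<in>J. f w j = n j}" and
          J': "finite J'" "J' \<subseteq> {0..t}" "b = {w \<in> space W. \<forall>j\<in>J'. f w j = n' j}"
          by (auto simp: B_def)
        show ?thesis
        proof (cases "\<forall>j\<in>J \<inter> J'. n j = n' j")
          case True
          have "a \<inter> b = {w \<in> space W. \<forall>j\<in>J \<union> J'. f w j = (if j \<in> J then n j else n' j)}"
            unfolding J(3) J'(3) using True by auto
          then show ?thesis using J J' by (simp add: B_I)
        next
          case False
          then have "a \<inter> b = {}" unfolding J(3) J'(3) by auto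
          then show ?thesis by (simp add: B_def)
        qed
      qed (auto simp: B_def)
    qed
    ultimately have ind: "indep_set (sigma_sets (space W) A) (sigma_sets (space W) B)"
      by (rule indep_set_sigma_sets)
    have "sets (vimage_algebra (space W) (\<lambda>w. f w (t + s) - f w t) (count_space UNIV)) \<subseteq> sigma_sets (space W) A"
    proof
      fix X assume "X \<in> sets (vimage_algebra (space W) (\<lambda>w. f w (t + s) - f w t) (count_space UNIV))"
      then obtain Y where "X = (\<lambda>w. f w (t + s) - f w t) -` Y \<inter> space W" by (auto simp: sets_vimage_algebra2)
      then have "X = (\<Union>k. if k \<in> Y then {w \<in> space W. f w (t + s) - f w t = k} else {})" by (auto split: if_splits)
      also have "\<dots> \<in> sigma_sets (space W) A"
        by (intro sigma_sets.Union) (auto simp: A_def intro: sigma_sets.Basic sigma_sets.Empty)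
      finally show "X \<in> sigma_sets (space W) A" .
    qed
    moreover have "sets (natural_filtration W (count_space UNIV) ?P t) \<subseteq> sigma_sets (space W) B"
    proof -
      have Bsp: "B \<subseteq> Pow (space W)" using Bev sets.sets_into_space by blast
      have "?P j \<in> measurable (sigma (space W) B) (count_space UNIV)" if "j \<in> {0..t}" for j
      proof (rule measurable_count_space_eq_countable[THEN iffD2], simp, intro conjI ballI)
        fix m
        have "?P j -` {m} \<inter> space W = {w \<in> space W. \<forall>j\<in>{j}. f w j = m}" by auto
        also have "\<dots> \<in> B" using that by (intro B_I[of "{j}" "\<lambda>_. m"]) auto
        finally show "?P j -` {m} \<inter> space (sigma (space W) B) \<in> sets (sigma (space W) B)"
          using Bsp by (simp add: sets_measure_of space_measure_of_conv sigma_sets.Basic)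
      qed simp
      then have "trajectory ?P t \<in> measurable (sigma (space W) B) (PiM {0..t} (\<lambda>_. count_space UNIV))"
        unfolding trajectory_def[abs_def] by (rule measurable_restrict)
      from sets_image_in_sets[OF _ this] show ?thesis
        using Bsp unfolding natural_filtration_def by (simp add: sets_measure_of space_measure_of_conv)
    qed
    ultimately show ?thesis using ind unfolding indep_set_def
      by (elim indep_sets_mono_sets) (auto split: bool.splits)
  qed
  show ?thesis
    unfolding poisson_process_def process_def
    using meas cp indep marginal
    by (auto simp: counting_paths_def poisson_prob_def)
qed

section \<open>Laws of singular numbers of random products\<close>

definition law :: "'a measure \<Rightarrow> ('a \<Rightarrow> 'b) \<Rightarrow> 'b pmf" where
  "law M f = embed_pmf (\<lambda>x. measure M {w \<in> space M. f w = x})"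

lemma total_probability:
  fixes Z :: "'a \<Rightarrow> 'b::countable"
  assumes "Z \<in> measurable M (count_space UNIV)" "A \<in> sets M"
  shows "emeasure M A = (\<integral>\<^sup>+x. emeasure M (A \<inter> {w \<in> space M. Z w = x}) \<partial>count_space UNIV)"
proof -
  have meas: "A \<inter> {w \<in> space M. Z w = x} \<in> sets M" for x
    using assms by (intro sets.Int) (auto intro: measurable_sets_Collect)
  have "A = (\<Union>x. A \<inter> {w \<in> space M. Z w = x})" using sets.sets_into_space[OF assms(2)] by auto
  then have "emeasure M A = emeasure M (\<Union>x\<in>UNIV. A \<inter> {w \<in> space M. Z w = x})" by simp
  also have "\<dots> = (\<integral>\<^sup>+x. emeasure M (A \<inter> {w \<in> space M. Z w = x}) \<partial>count_space UNIV)"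
    by (rule emeasure_UN_countable) (auto simp: disjoint_family_on_def meas)
  finally show ?thesis .
qed

lemma pmf_law:
  fixes f :: "'a \<Rightarrow> 'b::countable"
  assumes "prob_space M" "f \<in> measurable M (count_space UNIV)"
  shows "pmf (law M f) x = measure M {w \<in> space M. f w = x}"
  unfolding law_def
proof (rule pmf_embed_pmf)
  interpret prob_space M by fact
  have "(\<integral>\<^sup>+x. ennreal (measure M {w \<in> space M. f w = x}) \<partial>count_space UNIV)
      = (\<integral>\<^sup>+x. emeasure M (space M \<inter> {w \<in> space M. f w = x}) \<partial>count_space UNIV)"
    by (intro nn_integral_cong) (auto simp: emeasure_eq_measure intro!: arg_cong[of _ _ "measure M"] arg_cong[of _ _ ennreal])
  also have "\<dots> = 1" using total_probability[OF assms(2) sets.top] emeasure_space_1 by simp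
  finally show "(\<integral>\<^sup>+x. ennreal (measure M {w \<in> space M. f w = x}) \<partial>count_space UNIV) = 1" .
qed simp

lemma SN_compose_measurable [measurable]:
  fixes f :: "'a \<Rightarrow> ('p::prime_card, 'n::{finite, linorder}) pmat"
  assumes "f \<in> measurable M borel_GL_Qp" shows "(\<lambda>x. SN (f x)) \<in> measurable M (count_space UNIV)"
  using measurable_compose[OF measurable_compose[OF assms SN_measurable], of "\<lambda>x. x" "count_space UNIV"] by simp

lemma const_GL_Qp_measurable: "g \<in> GL_Qp \<Longrightarrow> (\<lambda>_. g) \<in> measurable M borel_GL_Qp"
  by (rule measurable_const) (simp add: space_restrict_space)

lemma measurable_GL_QpD: "f \<in> measurable M borel_GL_Qp \<Longrightarrow> w \<in> space M \<Longrightarrow> f w \<in> GL_Qp"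
  using measurable_space[of f M borel_GL_Qp w] by (simp add: space_restrict_space)

definition haar :: "('p::prime_card, 'n::{finite, linorder}) pmat measure" where
  "haar = (SOME H. haar_GL_Zp H \<and> (\<forall>k\<in>GL_Zp. distr H H (\<lambda>g. g ** k) = H))"

lemma haar:
  "haar_GL_Zp (haar :: ('p::prime_card, 'n::{finite, linorder}) pmat measure)"
  "k \<in> GL_Zp \<Longrightarrow> distr haar haar (\<lambda>g :: ('p, 'n) pmat. g ** k) = haar"
  unfolding haar_def using someI_ex[OF haar_GL_Zp_exists[where 'p='p and 'n='n]] by blast+

lemma prob_space_haar: "prob_space haar"
  and sets_haar: "sets haar = sets borel_GL_Zp"
  and haar_left: "k \<in> GL_Zp \<Longrightarrow> distr haar haar (\<lambda>g. k ** g) = haar"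
  using haar(1) by (auto simp: haar_GL_Zp_def)

lemma space_haar: "space haar = GL_Zp"
  using sets_eq_imp_space_eq[OF sets_haar] by (simp add: space_restrict_space)

lemma haar_GL_Qp_measurable: "(\<lambda>k. k) \<in> measurable (haar :: ('p::prime_card, 'n::{finite, linorder}) pmat measure) borel_GL_Qp"
proof -
  have "(\<lambda>k. k) \<in> measurable (borel_GL_Zp :: ('p, 'n) pmat measure) borel_GL_Qp"
    by (rule measurable_restrict_space2) (auto simp: space_restrict_space GL_Zp_subset_GL_Qp intro: measurable_restrict_space1)
  then show ?thesis using measurable_cong_sets[OF sets_haar refl] by blast
qed

lemma haar_mult_measurable:
  assumes "k \<in> GL_Zp" shows "(\<lambda>g. k ** g) \<in> measurable haar haar" "(\<lambda>g. g ** k) \<in> measurable haar haar"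
proof -
  have "(\<lambda>g. k ** g) \<in> measurable borel_GL_Zp borel_GL_Zp" "(\<lambda>g. g ** k) \<in> measurable borel_GL_Zp borel_GL_Zp"
    using assms by (auto simp: measurable_restrict_space2_iff space_restrict_space GL_Zp_mult intro!: measurable_restrict_space1)
  then show "(\<lambda>g. k ** g) \<in> measurable haar haar" "(\<lambda>g. g ** k) \<in> measurable haar haar"
    using measurable_cong_sets[OF sets_haar sets_haar] by blast+
qed

text \<open>
  The law of the singular numbers of \<open>A ** k ** B\<close>, where \<open>A\<close> and \<open>B\<close> have singular numbers \<open>\<mu>\<close> and
  \<open>l\<close>, and \<open>k\<close> is Haar distributed.  Outside \<open>Sig\<close> the values are chosen such that \<open>0\<close> acts as
  identity on both sides.  The type parameter \<open>'p\<close> determines the prime.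
\<close>

definition step_law :: "'p::prime_card itself \<Rightarrow> 'n tuple \<Rightarrow> 'n tuple \<Rightarrow> 'n::{finite, linorder} tuple pmf" where
  "step_law _ \<mu> l = (if l \<notin> Sig then return_pmf l else if \<mu> \<notin> Sig then return_pmf \<mu>
     else law haar (\<lambda>k. SN (diag_p \<mu> ** k ** diag_p l :: ('p, 'n) pmat)))"

lemma triple_measurable:
  assumes "g \<in> GL_Qp" "h \<in> GL_Qp" "f \<in> measurable M borel_GL_Qp"
  shows "(\<lambda>k. SN (g ** f k ** h :: ('p::prime_card, 'n::{finite, linorder}) pmat)) \<in> measurable M (count_space UNIV)"
  by (intro SN_compose_measurable matrix_mult_GL_Qp_measurable const_GL_Qp_measurable assms)

text \<open>
  The unimodular factors of \<open>g\<close> and \<open>h\<close> next to \<open>k\<close> are absorbed by the two-sided invariance of Haar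
  measure.
\<close>

lemma step_law_double_coset:
  fixes g h :: "('p::prime_card, 'n::{finite, linorder}) pmat"
  assumes g: "g \<in> GL_Qp" and h: "h \<in> GL_Qp"
  shows "pmf (step_law TYPE('p) (SN g) (SN h)) l = measure haar {k \<in> GL_Zp. SN (g ** k ** h) = l}"
proof -
  interpret H: prob_space "haar :: ('p, 'n) pmat measure" by (rule prob_space_haar)
  obtain U V \<mu> where UV: "U \<in> GL_Zp" "V \<in> GL_Zp" "g = U ** diag_p \<mu> ** V" "SN g = \<mu>" "\<mu> \<in> Sig"
    using SN_decomp[OF g] by metis
  obtain U' V' \<nu> where UV': "U' \<in> GL_Zp" "V' \<in> GL_Zp" "h = U' ** diag_p \<nu> ** V'" "SN h = \<nu>" "\<nu> \<in> Sig"
    using SN_decomp[OF h] by metis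
  define A where "A = {k \<in> GL_Zp. SN (diag_p \<mu> ** k ** diag_p \<nu> :: ('p, 'n) pmat) = l}"
  have m: "(\<lambda>k. SN (diag_p \<mu> ** k ** diag_p \<nu> :: ('p, 'n) pmat)) \<in> measurable haar (count_space UNIV)"
    by (intro triple_measurable diag_p_GL_Qp haar_GL_Qp_measurable)
  have "A = (\<lambda>k. SN (diag_p \<mu> ** k ** diag_p \<nu> :: ('p, 'n) pmat)) -` {l} \<inter> space haar"
    by (auto simp: A_def space_haar)
  then have A: "A \<in> sets haar" using measurable_sets[OF m, of "{l}"] by simp
  have "SN (g ** k ** h) = SN (diag_p \<mu> ** (V ** k ** U') ** diag_p \<nu>)" if "k \<in> GL_Zp" for k
  proof -
    have "g ** k ** h = U ** (diag_p \<mu> ** (V ** k ** U') ** diag_p \<nu>) ** V'"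
      unfolding UV(3) UV'(3) by (simp add: matrix_mul_assoc)
    then show ?thesis using UV UV' that
      by (simp add: SN_mult_K GL_Qp_mult diag_p_GL_Qp GL_Zp_subset_GL_Qp)
  qed
  then have "{k \<in> GL_Zp. SN (g ** k ** h) = l} = (\<lambda>k. V ** k) -` ((\<lambda>k. k ** U') -` A \<inter> space haar) \<inter> space haar"
    using UV UV' by (auto simp: A_def space_haar GL_Zp_mult)
  also have "measure haar \<dots> = measure (distr haar haar (\<lambda>k. V ** k)) ((\<lambda>k. k ** U') -` A \<inter> space haar)"
    using UV UV' A by (intro measure_distr[symmetric] haar_mult_measurable measurable_sets[OF haar_mult_measurable(2)])
  also have "\<dots> = measure (distr haar haar (\<lambda>k. k ** U')) A"
    using UV UV' A by (subst measure_distr) (auto simp: haar_left haar_mult_measurable)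
  also have "\<dots> = measure haar A" using UV' by (simp add: haar(2))
  also have "\<dots> = pmf (step_law TYPE('p) (SN g) (SN h)) l"
    using UV UV' by (simp add: step_law_def pmf_law[OF prob_space_haar m] A_def space_haar)
  finally show ?thesis by simp
qed

lemma step_law_zero_left: "step_law TYPE('p::prime_card) 0 l = return_pmf l"
proof (cases "l \<in> Sig")
  case True
  interpret H: prob_space "haar :: ('p, 'a) pmat measure" by (rule prob_space_haar)
  have "{k \<in> GL_Zp. SN (mat 1 ** k ** diag_p l :: ('p, 'a) pmat) = x} = (if x = l then GL_Zp else {})" for x
    using True by (auto simp: SN_mult_left_K diag_p_GL_Qp SN_diag_p)
  then have "pmf (step_law TYPE('p) 0 l) x = pmf (return_pmf l) x" for x
    using step_law_double_coset[of "mat 1 :: ('p, 'a) pmat" "diag_p l" x] True H.prob_space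
    by (simp add: GL_Qp_1 diag_p_GL_Qp SN_diag_p SN_GL_Zp GL_Zp_1 space_haar)
  then show ?thesis by (rule pmf_eqI)
qed (simp add: step_law_def)

lemma step_law_zero_right: "step_law TYPE('p::prime_card) \<mu> 0 = return_pmf \<mu>"
proof (cases "\<mu> \<in> Sig")
  case True
  interpret H: prob_space "haar :: ('p, 'a) pmat measure" by (rule prob_space_haar)
  have "{k \<in> GL_Zp. SN (diag_p \<mu> ** k ** mat 1 :: ('p, 'a) pmat) = x} = (if x = \<mu> then GL_Zp else {})" for x
    using True by (auto simp: SN_mult_right_K diag_p_GL_Qp SN_diag_p)
  then have "pmf (step_law TYPE('p) \<mu> 0) x = pmf (return_pmf \<mu>) x" for x
    using step_law_double_coset[of "diag_p \<mu> :: ('p, 'a) pmat" "mat 1" x] True H.prob_space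
    by (simp add: GL_Qp_1 diag_p_GL_Qp SN_diag_p SN_GL_Zp GL_Zp_1 space_haar)
  then show ?thesis by (rule pmf_eqI)
qed (simp add: step_law_def zero_Sig)

text \<open>Conditioning on an event \<open>E\<close> of the past: \<open>V\<close> is independent of \<open>E\<close> and \<open>Y\<close>, so it may be
  averaged with \<open>Y\<close> held fixed.\<close>

lemma average_independent_factor:
  fixes V :: "'a \<Rightarrow> 'b" and Y :: "'a \<Rightarrow> 'c"
  assumes W: "prob_space W" and V: "V \<in> measurable W G" and Y: "Y \<in> measurable W G'" and E: "E \<in> sets W"
    and indep: "\<And>A B. A \<in> sets G \<Longrightarrow> B \<in> sets G' \<Longrightarrow>
      measure W ((V -` A \<inter> space W) \<inter> (E \<inter> (Y -` B \<inter> space W))) = measure W (V -` A \<inter> space W) * measure W (E \<inter> (Y -` B \<inter> space W))"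
    and T: "T \<in> sets (G \<Otimes>\<^sub>M G')"
    and q: "\<And>w. w \<in> E \<Longrightarrow> measure W {v \<in> space W. (V v, Y w) \<in> T} = q"
  shows "measure W {w \<in> E. (V w, Y w) \<in> T} = measure W E * q"
proof -
  interpret prob_space W by fact
  let ?R = "restrict_space W E"
  have EW: "E \<subseteq> space W" "E \<inter> space W \<in> sets W" using sets.sets_into_space[OF E] E by auto
  have spR: "space ?R = E" using EW by (auto simp: space_restrict_space)
  have emR: "emeasure ?R A = emeasure W A" if "A \<subseteq> E" for A
    using emeasure_restrict_space[OF EW(2) that] .
  interpret R: finite_measure ?R by (rule finite_measureI) (simp add: spR emR emeasure_finite)
  have VR: "V \<in> measurable ?R G" and YR: "Y \<in> measurable ?R G'" using V Y by (auto intro: measurable_restrict_space1)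
  interpret DV: finite_measure "distr W G V" by (rule finite_measure_distr[OF V])
  interpret DY: finite_measure "distr ?R G' Y" by (rule R.finite_measure_distr[OF YR])
  interpret P: pair_sigma_finite "distr W G V" "distr ?R G' Y" ..
  have VY: "(\<lambda>w. (V w, Y w)) \<in> measurable ?R (G \<Otimes>\<^sub>M G')" using VR YR by measurable
  have prod: "distr W G V \<Otimes>\<^sub>M distr ?R G' Y = distr ?R (G \<Otimes>\<^sub>M G') (\<lambda>w. (V w, Y w))"
  proof (rule pair_measure_eqI)
    show "sets (distr W G V \<Otimes>\<^sub>M distr ?R G' Y) = sets (distr ?R (G \<Otimes>\<^sub>M G') (\<lambda>w. (V w, Y w)))"
      by (simp cong: sets_pair_measure_cong)
    fix A B assume "A \<in> sets (distr W G V)" "B \<in> sets (distr ?R G' Y)"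
    then have AB: "A \<in> sets G" "B \<in> sets G'" by simp_all
    have 1: "(\<lambda>w. (V w, Y w)) -` (A \<times> B) \<inter> space ?R = (V -` A \<inter> space W) \<inter> (E \<inter> (Y -` B \<inter> space W))"
      and 2: "Y -` B \<inter> space ?R = E \<inter> (Y -` B \<inter> space W)" using EW by (auto simp: spR)
    have "emeasure (distr ?R (G \<Otimes>\<^sub>M G') (\<lambda>w. (V w, Y w))) (A \<times> B) = emeasure W ((V -` A \<inter> space W) \<inter> (E \<inter> (Y -` B \<inter> space W)))"
      using AB VY by (subst emeasure_distr) (auto simp: 1 intro!: emR)
    also have "\<dots> = emeasure W (V -` A \<inter> space W) * emeasure W (E \<inter> (Y -` B \<inter> space W))"
      by (simp add: emeasure_eq_measure indep[OF AB] ennreal_mult)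
    also have "emeasure W (E \<inter> (Y -` B \<inter> space W)) = emeasure (distr ?R G' Y) B"
      using AB YR by (subst emeasure_distr) (auto simp: 2 intro!: emR[symmetric])
    also have "emeasure W (V -` A \<inter> space W) = emeasure (distr W G V) A"
      using AB V by (simp add: emeasure_distr)
    finally show "emeasure (distr W G V) A * emeasure (distr ?R G' Y) B = emeasure (distr ?R (G \<Otimes>\<^sub>M G') (\<lambda>w. (V w, Y w))) (A \<times> B)" ..
  qed (unfold_locales)
  have T': "T \<in> sets (distr W G V \<Otimes>\<^sub>M distr ?R G' Y)" using T by (simp cong: sets_pair_measure_cong)
  have Tm: "(\<lambda>y. emeasure (distr W G V) ((\<lambda>x. (x, y)) -` T)) \<in> borel_measurable (distr ?R G' Y)"
    using P.measurable_emeasure_Pair2[OF T'] .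
  have "emeasure W {w \<in> E. (V w, Y w) \<in> T} = emeasure (distr ?R (G \<Otimes>\<^sub>M G') (\<lambda>w. (V w, Y w))) T"
    using T VY by (subst emeasure_distr) (auto simp: spR intro!: emR[symmetric] arg_cong[of _ _ "emeasure ?R"] trans[OF emR[symmetric]])
  also have "\<dots> = (\<integral>\<^sup>+y. emeasure (distr W G V) ((\<lambda>x. (x, y)) -` T) \<partial>distr ?R G' Y)"
    unfolding prod[symmetric] by (rule P.emeasure_pair_measure_alt2[OF T'])
  also have "\<dots> = (\<integral>\<^sup>+w. emeasure (distr W G V) ((\<lambda>x. (x, Y w)) -` T) \<partial>?R)"
    by (rule nn_integral_distr[OF YR]) (use Tm in simp)
  also have "\<dots> = (\<integral>\<^sup>+w. ennreal q \<partial>?R)"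
  proof (rule nn_integral_cong)
    fix w assume "w \<in> space ?R"
    then have w: "w \<in> E" by (simp add: spR)
    then have Yw: "Y w \<in> space G'" using measurable_space[OF Y] EW by blast
    have "(\<lambda>x. (x, Y w)) -` T \<in> sets G" by (rule sets_Pair2[OF T])
    then have "emeasure (distr W G V) ((\<lambda>x. (x, Y w)) -` T) = emeasure W (V -` ((\<lambda>x. (x, Y w)) -` T) \<inter> space W)"
      by (rule emeasure_distr[OF V])
    also have "V -` ((\<lambda>x. (x, Y w)) -` T) \<inter> space W = {v \<in> space W. (V v, Y w) \<in> T}" by auto
    finally show "emeasure (distr W G V) ((\<lambda>x. (x, Y w)) -` T) = ennreal q" using q[OF w] by (simp add: emeasure_eq_measure)
  qed
  also have "\<dots> = ennreal q * emeasure W E" by (simp add: spR emR)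
  also have "\<dots> = ennreal (measure W E * q)"
  proof (cases "E = {}")
    case False
    then have "0 \<le> q" using q by (metis all_not_in_conv measure_nonneg)
    then show ?thesis by (simp add: emeasure_eq_measure ennreal_mult' mult.commute)
  qed simp
  finally have "ennreal (measure W {w \<in> E. (V w, Y w) \<in> T}) = ennreal (measure W E * q)" by (simp add: emeasure_eq_measure)
  moreover have "0 \<le> measure W E * q"
    using q by (cases "E = {}") (auto, metis measure_nonneg mult_nonneg_nonneg)
  ultimately show ?thesis by simp
qed

lemma measure_pmf_law:
  fixes f :: "'a \<Rightarrow> 'b::countable"
  assumes "prob_space M" "f \<in> measurable M (count_space UNIV)"
  shows "measure_pmf (law M f) = distr M (count_space UNIV) f"
proof (rule measure_eqI_countable[of _ UNIV])
  interpret prob_space M by fact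
  fix x :: 'b
  have "f -` {x} \<inter> space M = {w \<in> space M. f w = x}" by auto
  then show "emeasure (measure_pmf (law M f)) {x} = emeasure (distr M (count_space UNIV) f) {x}"
    using assms by (simp add: emeasure_pmf_single pmf_law[OF assms] emeasure_distr emeasure_eq_measure)
qed auto

text \<open>Applied to a p-adic norm, which is a power of \<open>p\<close>, this is the exponent.\<close>

definition plog :: "nat \<Rightarrow> real \<Rightarrow> int" where
  "plog p x = \<lfloor>log p x\<rfloor>"

lemma plog_powi: "1 < real p \<Longrightarrow> plog p (real p powi k) = k"
  by (simp add: plog_def powr_real_of_int'[symmetric])

section \<open>Isotropic processes with stationary independent increments\<close>

locale isotropic_process = prob_space W for W :: "'a measure" +
  fixes X :: "real \<Rightarrow> 'a \<Rightarrow> ('p::prime_card, 'n::{finite, linorder}) pmat"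
  assumes X_process: "process W borel_GL_Qp X"
    and X_start: "AE w in W. X 0 w = mat 1"
    and X_stationary: "stationary_increments W X"
    and X_independent: "independent_increments W X"
    and X_isotropic: "isotropic_increments W X"
begin

abbreviation G :: "('p, 'n) pmat measure" where "G \<equiv> borel_GL_Qp"

lemma space_G: "space G = GL_Qp"
  by (simp add: space_restrict_space)

lemma X_measurable [measurable]: "0 \<le> t \<Longrightarrow> X t \<in> measurable W G"
  using X_process by (simp add: process_def)

lemma X_GL: "0 \<le> t \<Longrightarrow> w \<in> space W \<Longrightarrow> X t w \<in> GL_Qp"
  by (rule measurable_GL_QpD[OF X_measurable])

lemma X_increment: "0 \<le> t \<Longrightarrow> w \<in> space W \<Longrightarrow> X (t + s) w = increment X t s w ** X t w"
  unfolding increment_def by (simp add: matrix_inv_GL_Qp(2) X_GL flip: matrix_mul_assoc)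

lemma increment_GL: "0 \<le> t \<Longrightarrow> 0 \<le> s \<Longrightarrow> w \<in> space W \<Longrightarrow> increment X t s w \<in> GL_Qp"
  unfolding increment_def by (intro GL_Qp_mult matrix_inv_GL_Qp(3) X_GL) auto

lemma increment_indep:
  "0 \<le> t \<Longrightarrow> 0 \<le> s \<Longrightarrow> indep_set (sets (vimage_algebra (space W) (increment X t s) G)) (sets (natural_filtration W G X t))"
  using X_independent unfolding independent_increments_def by blast

lemma increment_measurable:
  assumes "0 \<le> t" "0 \<le> s" shows "increment X t s \<in> measurable W G"
proof (rule measurableI)
  fix A assume "A \<in> sets G"
  then have "increment X t s -` A \<inter> space W \<in> sets (vimage_algebra (space W) (increment X t s) G)"
    by (rule in_vimage_algebra)
  then show "increment X t s -` A \<inter> space W \<in> sets W"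
    using indep_setD_ev1[OF increment_indep[OF assms]] by blast
qed (simp add: increment_GL assms space_G)

lemma increment_0_AE: "0 \<le> s \<Longrightarrow> AE w in W. increment X 0 s w = X s w"
  using X_start by eventually_elim (simp add: increment_def matrix_inv_1)

lemma event_measurable:
  assumes "f \<in> measurable W G" "\<phi> \<in> measurable G (count_space UNIV)"
  shows "{w \<in> space W. \<phi> (f w) = l} \<in> sets W"
proof -
  have "(\<lambda>w. \<phi> (f w)) -` {l} \<inter> space W \<in> sets W"
    by (rule measurable_sets[OF measurable_compose[OF assms]]) simp
  moreover have "(\<lambda>w. \<phi> (f w)) -` {l} \<inter> space W = {w \<in> space W. \<phi> (f w) = l}" by auto
  ultimately show ?thesis by simp
qed

lemma distr_event:
  assumes "f \<in> measurable W G" "\<phi> \<in> measurable G (count_space UNIV)"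
  shows "measure (distr W G f) (\<phi> -` {l} \<inter> space G) = measure W {w \<in> space W. \<phi> (f w) = l}"
proof -
  have "measure (distr W G f) (\<phi> -` {l} \<inter> space G) = measure W (f -` (\<phi> -` {l} \<inter> space G) \<inter> space W)"
    using assms by (intro measure_distr) (auto intro: measurable_sets)
  also have "f -` (\<phi> -` {l} \<inter> space G) \<inter> space W = {w \<in> space W. \<phi> (f w) = l}"
    using measurable_space[OF assms(1)] by auto
  finally show ?thesis .
qed

lemma increment_law:
  assumes ts: "0 \<le> t" "0 \<le> s" and \<phi>: "\<phi> \<in> measurable G (count_space UNIV)"
  shows "measure W {w \<in> space W. \<phi> (increment X t s w) = l} = measure W {w \<in> space W. \<phi> (X s w) = l}"
proof -
  have "distr W G (increment X t s) = distr W G (increment X 0 s)"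
    using X_stationary ts unfolding stationary_increments_def by blast
  then have "measure W {w \<in> space W. \<phi> (increment X t s w) = l} = measure W {w \<in> space W. \<phi> (increment X 0 s w) = l}"
    using distr_event[OF increment_measurable[OF ts] \<phi>, of l] distr_event[OF increment_measurable[of 0 s] \<phi>, of l] ts by simp
  also have "\<dots> = measure W {w \<in> space W. \<phi> (X s w) = l}"
  proof (rule measure_eq_AE)
    show "AE w in W. w \<in> {w \<in> space W. \<phi> (increment X 0 s w) = l} \<longleftrightarrow> w \<in> {w \<in> space W. \<phi> (X s w) = l}"
      using increment_0_AE[OF ts(2)] by eventually_elim simp
  qed (use event_measurable[OF increment_measurable \<phi>] event_measurable[OF X_measurable \<phi>] ts in auto)
  finally show ?thesis .
qed

lemma conjugate_law:
  assumes s: "0 \<le> s" and k: "k \<in> GL_Zp" and \<phi>: "\<phi> \<in> measurable G (count_space UNIV)"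
  shows "measure W {w \<in> space W. \<phi> (matrix_inv k ** X s w ** k) = l} = measure W {w \<in> space W. \<phi> (X s w) = l}"
proof -
  let ?B = "matrix_inv k"
  have B: "?B \<in> GL_Zp" by (rule matrix_inv_GL_Zp[OF k])
  have inv: "matrix_inv ?B = k"
    using matrix_inv_GL_Qp(2)[OF GL_Zp_subset_GL_Qp[OF k]] by (rule matrix_inv_unique)
  have m: "(\<lambda>w. ?B ** f w ** k) \<in> measurable W G" if "f \<in> measurable W G" for f
    by (intro matrix_mult_GL_Qp_measurable const_GL_Qp_measurable that GL_Zp_subset_GL_Qp B k)
  have im: "increment X 0 s \<in> measurable W G" using s by (intro increment_measurable) auto
  have "distr W G (increment X 0 s) = distr W G (\<lambda>w. ?B ** increment X 0 s w ** k)"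
    using X_isotropic s B inv unfolding isotropic_increments_def by force
  then have "measure W {w \<in> space W. \<phi> (increment X 0 s w) = l} = measure W {w \<in> space W. \<phi> (?B ** increment X 0 s w ** k) = l}"
    using distr_event[OF im \<phi>, of l] distr_event[OF m[OF im] \<phi>, of l] by simp
  also have "\<dots> = measure W {w \<in> space W. \<phi> (?B ** X s w ** k) = l}"
  proof (rule measure_eq_AE)
    show "AE w in W. w \<in> {w \<in> space W. \<phi> (?B ** increment X 0 s w ** k) = l} \<longleftrightarrow> w \<in> {w \<in> space W. \<phi> (?B ** X s w ** k) = l}"
      using increment_0_AE[OF s] by eventually_elim simp
  qed (use event_measurable[OF m[OF im] \<phi>] event_measurable[OF m[OF X_measurable] \<phi>] s in auto)
  finally show ?thesis using increment_law[OF _ s \<phi>, of 0 l] by simp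
qed

definition m :: "real \<Rightarrow> 'n tuple pmf" where
  "m t = law W (\<lambda>w. SN (X t w))"

definition T :: "real \<Rightarrow> 'n tuple \<Rightarrow> 'n tuple pmf" where
  "T t l = bind_pmf (m t) (\<lambda>\<mu>. step_law TYPE('p) \<mu> l)"

text \<open>
  Isotropy allows to insert an element of \<open>GL\<^sub>N(\<int>\<^sub>p)\<close>, chosen by Haar measure, between \<open>X s\<close> and \<open>g\<close>.
  Hence only the double cosets of the two factors matter.
\<close>

lemma law_X_mult:
  assumes s: "0 \<le> s" and g: "g \<in> GL_Qp"
  shows "measure W {w \<in> space W. SN (X s w ** g) = l} = pmf (T s (SN g)) l"
proof -
  let ?H = "haar :: ('p, 'n) pmat measure"
  interpret H: prob_space ?H by (rule prob_space_haar)
  interpret P: pair_prob_space W ?H ..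
  define c where "c = measure W {w \<in> space W. SN (X s w ** g) = l}"
  have fm: "(\<lambda>p. SN (X s (fst p) ** snd p ** g)) \<in> measurable (W \<Otimes>\<^sub>M ?H) (count_space UNIV)"
    by (intro SN_compose_measurable matrix_mult_GL_Qp_measurable const_GL_Qp_measurable g
        measurable_compose[OF measurable_fst X_measurable] measurable_compose[OF measurable_snd haar_GL_Qp_measurable] s)
  define T0 where "T0 = (\<lambda>p. SN (X s (fst p) ** snd p ** g)) -` {l} \<inter> space (W \<Otimes>\<^sub>M ?H)"
  have T0: "T0 \<in> sets (W \<Otimes>\<^sub>M ?H)" unfolding T0_def by (rule measurable_sets[OF fm]) simp
  have "emeasure W ((\<lambda>w. (w, k)) -` T0) = ennreal c" if k: "k \<in> space ?H" for k
  proof -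
    have K: "k \<in> GL_Zp" using k by (simp add: space_haar)
    have \<phi>: "(\<lambda>x. SN (x ** g)) \<in> measurable G (count_space UNIV)"
      by (intro SN_compose_measurable matrix_mult_GL_Qp_measurable const_GL_Qp_measurable g) simp
    have "(\<lambda>w. (w, k)) -` T0 = {w \<in> space W. SN (X s w ** k ** g) = l}"
      using k by (auto simp: T0_def space_pair_measure)
    also have "\<dots> = {w \<in> space W. SN ((matrix_inv k ** X s w ** k) ** g) = l}"
    proof (intro Collect_cong conj_cong refl)
      fix w assume w: "w \<in> space W"
      have "(matrix_inv k ** X s w ** k) ** g = matrix_inv k ** (X s w ** k ** g)" by (simp add: matrix_mul_assoc)
      then show "(SN (X s w ** k ** g) = l) = (SN ((matrix_inv k ** X s w ** k) ** g) = l)"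
        using K w s by (simp add: SN_mult_left_K GL_Qp_mult X_GL g GL_Zp_subset_GL_Qp matrix_inv_GL_Zp)
    qed
    finally show ?thesis using conjugate_law[OF s K \<phi>, of l] by (simp add: emeasure_eq_measure c_def)
  qed
  then have 1: "emeasure (W \<Otimes>\<^sub>M ?H) T0 = ennreal c"
    unfolding P.emeasure_pair_measure_alt2[OF T0]
    by (subst nn_integral_cong[where v="\<lambda>_. ennreal c"]) (simp_all add: H.emeasure_space_1)
  have "emeasure ?H (Pair w -` T0) = ennreal (pmf (step_law TYPE('p) (SN (X s w)) (SN g)) l)" if w: "w \<in> space W" for w
  proof -
    have "Pair w -` T0 = {k \<in> GL_Zp. SN (X s w ** k ** g) = l}"
      using w by (auto simp: T0_def space_pair_measure space_haar)
    then show ?thesis using step_law_double_coset[OF X_GL[OF s w] g, of l] by (simp add: H.emeasure_eq_measure)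
  qed
  then have "emeasure (W \<Otimes>\<^sub>M ?H) T0 = (\<integral>\<^sup>+w. ennreal (pmf (step_law TYPE('p) (SN (X s w)) (SN g)) l) \<partial>W)"
    unfolding H.emeasure_pair_measure_alt[OF T0] by (intro nn_integral_cong) auto
  also have "\<dots> = (\<integral>\<^sup>+\<mu>. ennreal (pmf (step_law TYPE('p) \<mu> (SN g)) l) \<partial>measure_pmf (m s))"
    unfolding m_def measure_pmf_law[OF prob_space_axioms SN_compose_measurable[OF X_measurable[OF s]]]
    by (rule nn_integral_distr[symmetric]) (use X_measurable[OF s] in auto)
  also have "\<dots> = ennreal (pmf (T s (SN g)) l)" by (simp add: T_def ennreal_pmf_bind)
  finally show ?thesis using 1 by (simp add: c_def)
qed

lemma past_event:
  assumes "0 \<le> u" "u \<le> t" "C \<in> sets G"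
  shows "X u -` C \<inter> space W \<in> sets (natural_filtration W G X t)"
proof -
  let ?P = "PiM {0..t} (\<lambda>_. G)"
  have "(\<lambda>f. f u) -` C \<inter> space ?P \<in> sets ?P"
    using assms by (intro measurable_sets[OF measurable_component_singleton]) auto
  then have "trajectory X t -` ((\<lambda>f. f u) -` C \<inter> space ?P) \<inter> space W \<in> sets (natural_filtration W G X t)"
    unfolding natural_filtration_def by (rule in_vimage_algebra)
  moreover have "trajectory X t -` ((\<lambda>f. f u) -` C \<inter> space ?P) \<inter> space W = X u -` C \<inter> space W"
    using assms X_GL by (auto simp: trajectory_def space_PiM space_G)
  ultimately show ?thesis by simp
qed

lemma past_event_fun:
  assumes "0 \<le> u" "u \<le> t" "\<phi> \<in> measurable G (count_space UNIV)"
  shows "{w \<in> space W. \<phi> (X u w) = l} \<in> sets (natural_filtration W G X t)"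
proof -
  have "X u -` (\<phi> -` {l} \<inter> space G) \<inter> space W \<in> sets (natural_filtration W G X t)"
    using assms by (intro past_event) (auto intro: measurable_sets)
  moreover have "X u -` (\<phi> -` {l} \<inter> space G) \<inter> space W = {w \<in> space W. \<phi> (X u w) = l}"
    using X_GL[OF assms(1)] by (auto simp: space_G)
  ultimately show ?thesis by simp
qed

lemma past_subset_events: "0 \<le> t \<Longrightarrow> sets (natural_filtration W G X t) \<subseteq> events"
  using indep_setD_ev2[OF increment_indep[of t 0]] by simp

lemma space_natural_filtration: "space (natural_filtration W G X t) = space W"
  by (simp add: natural_filtration_def)

text \<open>The increment is averaged over its law, which depends on \<open>s\<close> only, with the past held fixed.\<close>

lemma average_increment:
  assumes ts: "0 \<le> t" "0 \<le> s" and E: "E \<in> sets (natural_filtration W G X t)" and g: "g \<in> GL_Qp"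
    and \<phi>: "(\<lambda>p. \<phi> (fst p) (snd p)) \<in> measurable (G \<Otimes>\<^sub>M G) (count_space UNIV)"
    and q: "\<And>w. w \<in> E \<Longrightarrow> measure W {v \<in> space W. \<phi> (X s v) (X t w ** g) = l} = q"
  shows "measure W {w \<in> E. \<phi> (increment X t s w) (X t w ** g) = l} = measure W E * q"
proof -
  define T0 where "T0 = (\<lambda>p. \<phi> (fst p) (snd p)) -` {l} \<inter> space (G \<Otimes>\<^sub>M G)"
  have T0: "T0 \<in> sets (G \<Otimes>\<^sub>M G)" unfolding T0_def by (rule measurable_sets[OF \<phi>]) simp
  have Ev: "E \<in> sets W" "E \<subseteq> space W" using past_subset_events[OF ts(1)] E sets.sets_into_space by blast+
  have gm: "(\<lambda>x. x ** g) \<in> measurable G G"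
    by (intro matrix_mult_GL_Qp_measurable const_GL_Qp_measurable g) simp
  have Ym: "(\<lambda>w. X t w ** g) \<in> measurable W G" using measurable_compose[OF X_measurable[OF ts(1)] gm] .
  have mem: "(x, y) \<in> T0 \<longleftrightarrow> \<phi> x y = l" if "x \<in> GL_Qp" "y \<in> GL_Qp" for x y
    using that by (simp add: T0_def space_pair_measure space_G)
  have "measure W {w \<in> E. (increment X t s w, X t w ** g) \<in> T0} = measure W E * q"
  proof (rule average_independent_factor[OF prob_space_axioms increment_measurable[OF ts] Ym Ev(1) _ T0])
    fix A B assume AB: "A \<in> sets G" "B \<in> sets G"
    have "increment X t s -` A \<inter> space W \<in> sets (vimage_algebra (space W) (increment X t s) G)"
      using AB by (intro in_vimage_algebra)
    moreover have "(\<lambda>w. X t w ** g) -` B \<inter> space W = X t -` ((\<lambda>x. x ** g) -` B \<inter> space G) \<inter> space W"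
      using X_GL[OF ts(1)] by (auto simp: space_G)
    then have "(\<lambda>w. X t w ** g) -` B \<inter> space W \<in> sets (natural_filtration W G X t)"
      using past_event[OF ts(1) order_refl measurable_sets[OF gm AB(2)]] by simp
    then have "E \<inter> ((\<lambda>w. X t w ** g) -` B \<inter> space W) \<in> sets (natural_filtration W G X t)"
      by (rule sets.Int[OF E])
    ultimately show "measure W ((increment X t s -` A \<inter> space W) \<inter> (E \<inter> ((\<lambda>w. X t w ** g) -` B \<inter> space W)))
       = measure W (increment X t s -` A \<inter> space W) * measure W (E \<inter> ((\<lambda>w. X t w ** g) -` B \<inter> space W))"
      by (rule indep_setD[OF increment_indep[OF ts]])
  next
    fix w assume w: "w \<in> E"
    then have y: "X t w ** g \<in> GL_Qp" using Ev ts g by (auto intro: GL_Qp_mult X_GL)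
    have "(\<lambda>x. (x, X t w ** g)) \<in> measurable G (G \<Otimes>\<^sub>M G)" using y by (intro measurable_Pair) (auto simp: space_G)
    from measurable_compose[OF this \<phi>] have \<phi>y: "(\<lambda>x. \<phi> x (X t w ** g)) \<in> measurable G (count_space UNIV)" by simp
    have "{v \<in> space W. (increment X t s v, X t w ** g) \<in> T0} = {v \<in> space W. \<phi> (increment X t s v) (X t w ** g) = l}"
      using mem[OF increment_GL[OF ts] y] by auto
    then show "measure W {v \<in> space W. (increment X t s v, X t w ** g) \<in> T0} = q"
      using increment_law[OF ts \<phi>y, of l] q[OF w] by simp
  qed
  moreover have "{w \<in> E. (increment X t s w, X t w ** g) \<in> T0} = {w \<in> E. \<phi> (increment X t s w) (X t w ** g) = l}"
    using Ev ts g by (auto simp: mem increment_GL X_GL GL_Qp_mult subset_eq)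
  ultimately show ?thesis by simp
qed

text \<open>
  The factor \<open>g\<close> replaces the identity as initial state: a state of arbitrary singular numbers is
  needed for the semigroup property of the kernels \<open>T\<close>.
\<close>

lemma SN_markov:
  assumes ts: "0 \<le> t" "0 \<le> s" and E: "E \<in> sets (natural_filtration W G X t)" and g: "g \<in> GL_Qp"
    and \<nu>: "\<And>w. w \<in> E \<Longrightarrow> SN (X t w ** g) = \<nu>"
  shows "measure W {w \<in> E. SN (X (t + s) w ** g) = l} = measure W E * pmf (T s \<nu>) l"
proof -
  have Ev: "E \<subseteq> space W" using past_subset_events[OF ts(1)] E sets.sets_into_space by blast
  have "measure W {w \<in> E. SN (increment X t s w ** (X t w ** g)) = l} = measure W E * pmf (T s \<nu>) l"
  proof (rule average_increment[OF ts E g, where \<phi>="\<lambda>x y. SN (x ** y)"])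
    show "(\<lambda>p. SN (fst p ** snd p)) \<in> measurable (G \<Otimes>\<^sub>M G) (count_space UNIV)"
      by (intro SN_compose_measurable matrix_mult_GL_Qp_measurable) auto
    fix w assume "w \<in> E"
    then show "measure W {v \<in> space W. SN (X s v ** (X t w ** g)) = l} = pmf (T s \<nu>) l"
      using Ev ts g \<nu> by (subst law_X_mult) (auto intro: GL_Qp_mult X_GL)
  qed
  moreover have "{w \<in> E. SN (increment X t s w ** (X t w ** g)) = l} = {w \<in> E. SN (X (t + s) w ** g) = l}"
    using Ev X_increment[OF ts(1)] by (auto simp: matrix_mul_assoc subset_eq)
  ultimately show ?thesis by simp
qed

text \<open>
  An integer-valued function \<open>F\<close> for which \<open>F (X s y) - F y\<close> has the same law for all \<open>y\<close> turns the
  process into an integer-valued one with stationary independent increments.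
\<close>

lemma additive_functional_tendsto:
  fixes F :: "('p, 'n) pmat \<Rightarrow> int"
  assumes F: "F \<in> measurable G (count_space UNIV)"
    and add: "\<And>s y z. 0 \<le> s \<Longrightarrow> y \<in> GL_Qp \<Longrightarrow>
      measure W {w \<in> space W. F (X s w ** y) - F y = z} = measure W {w \<in> space W. F (X s w) = z}"
  shows "((\<lambda>t. measure W {w \<in> space W. F (X t w) = 0}) \<longlongrightarrow> 1) (at_right 0)"
proof -
  define r where "r t = law W (\<lambda>w. F (X t w))" for t
  have FX: "(\<lambda>w. F (X t w)) \<in> measurable W (count_space UNIV)" if "0 \<le> t" for t
    using measurable_compose[OF X_measurable[OF that] F] .
  have r: "pmf (r t) z = measure W {w \<in> space W. F (X t w) = z}" if "0 \<le> t" for t z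
    unfolding r_def by (rule pmf_law[OF prob_space_axioms FX[OF that]])
  have "r (s + t) = bind_pmf (r s) (\<lambda>x. map_pmf (\<lambda>y. x + y) (r t))" if st: "0 < s" "0 < t" for s t
  proof (rule pmf_eqI)
    fix i
    have joint: "measure W ({w \<in> space W. F (X (s + t) w) = i} \<inter> {w \<in> space W. F (X s w) = x}) = pmf (r s) x * pmf (r t) (i - x)" for x
    proof -
      let ?E = "{w \<in> space W. F (X s w) = x}"
      have "measure W {w \<in> ?E. F (increment X s t w ** (X s w ** mat 1)) - F (X s w ** mat 1) = i - x} = measure W ?E * pmf (r t) (i - x)"
      proof (rule average_increment[where \<phi>="\<lambda>x y. F (x ** y) - F y"])
        show "?E \<in> sets (natural_filtration W G X s)" using st by (intro past_event_fun F) auto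
        have 1: "(\<lambda>p. F (fst p ** snd p)) \<in> measurable (G \<Otimes>\<^sub>M G) (count_space UNIV)"
          by (rule measurable_compose[OF _ F]) (intro matrix_mult_GL_Qp_measurable, auto)
        have 2: "(\<lambda>p. F (snd p)) \<in> measurable (G \<Otimes>\<^sub>M G) (count_space UNIV)"
          by (rule measurable_compose[OF measurable_snd F])
        show "(\<lambda>p. F (fst p ** snd p) - F (snd p)) \<in> measurable (G \<Otimes>\<^sub>M G) (count_space UNIV)"
          by (rule measurable_compose_countable[OF _ 1, where f="\<lambda>i p. i - F (snd p)"])
            (rule measurable_compose[OF 2], simp)
        fix w assume "w \<in> ?E"
        then have "X s w ** mat 1 \<in> GL_Qp" using st by (simp add: X_GL)
        then show "measure W {v \<in> space W. F (X t v ** (X s w ** mat 1)) - F (X s w ** mat 1) = i - x} = pmf (r t) (i - x)"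
          using st by (subst add) (simp_all add: r)
      qed (use st GL_Qp_1 in auto)
      moreover have "{w \<in> ?E. F (increment X s t w ** (X s w ** mat 1)) - F (X s w ** mat 1) = i - x} = {w \<in> space W. F (X (s + t) w) = i} \<inter> ?E"
        using X_increment[of s] st by auto
      ultimately show ?thesis using st by (simp add: r)
    qed
    have ev: "{w \<in> space W. F (X (s + t) w) = i} \<in> events" using st by (intro event_measurable X_measurable F) auto
    have "ennreal (pmf (r (s + t)) i) = emeasure W {w \<in> space W. F (X (s + t) w) = i}"
      using st by (simp add: r emeasure_eq_measure)
    also have "\<dots> = (\<integral>\<^sup>+x. emeasure W ({w \<in> space W. F (X (s + t) w) = i} \<inter> {w \<in> space W. F (X s w) = x}) \<partial>count_space UNIV)"
      by (rule total_probability[OF FX ev]) (use st in simp)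
    also have "\<dots> = (\<integral>\<^sup>+x. ennreal (pmf (r s) x) * ennreal (pmf (map_pmf (\<lambda>y. x + y) (r t)) i) \<partial>count_space UNIV)"
    proof (rule nn_integral_cong)
      fix x
      have "pmf (map_pmf (\<lambda>y. x + y) (r t)) i = pmf (r t) (i - x)"
        using pmf_map_add[of x "r t" "i - x"] by simp
      then show "emeasure W ({w \<in> space W. F (X (s + t) w) = i} \<inter> {w \<in> space W. F (X s w) = x}) = ennreal (pmf (r s) x) * ennreal (pmf (map_pmf (\<lambda>y. x + y) (r t)) i)"
        by (simp only: emeasure_eq_measure joint) (simp add: ennreal_mult')
    qed
    also have "\<dots> = ennreal (pmf (bind_pmf (r s) (\<lambda>x. map_pmf (\<lambda>y. x + y) (r t))) i)"
      unfolding ennreal_pmf_bind nn_integral_measure_pmf ..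
    finally show "pmf (r (s + t)) i = pmf (bind_pmf (r s) (\<lambda>x. map_pmf (\<lambda>y. x + y) (r t))) i" by simp
  qed
  then have "((\<lambda>t. pmf (r t) 0) \<longlongrightarrow> 1) (at_right 0)" by (rule int_convolution_semigroup_tendsto)
  then show ?thesis
    by (rule Lim_transform_eventually) (auto simp: r eventually_at_right_field intro: exI[of _ 1])
qed

lemma log_det_tendsto:
  "((\<lambda>t. measure W {w \<in> space W. plog CARD('p) (padic_norm (det (X t w))) = 0}) \<longlongrightarrow> 1) (at_right 0)"
proof (rule additive_functional_tendsto)
  have "(\<lambda>A. log (real CARD('p)) (padic_norm (det A))) \<in> borel_measurable G"
    by (intro borel_measurable_log padic_norm_measurable det_measurable borel_measurable_const measurable_restrict_space1) simp
  then show "(\<lambda>A. plog CARD('p) (padic_norm (det A))) \<in> measurable G (count_space UNIV)"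
    unfolding plog_def by measurable
  fix s :: real and y and z :: int assume s: "0 \<le> s" and y: "y \<in> (GL_Qp :: ('p, 'n) pmat set)"
  have "plog CARD('p) (padic_norm (det (A ** y))) - plog CARD('p) (padic_norm (det y)) = plog CARD('p) (padic_norm (det A))"
    if A: "A \<in> GL_Qp" for A :: "('p, 'n) pmat"
  proof -
    have "det A \<noteq> 0" "det y \<noteq> 0" using A y by (simp_all add: GL_Qp_def invertible_det_nz)
    then obtain a b where ab: "padic_norm (det A) = real CARD('p) powi a" "padic_norm (det y) = real CARD('p) powi b"
      by (metis padic_norm_powi_ex)
    have "padic_norm (det (A ** y)) = real CARD('p) powi (a + b)"
      using prime_card_gt_1[where 'p='p] by (simp add: det_mul padic_norm_mult ab power_int_add)
    then show ?thesis using prime_card_gt_1[where 'p='p] by (simp add: ab plog_powi)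
  qed
  then show "measure W {w \<in> space W. plog CARD('p) (padic_norm (det (X s w ** y))) - plog CARD('p) (padic_norm (det y)) = z}
     = measure W {w \<in> space W. plog CARD('p) (padic_norm (det (X s w))) = z}"
    using X_GL[OF s] by (intro arg_cong[of _ _ "measure W"]) auto
qed

lemma column_log_measurable:
  "(\<lambda>A. plog CARD('p) (vec_norm (A *v axis a 1))) \<in> measurable G (count_space UNIV)"
proof -
  have "(\<lambda>A. log (real CARD('p)) (vec_norm (A *v axis a 1))) \<in> borel_measurable G"
    by (intro borel_measurable_log vec_norm_column_measurable borel_measurable_const measurable_restrict_space1) simp
  then show ?thesis unfolding plog_def by measurable
qed

lemma GL_Qp_mult_vec_nonzero:
  fixes v :: "('p padic, 'n) vec"
  assumes "A \<in> GL_Qp" "v \<noteq> 0" shows "A *v v \<noteq> 0"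
proof
  assume "A *v v = 0"
  then have "matrix_inv A *v (A *v v) = 0" by simp
  then show False using assms by (simp add: matrix_vector_mul_assoc matrix_inv_GL_Qp(2))
qed

text \<open>
  All vectors of norm \<open>1\<close> are equivalent under \<open>GL\<^sub>N(\<int>\<^sub>p)\<close>.  Matrices that carry a basis vector to a given
  vector are explicit if the vector has a unit at the same index; other basis vectors are reached via
  the sum of the two.
\<close>

lemma unit_vector_law:
  assumes s: "0 \<le> s" and u: "vec_norm u = 1"
  shows "measure W {w \<in> space W. plog CARD('p) (vec_norm (X s w *v u)) = z}
    = measure W {w \<in> space W. plog CARD('p) (vec_norm (X s w *v axis a 1)) = z}"
proof -
  have same: "measure W {w \<in> space W. plog CARD('p) (vec_norm (X s w *v u)) = z}
    = measure W {w \<in> space W. plog CARD('p) (vec_norm (X s w *v axis b 1)) = z}"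
    if u: "vec_norm u = 1" "padic_norm (u $ b) = 1" for u b
  proof -
    obtain k where k: "k \<in> GL_Zp" "k *v axis b 1 = u" using unimodular_column[OF u] by blast
    have "vec_norm ((matrix_inv k ** X s w ** k) *v axis b 1) = vec_norm (X s w *v u)" for w
    proof -
      have "(matrix_inv k ** X s w ** k) *v axis b 1 = matrix_inv k *v (X s w *v (k *v axis b 1))"
        by (simp add: matrix_vector_mul_assoc matrix_mul_assoc)
      then show ?thesis by (simp add: k vec_norm_GL_Zp matrix_inv_GL_Zp)
    qed
    then show ?thesis using conjugate_law[OF s k(1) column_log_measurable[of b], of z] by simp
  qed
  obtain b where b: "padic_norm (u $ b) = 1" using u by (metis vec_norm_attained)
  have "measure W {w \<in> space W. plog CARD('p) (vec_norm (X s w *v axis b 1)) = z}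
    = measure W {w \<in> space W. plog CARD('p) (vec_norm (X s w *v axis a 1)) = z}"
  proof (cases "a = b")
    case False
    let ?v = "axis a 1 + axis b 1 :: ('p padic, 'n) vec"
    have v: "padic_norm (?v $ a) = 1" "padic_norm (?v $ b) = 1" using False by (auto simp: axis_def)
    have "padic_norm (?v $ i) \<le> 1" for i using False by (auto simp: axis_def)
    then have "vec_norm ?v \<le> 1" by (rule vec_norm_leI)
    then have "vec_norm ?v = 1" using vec_norm_ge[of ?v a] v by simp
    then show ?thesis using same[of ?v a] same[of ?v b] v by simp
  qed simp
  then show ?thesis using same[OF u b] by simp
qed

text \<open>
  Each column of \<open>X s ** y\<close> is \<open>X s\<close> applied to a column of \<open>y\<close>, which is a scalar multiple of a vector
  of norm \<open>1\<close>; and the law of \<open>X s\<close> applied to such a vector does not depend on the vector.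
\<close>

lemma column_log_tendsto:
  "((\<lambda>t. measure W {w \<in> space W. plog CARD('p) (vec_norm (X t w *v axis a 1)) = 0}) \<longlongrightarrow> 1) (at_right 0)"
proof (rule additive_functional_tendsto[OF column_log_measurable])
  fix s :: real and y and z :: int assume s: "0 \<le> s" and y: "y \<in> (GL_Qp :: ('p, 'n) pmat set)"
  have "y *v axis a 1 \<noteq> 0" using y by (intro GL_Qp_mult_vec_nonzero) auto
  then obtain c u where c: "c \<noteq> 0" "y *v axis a 1 = c *s u" "vec_norm u = 1" by (rule vec_norm_normalize)
  then have u: "u \<noteq> 0" using vec_norm_scale[of 0 u] by auto
  have "plog CARD('p) (vec_norm ((X s w ** y) *v axis a 1)) - plog CARD('p) (vec_norm (y *v axis a 1)) = plog CARD('p) (vec_norm (X s w *v u))"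
    if w: "w \<in> space W" for w
  proof -
    have "X s w *v u \<noteq> 0" using X_GL[OF s w] u by (rule GL_Qp_mult_vec_nonzero)
    then obtain b where b: "vec_norm (X s w *v u) = real CARD('p) powi b" by (rule vec_norm_powi)
    obtain d where d: "padic_norm c = real CARD('p) powi d" using c(1) by (rule padic_norm_powi_ex)
    have "(X s w ** y) *v axis a 1 = c *s (X s w *v u)"
      by (simp add: c(2) vector_scalar_commute flip: matrix_vector_mul_assoc)
    then have "vec_norm ((X s w ** y) *v axis a 1) = real CARD('p) powi (d + b)"
      using prime_card_gt_1[where 'p='p] by (simp add: vec_norm_scale b d power_int_add)
    then show ?thesis using prime_card_gt_1[where 'p='p] by (simp add: c(2,3) vec_norm_scale b d plog_powi)
  qed
  then have "{w \<in> space W. plog CARD('p) (vec_norm ((X s w ** y) *v axis a 1)) - plog CARD('p) (vec_norm (y *v axis a 1)) = z}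
     = {w \<in> space W. plog CARD('p) (vec_norm (X s w *v u)) = z}" by auto
  then show "measure W {w \<in> space W. plog CARD('p) (vec_norm ((X s w ** y) *v axis a 1)) - plog CARD('p) (vec_norm (y *v axis a 1)) = z}
     = measure W {w \<in> space W. plog CARD('p) (vec_norm (X s w *v axis a 1)) = z}"
    using unit_vector_law[OF s c(3), of z a] by simp
qed

text \<open>Columns of norm \<open>1\<close> make the matrix integral, and then the determinant decides whether it is in the group.\<close>

lemma GL_Zp_of_logs:
  assumes A: "A \<in> GL_Qp" and det: "plog CARD('p) (padic_norm (det A)) = 0"
    and col: "\<And>a. plog CARD('p) (vec_norm (A *v axis a 1)) = 0"
  shows "A \<in> (GL_Zp :: ('p, 'n) pmat set)"
proof (rule GL_Zp_of_det)
  note p = prime_card_gt_1[where 'p='p]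
  have "det A \<noteq> 0" using A by (simp add: GL_Qp_def invertible_det_nz)
  then obtain b where "padic_norm (det A) = real CARD('p) powi b" by (rule padic_norm_powi_ex)
  then show "padic_norm (det A) = 1" using det p by (simp add: plog_powi)
  have "padic_norm (A $ i $ a) \<le> 1" for i a
  proof -
    have "A *v axis a 1 \<noteq> 0" using A by (intro GL_Qp_mult_vec_nonzero) auto
    then obtain b where "vec_norm (A *v axis a 1) = real CARD('p) powi b" by (rule vec_norm_powi)
    then have "vec_norm (A *v axis a 1) = 1" using col[of a] p by (simp add: plog_powi)
    then show ?thesis using vec_norm_ge[of "A *v axis a 1" i] by (simp add: matrix_axis_column column_def)
  qed
  then show "integral_mat A" by (simp add: integral_mat_def padic_ints_def)
qed

lemma pmf_m: "0 \<le> t \<Longrightarrow> pmf (m t) \<mu> = measure W {w \<in> space W. SN (X t w) = \<mu>}"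
  unfolding m_def by (rule pmf_law[OF prob_space_axioms SN_compose_measurable[OF X_measurable]])

text \<open>
  The process stays in \<open>GL\<^sub>N(\<int>\<^sub>p)\<close> for small times: the logarithms of the norms of its determinant and of
  its columns are finitely many integers, and each of them vanishes with probability tending to \<open>1\<close>.
\<close>

lemma m_tendsto: "((\<lambda>t. pmf (m t) 0) \<longlongrightarrow> 1) (at_right 0)"
proof -
  define D where "D t = {w \<in> space W. plog CARD('p) (padic_norm (det (X t w))) = 0}" for t
  define C where "C a t = {w \<in> space W. plog CARD('p) (vec_norm (X t w *v axis a 1)) = 0}" for a t
  have Dm: "D t \<in> events" if "0 \<le> t" for t
  proof -
    have "(\<lambda>A. log (real CARD('p)) (padic_norm (det A))) \<in> borel_measurable G"
      by (intro borel_measurable_log padic_norm_measurable det_measurable borel_measurable_const measurable_restrict_space1) simp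
    then have "(\<lambda>A. plog CARD('p) (padic_norm (det A))) \<in> measurable G (count_space UNIV)"
      unfolding plog_def by measurable
    then show ?thesis unfolding D_def using that by (intro event_measurable X_measurable)
  qed
  have Cm: "C a t \<in> events" if "0 \<le> t" for a t
    unfolding C_def using that by (intro event_measurable X_measurable column_log_measurable)
  have lower: "1 - ((1 - measure W (D t)) + (\<Sum>a\<in>UNIV. 1 - measure W (C a t))) \<le> pmf (m t) 0" if t: "0 \<le> t" for t
  proof -
    let ?K = "{w \<in> space W. SN (X t w) = 0}"
    have K: "?K \<in> events"
      by (rule event_measurable[OF X_measurable[OF t], where \<phi>=SN]) (intro SN_compose_measurable, simp)
    have "space W - ?K \<subseteq> (space W - D t) \<union> (\<Union>a. space W - C a t)"
      using GL_Zp_of_logs X_GL[OF t] SN_GL_Zp by (fastforce simp: D_def C_def)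
    then have "measure W (space W - ?K) \<le> measure W ((space W - D t) \<union> (\<Union>a. space W - C a t))"
      using Dm[OF t] Cm[OF t] by (intro finite_measure_mono) auto
    also have "\<dots> \<le> measure W (space W - D t) + measure W (\<Union>a. space W - C a t)"
      using Dm[OF t] Cm[OF t] by (intro measure_Un_le) auto
    also have "\<dots> \<le> measure W (space W - D t) + (\<Sum>a\<in>UNIV. measure W (space W - C a t))"
      using Cm[OF t] by (intro add_left_mono measure_UNION_le) auto
    finally show ?thesis using K Dm[OF t] Cm[OF t] by (simp add: prob_compl pmf_m t)
  qed
  show ?thesis
  proof (rule tendsto_sandwich[OF _ _ _ tendsto_const])
    have "((\<lambda>t. 1 - ((1 - measure W (D t)) + (\<Sum>a\<in>UNIV. 1 - measure W (C a t)))) \<longlongrightarrow> 1 - ((1 - 1) + (\<Sum>a\<in>(UNIV :: 'n set). 1 - 1))) (at_right 0)"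
      unfolding D_def C_def by (intro tendsto_intros log_det_tendsto column_log_tendsto)
    then show "((\<lambda>t. 1 - ((1 - measure W (D t)) + (\<Sum>a\<in>UNIV. 1 - measure W (C a t)))) \<longlongrightarrow> 1) (at_right 0)" by simp
    show "\<forall>\<^sub>F t in at_right 0. 1 - ((1 - measure W (D t)) + (\<Sum>a\<in>UNIV. 1 - measure W (C a t))) \<le> pmf (m t) 0"
      by (rule eventually_at_rightI[of 0 1], rule lower) auto
  qed (simp add: pmf_le_1)
qed

lemma T_add:
  assumes st: "0 < s" "0 < t" shows "T (s + t) l = bind_pmf (T s l) (T t)"
proof (cases "l \<in> Sig")
  case False
  then show ?thesis by (simp add: T_def step_law_def bind_return_pmf)
next
  case True
  define g where "g = (diag_p l :: ('p, 'n) pmat)"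
  have g: "g \<in> GL_Qp" "SN g = l" using True by (simp_all add: g_def diag_p_GL_Qp SN_diag_p)
  have \<phi>: "(\<lambda>x. SN (x ** g)) \<in> measurable G (count_space UNIV)"
    by (intro SN_compose_measurable matrix_mult_GL_Qp_measurable const_GL_Qp_measurable g) simp
  show ?thesis
  proof (rule pmf_eqI)
    fix l'
    let ?A = "{w \<in> space W. SN (X (s + t) w ** g) = l'}"
    have A: "?A \<in> events" using st by (intro event_measurable[OF X_measurable \<phi>]) simp
    have Z: "(\<lambda>w. SN (X s w ** g)) \<in> measurable W (count_space UNIV)"
      using measurable_compose[OF X_measurable \<phi>] st by simp
    have "ennreal (pmf (T (s + t) l) l') = emeasure W ?A"
      using law_X_mult[of "s + t" g l'] st g by (simp add: emeasure_eq_measure)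
    also have "\<dots> = (\<integral>\<^sup>+\<nu>. emeasure W (?A \<inter> {w \<in> space W. SN (X s w ** g) = \<nu>}) \<partial>count_space UNIV)"
      by (rule total_probability[OF Z A])
    also have "\<dots> = (\<integral>\<^sup>+\<nu>. ennreal (pmf (T s l) \<nu>) * ennreal (pmf (T t \<nu>) l') \<partial>count_space UNIV)"
    proof (rule nn_integral_cong)
      fix \<nu>
      let ?E = "{w \<in> space W. SN (X s w ** g) = \<nu>}"
      have "?E \<in> sets (natural_filtration W G X s)" using st by (intro past_event_fun \<phi>) auto
      then have "measure W {w \<in> ?E. SN (X (s + t) w ** g) = l'} = measure W ?E * pmf (T t \<nu>) l'"
        using st g by (intro SN_markov) auto
      moreover have "{w \<in> ?E. SN (X (s + t) w ** g) = l'} = ?A \<inter> ?E" by auto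
      moreover have "measure W ?E = pmf (T s l) \<nu>" using law_X_mult[of s g \<nu>] st g by simp
      ultimately show "emeasure W (?A \<inter> ?E) = ennreal (pmf (T s l) \<nu>) * ennreal (pmf (T t \<nu>) l')"
        by (simp add: emeasure_eq_measure ennreal_mult')
    qed
    also have "\<dots> = ennreal (pmf (bind_pmf (T s l) (T t)) l')"
      unfolding ennreal_pmf_bind nn_integral_measure_pmf ..
    finally show "pmf (T (s + t) l) l' = pmf (bind_pmf (T s l) (T t)) l'" by simp
  qed
qed

lemma compound_poisson_kernels:
  "\<exists>c M. 0 \<le> c \<and> set_pmf M \<subseteq> Sig \<and>
    (\<forall>t>0. \<forall>l. T t l = bind_pmf (poisson_law (c * t)) (\<lambda>k. kernel_power (\<lambda>z. bind_pmf M (\<lambda>\<mu>. step_law TYPE('p) \<mu> z)) k l))"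
proof -
  interpret convolution_semigroup "step_law TYPE('p)" 0 m T
    by unfold_locales (simp_all add: step_law_zero_left step_law_zero_right T_def[symmetric] T_add m_tendsto)
  have supp: "\<mu> \<in> Sig" if "\<mu> \<in> set_pmf (m t)" "0 < t" for \<mu> t
  proof -
    have "measure W {w \<in> space W. SN (X t w) = \<mu>} \<noteq> 0" using that pmf_m[of t \<mu>] by (simp add: set_pmf_iff)
    then have "{w \<in> space W. SN (X t w) = \<mu>} \<noteq> {}" by (metis measure_empty)
    then show ?thesis using X_GL[of t] that SN_Sig by auto
  qed
  show ?thesis using compound_poisson supp zero_Sig by (metis subsetI)
qed

end

section \<open>The compound Poisson product\<close>

text \<open>The restriction makes \<open>Sig\<close> the whole space, as the data of the process require.\<close>

definition signature_measure :: "'n::{finite, linorder} tuple pmf \<Rightarrow> 'n tuple measure" where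
  "signature_measure M = restrict_space (measure_pmf M) Sig"

lemma sets_signature_measure: "sets (signature_measure M) = sets (count_space Sig)"
  by (auto simp: signature_measure_def sets_restrict_space)

lemma space_signature_measure: "space (signature_measure M) = Sig"
  using sets_eq_imp_space_eq[OF sets_signature_measure] by simp

lemma emeasure_signature_measure: "A \<subseteq> Sig \<Longrightarrow> emeasure (signature_measure M) A = emeasure (measure_pmf M) A"
  unfolding signature_measure_def by (rule emeasure_restrict_space) auto

lemma prob_space_signature_measure: "set_pmf M \<subseteq> Sig \<Longrightarrow> prob_space (signature_measure M)"
  by (rule prob_spaceI)
    (simp add: space_signature_measure emeasure_signature_measure measure_pmf.emeasure_eq_1_AE AE_measure_pmf_iff subset_eq)

text \<open>
  A realisation of the data that define the compound Poisson product, where the \<open>V i\<close> have the fixed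
  two-sided invariant Haar measure as law.
\<close>

locale Y_realisation = prob_space W for W :: "'a measure" +
  fixes M :: "'n::{finite, linorder} tuple pmf" and c :: real and P :: "real \<Rightarrow> 'a \<Rightarrow> nat"
    and nu :: "nat \<Rightarrow> 'a \<Rightarrow> 'n tuple" and U V :: "nat \<Rightarrow> 'a \<Rightarrow> ('p::prime_card, 'n) pmat"
  assumes data: "Y_data W (signature_measure M) c P nu U V"
    and M_Sig: "set_pmf M \<subseteq> Sig"
    and V_haar: "distr W haar (V i) = haar"
    and c_nonneg: "0 \<le> c"
begin

definition source :: "Y_source \<Rightarrow> 'a set set" where
  "source src = (case src of
     Src_P \<Rightarrow> sets (vimage_algebra (space W) (\<lambda>w. \<lambda>t\<in>{0..}. P t w) (PiM {0..} (\<lambda>_. count_space UNIV)))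
   | Src_nu i \<Rightarrow> sets (vimage_algebra (space W) (nu i) (signature_measure M))
   | Src_U i \<Rightarrow> sets (vimage_algebra (space W) (U i) borel_GL_Zp)
   | Src_V i \<Rightarrow> sets (vimage_algebra (space W) (V i) borel_GL_Zp))"

text \<open>The events that are determined by the variables listed in \<open>S\<close>.\<close>

definition generated :: "Y_source set \<Rightarrow> 'a measure" where
  "generated S = sigma (space W) (\<Union>src\<in>S. source src)"

text \<open>The sources that determine the whole process \<open>P\<close> and the product after \<open>k\<close> factors.\<close>

definition past :: "nat \<Rightarrow> Y_source set" where
  "past k = insert Src_P (\<Union>i<k. {Src_nu i, Src_U i, Src_V i})"

lemma past_simps: "Src_P \<in> past k" "Src_nu i \<in> past k \<longleftrightarrow> i < k" "Src_U i \<in> past k \<longleftrightarrow> i < k" "Src_V i \<in> past k \<longleftrightarrow> i < k"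
  by (auto simp: past_def)

lemma past_mono: "k \<le> k' \<Longrightarrow> past k \<subseteq> past k'"
  unfolding past_def by fastforce

lemma source_indep: "indep_sets source UNIV"
  using data unfolding Y_data_def source_def by blast

lemma source_events: "source src \<subseteq> events"
  using source_indep unfolding indep_sets_def by blast

lemma source_Int_stable: "Int_stable (source src)"
  unfolding source_def by (cases src) (simp_all add: sets.Int_stable)

lemma space_generated [simp]: "space (generated S) = space W"
  unfolding generated_def by (rule space_measure_of) (use source_events sets.sets_into_space in blast)

lemma sets_generated: "sets (generated S) = sigma_sets (space W) (\<Union>src\<in>S. source src)"
  unfolding generated_def by (rule sets_measure_of) (use source_events sets.sets_into_space in blast)

lemma source_generated: "src \<in> S \<Longrightarrow> source src \<subseteq> sets (generated S)"
  unfolding sets_generated by (auto intro: sigma_sets.Basic)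

lemma generated_mono: "S \<subseteq> S' \<Longrightarrow> sets (generated S) \<subseteq> sets (generated S')"
  unfolding sets_generated by (intro sigma_sets_mono') auto

lemma generated_events: "sets (generated S) \<subseteq> events"
  unfolding sets_generated using source_events by (intro sets.sigma_sets_subset) auto

lemma generated_indep:
  assumes "S \<inter> S' = {}" "A \<in> sets (generated S)" "B \<in> sets (generated S')"
  shows "prob (A \<inter> B) = prob A * prob B"
proof -
  let ?I = "case_bool S S'"
  have "indep_sets (\<lambda>b. sigma_sets (space W) (\<Union>i\<in>?I b. source i)) UNIV"
    by (rule indep_sets_collect_sigma)
      (use assms(1) in \<open>auto simp: disjoint_family_on_def source_Int_stable split: bool.splits intro: indep_sets_mono[OF source_indep]\<close>)
  then have "prob (\<Inter>b\<in>UNIV. case_bool A B b) = (\<Prod>b\<in>UNIV. prob (case_bool A B b))"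
    using assms(2,3) by (intro indep_setsD) (auto simp: sets_generated split: bool.splits)
  then show ?thesis by (simp add: UNIV_bool Int_commute mult.commute)
qed

lemma generated_measurable:
  assumes "src \<in> S" "f \<in> measurable W N" "source src = sets (vimage_algebra (space W) f N)"
  shows "f \<in> measurable (generated S) N"
proof (rule measurableI)
  fix A assume "A \<in> sets N"
  then have "f -` A \<inter> space W \<in> source src" unfolding assms(3) by (rule in_vimage_algebra)
  then show "f -` A \<inter> space (generated S) \<in> sets (generated S)" using source_generated[OF assms(1)] by auto
qed (use measurable_space[OF assms(2)] in simp)

lemma P_process: "0 \<le> t \<Longrightarrow> P t \<in> measurable W (count_space UNIV)"
  using data by (simp add: Y_data_def poisson_process_def process_def)

lemma P_start: "w \<in> space W \<Longrightarrow> P 0 w = 0"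
  using data by (simp add: Y_data_def poisson_process_def)

lemma P_mono: "w \<in> space W \<Longrightarrow> 0 \<le> s \<Longrightarrow> s \<le> t \<Longrightarrow> P s w \<le> P t w"
  using data by (auto simp: Y_data_def poisson_process_def mono_on_def)

lemma P_generated:
  assumes "Src_P \<in> S" "0 \<le> t" shows "P t \<in> measurable (generated S) (count_space UNIV)"
proof -
  have "(\<lambda>w. \<lambda>t\<in>{0..}. P t w) \<in> measurable (generated S) (PiM {0..} (\<lambda>_. count_space UNIV))"
    by (rule generated_measurable[OF assms(1)]) (auto intro!: measurable_restrict P_process simp: source_def)
  from measurable_compose[OF this measurable_component_singleton[of t]]
  show ?thesis using assms(2) by simp
qed

lemma nu_generated:
  assumes "Src_nu i \<in> S" shows "nu i \<in> measurable (generated S) (count_space Sig)"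
proof -
  have "nu i \<in> measurable (generated S) (signature_measure M)"
    by (rule generated_measurable[OF assms]) (use data in \<open>simp_all add: source_def Y_data_def has_law_def\<close>)
  then show ?thesis using measurable_cong_sets[OF refl sets_signature_measure] by blast
qed

lemma haar_cong: "haar_GL_Zp H \<Longrightarrow> f \<in> measurable W H \<Longrightarrow> f \<in> measurable W borel_GL_Zp"
  unfolding haar_GL_Zp_def using measurable_cong_sets[OF refl] by blast

lemma UV_measurable: "U i \<in> measurable W borel_GL_Zp" "V i \<in> measurable W borel_GL_Zp"
proof -
  have "\<exists>H. haar_GL_Zp H \<and> has_law W (U i) H" "\<exists>H. haar_GL_Zp H \<and> has_law W (V i) H"
    using data by (simp_all only: Y_data_def)
  then show "U i \<in> measurable W borel_GL_Zp" "V i \<in> measurable W borel_GL_Zp"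
    by (auto simp only: has_law_def intro: haar_cong)
qed

lemma UV_generated:
  "Src_U i \<in> S \<Longrightarrow> U i \<in> measurable (generated S) borel_GL_Zp"
  "Src_V i \<in> S \<Longrightarrow> V i \<in> measurable (generated S) borel_GL_Zp"
  by (erule generated_measurable[OF _ UV_measurable(1)], simp add: source_def)
    (erule generated_measurable[OF _ UV_measurable(2)], simp add: source_def)

lemma K_measurable: "f \<in> measurable N borel_GL_Zp \<Longrightarrow> f \<in> measurable N (haar :: ('p, 'n) pmat measure)"
  using measurable_cong_sets[OF refl sets_haar] by blast

lemma K_GL_Qp_measurable: "f \<in> measurable N borel_GL_Zp \<Longrightarrow> f \<in> measurable N (borel_GL_Qp :: ('p, 'n) pmat measure)"
  by (drule K_measurable, drule measurable_compose[OF _ haar_GL_Qp_measurable])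

definition Y :: "nat \<Rightarrow> 'a \<Rightarrow> ('p, 'n) pmat" where
  "Y k w = Y_product (\<lambda>i. nu i w) (\<lambda>i. U i w) (\<lambda>i. V i w) k"

lemma Y_simps: "Y 0 w = mat 1" "Y (Suc k) w = U k w ** diag_p (nu k w) ** V k w ** Y k w"
  by (simp_all add: Y_def)

lemma Y_generated:
  assumes "\<And>i. i < k \<Longrightarrow> Src_nu i \<in> S \<and> Src_U i \<in> S \<and> Src_V i \<in> S"
  shows "Y k \<in> measurable (generated S) borel_GL_Qp"
  using assms
proof (induction k)
  case 0
  show ?case unfolding Y_simps by (rule const_GL_Qp_measurable[OF GL_Qp_1])
next
  case (Suc k)
  have k: "Src_nu k \<in> S" "Src_U k \<in> S" "Src_V k \<in> S" using Suc.prems by auto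
  have "diag_p \<in> measurable (count_space Sig) (borel_GL_Qp :: ('p, 'n) pmat measure)"
    by (auto simp: space_restrict_space diag_p_GL_Qp)
  then have "(\<lambda>w. diag_p (nu k w)) \<in> measurable (generated S) (borel_GL_Qp :: ('p, 'n) pmat measure)"
    by (rule measurable_compose[OF nu_generated[OF k(1)]])
  moreover have "Y k \<in> measurable (generated S) borel_GL_Qp" using Suc by auto
  ultimately show ?case unfolding Y_simps
    by (rule matrix_mult_GL_Qp_measurable[OF matrix_mult_GL_Qp_measurable[OF matrix_mult_GL_Qp_measurable[OF
        K_GL_Qp_measurable[OF UV_generated(1)[OF k(2)]]] K_GL_Qp_measurable[OF UV_generated(2)[OF k(3)]]]])
qed

lemma all_sources: "f \<in> measurable (generated UNIV) N \<Longrightarrow> f \<in> measurable W N"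
  by (rule measurableI) (use measurable_space[of f] measurable_sets[of f] generated_events[of UNIV] in fastforce)+

lemma nu_Sig: "w \<in> space W \<Longrightarrow> nu i w \<in> Sig"
  using measurable_space[OF all_sources[OF nu_generated[of i]]] by simp

lemma nu_event:
  assumes "Src_nu i \<in> S" shows "{w \<in> space W. nu i w = \<mu>} \<in> sets (generated S)"
proof -
  have "nu i -` ({\<mu>} \<inter> Sig) \<inter> space (generated S) \<in> sets (generated S)"
    by (rule measurable_sets[OF nu_generated[OF assms]]) auto
  moreover have "nu i -` ({\<mu>} \<inter> Sig) \<inter> space (generated S) = {w \<in> space W. nu i w = \<mu>}"
    using nu_Sig by auto
  ultimately show ?thesis by simp
qed

lemma SN_Y_event:
  assumes "\<And>i. i < k \<Longrightarrow> Src_nu i \<in> S \<and> Src_U i \<in> S \<and> Src_V i \<in> S"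
  shows "{w \<in> space W. SN (Y k w) = l} \<in> sets (generated S)"
proof -
  have "(\<lambda>w. SN (Y k w)) -` {l} \<inter> space (generated S) \<in> sets (generated S)"
    by (rule measurable_sets[OF SN_compose_measurable[OF Y_generated[OF assms]]]) auto
  then show ?thesis by (simp add: vimage_def Int_def conj_commute)
qed

definition R :: "'n tuple \<Rightarrow> 'n tuple pmf" where
  "R z = bind_pmf M (\<lambda>\<mu>. step_law TYPE('p) \<mu> z)"

lemma prob_nu: "prob {w \<in> space W. nu i w = \<mu>} = pmf M \<mu>"
proof (cases "\<mu> \<in> Sig")
  case True
  have nu: "nu i \<in> measurable W (signature_measure M)" "distr W (signature_measure M) (nu i) = signature_measure M"
    using data by (simp_all add: Y_data_def has_law_def)
  have "emeasure (signature_measure M) {\<mu>} = emeasure W (nu i -` {\<mu>} \<inter> space W)"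
    by (subst nu(2)[symmetric], rule emeasure_distr[OF nu(1)]) (use True in \<open>simp add: sets_signature_measure\<close>)
  also have "nu i -` {\<mu>} \<inter> space W = {w \<in> space W. nu i w = \<mu>}" by auto
  finally show ?thesis using True by (simp add: emeasure_signature_measure emeasure_pmf_single emeasure_eq_measure)
next
  case False
  then have "{w \<in> space W. nu i w = \<mu>} = {}" using nu_Sig by auto
  then show ?thesis using False M_Sig by (metis measure_empty pmf_eq_0_set_pmf subsetD)
qed

text \<open>
  The left factor \<open>U\<close> does not change singular numbers, and \<open>V\<close> is Haar distributed and independent
  of everything before: one more factor moves \<open>SN\<close> by the kernel of the double coset product.
\<close>

lemma chain_step:
  assumes E: "E \<in> sets (generated (past k))" and z: "\<And>w. w \<in> E \<Longrightarrow> SN (Y k w) = z"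
  shows "prob {w \<in> E. SN (Y (Suc k) w) = l} = prob E * pmf (R z) l"
proof -
  have Ev: "E \<in> events" "E \<subseteq> space W" using E generated_events sets.sets_into_space by blast+
  have Yk: "Y k w \<in> GL_Qp" if "w \<in> space W" for k w
    by (rule measurable_GL_QpD[OF all_sources[OF Y_generated] that]) simp
  have K: "U k w \<in> GL_Zp" "V k w \<in> GL_Zp" if "w \<in> space W" for w
    using measurable_space[OF all_sources[OF UV_generated(1)] that] measurable_space[OF all_sources[OF UV_generated(2)] that]
    by (simp_all add: space_restrict_space)
  define Eq where "Eq \<mu> = E \<inter> {w \<in> space W. nu k w = \<mu>}" for \<mu>
  have Eq_gen: "Eq \<mu> \<in> sets (generated (insert (Src_nu k) (past k)))" for \<mu>
    unfolding Eq_def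
  proof (rule sets.Int)
    show "E \<in> sets (generated (insert (Src_nu k) (past k)))" using E generated_mono[of "past k" "insert (Src_nu k) (past k)"] by blast
  qed (simp add: nu_event)
  have Eq_ev: "Eq \<mu> \<in> events" for \<mu> using Eq_gen generated_events by blast
  have Eq_prob: "prob (Eq \<mu>) = prob E * pmf M \<mu>" for \<mu>
  proof -
    have "{w \<in> space W. nu k w = \<mu>} \<in> sets (generated {Src_nu k})" by (simp add: nu_event)
    then have "prob (Eq \<mu>) = prob E * prob {w \<in> space W. nu k w = \<mu>}"
      unfolding Eq_def using generated_indep[OF _ E, of "{Src_nu k}"] by (simp add: past_simps)
    then show ?thesis by (simp add: prob_nu)
  qed
  have step: "prob {w \<in> Eq \<mu>. SN (Y (Suc k) w) = l} = prob E * (pmf M \<mu> * pmf (step_law TYPE('p) \<mu> z) l)" for \<mu>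
  proof (cases "\<mu> \<in> Sig")
    case False
    then have \<mu>: "pmf M \<mu> = 0" using M_Sig by (metis pmf_eq_0_set_pmf subsetD)
    have "prob {w \<in> Eq \<mu>. SN (Y (Suc k) w) = l} \<le> prob (Eq \<mu>)"
      by (rule finite_measure_mono[OF _ Eq_ev]) auto
    then show ?thesis using Eq_prob[of \<mu>] by (simp add: \<mu> measure_le_0_iff)
  next
    case True
    let ?D = "diag_p \<mu> :: ('p, 'n) pmat"
    let ?\<phi> = "\<lambda>q :: ('p, 'n) pmat \<times> ('p, 'n) pmat. SN (?D ** fst q ** snd q)"
    have \<phi>: "?\<phi> \<in> measurable (haar \<Otimes>\<^sub>M borel_GL_Qp) (count_space UNIV)"
      by (intro SN_compose_measurable matrix_mult_GL_Qp_measurable const_GL_Qp_measurable diag_p_GL_Qp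
          measurable_compose[OF measurable_fst haar_GL_Qp_measurable] measurable_snd)
    define T0 where "T0 = ?\<phi> -` {l} \<inter> space ((haar :: ('p, 'n) pmat measure) \<Otimes>\<^sub>M borel_GL_Qp)"
    have T0: "T0 \<in> sets (haar \<Otimes>\<^sub>M borel_GL_Qp)" unfolding T0_def by (rule measurable_sets[OF \<phi>]) simp
    have mem: "(x, y) \<in> T0 \<longleftrightarrow> SN (?D ** x ** y) = l" if "x \<in> GL_Zp" "y \<in> GL_Qp" for x y
      using that by (simp add: T0_def space_pair_measure space_haar space_restrict_space)
    have Vm: "V k \<in> measurable (generated {Src_V k}) haar" by (intro K_measurable UV_generated) simp
    have Vm': "V k \<in> measurable W haar" by (intro K_measurable all_sources UV_generated) simp
    have Ym: "Y k \<in> measurable (generated (insert (Src_nu k) (past k))) borel_GL_Qp"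
      by (rule Y_generated) (simp add: past_simps)
    have "prob {w \<in> Eq \<mu>. (V k w, Y k w) \<in> T0} = prob (Eq \<mu>) * pmf (step_law TYPE('p) \<mu> z) l"
    proof (rule average_independent_factor[OF prob_space_axioms Vm' all_sources[OF Y_generated] Eq_ev _ T0])
      fix A B assume AB: "A \<in> sets (haar :: ('p, 'n) pmat measure)" "B \<in> sets (borel_GL_Qp :: ('p, 'n) pmat measure)"
      have "V k -` A \<inter> space W \<in> sets (generated {Src_V k})" using measurable_sets[OF Vm AB(1)] by simp
      moreover have "Y k -` B \<inter> space W \<in> sets (generated (insert (Src_nu k) (past k)))" using measurable_sets[OF Ym AB(2)] by simp
      then have "Eq \<mu> \<inter> (Y k -` B \<inter> space W) \<in> sets (generated (insert (Src_nu k) (past k)))" by (rule sets.Int[OF Eq_gen])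
      ultimately show "prob (V k -` A \<inter> space W \<inter> (Eq \<mu> \<inter> (Y k -` B \<inter> space W))) = prob (V k -` A \<inter> space W) * prob (Eq \<mu> \<inter> (Y k -` B \<inter> space W))"
        by (rule generated_indep[rotated]) (simp add: past_simps)
    next
      fix w assume w: "w \<in> Eq \<mu>"
      then have ws: "w \<in> space W" "SN (Y k w) = z" using z by (auto simp: Eq_def)
      have "{x \<in> GL_Zp. SN (?D ** x ** Y k w) = l} \<in> sets haar"
      proof -
        have "(\<lambda>x. SN (?D ** x ** Y k w)) -` {l} \<inter> space (haar :: ('p, 'n) pmat measure) \<in> sets haar"
          by (rule measurable_sets[OF triple_measurable[OF diag_p_GL_Qp Yk[OF ws(1)] haar_GL_Qp_measurable]]) simp
        then show ?thesis by (simp add: space_haar vimage_def Int_def conj_commute)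
      qed
      then have "measure (distr W haar (V k)) {x \<in> GL_Zp. SN (?D ** x ** Y k w) = l} = prob (V k -` {x \<in> GL_Zp. SN (?D ** x ** Y k w) = l} \<inter> space W)"
        by (rule measure_distr[OF Vm'])
      moreover have "V k -` {x \<in> GL_Zp. SN (?D ** x ** Y k w) = l} \<inter> space W = {v \<in> space W. (V k v, Y k w) \<in> T0}"
        using K mem Yk[OF ws(1)] by auto
      moreover have "pmf (step_law TYPE('p) \<mu> z) l = measure haar {x \<in> GL_Zp. SN (?D ** x ** Y k w) = l}"
        using step_law_double_coset[OF diag_p_GL_Qp[of \<mu>] Yk[OF ws(1), of k], of l] by (simp only: SN_diag_p[OF True] ws(2))
      ultimately show "prob {v \<in> space W. (V k v, Y k w) \<in> T0} = pmf (step_law TYPE('p) \<mu> z) l"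
        by (simp only: V_haar)
    qed simp
    moreover have "{w \<in> Eq \<mu>. (V k w, Y k w) \<in> T0} = {w \<in> Eq \<mu>. SN (Y (Suc k) w) = l}"
    proof (intro Collect_cong conj_cong refl)
      fix w assume w: "w \<in> Eq \<mu>"
      then have ws: "w \<in> space W" "nu k w = \<mu>" by (auto simp: Eq_def)
      have "Y (Suc k) w = U k w ** (?D ** V k w ** Y k w)" by (simp add: Y_simps ws matrix_mul_assoc)
      then have "SN (Y (Suc k) w) = SN (?D ** V k w ** Y k w)"
        using K[OF ws(1)] Yk[OF ws(1)] by (simp add: SN_mult_left_K GL_Qp_mult diag_p_GL_Qp GL_Zp_subset_GL_Qp)
      then show "((V k w, Y k w) \<in> T0) = (SN (Y (Suc k) w) = l)"
        using mem[OF K(2)[OF ws(1)] Yk[OF ws(1)]] by simp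
    qed
    ultimately show ?thesis by (simp add: Eq_prob mult.assoc)
  qed
  let ?A = "{w \<in> E. SN (Y (Suc k) w) = l}"
  have A: "?A \<in> events"
  proof -
    have "E \<inter> {w \<in> space W. SN (Y (Suc k) w) = l} \<in> events"
      using Ev(1) SN_Y_event[of "Suc k" UNIV l] generated_events by blast
    moreover have "E \<inter> {w \<in> space W. SN (Y (Suc k) w) = l} = ?A" using Ev by auto
    ultimately show ?thesis by simp
  qed
  have "nu k \<in> measurable W (count_space UNIV)"
    using measurable_compose[OF all_sources[OF nu_generated[of k]], of "\<lambda>x. x" "count_space UNIV"] by simp
  from total_probability[OF this A]
  have "emeasure W ?A = (\<integral>\<^sup>+\<mu>. emeasure W (?A \<inter> {w \<in> space W. nu k w = \<mu>}) \<partial>count_space UNIV)" .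
  also have "\<dots> = (\<integral>\<^sup>+\<mu>. ennreal (prob E) * (ennreal (pmf M \<mu>) * ennreal (pmf (step_law TYPE('p) \<mu> z) l)) \<partial>count_space UNIV)"
  proof (rule nn_integral_cong)
    fix \<mu>
    have "?A \<inter> {w \<in> space W. nu k w = \<mu>} = {w \<in> Eq \<mu>. SN (Y (Suc k) w) = l}" by (auto simp: Eq_def)
    then show "emeasure W (?A \<inter> {w \<in> space W. nu k w = \<mu>}) = ennreal (prob E) * (ennreal (pmf M \<mu>) * ennreal (pmf (step_law TYPE('p) \<mu> z) l))"
      by (simp only: emeasure_eq_measure step) (simp add: ennreal_mult')
  qed
  also have "\<dots> = ennreal (prob E) * ennreal (pmf (R z) l)"
    unfolding R_def ennreal_pmf_bind nn_integral_measure_pmf by (rule nn_integral_cmult) simp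
  finally show ?thesis by (simp add: emeasure_eq_measure flip: ennreal_mult')
qed

text \<open>The process \<open>P\<close> belongs to \<open>past k\<close>, so \<open>E\<close> may also restrict the numbers of factors at given times.\<close>

lemma chain_power:
  assumes E: "E \<in> sets (generated (past k))" and z: "\<And>w. w \<in> E \<Longrightarrow> SN (Y k w) = z"
  shows "prob {w \<in> E. SN (Y (k + j) w) = l} = prob E * pmf (kernel_power R j z) l"
proof (induction j arbitrary: l)
  case 0
  have "{w \<in> E. SN (Y k w) = l} = (if l = z then E else {})" using z by auto
  then show ?case by (simp add: pmf_return)
next
  case (Suc j)
  let ?A = "{w \<in> E. SN (Y (k + Suc j) w) = l}"
  have Ev: "E \<in> events" "E \<subseteq> space W" using E generated_events sets.sets_into_space by blast+
  have E': "E \<in> sets (generated (past (k + j)))" using E generated_mono[OF past_mono, of k "k + j"] by auto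
  have "E \<inter> {w \<in> space W. SN (Y (k + Suc j) w) = l} \<in> events"
    using Ev(1) SN_Y_event[of "k + Suc j" UNIV l] generated_events by blast
  moreover have "E \<inter> {w \<in> space W. SN (Y (k + Suc j) w) = l} = ?A" using Ev by auto
  ultimately have A: "?A \<in> events" by simp
  have "(\<lambda>w. SN (Y (k + j) w)) \<in> measurable W (count_space UNIV)"
    by (intro SN_compose_measurable all_sources Y_generated) simp
  from total_probability[OF this A]
  have "emeasure W ?A = (\<integral>\<^sup>+y. emeasure W (?A \<inter> {w \<in> space W. SN (Y (k + j) w) = y}) \<partial>count_space UNIV)" .
  also have "\<dots> = (\<integral>\<^sup>+y. ennreal (prob E) * (ennreal (pmf (kernel_power R j z) y) * ennreal (pmf (R y) l)) \<partial>count_space UNIV)"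
  proof (rule nn_integral_cong)
    fix y
    let ?E = "E \<inter> {w \<in> space W. SN (Y (k + j) w) = y}"
    have "?E \<in> sets (generated (past (k + j)))" by (rule sets.Int[OF E' SN_Y_event]) (simp add: past_simps)
    then have "prob {w \<in> ?E. SN (Y (Suc (k + j)) w) = l} = prob ?E * pmf (R y) l" by (rule chain_step) simp
    moreover have "?E = {w \<in> E. SN (Y (k + j) w) = y}" using Ev by auto
    moreover have "?A \<inter> {w \<in> space W. SN (Y (k + j) w) = y} = {w \<in> ?E. SN (Y (Suc (k + j)) w) = l}" by auto
    ultimately show "emeasure W (?A \<inter> {w \<in> space W. SN (Y (k + j) w) = y}) = ennreal (prob E) * (ennreal (pmf (kernel_power R j z) y) * ennreal (pmf (R y) l))"
      by (simp only: emeasure_eq_measure Suc) (simp add: ennreal_mult' mult.assoc)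
  qed
  also have "\<dots> = ennreal (prob E) * ennreal (pmf (kernel_power R (Suc j) z) l)"
    unfolding kernel_power.simps ennreal_pmf_bind nn_integral_measure_pmf by (rule nn_integral_cmult) simp
  finally show ?case by (simp add: emeasure_eq_measure flip: ennreal_mult')
qed

end

context Y_realisation
begin

lemma SN_Y_measurable: "(\<lambda>w. SN (Y k w)) \<in> measurable W (count_space UNIV)"
  by (intro SN_compose_measurable all_sources Y_generated) simp

lemma SN_Y_process_measurable: "0 \<le> t \<Longrightarrow> (\<lambda>w. SN (Y (P t w) w)) \<in> measurable W (count_space UNIV)"
  by (rule measurable_compose_countable[OF SN_Y_measurable P_process])

lemma increment_event: "{w \<in> space W. P (t + s) w - P t w = k} \<in> sets (generated {Src_P})" if "0 \<le> t" "0 \<le> s"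
proof -
  have "(\<lambda>w. P (t + s) w - P t w) \<in> measurable (generated {Src_P}) (count_space UNIV)"
    by (rule measurable_compose_countable[OF _ P_generated, where f="\<lambda>i w. P (t + s) w - i"],
        rule measurable_compose[OF P_generated]) (use that in auto)
  from measurable_sets[OF this, of "{k}"] show ?thesis by (simp add: vimage_def Int_def conj_commute)
qed

lemma P_cylinder:
  assumes "finite J" "J \<subseteq> {0..}" "Src_P \<in> S"
  shows "{w \<in> space W. \<forall>j\<in>J. P j w = n j} \<in> sets (generated S)"
proof -
  have "{w \<in> space (generated S). \<forall>j\<in>J. P j w = n j} \<in> sets (generated S)"
  proof (rule sets.sets_Collect_finite_All[OF _ assms(1)])
    fix j assume "j \<in> J"
    then have "P j -` {n j} \<inter> space (generated S) \<in> sets (generated S)"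
      using assms by (intro measurable_sets[OF P_generated]) auto
    then show "{w \<in> space (generated S). P j w = n j} \<in> sets (generated S)"
      by (simp add: vimage_def Int_def conj_commute)
  qed
  then show ?thesis by simp
qed

lemma P_increment:
  assumes J: "finite J" "J \<subseteq> {0..t}" and ts: "0 \<le> t" "0 \<le> s"
  shows "prob ({w \<in> space W. \<forall>j\<in>J. P j w = n j} \<inter> {w \<in> space W. P (t + s) w - P t w = k})
    = prob {w \<in> space W. \<forall>j\<in>J. P j w = n j} * poisson_prob c s k"
proof -
  let ?S = "PiM {0..t} (\<lambda>_. count_space (UNIV :: nat set))"
  have "{x \<in> space ?S. \<forall>j\<in>J. x j = n j} \<in> sets ?S"
  proof (rule sets.sets_Collect_finite_All[OF _ J(1)])
    fix j assume "j \<in> J"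
    then have "(\<lambda>x. x j) -` {n j} \<inter> space ?S \<in> sets ?S"
      using J by (intro measurable_sets[OF measurable_component_singleton]) auto
    then show "{x \<in> space ?S. x j = n j} \<in> sets ?S" by (simp add: vimage_def Int_def conj_commute)
  qed
  from in_vimage_algebra[OF this, of "trajectory P t" "space W"]
  have "trajectory P t -` {x \<in> space ?S. \<forall>j\<in>J. x j = n j} \<inter> space W \<in> sets (natural_filtration W (count_space UNIV) P t)"
    by (simp add: natural_filtration_def)
  moreover have "trajectory P t -` {x \<in> space ?S. \<forall>j\<in>J. x j = n j} \<inter> space W = {w \<in> space W. \<forall>j\<in>J. P j w = n j}"
    using J(2) by (auto simp: trajectory_def space_PiM)
  ultimately have past: "{w \<in> space W. \<forall>j\<in>J. P j w = n j} \<in> sets (natural_filtration W (count_space UNIV) P t)" by simp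
  have "(\<lambda>w. P (t + s) w - P t w) -` {k} \<inter> space W \<in> sets (vimage_algebra (space W) (\<lambda>w. P (t + s) w - P t w) (count_space UNIV))"
    by (rule in_vimage_algebra) simp
  moreover have "(\<lambda>w. P (t + s) w - P t w) -` {k} \<inter> space W = {w \<in> space W. P (t + s) w - P t w = k}" by auto
  ultimately have future: "{w \<in> space W. P (t + s) w - P t w = k} \<in> sets (vimage_algebra (space W) (\<lambda>w. P (t + s) w - P t w) (count_space UNIV))"
    by simp
  have "indep_set (sets (vimage_algebra (space W) (\<lambda>w. P (t + s) w - P t w) (count_space UNIV)))
      (sets (natural_filtration W (count_space UNIV) P t))"
    and law: "prob {w \<in> space W. P (t + s) w - P t w = k} = poisson_prob c s k"
    using data ts by (simp_all add: Y_data_def poisson_process_def poisson_prob_def)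
  from indep_setD[OF this(1) future past] show ?thesis by (simp only: law Int_commute mult.commute)
qed

text \<open>
  Given the values of \<open>P\<close> up to time \<open>t\<close>, the states of the chain are determined by finitely many
  factors, so an increment of \<open>P\<close> is independent of them, and it runs the chain that many steps
  further.
\<close>

lemma SN_Y_process_markov:
  assumes J: "finite J" "J \<subseteq> {0..t}" "t \<in> J" and s: "0 \<le> s"
  shows "prob {w \<in> space W. (\<forall>j\<in>J. SN (Y (P j w) w) = \<xi> j) \<and> SN (Y (P (t + s) w) w) = l}
    = prob {w \<in> space W. \<forall>j\<in>J. SN (Y (P j w) w) = \<xi> j}
      * pmf (bind_pmf (poisson_law (c * s)) (\<lambda>k. kernel_power R k (\<xi> t))) l"
proof -
  have t: "0 \<le> t" using J by auto
  define E where "E = {w \<in> space W. \<forall>j\<in>J. SN (Y (P j w) w) = \<xi> j}"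
  define I where "I k = {w \<in> space W. P (t + s) w - P t w = k}" for k
  define EK where "EK K = E \<inter> {w \<in> space W. P t w = K}" for K
  define N where "N K = {n \<in> PiE J (\<lambda>_. {..K}). n t = K}" for K :: nat
  define A where "A n = {w \<in> space W. \<forall>j\<in>J. P j w = n j}" for n
  define B where "B n = {w \<in> space W. \<forall>j\<in>J. SN (Y (n j) w) = \<xi> j}" for n
  have finN: "finite (N K)" for K
    unfolding N_def using J(1) by (intro finite_subset[OF _ finite_PiE[of J "\<lambda>_. {..K}"]]) auto
  have A_gen: "A n \<in> sets (generated S)" if "Src_P \<in> S" for n S
    unfolding A_def using J that by (intro P_cylinder) auto
  have I_gen: "I k \<in> sets (generated {Src_P})" for k unfolding I_def by (rule increment_event[OF t s])
  have B_gen: "B n \<in> sets (generated S)" if "\<And>i j. j \<in> J \<Longrightarrow> i < n j \<Longrightarrow> Src_nu i \<in> S \<and> Src_U i \<in> S \<and> Src_V i \<in> S" for n S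
  proof -
    have "{w \<in> space (generated S). \<forall>j\<in>J. SN (Y (n j) w) = \<xi> j} \<in> sets (generated S)"
      by (rule sets.sets_Collect_finite_All[OF _ J(1)]) (use SN_Y_event that in simp)
    then show ?thesis by (simp add: B_def)
  qed
  have EK_eq: "EK K = (\<Union>n\<in>N K. A n \<inter> B n)" for K
  proof (intro equalityI subsetI)
    fix w assume w: "w \<in> EK K"
    then have ws: "w \<in> space W" "P t w = K" "\<forall>j\<in>J. SN (Y (P j w) w) = \<xi> j" by (auto simp: EK_def E_def)
    have "(\<lambda>j\<in>J. P j w) \<in> N K" using J ws P_mono[OF ws(1), of _ t] by (auto simp: N_def)
    moreover have "w \<in> A (\<lambda>j\<in>J. P j w) \<inter> B (\<lambda>j\<in>J. P j w)" using ws by (auto simp: A_def B_def)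
    ultimately show "w \<in> (\<Union>n\<in>N K. A n \<inter> B n)" by blast
  next
    fix w assume "w \<in> (\<Union>n\<in>N K. A n \<inter> B n)"
    then show "w \<in> EK K" using J by (auto simp: N_def A_def B_def EK_def E_def)
  qed
  have disj: "disjoint_family_on C (N K)" if C: "\<And>n. C n \<subseteq> A n" for C K
    unfolding disjoint_family_on_def
  proof (intro ballI impI)
    fix n n' assume n: "n \<in> N K" "n' \<in> N K" "n \<noteq> n'"
    then obtain j where "j \<in> J" "n j \<noteq> n' j" unfolding N_def by (metis (mono_tags, lifting) PiE_ext mem_Collect_eq)
    then have "A n \<inter> A n' = {}" by (auto simp: A_def)
    then show "C n \<inter> C n' = {}" using C[of n] C[of n'] by blast
  qed
  have EK_gen: "EK K \<in> sets (generated (past K))" for K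
    unfolding EK_eq
  proof (intro sets.finite_UN finN)
    fix n assume n: "n \<in> N K"
    have "n j \<le> K" if "j \<in> J" for j using n that by (auto simp: N_def PiE_iff)
    then have "B n \<in> sets (generated (past K))" by (intro B_gen) (fastforce simp: past_simps)
    with A_gen[of "past K" n] show "A n \<inter> B n \<in> sets (generated (past K))" by (auto simp: past_simps)
  qed
  have EKI: "prob (EK K \<inter> I k) = prob (EK K) * poisson_prob c s k" for K k
  proof -
    have ev: "A n \<in> events" "B n \<in> events" "I k \<in> events" for n
      using A_gen[of UNIV n] B_gen[of n UNIV] I_gen[of k] generated_events by blast+
    have split: "prob (A n \<inter> D \<inter> B n) = prob (A n \<inter> D) * prob (B n)" if "D \<in> sets (generated {Src_P})" for n D
      by (rule generated_indep[of "{Src_P}" "- {Src_P}"]) (use A_gen[of "{Src_P}" n] that B_gen in auto)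
    have whole: "space W \<in> sets (generated {Src_P})" using sets.top[of "generated {Src_P}"] by simp
    have An: "A n \<inter> space W = A n" for n by (auto simp: A_def)
    have "prob (EK K \<inter> I k) = prob (\<Union>n\<in>N K. A n \<inter> I k \<inter> B n)" unfolding EK_eq by (intro arg_cong[of _ _ prob]) auto
    also have "\<dots> = (\<Sum>n\<in>N K. prob (A n \<inter> I k \<inter> B n))"
      by (rule finite_measure_finite_Union[OF finN _ disj]) (use ev in auto)
    also have "\<dots> = (\<Sum>n\<in>N K. prob (A n \<inter> B n) * poisson_prob c s k)"
    proof (rule sum.cong[OF refl])
      fix n
      have "prob (A n \<inter> I k) = prob (A n) * poisson_prob c s k"
        unfolding A_def I_def using J t s by (intro P_increment)
      then show "prob (A n \<inter> I k \<inter> B n) = prob (A n \<inter> B n) * poisson_prob c s k"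
        using split[OF I_gen[of k], of n] split[OF whole, of n] by (simp add: An)
    qed
    also have "\<dots> = (\<Sum>n\<in>N K. prob (A n \<inter> B n)) * poisson_prob c s k" by (simp add: sum_distrib_right)
    also have "(\<Sum>n\<in>N K. prob (A n \<inter> B n)) = prob (EK K)"
      unfolding EK_eq by (rule finite_measure_finite_Union[OF finN _ disj, symmetric]) (use ev in auto)
    finally show ?thesis .
  qed
  have E_ev: "E \<in> events"
    unfolding E_def
  proof (rule sets.sets_Collect_finite_All[OF _ J(1)])
    fix j assume "j \<in> J"
    then have "(\<lambda>w. SN (Y (P j w) w)) -` {\<xi> j} \<inter> space W \<in> events"
      using J by (intro measurable_sets[OF SN_Y_process_measurable]) auto
    then show "{w \<in> space W. SN (Y (P j w) w) = \<xi> j} \<in> events" by (simp add: vimage_def Int_def conj_commute)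
  qed
  let ?A = "E \<inter> {w \<in> space W. SN (Y (P (t + s) w) w) = l}"
  have "(\<lambda>w. SN (Y (P (t + s) w) w)) -` {l} \<inter> space W \<in> events"
    using t s by (intro measurable_sets[OF SN_Y_process_measurable]) auto
  then have A_ev: "?A \<in> events" using E_ev by (auto simp: vimage_def Int_def conj_commute)
  have Pt: "P t \<in> measurable W (count_space UNIV)" by (rule P_process[OF t])
  have inc: "(\<lambda>w. P (t + s) w - P t w) \<in> measurable W (count_space UNIV)"
    by (rule measurable_compose_countable[OF _ Pt, where f="\<lambda>i w. P (t + s) w - i"],
        rule measurable_compose[OF P_process]) (use t s in auto)
  have Pt_ev: "{w \<in> space W. P t w = K} \<in> events" for K
    using measurable_sets[OF Pt, of "{K}"] by (simp add: vimage_def Int_def conj_commute)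
  have "emeasure W ?A = (\<integral>\<^sup>+K. emeasure W (?A \<inter> {w \<in> space W. P t w = K}) \<partial>count_space UNIV)"
    by (rule total_probability[OF Pt A_ev])
  also have "\<dots> = (\<integral>\<^sup>+K. (\<integral>\<^sup>+k. emeasure W (?A \<inter> {w \<in> space W. P t w = K} \<inter> I k) \<partial>count_space UNIV) \<partial>count_space UNIV)"
    unfolding I_def by (intro nn_integral_cong total_probability[OF inc] sets.Int[OF A_ev Pt_ev])
  also have "\<dots> = (\<integral>\<^sup>+K. (\<integral>\<^sup>+k. ennreal (prob (EK K)) * (ennreal (pmf (poisson_law (c * s)) k) * ennreal (pmf (kernel_power R k (\<xi> t)) l)) \<partial>count_space UNIV) \<partial>count_space UNIV)"
  proof (intro nn_integral_cong)
    fix K k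
    have "EK K \<inter> I k \<in> sets (generated (past K))"
      using EK_gen I_gen generated_mono[of "{Src_P}" "past K"] by (auto simp: past_simps)
    then have "prob {w \<in> EK K \<inter> I k. SN (Y (K + k) w) = l} = prob (EK K \<inter> I k) * pmf (kernel_power R k (\<xi> t)) l"
      by (rule chain_power) (use J in \<open>auto simp: EK_def E_def\<close>)
    moreover have "{w \<in> EK K \<inter> I k. SN (Y (K + k) w) = l} = ?A \<inter> {w \<in> space W. P t w = K} \<inter> I k"
    proof -
      have "P (t + s) w = K + k" if "w \<in> I k" "P t w = K" for w
        using that P_mono[of w t "t + s"] t s by (auto simp: I_def)
      then show ?thesis by (auto simp: EK_def E_def I_def)
    qed
    ultimately have "prob (?A \<inter> {w \<in> space W. P t w = K} \<inter> I k) = prob (EK K) * (poisson_prob c s k * pmf (kernel_power R k (\<xi> t)) l)"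
      by (simp add: EKI)
    moreover have "poisson_prob c s k = pmf (poisson_law (c * s)) k" using c_nonneg s by (simp add: pmf_poisson_law_eq)
    ultimately show "emeasure W (?A \<inter> {w \<in> space W. P t w = K} \<inter> I k) = ennreal (prob (EK K)) * (ennreal (pmf (poisson_law (c * s)) k) * ennreal (pmf (kernel_power R k (\<xi> t)) l))"
      by (simp only: emeasure_eq_measure) (simp add: ennreal_mult')
  qed
  also have "\<dots> = (\<integral>\<^sup>+K. emeasure W (EK K) * ennreal (pmf (bind_pmf (poisson_law (c * s)) (\<lambda>k. kernel_power R k (\<xi> t))) l) \<partial>count_space UNIV)"
    unfolding ennreal_pmf_bind nn_integral_measure_pmf emeasure_eq_measure
    by (intro nn_integral_cong nn_integral_cmult) simp
  also have "\<dots> = emeasure W E * ennreal (pmf (bind_pmf (poisson_law (c * s)) (\<lambda>k. kernel_power R k (\<xi> t))) l)"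
    unfolding EK_def total_probability[OF Pt E_ev] by (rule nn_integral_multc) simp
  finally have "prob ?A = prob E * pmf (bind_pmf (poisson_law (c * s)) (\<lambda>k. kernel_power R k (\<xi> t))) l"
    by (simp add: emeasure_eq_measure flip: ennreal_mult')
  moreover have "?A = {w \<in> space W. (\<forall>j\<in>J. SN (Y (P j w) w) = \<xi> j) \<and> SN (Y (P (t + s) w) w) = l}" by (auto simp: E_def)
  ultimately show ?thesis by (simp add: E_def)
qed

end

section \<open>Existence of the compound Poisson product\<close>

definition preimages :: "'a set \<Rightarrow> ('a \<Rightarrow> 'b) \<Rightarrow> 'b measure \<Rightarrow> 'a set set" where
  "preimages S f N = {f -` A \<inter> S |A. A \<in> sets N}"

lemma indep_sets_coordinates:
  fixes g :: "'i \<Rightarrow> 'j"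
  assumes N: "prob_space N" and g: "inj g"
    and H: "\<And>i. H (g i) \<subseteq> preimages (space (PiM UNIV (\<lambda>_. N))) (\<lambda>x. x i) N"
  shows "prob_space.indep_sets (PiM UNIV (\<lambda>_ :: 'i. N)) H (range g)"
proof -
  let ?M = "PiM UNIV (\<lambda>_ :: 'i. N)"
  interpret N: prob_space N by fact
  interpret product_prob_space "\<lambda>_ :: 'i. N" UNIV ..
  show ?thesis
  proof (rule indep_setsI)
    fix j assume "j \<in> range g"
    then obtain i where "j = g i" by blast
    then show "H j \<subseteq> P.events" using H[of i] by (auto simp: preimages_def intro!: measurable_sets[OF measurable_component_singleton])
  next
    fix A J assume J: "J \<noteq> {}" "J \<subseteq> range g" "finite J" "\<forall>j\<in>J. A j \<in> H j"
    define L where "L = g -` J"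
    have JL: "J = g ` L" and L: "finite L" "L \<noteq> {}"
      using J g by (auto simp: L_def finite_vimageI)
    have "\<exists>B. \<forall>i\<in>L. B i \<in> sets N \<and> A (g i) = (\<lambda>x. x i) -` B i \<inter> space ?M"
      using J(4) H by (intro bchoice) (fastforce simp: L_def preimages_def)
    then obtain B where B: "\<And>i. i \<in> L \<Longrightarrow> B i \<in> sets N" "\<And>i. i \<in> L \<Longrightarrow> A (g i) = (\<lambda>x. x i) -` B i \<inter> space ?M" by blast
    have one: "measure ?M ((\<lambda>x. x i) -` B i \<inter> space ?M) = measure N (B i)" if "i \<in> L" for i
    proof -
      have "(\<lambda>x. x i) -` B i \<inter> space ?M = prod_emb UNIV (\<lambda>_. N) {i} (PiE {i} B)" by (auto simp: prod_emb_def space_PiM PiE_iff)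
      then show ?thesis using measure_PiM_emb[of "{i}" B] B(1) that by simp
    qed
    have "(\<Inter>j\<in>J. A j) = prod_emb UNIV (\<lambda>_. N) L (PiE L B)"
      unfolding JL using B(2) L(2) by (auto simp: prod_emb_def space_PiM PiE_iff)
    then have "measure ?M (\<Inter>j\<in>J. A j) = (\<Prod>i\<in>L. measure N (B i))"
      using measure_PiM_emb[of L B] B(1) L by simp
    also have "\<dots> = (\<Prod>i\<in>L. measure ?M (A (g i)))" by (rule prod.cong) (simp_all add: B(2) one)
    also have "\<dots> = (\<Prod>j\<in>J. measure ?M (A j))" unfolding JL by (subst prod.reindex) (use g in \<open>auto intro: inj_on_subset\<close>)
    finally show "measure ?M (\<Inter>j\<in>J. A j) = (\<Prod>j\<in>J. measure ?M (A j))" .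
  qed
qed

lemma indep_sets_pair_measure:
  assumes M: "prob_space M1" "prob_space M2"
    and EF: "prob_space.indep_sets M1 E I" "prob_space.indep_sets M2 F J" and IJ: "I \<inter> J = {}"
    and H: "\<And>i. i \<in> I \<Longrightarrow> H i \<subseteq> (\<lambda>A. A \<times> space M2) ` E i" "\<And>j. j \<in> J \<Longrightarrow> H j \<subseteq> (\<lambda>B. space M1 \<times> B) ` F j"
  shows "prob_space.indep_sets (M1 \<Otimes>\<^sub>M M2) H (I \<union> J)"
proof -
  interpret M1: prob_space M1 by fact
  interpret M2: prob_space M2 by fact
  interpret pair_prob_space M1 M2 ..
  have ev: "A \<in> sets M1" if "i \<in> I" "A \<in> E i" for i A using EF(1) that unfolding M1.indep_sets_def by blast
  have ev': "B \<in> sets M2" if "j \<in> J" "B \<in> F j" for j B using EF(2) that unfolding M2.indep_sets_def by blast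
  have times: "measure (M1 \<Otimes>\<^sub>M M2) (A \<times> B) = measure M1 A * measure M2 B" if "A \<in> sets M1" "B \<in> sets M2" for A B
    using M2.emeasure_pair_measure_Times[OF that] unfolding P.emeasure_eq_measure M1.emeasure_eq_measure M2.emeasure_eq_measure
    by (simp flip: ennreal_mult')
  show ?thesis
  proof (rule P.indep_setsI)
    fix i assume "i \<in> I \<union> J"
    then show "H i \<subseteq> P.events" using H ev ev' by fastforce
  next
    fix C K assume K: "K \<noteq> {}" "K \<subseteq> I \<union> J" "finite K" "\<forall>k\<in>K. C k \<in> H k"
    have "\<exists>A. \<forall>i\<in>K \<inter> I. A i \<in> E i \<and> C i = A i \<times> space M2"
      using K(4) H(1) by (intro bchoice) blast
    then obtain A where A: "\<And>i. i \<in> K \<inter> I \<Longrightarrow> A i \<in> E i" "\<And>i. i \<in> K \<inter> I \<Longrightarrow> C i = A i \<times> space M2" by blast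
    have "\<exists>B. \<forall>j\<in>K \<inter> J. B j \<in> F j \<and> C j = space M1 \<times> B j"
      using K(4) H(2) by (intro bchoice) blast
    then obtain B where B: "\<And>j. j \<in> K \<inter> J \<Longrightarrow> B j \<in> F j" "\<And>j. j \<in> K \<inter> J \<Longrightarrow> C j = space M1 \<times> B j" by blast
    have A': "A i \<in> sets M1" if "i \<in> K \<inter> I" for i using A(1)[OF that] ev that by blast
    have B': "B j \<in> sets M2" if "j \<in> K \<inter> J" for j using B(1)[OF that] ev' that by blast
    define A0 where "A0 = (if K \<inter> I = {} then space M1 else \<Inter>i\<in>K \<inter> I. A i)"
    define B0 where "B0 = (if K \<inter> J = {} then space M2 else \<Inter>j\<in>K \<inter> J. B j)"
    have A0: "A0 \<in> sets M1" "measure M1 A0 = (\<Prod>i\<in>K \<inter> I. measure M1 (A i))"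
      using A' K(3) M1.indep_setsD[OF EF(1), of "K \<inter> I" A] A(1) by (auto simp: A0_def M1.prob_space)
    have B0: "B0 \<in> sets M2" "measure M2 B0 = (\<Prod>j\<in>K \<inter> J. measure M2 (B j))"
      using B' K(3) M2.indep_setsD[OF EF(2), of "K \<inter> J" B] B(1) by (auto simp: B0_def M2.prob_space)
    have sub: "A i \<subseteq> space M1" if "i \<in> K \<inter> I" for i using sets.sets_into_space[OF A'[OF that]] .
    have sub': "B j \<subseteq> space M2" if "j \<in> K \<inter> J" for j using sets.sets_into_space[OF B'[OF that]] .
    have KIJ: "K = (K \<inter> I) \<union> (K \<inter> J)" using K(2) by blast
    have "(\<Inter>k\<in>K. C k) = A0 \<times> B0"
    proof -
      have "(\<Inter>k\<in>K. C k) = (\<Inter>i\<in>K \<inter> I. A i \<times> space M2) \<inter> (\<Inter>j\<in>K \<inter> J. space M1 \<times> B j)"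
        by (subst KIJ) (simp add: INT_Un A(2) B(2) del: Int_iff cong: INF_cong)
      then have C: "(x, y) \<in> (\<Inter>k\<in>K. C k) \<longleftrightarrow> (\<forall>i\<in>K \<inter> I. x \<in> A i \<and> y \<in> space M2) \<and> (\<forall>j\<in>K \<inter> J. x \<in> space M1 \<and> y \<in> B j)" for x y
        by simp
      have "x \<in> A0 \<longleftrightarrow> x \<in> space M1 \<and> (\<forall>i\<in>K \<inter> I. x \<in> A i)" for x using sub by (auto simp: A0_def)
      moreover have "y \<in> B0 \<longleftrightarrow> y \<in> space M2 \<and> (\<forall>j\<in>K \<inter> J. y \<in> B j)" for y using sub' by (auto simp: B0_def)
      moreover obtain k where "k \<in> K \<inter> I \<or> k \<in> K \<inter> J" using K(1,2) by blast
      ultimately have "(x, y) \<in> (\<Inter>k\<in>K. C k) \<longleftrightarrow> x \<in> A0 \<and> y \<in> B0" for x y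
        unfolding C using sub sub' by (metis subsetD)
      then show ?thesis by (intro Set.set_eqI) (simp only: split_paired_all mem_Times_iff fst_conv snd_conv)
    qed
    then have "measure (M1 \<Otimes>\<^sub>M M2) (\<Inter>k\<in>K. C k) = (\<Prod>i\<in>K \<inter> I. measure M1 (A i)) * (\<Prod>j\<in>K \<inter> J. measure M2 (B j))"
      by (simp add: times A0 B0)
    also have "\<dots> = (\<Prod>i\<in>K \<inter> I. measure (M1 \<Otimes>\<^sub>M M2) (C i)) * (\<Prod>j\<in>K \<inter> J. measure (M1 \<Otimes>\<^sub>M M2) (C j))"
      by (intro arg_cong2[of _ _ _ _ "(*)"] prod.cong refl)
        (simp_all add: A(2) B(2) times A' B' M1.prob_space M2.prob_space)
    also have "\<dots> = (\<Prod>k\<in>K. measure (M1 \<Otimes>\<^sub>M M2) (C k))"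
      by (subst (3) KIJ, rule prod.union_disjoint[symmetric]) (use K(3) IJ in auto)
    finally show "measure (M1 \<Otimes>\<^sub>M M2) (\<Inter>k\<in>K. C k) = (\<Prod>k\<in>K. measure (M1 \<Otimes>\<^sub>M M2) (C k))" .
  qed
qed

lemma preimages_fst: "preimages (space (A \<Otimes>\<^sub>M B)) (\<lambda>w. f (fst w)) N = (\<lambda>X. X \<times> space B) ` preimages (space A) f N"
  unfolding preimages_def Setcompr_eq_image image_image by (intro image_cong refl) (auto simp: space_pair_measure)

lemma preimages_snd: "preimages (space (A \<Otimes>\<^sub>M B)) (\<lambda>w. f (snd w)) N = (\<lambda>X. space A \<times> X) ` preimages (space B) f N"
  unfolding preimages_def Setcompr_eq_image image_image by (intro image_cong refl) (auto simp: space_pair_measure)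

lemma (in prob_space) distr_pair_snd:
  assumes "prob_space N" shows "distr (M \<Otimes>\<^sub>M N) N snd = N"
proof (rule measure_eqI)
  interpret N: prob_space N by fact
  fix A assume A: "A \<in> sets (distr (M \<Otimes>\<^sub>M N) N snd)"
  then have "emeasure (distr (M \<Otimes>\<^sub>M N) N snd) A = emeasure (M \<Otimes>\<^sub>M N) (space M \<times> A)"
    by (auto simp: emeasure_distr space_pair_measure dest: sets.sets_into_space intro!: arg_cong2[where f=emeasure])
  with A show "emeasure (distr (M \<Otimes>\<^sub>M N) N snd) A = emeasure N A"
    by (simp add: N.emeasure_pair_measure_Times emeasure_space_1)
qed simp

lemma has_law_fst:
  assumes "prob_space B" "has_law A f N" shows "has_law (A \<Otimes>\<^sub>M B) (\<lambda>w. f (fst w)) N"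
proof -
  have f: "f \<in> measurable A N" "distr A N f = N" using assms(2) by (auto simp: has_law_def)
  have "distr (distr (A \<Otimes>\<^sub>M B) A fst) N f = distr (A \<Otimes>\<^sub>M B) N (f \<circ> fst)" by (rule distr_distr[OF f(1)]) simp
  then show ?thesis using f prob_space.distr_pair_fst[OF assms(1), of A]
    by (simp add: has_law_def comp_def measurable_compose[OF measurable_fst f(1)])
qed

lemma has_law_snd:
  assumes "prob_space A" "prob_space B" "has_law B f N" shows "has_law (A \<Otimes>\<^sub>M B) (\<lambda>w. f (snd w)) N"
proof -
  have f: "f \<in> measurable B N" "distr B N f = N" using assms(3) by (auto simp: has_law_def)
  have "distr (distr (A \<Otimes>\<^sub>M B) B snd) N f = distr (A \<Otimes>\<^sub>M B) N (f \<circ> snd)" by (rule distr_distr[OF f(1)]) simp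
  then show ?thesis using f prob_space.distr_pair_snd[OF assms(1,2)]
    by (simp add: has_law_def comp_def measurable_compose[OF measurable_snd f(1)])
qed

lemma has_law_coordinate: "prob_space N \<Longrightarrow> has_law (PiM UNIV (\<lambda>_. N)) (\<lambda>x. x i) N"
  unfolding has_law_def using distr_PiM_component[of UNIV "\<lambda>_. N" i] by simp

lemma preimages_vimage_algebra: "f \<in> measurable M N \<Longrightarrow> sets (vimage_algebra (space M) f N) = preimages (space M) f N"
  unfolding preimages_def by (rule sets_vimage_algebra2) (auto dest: measurable_space)

text \<open>
  The sample space is the product of the path space, with the law of the Poisson process, and of
  infinite powers of \<open>M\<close> and of Haar measure; its coordinates are the data.
\<close>

lemma Y_data_exists:
  assumes c: "0 \<le> c" and M: "set_pmf M \<subseteq> (Sig :: 'n::{finite, linorder} tuple set)"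
  shows "\<exists>(W :: ('p::prime_card, 'n) Y_sample measure) P nu (U :: nat \<Rightarrow> ('p, 'n) Y_sample \<Rightarrow> ('p, 'n) pmat)
    (V :: nat \<Rightarrow> ('p, 'n) Y_sample \<Rightarrow> ('p, 'n) pmat). Y_data W (signature_measure M) c P nu U V
    \<and> (\<forall>i. distr W haar (V i) = haar)"
proof -
  obtain D where D: "prob_space D" "sets D = sets path_space" "has_poisson_increments c D"
    using poisson_path_law_exists[OF c] by blast
  define S where "S = signature_measure M"
  define H where "H = (haar :: ('p, 'n) pmat measure)"
  have S: "prob_space S" unfolding S_def by (rule prob_space_signature_measure[OF M])
  have H: "prob_space H" "haar_GL_Zp H" unfolding H_def by (rule prob_space_haar, rule haar(1))
  define WH where "WH = PiM UNIV (\<lambda>_ :: nat. H)"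
  define WS where "WS = PiM UNIV (\<lambda>_ :: nat. S)"
  define W where "W = D \<Otimes>\<^sub>M (WS \<Otimes>\<^sub>M (WH \<Otimes>\<^sub>M WH))"
  have pWH: "prob_space WH" unfolding WH_def by (rule prob_space_PiM[OF H(1)])
  have pWS: "prob_space WS" unfolding WS_def by (rule prob_space_PiM[OF S])
  have p1: "prob_space (WH \<Otimes>\<^sub>M WH)" by (rule prob_space_pair[OF pWH pWH])
  have p2: "prob_space (WS \<Otimes>\<^sub>M (WH \<Otimes>\<^sub>M WH))" by (rule prob_space_pair[OF pWS p1])
  have pW: "prob_space W" unfolding W_def by (rule prob_space_pair[OF D(1) p2])
  define P where "P t w = fst w t" for t and w :: "('p, 'n) Y_sample"
  define nu where "nu i w = fst (snd w) i" for i and w :: "('p, 'n) Y_sample"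
  define U where "U i w = fst (snd (snd w)) i" for i and w :: "('p, 'n) Y_sample"
  define V where "V i w = snd (snd (snd w)) i" for i and w :: "('p, 'n) Y_sample"
  have cH: "has_law WH (\<lambda>x. x i) H" for i unfolding WH_def by (rule has_law_coordinate[OF H(1)])
  have cS: "has_law WS (\<lambda>x. x i) S" for i unfolding WS_def by (rule has_law_coordinate[OF S])
  have lnu: "has_law W (nu i) S" for i
    unfolding nu_def W_def by (rule has_law_snd[OF D(1) p2 has_law_fst[OF p1 cS]])
  have lU: "has_law W (U i) H" for i
    unfolding U_def W_def by (rule has_law_snd[OF D(1) p2 has_law_snd[OF pWS p1 has_law_fst[OF pWH cH]]])
  have lV: "has_law W (V i) H" for i
    unfolding V_def W_def by (rule has_law_snd[OF D(1) p2 has_law_snd[OF pWS p1 has_law_snd[OF pWH pWH cH]]])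
  have fst_D: "fst \<in> measurable W D" unfolding W_def by simp
  then have fst_path: "fst \<in> measurable W path_space" using measurable_cong_sets[OF refl D(2)] by blast
  have "distr W path_space fst = distr W D fst" by (rule distr_cong) (simp_all add: D(2))
  also have "\<dots> = D" unfolding W_def by (rule prob_space.distr_pair_fst[OF p2])
  finally have poisson: "poisson_process W c P"
    unfolding P_def by (rule poisson_processI[OF pW c D(3,2) fst_path])
  define Q where "Q = PiM {0::real..} (\<lambda>_. count_space (UNIV :: nat set))"
  define r where "r x = (\<lambda>t\<in>{0::real..}. x t)" for x :: "real \<Rightarrow> nat"
  have r_path: "r \<in> measurable path_space Q"
    unfolding r_def Q_def by (rule measurable_restrict) (rule coordinate_path_space)
  then have r_D: "r \<in> measurable D Q" using measurable_cong_sets[OF D(2) refl] by blast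
  define src where "src s = (case s of
         Src_P \<Rightarrow> sets (vimage_algebra (space W) (\<lambda>w. \<lambda>t\<in>{0..}. P t w) (PiM {0..} (\<lambda>_. count_space UNIV)))
       | Src_nu i \<Rightarrow> sets (vimage_algebra (space W) (nu i) S)
       | Src_U i \<Rightarrow> sets (vimage_algebra (space W) (U i) borel_GL_Zp)
       | Src_V i \<Rightarrow> sets (vimage_algebra (space W) (V i) borel_GL_Zp))" for s
  have src_P: "src Src_P = preimages (space W) (\<lambda>w. r (fst w)) Q"
    using preimages_vimage_algebra[OF measurable_compose[OF fst_D r_D]] by (simp add: src_def P_def r_def Q_def)
  have src_nu: "src (Src_nu i) = preimages (space W) (nu i) S" for i
    using preimages_vimage_algebra[of "nu i" W S] lnu[of i] by (simp add: src_def has_law_def)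
  have HK: "sets H = sets borel_GL_Zp" unfolding H_def by (rule sets_haar)
  have src_U: "src (Src_U i) = preimages (space W) (U i) H" for i
    using preimages_vimage_algebra[of "U i" W H] lU[of i] sets_vimage_algebra_cong[OF HK, of "space W" "U i"] by (simp add: src_def has_law_def)
  have src_V: "src (Src_V i) = preimages (space W) (V i) H" for i
    using preimages_vimage_algebra[of "V i" W H] lV[of i] sets_vimage_algebra_cong[OF HK, of "space W" "V i"] by (simp add: src_def has_law_def)
  have iU: "prob_space.indep_sets WH (\<lambda>s. case s of Src_U i \<Rightarrow> preimages (space WH) (\<lambda>x. x i) H | _ \<Rightarrow> {}) (range Src_U)"
    unfolding WH_def by (rule indep_sets_coordinates[OF H(1)]) (auto intro: injI)
  have iV: "prob_space.indep_sets WH (\<lambda>s. case s of Src_V i \<Rightarrow> preimages (space WH) (\<lambda>x. x i) H | _ \<Rightarrow> {}) (range Src_V)"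
    unfolding WH_def by (rule indep_sets_coordinates[OF H(1)]) (auto intro: injI)
  have inu: "prob_space.indep_sets WS (\<lambda>s. case s of Src_nu i \<Rightarrow> preimages (space WS) (\<lambda>x. x i) S | _ \<Rightarrow> {}) (range Src_nu)"
    unfolding WS_def by (rule indep_sets_coordinates[OF S]) (auto intro: injI)
  have iP: "prob_space.indep_sets D (\<lambda>_. preimages (space D) r Q) {Src_P}"
  proof -
    interpret D: prob_space D by fact
    show ?thesis
    proof (rule D.indep_setsI)
      fix A and J :: "Y_source set" assume "J \<noteq> {}" "J \<subseteq> {Src_P}"
      then have "J = {Src_P}" by auto
      then show "D.prob (\<Inter>j\<in>J. A j) = (\<Prod>j\<in>J. D.prob (A j))" by simp
    qed (auto simp: preimages_def intro: measurable_sets[OF r_D])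
  qed
  have i1: "prob_space.indep_sets (WH \<Otimes>\<^sub>M WH) (\<lambda>s. case s of
      Src_U i \<Rightarrow> preimages (space (WH \<Otimes>\<^sub>M WH)) (\<lambda>w. fst w i) H
    | Src_V i \<Rightarrow> preimages (space (WH \<Otimes>\<^sub>M WH)) (\<lambda>w. snd w i) H | _ \<Rightarrow> {}) (range Src_U \<union> range Src_V)"
    by (rule indep_sets_pair_measure[OF pWH pWH iU iV])
      (auto simp: preimages_fst[where f="\<lambda>x. x i" for i] preimages_snd[where f="\<lambda>x. x i" for i])
  have i2: "prob_space.indep_sets (WS \<Otimes>\<^sub>M (WH \<Otimes>\<^sub>M WH)) (\<lambda>s. case s of
      Src_nu i \<Rightarrow> preimages (space (WS \<Otimes>\<^sub>M (WH \<Otimes>\<^sub>M WH))) (\<lambda>w. fst w i) S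
    | Src_U i \<Rightarrow> preimages (space (WS \<Otimes>\<^sub>M (WH \<Otimes>\<^sub>M WH))) (\<lambda>w. fst (snd w) i) H
    | Src_V i \<Rightarrow> preimages (space (WS \<Otimes>\<^sub>M (WH \<Otimes>\<^sub>M WH))) (\<lambda>w. snd (snd w) i) H | _ \<Rightarrow> {})
      (range Src_nu \<union> (range Src_U \<union> range Src_V))"
    by (rule indep_sets_pair_measure[OF pWS p1 inu i1])
      (auto simp: preimages_fst[where f="\<lambda>x. x i" for i] preimages_snd[where f="\<lambda>x. fst x i" for i] preimages_snd[where f="\<lambda>x. snd x i" for i])
  have "prob_space.indep_sets W src ({Src_P} \<union> (range Src_nu \<union> (range Src_U \<union> range Src_V)))"
    unfolding W_def
    by (rule indep_sets_pair_measure[OF D(1) p2 iP i2])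
      (auto simp: src_P src_nu src_U src_V nu_def[abs_def] U_def[abs_def] V_def[abs_def] preimages_fst[where f=r] W_def
        preimages_snd[where f="\<lambda>x. fst x i" for i] preimages_snd[where f="\<lambda>x. fst (snd x) i" for i] preimages_snd[where f="\<lambda>x. snd (snd x) i" for i])
  moreover have "{Src_P} \<union> (range Src_nu \<union> (range Src_U \<union> range Src_V)) = UNIV"
    using Y_source.exhaust by (auto simp: image_iff) metis
  ultimately have "prob_space.indep_sets W src UNIV" by simp
  then have "Y_data W S c P nu U V"
    unfolding Y_data_def src_def using pW poisson lnu lU lV H(2) by blast
  moreover have "distr W haar (V i) = haar" for i using lV[of i] by (simp add: has_law_def H_def)
  ultimately show ?thesis unfolding S_def by blast
qed

section \<open>Finite-dimensional laws\<close>

text \<open>The Markov property with transition kernels \<open>T\<close> and initial state \<open>z0\<close>, tested on cylinder events of the past.\<close>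

definition markov_from :: "'a measure \<Rightarrow> (real \<Rightarrow> 'a \<Rightarrow> 'c) \<Rightarrow> 'c \<Rightarrow> (real \<Rightarrow> 'c \<Rightarrow> 'c pmf) \<Rightarrow> bool" where
  "markov_from W Z z0 T \<longleftrightarrow> prob_space W \<and> (\<forall>t\<ge>0. Z t \<in> measurable W (count_space UNIV)) \<and>
    (AE w in W. Z 0 w = z0) \<and>
    (\<forall>J t s \<xi> l. finite J \<longrightarrow> J \<subseteq> {0..t} \<longrightarrow> t \<in> J \<longrightarrow> 0 < s \<longrightarrow>
      measure W {w \<in> space W. (\<forall>j\<in>J. Z j w = \<xi> j) \<and> Z (t + s) w = l} =
      measure W {w \<in> space W. \<forall>j\<in>J. Z j w = \<xi> j} * pmf (T s (\<xi> t)) l)"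

lemma markov_from_event:
  assumes "markov_from W Z z0 T" "finite J" "J \<subseteq> {0..}"
  shows "{w \<in> space W. \<forall>j\<in>J. Z j w = \<xi> j} \<in> sets W"
proof (rule sets.sets_Collect_finite_All[OF _ assms(2)])
  fix j assume "j \<in> J"
  then have "Z j \<in> measurable W (count_space UNIV)" using assms by (auto simp: markov_from_def)
  from measurable_sets[OF this, of "{\<xi> j}"] show "{w \<in> space W. Z j w = \<xi> j} \<in> sets W"
    by (simp add: vimage_def Int_def conj_commute)
qed

text \<open>Time \<open>0\<close> may be added to \<open>J\<close> or removed from it, as the state at that time is almost surely \<open>z0\<close>.\<close>

lemma markov_from_initial:
  assumes M: "markov_from W Z z0 T" and J: "finite J" "J \<subseteq> {0..}"
  shows "measure W {w \<in> space W. \<forall>j\<in>insert 0 J. Z j w = (\<xi>(0 := z0)) j} = measure W {w \<in> space W. \<forall>j\<in>J - {0}. Z j w = \<xi> j}"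
proof (rule measure_eq_AE)
  have "AE w in W. Z 0 w = z0" using M by (simp add: markov_from_def)
  then show "AE w in W. w \<in> {w \<in> space W. \<forall>j\<in>insert 0 J. Z j w = (\<xi>(0 := z0)) j} \<longleftrightarrow> w \<in> {w \<in> space W. \<forall>j\<in>J - {0}. Z j w = \<xi> j}"
    by eventually_elim auto
qed (rule markov_from_event[OF M], use J in auto)+

lemma markov_from_initial_law:
  assumes M: "markov_from W Z z0 T"
  shows "measure W {w \<in> space W. Z 0 w = z} = (if z = z0 then 1 else 0)"
proof -
  interpret prob_space W using M by (simp add: markov_from_def)
  have ev: "{w \<in> space W. Z 0 w = z} \<in> events"
    using markov_from_event[OF M, of "{0}" "\<lambda>_. z"] by simp
  have AE: "AE w in W. Z 0 w = z0" using M by (simp add: markov_from_def)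
  show ?thesis
  proof (cases "z = z0")
    case True
    then show ?thesis using prob_Collect_eq_1[OF ev] AE by simp
  next
    case False
    have "AE w in W. \<not> Z 0 w = z" using AE by eventually_elim (use False in auto)
    then show ?thesis using prob_Collect_eq_0[OF ev] False by simp
  qed
qed

lemma markov_from_step:
  assumes M: "markov_from W Z z0 T" and A: "finite A" "A \<subseteq> {0..t}" "t \<in> A" and b: "t < b"
  shows "measure W {w \<in> space W. \<forall>j\<in>insert b A. Z j w = \<xi> j}
    = measure W {w \<in> space W. \<forall>j\<in>A. Z j w = \<xi> j} * pmf (T (b - t) (\<xi> t)) (\<xi> b)"
proof -
  have "0 < b - t" using b by simp
  then have "measure W {w \<in> space W. (\<forall>j\<in>A. Z j w = \<xi> j) \<and> Z (t + (b - t)) w = \<xi> b}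
      = measure W {w \<in> space W. \<forall>j\<in>A. Z j w = \<xi> j} * pmf (T (b - t) (\<xi> t)) (\<xi> b)"
    using M A unfolding markov_from_def by blast
  moreover have "{w \<in> space W. (\<forall>j\<in>A. Z j w = \<xi> j) \<and> Z (t + (b - t)) w = \<xi> b} = {w \<in> space W. \<forall>j\<in>insert b A. Z j w = \<xi> j}"
    by auto
  ultimately show ?thesis by simp
qed

text \<open>The cylinder probabilities are determined by the kernel, by induction over the latest time.\<close>

lemma markov_from_unique_positive:
  assumes M: "markov_from W Z z0 T" "markov_from W' Z' z0 T"
    and J: "finite J" "J \<subseteq> {0<..}"
  shows "measure W {w \<in> space W. \<forall>j\<in>insert 0 J. Z j w = \<xi> j} = measure W' {w \<in> space W'. \<forall>j\<in>insert 0 J. Z' j w = \<xi> j}"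
  using J
proof (induction J rule: finite_linorder_max_induct)
  case empty
  then show ?case using M by (simp add: markov_from_initial_law)
next
  case (insert b A)
  define t where "t = Max (insert 0 A)"
  have fin: "finite (insert 0 A)" using insert.hyps(1) by simp
  have t_in: "t \<in> insert 0 A" unfolding t_def by (rule Max_in[OF fin]) simp
  have pos: "0 \<le> j" if "j \<in> insert 0 A" for j using that insert.prems by (auto simp: less_imp_le)
  have t_ge: "insert 0 A \<subseteq> {0..t}" using pos Max_ge[OF fin] by (simp add: t_def subset_eq)
  have "t < b" using t_in insert.hyps(2) insert.prems by auto
  then show ?case
    using markov_from_step[OF M(1) fin t_ge t_in, of b \<xi>] markov_from_step[OF M(2) fin t_ge t_in, of b \<xi>] insert
    by (simp only: insert_commute[of 0 b]) simp
qed

lemma markov_from_unique: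
  assumes M: "markov_from W Z z0 T" "markov_from W' Z' z0 T" and J: "finite J" "J \<subseteq> {0..}"
  shows "measure W {w \<in> space W. \<forall>j\<in>J. Z j w = \<xi> j} = measure W' {w \<in> space W'. \<forall>j\<in>J. Z' j w = \<xi> j}"
proof (cases "0 \<in> J")
  case True
  then have "J = insert 0 (J - {0})" by auto
  then show ?thesis using markov_from_unique_positive[OF M, of "J - {0}" \<xi>] J by fastforce
next
  case False
  then have J0: "J - {0} = J" by auto
  have J1: "J \<subseteq> {0<..}" using J(2) False by (auto simp: less_le subset_eq)
  show ?thesis
    using markov_from_initial[OF M(1) J, of \<xi>] markov_from_initial[OF M(2) J, of \<xi>]
      markov_from_unique_positive[OF M J(1) J1, of "\<xi>(0 := z0)"] by (simp only: J0)
qed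

text \<open>
  The joint law at finitely many times lives on a countable space, so it is determined by the
  probabilities of points, which are cylinder probabilities.
\<close>

lemma same_multitime_law_count_space:
  fixes S :: "'c::countable set"
  assumes Z: "process W (count_space S) Z" "process W' (count_space S) Z'"
    and W: "finite_measure W" "finite_measure W'"
    and cyl: "\<And>J \<xi>. finite J \<Longrightarrow> J \<subseteq> {0..} \<Longrightarrow>
      measure W {w \<in> space W. \<forall>j\<in>J. Z j w = \<xi> j} = measure W' {w \<in> space W'. \<forall>j\<in>J. Z' j w = \<xi> j}"
  shows "same_multitime_law W W' (count_space S) Z Z'"
  unfolding same_multitime_law_def
proof (intro conjI Z allI impI)
  fix J :: "real set" assume J: "finite J \<and> J \<subseteq> {0..}"
  let ?P = "PiM J (\<lambda>_. count_space S)"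
  have P: "?P = count_space (PiE J (\<lambda>_. S))" using J by (intro count_space_PiM_finite) auto
  have point: "emeasure (distr V ?P (\<lambda>w. \<lambda>t\<in>J. Y t w)) {a} = ennreal (measure V {w \<in> space V. \<forall>j\<in>J. Y j w = a j})"
    if Y: "process V (count_space S) Y" and V: "finite_measure V" and a: "a \<in> PiE J (\<lambda>_. S)"
    for V and Y :: "real \<Rightarrow> _ \<Rightarrow> 'c" and a
  proof -
    have "(\<lambda>w. \<lambda>t\<in>J. Y t w) \<in> measurable V ?P"
      by (rule measurable_restrict) (use Y J in \<open>auto simp: process_def\<close>)
    then have "emeasure (distr V ?P (\<lambda>w. \<lambda>t\<in>J. Y t w)) {a} = emeasure V ((\<lambda>w. \<lambda>t\<in>J. Y t w) -` {a} \<inter> space V)"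
      by (rule emeasure_distr) (use a in \<open>simp add: P\<close>)
    also have "(\<lambda>w. \<lambda>t\<in>J. Y t w) -` {a} \<inter> space V = {w \<in> space V. \<forall>j\<in>J. Y j w = a j}"
      using a by (auto simp: fun_eq_iff restrict_def PiE_iff extensional_def)
    finally show ?thesis by (simp only: finite_measure.emeasure_eq_measure[OF V])
  qed
  show "distr W ?P (\<lambda>w. \<lambda>t\<in>J. Z t w) = distr W' ?P (\<lambda>w. \<lambda>t\<in>J. Z' t w)"
  proof (rule measure_eqI_countable[where A="PiE J (\<lambda>_. S)"])
    show "countable (PiE J (\<lambda>_. S))" using J by (intro countable_PiE) auto
    fix a assume a: "a \<in> PiE J (\<lambda>_. S)"
    show "emeasure (distr W ?P (\<lambda>w. \<lambda>t\<in>J. Z t w)) {a} = emeasure (distr W' ?P (\<lambda>w. \<lambda>t\<in>J. Z' t w)) {a}"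
      unfolding point[OF Z(1) W(1) a] point[OF Z(2) W(2) a] using cyl J by simp
  qed (simp_all add: P)
qed

lemma (in isotropic_process) SN_markov_from: "markov_from W (\<lambda>t w. SN (X t w)) 0 T"
  unfolding markov_from_def
proof (intro conjI allI impI)
  show "prob_space W" by (rule prob_space_axioms)
  show "(\<lambda>w. SN (X t w)) \<in> measurable W (count_space UNIV)" if "0 \<le> t" for t
    by (rule SN_compose_measurable[OF X_measurable[OF that]])
  show "AE w in W. SN (X 0 w) = 0" using X_start by eventually_elim (simp add: SN_GL_Zp GL_Zp_1)
next
  fix J :: "real set" and t s :: real and \<xi> :: "real \<Rightarrow> 'n tuple" and l
  assume J: "finite J" "J \<subseteq> {0..t}" "t \<in> J" and s: "0 < s"
  let ?E = "{w \<in> space W. \<forall>j\<in>J. SN (X j w) = \<xi> j}"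
  have t: "0 \<le> t" using J by auto
  have "{w \<in> space (natural_filtration W G X t). \<forall>j\<in>J. SN (X j w) = \<xi> j} \<in> sets (natural_filtration W G X t)"
  proof (rule sets.sets_Collect_finite_All[OF _ J(1)])
    fix j assume "j \<in> J"
    then show "{w \<in> space (natural_filtration W G X t). SN (X j w) = \<xi> j} \<in> sets (natural_filtration W G X t)"
      using J past_event_fun[of j t SN "\<xi> j"] SN_compose_measurable[of "\<lambda>x. x" G] by (auto simp: space_natural_filtration)
  qed
  then have E: "?E \<in> sets (natural_filtration W G X t)" by (simp add: space_natural_filtration)
  have "measure W {w \<in> ?E. SN (X (t + s) w ** mat 1) = l} = measure W ?E * pmf (T s (\<xi> t)) l"
    by (rule SN_markov[OF t _ E GL_Qp_1]) (use J s in auto)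
  moreover have "{w \<in> ?E. SN (X (t + s) w ** mat 1) = l} = {w \<in> space W. (\<forall>j\<in>J. SN (X j w) = \<xi> j) \<and> SN (X (t + s) w) = l}" by auto
  ultimately show "measure W {w \<in> space W. (\<forall>j\<in>J. SN (X j w) = \<xi> j) \<and> SN (X (t + s) w) = l} = measure W ?E * pmf (T s (\<xi> t)) l" by simp
qed

context Y_realisation
begin

lemma Y_process_eq: "Y_process P nu U V t w = Y (P t w) w"
  by (simp add: Y_process_def Y_def)

lemma SN_Y_process: "process W (count_space Sig) (\<lambda>t w. SN (Y_process P nu U V t w))"
  unfolding process_def Y_process_eq
proof (intro allI impI)
  fix t :: real assume "0 \<le> t"
  then show "(\<lambda>w. SN (Y (P t w) w)) \<in> measurable W (count_space Sig)"
    by (intro measurable_compose_countable[OF measurable_compose[OF all_sources[OF Y_generated] SN_measurable] P_process]) auto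
qed

lemma SN_Y_markov_from:
  assumes T: "\<And>s l. 0 < s \<Longrightarrow> T s l = bind_pmf (poisson_law (c * s)) (\<lambda>k. kernel_power R k l)"
  shows "markov_from W (\<lambda>t w. SN (Y_process P nu U V t w)) 0 T"
  unfolding markov_from_def Y_process_eq
proof (intro conjI allI impI)
  show "prob_space W" by (rule prob_space_axioms)
  show "(\<lambda>w. SN (Y (P t w) w)) \<in> measurable W (count_space UNIV)" if "0 \<le> t" for t
    by (rule SN_Y_process_measurable[OF that])
  show "AE w in W. SN (Y (P 0 w) w) = 0" by (rule AE_I2) (simp add: P_start Y_simps SN_GL_Zp GL_Zp_1)
qed (simp add: T SN_Y_process_markov)

end

theorem theorem1p1:
  fixes W :: "'a measure"
    and X :: "real \<Rightarrow> 'a \<Rightarrow> ('p::prime_card, 'n::{finite, linorder}) pmat"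
  assumes "prob_space W"
    and "markov_process W borel_GL_Qp X"
    and "AE w in W. X 0 w = mat 1"
    and "stationary_increments W X"
    and "independent_increments W X"
    and "isotropic_increments W X"
  shows "\<exists>(c::real) (M :: 'n tuple measure).
    c \<ge> 0 \<and> prob_space M \<and> sets M = sets (count_space Sig) \<and>
    (\<exists>(W' :: ('p, 'n) Y_sample measure) P nu
        (U :: nat \<Rightarrow> ('p, 'n) Y_sample \<Rightarrow> ('p, 'n) pmat) (V :: nat \<Rightarrow> ('p, 'n) Y_sample \<Rightarrow> ('p, 'n) pmat).
       Y_data W' M c P nu U V \<and>
       same_multitime_law W W' (count_space Sig)
         (\<lambda>t w. SN (X t w)) (\<lambda>t w. SN (Y_process P nu U V t w)))"
proof -
  interpret prob_space W by fact
  interpret X: isotropic_process W X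
    using assms by unfold_locales (auto simp: markov_process_def)
  obtain c M where c: "0 \<le> c" and M: "set_pmf M \<subseteq> (Sig :: 'n tuple set)"
    and T: "\<And>t l. 0 < t \<Longrightarrow> X.T t l = bind_pmf (poisson_law (c * t)) (\<lambda>k. kernel_power (\<lambda>z. bind_pmf M (\<lambda>\<mu>. step_law TYPE('p) \<mu> z)) k l)"
    using X.compound_poisson_kernels by blast
  obtain W' :: "('p, 'n) Y_sample measure" and P nu
    and U V :: "nat \<Rightarrow> ('p, 'n) Y_sample \<Rightarrow> ('p, 'n) pmat"
    where Y: "Y_data W' (signature_measure M) c P nu U V" "\<And>i. distr W' haar (V i) = haar"
    using Y_data_exists[OF c M, where 'p='p] by blast
  have W': "prob_space W'" using Y(1) by (simp add: Y_data_def)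
  interpret Y: Y_realisation W' M c P nu U V
    by (rule Y_realisation.intro[OF W']) (unfold_locales, use Y c M in auto)
  have R: "Y.R = (\<lambda>z. bind_pmf M (\<lambda>\<mu>. step_law TYPE('p) \<mu> z))" by (simp add: fun_eq_iff Y.R_def)
  have mX: "markov_from W (\<lambda>t w. SN (X t w)) 0 X.T" by (rule X.SN_markov_from)
  have mY: "markov_from W' (\<lambda>t w. SN (Y_process P nu U V t w)) 0 X.T"
    by (rule Y.SN_Y_markov_from) (simp add: T R)
  have pX: "process W (count_space Sig) (\<lambda>t w. SN (X t w))"
    using measurable_compose[OF X.X_measurable SN_measurable] by (simp add: process_def)
  have "same_multitime_law W W' (count_space Sig) (\<lambda>t w. SN (X t w)) (\<lambda>t w. SN (Y_process P nu U V t w))"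
    by (rule same_multitime_law_count_space[OF pX Y.SN_Y_process])
      (use markov_from_unique[OF mX mY] in \<open>auto intro: finite_measure_axioms Y.finite_measure_axioms\<close>)
  then show ?thesis
    using c Y(1) prob_space_signature_measure[OF M] sets_signature_measure[of M] by blast
qed

end
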